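(* Let $\Delta=(\Sigma,C,w^\pm)$ be a simplicial multi-fan in a lattice $L$ of rank $n$ (every simplex $J\in\Sigma$ being contained in some $I\in\Sigma^{(n)}$), let $\mathcal V=\{v_i\}_{i\in\Sigma^{(1)}}$ be a set of edge vectors for $\Delta$, and let $\xi\in H_T^2(\Delta,\mathcal V)\otimes\mathbb Q$ be a $\mathbb Q$-divisor. Let $\Delta'=(\Sigma',C',w'^{\pm})$ be a simplicial multi-fan in the same lattice, $\rho:\Delta'\to\Delta$ a birational morphism (a map satisfying conditions a) and b) of the context), and $\mathcal V'=\{v_{i'}\}_{i'\in\Sigma'^{(1)}}$ a set of edge vectors for $\Delta'$. Then $$\rho_*\bigl(\hat{\mathcal E}_{st}(\Delta',\mathcal V',\rho^*(\xi))\bigr)=\hat{\mathcal E}_{st}(\Delta,\mathcal V,\xi).$$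
   Context: **Multi-fans.** Let $L$ be a lattice of rank $n$, $L_{\mathbb R}=L\otimes\mathbb R$, $T=L_{\mathbb R}/L$, $L^*$ the dual lattice. A simplicial multi-fan in $L$ is a triple $\Delta=(\Sigma,C,w^\pm)$: $\Sigma$ is a finite abstract simplicial complex including the empty simplex; $\Sigma^{(k)}$ is the set of simplices with $k$ vertices ($\Sigma^{(1)}$ is identified with the vertex set); $\Sigma=\coprod_{k=0}^n\Sigma^{(k)}$, $\Sigma^{(n)}\ne\emptyset$, and every simplex lies in some $I\in\Sigma^{(n)}$. $C$ assigns to $J\in\Sigma^{(k)}$ a $k$-dimensional strongly convex rational polyhedral cone $C(J)\subset L_{\mathbb R}$, with $C(\emptyset)=\{0\}$, such that for each $I\in\Sigma$ the map $J\mapsto C(J)$ is an isomorphism of ordered sets from the faces of $I$ onto the faces of $C(I)$. $w^\pm:\Sigma^{(n)}\to\mathbb Z_{\ge0}$ are maps and $w=w^+-w^-$. **Edge vectors.** $\mathcal V=\{v_i\}_{i\in\Sigma^{(1)}}$ with $0\ne v_i\in L\cap C(i)$ (not necessarily primitive). For $J\in\Sigma$: $L_J=L\cap\operatorname{span}_{\mathbb R}C(J)$, $L_{J,\mathcal V}\subset L_J$ is the sublattice generated by $\{v_i\}_{i\in J}$, $\{u_i^J\}_{i\in J}$ is the basis of $L_{J,\mathcal V}^*$ dual to $\{v_i\}_{i\in J}$, and $H_J=H_{J,\mathcal V}=L_J/L_{J,\mathcal V}$ (a finite group). **Equivariant cohomology.** $H_T^*(\Delta,\mathcal V)$ is the Stanley–Reisner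 ring $\mathbb Z[x_i:i\in\Sigma^{(1)}]/(\prod_{i\in J}x_i: J\notin\Sigma)$, $\deg x_i=2$; $H_T^{**}$ is its completion (product of all graded parts). $H^*(BT)\otimes\mathbb Q$ is the symmetric algebra of $L^*\otimes\mathbb Q$; $H^{**}(BT)$ is its completion. For $I\in\Sigma^{(n)}$ the ring homomorphism $\iota_I^*:H_T^*(\Delta,\mathcal V)\otimes\mathbb Q\to H^*(BT)\otimes\mathbb Q$ sends $x_i\mapsto u_i^I$ if $i\in I$ and $x_i\mapsto0$ otherwise. $\bigoplus_I\iota_I^*$ is injective. A $\mathbb Q$-divisor is an element $\xi=\sum_i d_ix_i$, $d_i\in\mathbb Q$, of $H_T^2(\Delta,\mathcal V)\otimes\mathbb Q$. **Orbifold elliptic class.** Put $q=e^{2\pi\sqrt{-1}\tau}$ ($\Im\tau>0$), $\zeta=e^{2\pi\sqrt{-1}\sigma}$ with $\sigma\in\mathbb C$, $\zeta^a:=e^{2\pi\sqrt{-1}a\sigma}$, and, with $t=e^{2\pi\sqrt{-1}z}$, $$\phi_{st}(z,\tau,\sigma)=\frac{1-\zeta t}{(1-\zeta)(1-t)}\prod_{k\ge1}\frac{(1-q^k)^2(1-\zeta tq^k)(1-\zeta^{-1}t^{-1}q^k)}{(1-\zeta q^k)(1-\zeta^{-1}q^k)(1-tq^k)(1-t^{-1}q^k)}.$$ For $I\in\Sigma^{(n)}$ let $G_I\subset\mathbb R^{\Sigma^{(1)}}/\mathbb Z^{\Sigma^{(1)}}$ be the image of $\{(a_i): \sum a_iv_i\in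 L,\ a_j=0\text{ for }j\notin I\}$, and $DG_\Delta=\bigcup_{I\in\Sigma^{(n)}}G_I\times G_I$. For $g$ in $\bigcup_IG_I$ let $v_i(g)\in\mathbb R$ be the $i$-th coordinate of a representative of $g$. Then $$\hat{\mathcal E}_{st}(\Delta,\mathcal V,\xi)=\sum_{(g_1,g_2)\in DG_\Delta}\ \prod_{i\in\Sigma^{(1)}}x_i\,\zeta^{d_iv_i(g_1)}\,\phi_{st}\Bigl(-\tfrac{x_i}{2\pi\sqrt{-1}}+v_i(g_1)\tau-v_i(g_2),\tau,d_i\sigma\Bigr).$$ This is independent of the representatives; taking $0\le v_i(g)<1$ and expanding in $q$ it is an element of $(H_T^{**}(\Delta,\mathcal V)\otimes\mathbb C)[[q]]$ (a priori in fractional powers of $q$). It is understood that $\zeta^{d_i}\ne1$ for every coefficient $d_i$ (also for the divisor on $\Delta'$), so that the expressions are defined. **Birational morphisms.** $\Delta'=(\Sigma',C',w'^\pm)$ is a simplicial multi-fan in $L$, and $\rho:\Sigma'\to\Sigma$ is an order-preserving map such that: a) there is an injection $\kappa:\Sigma^{(1)}\to\Sigma'^{(1)}$ with $C'(\kappa(i))=C(i)$ and $\rho(\kappa(i))=i$; b) for each $J'\in\Sigma'$, $C'(J')\subset C(\rho(J'))$ with $\rho(J')$ the minimal such simplex; and for each $J\in\Sigma$ the cones $C'(J')$ with $\rho(J')\subset J$ (pairwise distinct) form a subdivision of the cone $C(J)$. **Pull-back.** Write $v_{i'}=\sum_{i\in\rho(i')}a_{i'i}v_i$ and put $a_{i'i}=0$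 for $i\notin\rho(i')$; $\rho^*(x_i)=\sum_{i'\in\Sigma'^{(1)}}a_{i'i}x_{i'}$, extended linearly. **Push-forward.** For $x\in H_T^*(\Delta',\mathcal V')\otimes\mathbb Q$, $\rho_*(x)\in H_T^*(\Delta,\mathcal V)\otimes\mathbb Q$ is the element determined by $$\iota_I^*(\rho_*(x))=|H_{I,\mathcal V}|\,u_I\sum_{I'\in\Sigma'^{(n)},\,\rho(I')=I}\frac{\iota_{I'}^*(x)}{|H_{I',\mathcal V'}|\,u_{I'}}\qquad(I\in\Sigma^{(n)}),$$ where $u_I=\prod_{i\in I}u_i^I$ and $u_{I'}=\prod_{i'\in I'}u_{i'}^{I'}$. It is extended to completions, to $\mathbb C$-coefficients and coefficientwise to power series in $q$. *)

theory Defs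
  imports
    "HOL-Analysis.Analysis"
    "HOL-Library.Poly_Mapping"
    "HOL-Computational_Algebra.Computational_Algebra"
    "HOL-Algebra.QuotRing"
begin

section \<open>Formal power series in several variables\<close>

text \<open>Formal power series in variables indexed by \<^typ>\<open>'i\<close>: a coefficient for every monomial,
  monomials being finitely supported exponent functions \<^typ>\<open>'i \<Rightarrow>\<^sub>0 nat\<close>.\<close>

typedef ('i, 'r) mps = "UNIV :: (('i \<Rightarrow>\<^sub>0 nat) \<Rightarrow> 'r) set"
  morphisms mps_nth Abs_mps by simp

setup_lifting type_definition_mps

lemma mps_eqI: "(\<And>m. mps_nth f m = mps_nth g m) \<Longrightarrow> f = g"
  by (metis ext mps_nth_inject)

lemma finite_monomial_pairs: "finite {(a, b). a + b = (m :: 'i \<Rightarrow>\<^sub>0 nat)}"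
proof -
  let ?F = "{f. \<forall>x. (x \<in> Poly_Mapping.keys m \<longrightarrow> f x \<in> {..Max (Poly_Mapping.lookup m ` Poly_Mapping.keys m)}) \<and> (x \<notin> Poly_Mapping.keys m \<longrightarrow> f x = (0::nat))}"
  let ?S = "Poly_Mapping.lookup -` ?F :: ('i \<Rightarrow>\<^sub>0 nat) set"
  have fin: "finite ?S"
    by (rule finite_vimageI[OF finite_set_of_finite_funs]) (auto simp: inj_def lookup_inject)
  have le: "a \<in> ?S" if "a + b = m" for a b :: "'i \<Rightarrow>\<^sub>0 nat"
  proof -
    have sum: "Poly_Mapping.lookup a x + Poly_Mapping.lookup b x = Poly_Mapping.lookup m x" for x
      using that by (simp add: lookup_add flip: that)
    have "Poly_Mapping.lookup a x \<le> Max (Poly_Mapping.lookup m ` Poly_Mapping.keys m)"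
      if "x \<in> Poly_Mapping.keys m" for x
      using Max_ge[of "Poly_Mapping.lookup m ` Poly_Mapping.keys m" "Poly_Mapping.lookup m x"]
        that sum[of x] by (simp del: Max_ge)
    moreover have "Poly_Mapping.lookup a x = 0" if "x \<notin> Poly_Mapping.keys m" for x
      using that sum[of x] by (simp add: in_keys_iff)
    ultimately show ?thesis by simp
  qed
  have "{(a, b). a + b = m} \<subseteq> ?S \<times> ?S"
  proof
    fix p assume "p \<in> {(a, b). a + b = m}"
    then have "fst p + snd p = m" by auto
    then have "fst p \<in> ?S" "snd p \<in> ?S"
      using le[of "fst p" "snd p"] le[of "snd p" "fst p"] by (simp_all only: add.commute)
    then show "p \<in> ?S \<times> ?S" by (simp only: mem_Times_iff)
  qed
  then show ?thesis
    using fin finite_subset by blast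
qed

instantiation mps :: (type, zero) zero
begin
lift_definition zero_mps :: "('a, 'b) mps" is "\<lambda>_. 0" .
instance ..
end

instantiation mps :: (type, zero_neq_one) one
begin
lift_definition one_mps :: "('a, 'b) mps" is "\<lambda>m. if m = 0 then 1 else 0" .
instance ..
end

instantiation mps :: (type, comm_ring_1) "{plus, minus, uminus, times}"
begin
lift_definition plus_mps :: "('a, 'b) mps \<Rightarrow> ('a, 'b) mps \<Rightarrow> ('a, 'b) mps"
  is "\<lambda>f g m. f m + g m" .
lift_definition minus_mps :: "('a, 'b) mps \<Rightarrow> ('a, 'b) mps \<Rightarrow> ('a, 'b) mps"
  is "\<lambda>f g m. f m - g m" .
lift_definition uminus_mps :: "('a, 'b) mps \<Rightarrow> ('a, 'b) mps"
  is "\<lambda>f m. - f m" .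
lift_definition times_mps :: "('a, 'b) mps \<Rightarrow> ('a, 'b) mps \<Rightarrow> ('a, 'b) mps"
  is "\<lambda>f g m. \<Sum>(a, b) | a + b = m. f a * g b" .
instance ..
end

lemmas mps_nth_simps =
  zero_mps.rep_eq one_mps.rep_eq plus_mps.rep_eq minus_mps.rep_eq uminus_mps.rep_eq

instance mps :: (type, comm_ring_1) comm_ring_1
proof
  fix f g h :: "('a, 'b) mps"
  show "f + g + h = f + (g + h)" "f + g = g + f" "0 + f = f" "- f + f = 0" "f - g = f + - g"
    by (rule mps_eqI; simp add: mps_nth_simps)+
  show "f * g = g * f"
  proof (rule mps_eqI)
    fix m show "mps_nth (f * g) m = mps_nth (g * f) m"
      unfolding times_mps.rep_eq
      by (rule sum.reindex_bij_witness[of _ prod.swap prod.swap])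
         (auto simp: add.commute mult.commute)
  qed
  show "(f + g) * h = f * h + g * h"
    by (rule mps_eqI)
       (simp add: times_mps.rep_eq mps_nth_simps distrib_right case_prod_unfold sum.distrib)
  show "1 * f = f"
  proof (rule mps_eqI)
    fix m
    have "mps_nth (1 * f) m = (\<Sum>(a, b)\<in>{(0, m)}. mps_nth (1 :: ('a, 'b) mps) a * mps_nth f b)"
      unfolding times_mps.rep_eq
    proof (rule sum.mono_neutral_right)
      show "finite {(a, b). a + b = m}" by (rule finite_monomial_pairs)
    qed (auto simp: mps_nth_simps split: if_splits)
    then show "mps_nth (1 * f) m = mps_nth f m"
      by (simp add: mps_nth_simps)
  qed
  show "(0::('a, 'b) mps) \<noteq> 1"
  proof
    assume "(0::('a, 'b) mps) = 1"
    then have "mps_nth (0::('a, 'b) mps) 0 = mps_nth (1::('a, 'b) mps) 0" by simp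
    then show False by (simp add: mps_nth_simps)
  qed
  show "f * g * h = f * (g * h)"
  proof (rule mps_eqI)
    fix m
    let ?F = "mps_nth f" and ?G = "mps_nth g" and ?H = "mps_nth h"
    have "mps_nth (f * g * h) m =
        (\<Sum>(p, c) | p + c = m. \<Sum>(a, b) | a + b = p. ?F a * ?G b * ?H c)"
      unfolding times_mps.rep_eq by (simp add: case_prod_unfold sum_distrib_right)
    also have "\<dots> = (\<Sum>(x, y)\<in>(SIGMA x:{(p, c). p + c = m}. {(a, b). a + b = fst x}).
        ?F (fst y) * ?G (snd y) * ?H (snd x))"
      by (subst sum.Sigma[symmetric]) (use finite_monomial_pairs in \<open>auto simp: case_prod_unfold\<close>)
    also have "\<dots> = (\<Sum>(x, y)\<in>(SIGMA x:{(a, p). a + p = m}. {(b, c). b + c = snd x}).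
        ?F (fst x) * (?G (fst y) * ?H (snd y)))"
      by (rule sum.reindex_bij_witness[of _
            "\<lambda>(x, y). ((fst x + fst y, snd y), (fst x, fst y))"
            "\<lambda>(x, y). ((fst y, snd y + snd x), (snd y, snd x))"])
         (auto simp: add.assoc mult.assoc)
    also have "\<dots> = (\<Sum>(a, p) | a + p = m. \<Sum>(b, c) | b + c = p. ?F a * (?G b * ?H c))"
      by (subst sum.Sigma[symmetric]) (use finite_monomial_pairs in \<open>auto simp: case_prod_unfold\<close>)
    also have "\<dots> = mps_nth (f * (g * h)) m"
      unfolding times_mps.rep_eq by (simp add: case_prod_unfold sum_distrib_left)
    finally show "mps_nth (f * g * h) m = mps_nth (f * (g * h)) m" .
  qed
qed

text \<open>Over an integral domain there are no zero divisors: two sets of monomials contain a pair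
  whose sum arises in only one way.\<close>

lemma unique_sum_pair:
  assumes "finite F" "A \<noteq> {}" "B \<noteq> {}"
    and "\<And>a a' j. a \<in> A \<Longrightarrow> a' \<in> A \<Longrightarrow> j \<notin> F \<Longrightarrow> Poly_Mapping.lookup a j = Poly_Mapping.lookup a' j"
    and "\<And>b b' j. b \<in> B \<Longrightarrow> b' \<in> B \<Longrightarrow> j \<notin> F \<Longrightarrow> Poly_Mapping.lookup b j = Poly_Mapping.lookup b' j"
  shows "\<exists>a\<in>A. \<exists>b\<in>B. \<forall>a'\<in>A. \<forall>b'\<in>B. a' + b' = a + b \<longrightarrow> a' = a \<and> b' = (b :: 'i \<Rightarrow>\<^sub>0 nat)"
  using assms
proof (induction F arbitrary: A B rule: finite_induct)
  case empty
  then obtain a b where "a \<in> A" "b \<in> B" by blast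
  moreover have "a' = a" if "a' \<in> A" for a'
    using empty(3)[OF that \<open>a \<in> A\<close>] by (simp add: poly_mapping_eqI)
  moreover have "b' = b" if "b' \<in> B" for b'
    using empty(4)[OF that \<open>b \<in> B\<close>] by (simp add: poly_mapping_eqI)
  ultimately show ?case by blast
next
  case (insert i F)
  define p where "p = (LEAST k. \<exists>a\<in>A. Poly_Mapping.lookup a i = k)"
  define r where "r = (LEAST k. \<exists>b\<in>B. Poly_Mapping.lookup b i = k)"
  have pA: "\<exists>a\<in>A. Poly_Mapping.lookup a i = p"
    unfolding p_def by (rule LeastI_ex) (use insert.prems(1) in blast)
  have rB: "\<exists>b\<in>B. Poly_Mapping.lookup b i = r"
    unfolding r_def by (rule LeastI_ex) (use insert.prems(2) in blast)
  have pmin: "p \<le> Poly_Mapping.lookup a i" if "a \<in> A" for a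
    unfolding p_def by (rule Least_le) (use that in blast)
  have rmin: "r \<le> Poly_Mapping.lookup b i" if "b \<in> B" for b
    unfolding r_def by (rule Least_le) (use that in blast)
  let ?A = "{a\<in>A. Poly_Mapping.lookup a i = p}" and ?B = "{b\<in>B. Poly_Mapping.lookup b i = r}"
  have "\<exists>a\<in>?A. \<exists>b\<in>?B. \<forall>a'\<in>?A. \<forall>b'\<in>?B. a' + b' = a + b \<longrightarrow> a' = a \<and> b' = b"
  proof (rule insert.IH)
    show "?A \<noteq> {}" "?B \<noteq> {}" using pA rB by auto
    show "Poly_Mapping.lookup a j = Poly_Mapping.lookup a' j" if "a \<in> ?A" "a' \<in> ?A" "j \<notin> F" for a a' j
      using insert.prems(3)[of a a' j] that by (cases "j = i") auto
    show "Poly_Mapping.lookup b j = Poly_Mapping.lookup b' j" if "b \<in> ?B" "b' \<in> ?B" "j \<notin> F" for b b' j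
      using insert.prems(4)[of b b' j] that by (cases "j = i") auto
  qed
  then obtain a b where ab: "a \<in> ?A" "b \<in> ?B"
    and uniq: "\<forall>a'\<in>?A. \<forall>b'\<in>?B. a' + b' = a + b \<longrightarrow> a' = a \<and> b' = b" by blast
  have "a' = a \<and> b' = b" if "a' \<in> A" "b' \<in> B" "a' + b' = a + b" for a' b'
  proof -
    have "Poly_Mapping.lookup a' i + Poly_Mapping.lookup b' i = p + r"
      using that(3) ab by (metis (mono_tags, lifting) lookup_add mem_Collect_eq)
    then have "Poly_Mapping.lookup a' i = p" "Poly_Mapping.lookup b' i = r"
      using pmin[OF that(1)] rmin[OF that(2)] by linarith+
    then show ?thesis using uniq that by blast
  qed
  then show ?case using ab by blast
qed

instance mps :: (type, idom) idom
proof
  fix f g :: "('a, 'b) mps" assume "f \<noteq> 0" "g \<noteq> 0"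
  then obtain m0 m1 where m0: "mps_nth f m0 \<noteq> 0" and m1: "mps_nth g m1 \<noteq> 0"
    by (metis mps_eqI zero_mps.rep_eq)
  define F where "F = Poly_Mapping.keys m0 \<union> Poly_Mapping.keys m1"
  let ?A = "{m. mps_nth f m \<noteq> 0 \<and> Poly_Mapping.keys m \<subseteq> F}"
  let ?B = "{m. mps_nth g m \<noteq> 0 \<and> Poly_Mapping.keys m \<subseteq> F}"
  have "\<exists>a\<in>?A. \<exists>b\<in>?B. \<forall>a'\<in>?A. \<forall>b'\<in>?B. a' + b' = a + b \<longrightarrow> a' = a \<and> b' = b"
  proof (rule unique_sum_pair[of F])
    show "finite F" "?A \<noteq> {}" "?B \<noteq> {}"
      using m0 m1 by (auto simp: F_def)
    show "Poly_Mapping.lookup a j = Poly_Mapping.lookup a' j"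
      if "a \<in> ?A" "a' \<in> ?A" "j \<notin> F" for a a' j
      using that by (metis (mono_tags, lifting) in_keys_iff mem_Collect_eq subsetD)
    show "Poly_Mapping.lookup b j = Poly_Mapping.lookup b' j"
      if "b \<in> ?B" "b' \<in> ?B" "j \<notin> F" for b b' j
      using that by (metis (mono_tags, lifting) in_keys_iff mem_Collect_eq subsetD)
  qed
  then obtain a b where ab: "a \<in> ?A" "b \<in> ?B"
    and uniq: "\<forall>a'\<in>?A. \<forall>b'\<in>?B. a' + b' = a + b \<longrightarrow> a' = a \<and> b' = b" by blast
  have "mps_nth (f * g) (a + b) = (\<Sum>(a', b')\<in>{(a, b)}. mps_nth f a' * mps_nth g b')"
    unfolding times_mps.rep_eq
  proof (rule sum.mono_neutral_right)
    show "\<forall>x\<in>{(a', b'). a' + b' = a + b} - {(a, b)}.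
        (case x of (a', b') \<Rightarrow> mps_nth f a' * mps_nth g b') = 0"
    proof
      fix x assume "x \<in> {(a', b'). a' + b' = a + b} - {(a, b)}"
      then obtain a' b' where x: "x = (a', b')" and eq: "a' + b' = a + b"
        and ne: "a' \<noteq> a \<or> b' \<noteq> b" by auto
      have "Poly_Mapping.keys a' \<union> Poly_Mapping.keys b' \<subseteq> F"
      proof
        fix x assume "x \<in> Poly_Mapping.keys a' \<union> Poly_Mapping.keys b'"
        then have "Poly_Mapping.lookup (a' + b') x \<noteq> 0" by (auto simp: lookup_add in_keys_iff)
        then have "Poly_Mapping.lookup (a + b) x \<noteq> 0" using eq by simp
        then have "x \<in> Poly_Mapping.keys a \<union> Poly_Mapping.keys b" by (auto simp: lookup_add in_keys_iff)
        then show "x \<in> F" using ab by blast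
      qed
      then show "(case x of (a', b') \<Rightarrow> mps_nth f a' * mps_nth g b') = 0"
        using uniq eq ne x by auto
    qed
  qed (auto simp: finite_monomial_pairs)
  also have "\<dots> \<noteq> 0" using ab by simp
  finally show "f * g \<noteq> 0" by (metis zero_mps.rep_eq)
qed

definition mps_const :: "'r::zero \<Rightarrow> ('i, 'r) mps" where
  "mps_const c = Abs_mps (\<lambda>m. if m = 0 then c else 0)"

definition mps_var :: "'i \<Rightarrow> ('i, 'r::zero_neq_one) mps" where
  "mps_var i = Abs_mps (\<lambda>m. if m = Poly_Mapping.single i 1 then 1 else 0)"

definition mps_of_fps :: "'i \<Rightarrow> 'r::zero fps \<Rightarrow> ('i, 'r) mps" where
  "mps_of_fps i f = Abs_mps (\<lambda>m. if Poly_Mapping.keys m \<subseteq> {i} then fps_nth f (Poly_Mapping.lookup m i) else 0)"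

definition mdeg :: "('i \<Rightarrow>\<^sub>0 nat) \<Rightarrow> nat" where
  "mdeg m = (\<Sum>i\<in>Poly_Mapping.keys m. Poly_Mapping.lookup m i)"

text \<open>Substitution \<open>x\<^sub>i \<mapsto> h i\<close> into a series in the finitely many variables from \<open>V\<close>, for series \<open>h i\<close>
  without constant term; monomials of degree above that of \<open>m\<close> then do not contribute to the
  coefficient of \<open>m\<close>, so the sum below is the full one.\<close>

definition mps_subst ::
  "'i set \<Rightarrow> ('i \<Rightarrow> ('k, 'r::comm_ring_1) mps) \<Rightarrow> ('i, 'r) mps \<Rightarrow> ('k, 'r) mps" where
  "mps_subst V h f = Abs_mps (\<lambda>m. \<Sum>m' | Poly_Mapping.keys m' \<subseteq> V \<and> mdeg m' \<le> mdeg m.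
     mps_nth f m' * mps_nth (\<Prod>i\<in>V. h i ^ Poly_Mapping.lookup m' i) m)"


section \<open>Lattices and cones\<close>

definition int_span :: "'v::real_vector set \<Rightarrow> 'v set" where
  "int_span S = {\<Sum>b\<in>S. of_int (c b) *\<^sub>R b | c :: 'v \<Rightarrow> int. True}"

text \<open>The ambient space is \<open>L \<otimes> \<real>\<close>.\<close>

definition lattice_basis :: "'v::real_vector set \<Rightarrow> 'v set \<Rightarrow> bool" where
  "lattice_basis B L \<longleftrightarrow> finite B \<and> independent B \<and> span B = UNIV \<and> L = int_span B"

definition rational_cone :: "'v::real_vector set \<Rightarrow> 'v set \<Rightarrow> bool" where
  "rational_cone L c \<longleftrightarrow> (\<exists>S. finite S \<and> S \<subseteq> L \<and> c = convex_cone hull S)"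

definition strongly_convex :: "'v::real_vector set \<Rightarrow> bool" where
  "strongly_convex c \<longleftrightarrow> (\<forall>x. x \<in> c \<and> - x \<in> c \<longrightarrow> x = 0)"

text \<open>\<^const>\<open>face_of\<close> admits the empty face, which is not a face of a cone in the sense of fans.\<close>

definition cone_faces :: "'v::real_vector set \<Rightarrow> 'v set set" where
  "cone_faces c = {F. F face_of c \<and> F \<noteq> {}}"

definition cone_subdivision :: "'v::real_vector set set \<Rightarrow> 'v set \<Rightarrow> bool" where
  "cone_subdivision \<F> c \<longleftrightarrow> finite \<F> \<and> \<Union>\<F> = c \<and> (\<forall>A\<in>\<F>. cone_faces A \<subseteq> \<F>) \<and>
     (\<forall>A\<in>\<F>. \<forall>D\<in>\<F>. A \<inter> D \<in> cone_faces A \<and> A \<inter> D \<in> cone_faces D)"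


section \<open>Multi-fans\<close>

record ('i, 'v) multi_fan =
  simplices :: "'i set set"
  mf_cone :: "'i set \<Rightarrow> 'v set"
  w_pos :: "'i set \<Rightarrow> nat"
  w_neg :: "'i set \<Rightarrow> nat"

definition k_simplices :: "('i, 'v) multi_fan \<Rightarrow> nat \<Rightarrow> 'i set set" where
  "k_simplices \<Delta> k = {J \<in> simplices \<Delta>. card J = k}"

definition verts :: "('i, 'v) multi_fan \<Rightarrow> 'i set" where
  "verts \<Delta> = {i. {i} \<in> simplices \<Delta>}"

definition simplicial_multi_fan ::
  "'v::real_vector set \<Rightarrow> nat \<Rightarrow> ('i, 'v) multi_fan \<Rightarrow> bool" where
  "simplicial_multi_fan L n \<Delta> \<longleftrightarrow>
     finite (simplices \<Delta>) \<and> {} \<in> simplices \<Delta> \<and>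
     (\<forall>J\<in>simplices \<Delta>. finite J \<and> card J \<le> n) \<and>
     (\<forall>J\<in>simplices \<Delta>. \<forall>K\<subseteq>J. K \<in> simplices \<Delta>) \<and>
     k_simplices \<Delta> n \<noteq> {} \<and>
     (\<forall>J\<in>simplices \<Delta>. \<exists>I\<in>k_simplices \<Delta> n. J \<subseteq> I) \<and>
     (\<forall>J\<in>simplices \<Delta>. rational_cone L (mf_cone \<Delta> J) \<and> strongly_convex (mf_cone \<Delta> J) \<and>
        dim (mf_cone \<Delta> J) = card J) \<and>
     mf_cone \<Delta> {} = {0} \<and>
     (\<forall>I\<in>simplices \<Delta>. bij_betw (mf_cone \<Delta>) (Pow I) (cone_faces (mf_cone \<Delta> I)) \<and>
        (\<forall>J\<in>Pow I. \<forall>K\<in>Pow I. J \<subseteq> K \<longleftrightarrow> mf_cone \<Delta> J \<subseteq> mf_cone \<Delta> K))"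

definition edge_vectors ::
  "'v::real_vector set \<Rightarrow> ('i, 'v) multi_fan \<Rightarrow> ('i \<Rightarrow> 'v) \<Rightarrow> bool" where
  "edge_vectors L \<Delta> v \<longleftrightarrow> (\<forall>i\<in>verts \<Delta>. v i \<noteq> 0 \<and> v i \<in> L \<inter> mf_cone \<Delta> {i})"

definition dual_vec :: "('i \<Rightarrow> 'v::real_vector) \<Rightarrow> 'i set \<Rightarrow> 'i \<Rightarrow> 'v \<Rightarrow> real" where
  "dual_vec v J i = (\<lambda>x. representation (v ` J) x (v i))"

text \<open>\<open>H\<^sub>J = L\<^sub>J / L\<^bsub>J,V\<^esub>\<close> as the set of cosets.\<close>

definition H_group ::
  "'v::real_vector set \<Rightarrow> ('i, 'v) multi_fan \<Rightarrow> ('i \<Rightarrow> 'v) \<Rightarrow> 'i set \<Rightarrow> 'v set set" where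
  "H_group L \<Delta> v J = (let LJ = L \<inter> span (mf_cone \<Delta> J) in
     LJ // {(x, y). x \<in> LJ \<and> y \<in> LJ \<and> x - y \<in> int_span (v ` J)})"

text \<open>Cones of unrelated simplices of \<open>\<Delta>\<close> may overlap, so minimality of \<open>\<rho> J'\<close> means that no proper
  face of \<open>\<rho> J'\<close> has a cone containing that of \<open>J'\<close>; \<open>\<rho> J'\<close> need not be a least element among all
  simplices whose cones contain that of \<open>J'\<close>.\<close>

definition birational_morphism ::
  "('j, 'v::real_vector) multi_fan \<Rightarrow> ('i, 'v) multi_fan \<Rightarrow> ('j set \<Rightarrow> 'i set) \<Rightarrow> bool" where
  "birational_morphism \<Delta>' \<Delta> \<rho> \<longleftrightarrow>
     \<rho> ` simplices \<Delta>' \<subseteq> simplices \<Delta> \<and>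
     (\<forall>J\<in>simplices \<Delta>'. \<forall>K\<in>simplices \<Delta>'. J \<subseteq> K \<longrightarrow> \<rho> J \<subseteq> \<rho> K) \<and>
     (\<exists>\<kappa>. inj_on \<kappa> (verts \<Delta>) \<and> \<kappa> ` verts \<Delta> \<subseteq> verts \<Delta>' \<and>
        (\<forall>i\<in>verts \<Delta>. mf_cone \<Delta>' {\<kappa> i} = mf_cone \<Delta> {i} \<and> \<rho> {\<kappa> i} = {i})) \<and>
     (\<forall>J'\<in>simplices \<Delta>'. mf_cone \<Delta>' J' \<subseteq> mf_cone \<Delta> (\<rho> J') \<and>
        (\<forall>J\<in>simplices \<Delta>. J \<subseteq> \<rho> J' \<and> mf_cone \<Delta>' J' \<subseteq> mf_cone \<Delta> J \<longrightarrow> J = \<rho> J')) \<and>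
     (\<forall>J\<in>simplices \<Delta>.
        inj_on (mf_cone \<Delta>') {J'\<in>simplices \<Delta>'. \<rho> J' \<subseteq> J} \<and>
        cone_subdivision (mf_cone \<Delta>' ` {J'\<in>simplices \<Delta>'. \<rho> J' \<subseteq> J}) (mf_cone \<Delta> J))"


section \<open>Completed equivariant cohomology with complex coefficients\<close>

definition power_series_ring :: "'i set \<Rightarrow> ('i, complex) mps ring" where
  "power_series_ring V =
     \<lparr>carrier = {f. \<forall>m. mps_nth f m \<noteq> 0 \<longrightarrow> Poly_Mapping.keys m \<subseteq> V}, mult = (*), one = 1, zero = 0, add = (+)\<rparr>"

definition SR_ideal :: "('i, 'v) multi_fan \<Rightarrow> ('i, complex) mps set" where
  "SR_ideal \<Delta> = genideal (power_series_ring (verts \<Delta>))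
     {\<Prod>i\<in>J. mps_var i | J. J \<subseteq> verts \<Delta> \<and> J \<notin> simplices \<Delta>}"

text \<open>The product of the graded parts of the Stanley--Reisner ring, with complex coefficients, is
  the quotient of the power series ring by the ideal generated by the same monomials.\<close>

definition HT_ring :: "('i, 'v) multi_fan \<Rightarrow> ('i, complex) mps set ring" where
  "HT_ring \<Delta> = power_series_ring (verts \<Delta>) Quot SR_ideal \<Delta>"

definition HT_class :: "('i, 'v) multi_fan \<Rightarrow> ('i, complex) mps \<Rightarrow> ('i, complex) mps set" where
  "HT_class \<Delta> f = a_r_coset (power_series_ring (verts \<Delta>)) (SR_ideal \<Delta>) f"

text \<open>A basis \<open>B\<close> of \<open>L\<close> identifies \<open>H\<^sup>*\<^sup>*(BT) \<otimes> \<complex>\<close> with the power series ring in the coordinate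
  functions dual to \<open>B\<close>; \<open>lin_form B u\<close> is the image of the linear functional \<open>u\<close>.\<close>

definition lin_form :: "'v set \<Rightarrow> ('v \<Rightarrow> real) \<Rightarrow> ('v, complex) mps" where
  "lin_form B u = (\<Sum>b\<in>B. mps_const (complex_of_real (u b)) * mps_var b)"

definition iota_series ::
  "'v::real_vector set \<Rightarrow> ('i, 'v) multi_fan \<Rightarrow> ('i \<Rightarrow> 'v) \<Rightarrow> 'i set \<Rightarrow>
     ('i, complex) mps \<Rightarrow> ('v, complex) mps" where
  "iota_series B \<Delta> v I =
     mps_subst (verts \<Delta>) (\<lambda>i. if i \<in> I then lin_form B (dual_vec v I i) else 0)"

text \<open>The map induced by the substitution on the quotient ring.\<close>

definition iota ::
  "'v::real_vector set \<Rightarrow> ('i, 'v) multi_fan \<Rightarrow> ('i \<Rightarrow> 'v) \<Rightarrow> 'i set \<Rightarrow>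
     ('i, complex) mps set \<Rightarrow> ('v, complex) mps" where
  "iota B \<Delta> v I x = the_elem (iota_series B \<Delta> v I ` x)"

definition u_prod ::
  "'v::real_vector set \<Rightarrow> ('i \<Rightarrow> 'v) \<Rightarrow> 'i set \<Rightarrow> ('v, complex) mps" where
  "u_prod B v I = (\<Prod>i\<in>I. lin_form B (dual_vec v I i))"

text \<open>The defining formula is an equation in the fraction field of \<open>H\<^sup>*\<^sup>*(BT) \<otimes> \<complex>\<close>. It preserves
  degrees, so it also describes the extension of the push-forward to the completion.\<close>

definition push_forward ::
  "'v::real_vector set \<Rightarrow> 'v set \<Rightarrow> nat \<Rightarrow> ('j, 'v) multi_fan \<Rightarrow> ('j \<Rightarrow> 'v) \<Rightarrow>
     ('i, 'v) multi_fan \<Rightarrow> ('i \<Rightarrow> 'v) \<Rightarrow> ('j set \<Rightarrow> 'i set) \<Rightarrow>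
     ('j, complex) mps set \<Rightarrow> ('i, complex) mps set" where
  "push_forward B L n \<Delta>' v' \<Delta> v \<rho> x = (THE y. y \<in> carrier (HT_ring \<Delta>) \<and>
     (\<forall>I\<in>k_simplices \<Delta> n.
        Fract (iota B \<Delta> v I y) 1 =
        Fract (of_nat (card (H_group L \<Delta> v I)) * u_prod B v I) 1 *
        (\<Sum>I' | I' \<in> k_simplices \<Delta>' n \<and> \<rho> I' = I.
           Fract (iota B \<Delta>' v' I' x) (of_nat (card (H_group L \<Delta>' v' I')) * u_prod B v' I'))))"

definition push_forward_q ::
  "'v::real_vector set \<Rightarrow> 'v set \<Rightarrow> nat \<Rightarrow> ('j, 'v) multi_fan \<Rightarrow> ('j \<Rightarrow> 'v) \<Rightarrow>
     ('i, 'v) multi_fan \<Rightarrow> ('i \<Rightarrow> 'v) \<Rightarrow> ('j set \<Rightarrow> 'i set) \<Rightarrow>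
     ('j, complex) mps set fps \<Rightarrow> ('i, complex) mps set fps" where
  "push_forward_q B L n \<Delta>' v' \<Delta> v \<rho> F =
     Abs_fps (\<lambda>k. push_forward B L n \<Delta>' v' \<Delta> v \<rho> (fps_nth F k))"


section \<open>Divisors\<close>

text \<open>A divisor \<open>\<Sum> d\<^sub>i x\<^sub>i\<close> is given by its coefficients; the \<open>x\<^sub>i\<close> are linearly independent in
  degree 2, since every vertex is a simplex.\<close>

definition Q_divisor :: "('i, 'v) multi_fan \<Rightarrow> ('i \<Rightarrow> real) \<Rightarrow> bool" where
  "Q_divisor \<Delta> d \<longleftrightarrow> (\<forall>i\<in>verts \<Delta>. d i \<in> \<rat>)"

text \<open>The coefficient of \<open>v' i'\<close> at \<open>v i\<close> in its expansion over the vertices of \<open>\<rho> {i'}\<close>.\<close>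

definition edge_coeff ::
  "('j \<Rightarrow> 'v::real_vector) \<Rightarrow> ('i \<Rightarrow> 'v) \<Rightarrow> ('j set \<Rightarrow> 'i set) \<Rightarrow> 'j \<Rightarrow> 'i \<Rightarrow> real" where
  "edge_coeff v' v \<rho> i' i = (if i \<in> \<rho> {i'} then dual_vec v (\<rho> {i'}) i (v' i') else 0)"

definition pull_back ::
  "('i, 'v::real_vector) multi_fan \<Rightarrow> ('j \<Rightarrow> 'v) \<Rightarrow> ('i \<Rightarrow> 'v) \<Rightarrow> ('j set \<Rightarrow> 'i set) \<Rightarrow>
     ('i \<Rightarrow> real) \<Rightarrow> 'j \<Rightarrow> real" where
  "pull_back \<Delta> v' v \<rho> d i' = (\<Sum>i\<in>verts \<Delta>. d i * edge_coeff v' v \<rho> i' i)"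


section \<open>The orbifold elliptic class\<close>

text \<open>The class of \<open>a\<close> modulo \<open>\<int>\<close> is represented in \<open>[0,1)\<close> by \<^term>\<open>frac a\<close>; thus \<open>v\<^sub>i(g)\<close> is \<open>g i\<close>
  with the normalisation \<open>0 \<le> v\<^sub>i(g) < 1\<close>.\<close>

definition G_group ::
  "'v::real_vector set \<Rightarrow> ('i, 'v) multi_fan \<Rightarrow> ('i \<Rightarrow> 'v) \<Rightarrow> 'i set \<Rightarrow> ('i \<Rightarrow> real) set" where
  "G_group L \<Delta> v I =
     (\<lambda>a i. frac (a i)) ` {a. (\<Sum>i\<in>verts \<Delta>. a i *\<^sub>R v i) \<in> L \<and> (\<forall>j. j \<notin> I \<longrightarrow> a j = 0)}"

definition DG ::
  "'v::real_vector set \<Rightarrow> nat \<Rightarrow> ('i, 'v) multi_fan \<Rightarrow> ('i \<Rightarrow> 'v) \<Rightarrow>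
     (('i \<Rightarrow> real) \<times> ('i \<Rightarrow> real)) set" where
  "DG L n \<Delta> v = (\<Union>I\<in>k_simplices \<Delta> n. G_group L \<Delta> v I \<times> G_group L \<Delta> v I)"

definition zeta_pow :: "complex \<Rightarrow> real \<Rightarrow> complex" where
  "zeta_pow \<sigma> a = exp (2 * complex_of_real pi * \<i> * complex_of_real a * \<sigma>)"

text \<open>\<open>\<phi>\<^sub>s\<^sub>t\<close> in terms of \<open>t = exp (2\<pi>\<i>z)\<close>, \<open>q = exp (2\<pi>\<i>\<tau>)\<close>, \<open>\<zeta> = exp (2\<pi>\<i>\<sigma>)\<close>.\<close>

definition phi_st :: "'a \<Rightarrow> 'a \<Rightarrow> 'a \<Rightarrow> 'a::{field, t2_space}" where
  "phi_st t q \<zeta> = (1 - \<zeta> * t) / ((1 - \<zeta>) * (1 - t)) *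
     prodinf (\<lambda>k. ((1 - q ^ Suc k)\<^sup>2 * (1 - \<zeta> * t * q ^ Suc k) *
              (1 - inverse \<zeta> * inverse t * q ^ Suc k)) /
            ((1 - \<zeta> * q ^ Suc k) * (1 - inverse \<zeta> * q ^ Suc k) *
              (1 - t * q ^ Suc k) * (1 - inverse t * q ^ Suc k)))"

text \<open>The expansion of \<open>x \<phi>\<^sub>s\<^sub>t(- x/(2\<pi>\<i>) + a \<tau> - b, \<tau>, c \<sigma>)\<close> in powers of \<open>s = q\<^sup>1\<^sup>/\<^sup>N\<close>, where \<open>N a\<close> is an
  integer and \<open>0 \<le> a < 1\<close>. The factor \<open>\<phi>\<^sub>s\<^sub>t\<close> is computed at \<open>t = e\<^sup>-\<^sup>x s\<^sup>N\<^sup>a e\<^bsup>-2\<pi>\<i>b\<^esup>\<close> in the field of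
  Laurent series in \<open>s\<close> over the field of Laurent series in \<open>x\<close>, with its \<open>s\<close>-adic topology. No
  negative powers of \<open>s\<close> occur, and the coefficients have at most a simple pole in \<open>x\<close>, so that
  \<^const>\<open>fls_regpart\<close> discards nothing.\<close>

definition phi_expansion :: "nat \<Rightarrow> real \<Rightarrow> real \<Rightarrow> complex \<Rightarrow> real \<Rightarrow> complex fls fls" where
  "phi_expansion N a b \<sigma> c = phi_st
     (fls_const (fps_to_fls (fps_exp (- 1)) * fls_const (cis (- 2 * pi * b)))
        * fls_X_intpow \<lfloor>real N * a\<rfloor>)
     (fls_X ^ N)
     (fls_const (fls_const (zeta_pow \<sigma> c)))"

definition x_phi ::
  "nat \<Rightarrow> 'i \<Rightarrow> real \<Rightarrow> real \<Rightarrow> complex \<Rightarrow> real \<Rightarrow> ('i, complex) mps fps" where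
  "x_phi N i a b \<sigma> c = Abs_fps (\<lambda>k.
     mps_of_fps i (fls_regpart (fls_X * fls_nth (phi_expansion N a b \<sigma> c) (int k))))"

definition elliptic_series ::
  "nat \<Rightarrow> 'v::real_vector set \<Rightarrow> nat \<Rightarrow> ('i, 'v) multi_fan \<Rightarrow> ('i \<Rightarrow> 'v) \<Rightarrow> ('i \<Rightarrow> real) \<Rightarrow>
     complex \<Rightarrow> ('i, complex) mps fps" where
  "elliptic_series N L n \<Delta> v d \<sigma> =
     (\<Sum>(g1, g2)\<in>DG L n \<Delta> v. \<Prod>i\<in>verts \<Delta>.
        fps_const (mps_const (zeta_pow \<sigma> (d i * g1 i))) * x_phi N i (g1 i) (g2 i) \<sigma> (d i))"

text \<open>The elliptic class as a power series in \<open>q\<^sup>1\<^sup>/\<^sup>N\<close> with coefficients in the completed ring.\<close>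

definition elliptic_class ::
  "nat \<Rightarrow> 'v::real_vector set \<Rightarrow> nat \<Rightarrow> ('i, 'v) multi_fan \<Rightarrow> ('i \<Rightarrow> 'v) \<Rightarrow> ('i \<Rightarrow> real) \<Rightarrow>
     complex \<Rightarrow> ('i, complex) mps set fps" where
  "elliptic_class N L n \<Delta> v d \<sigma> =
     Abs_fps (\<lambda>k. HT_class \<Delta> (fps_nth (elliptic_series N L n \<Delta> v d \<sigma>) k))"

text \<open>All fractional powers of \<open>q\<close> occurring in the elliptic class are powers of \<open>q\<^sup>1\<^sup>/\<^sup>N\<close>. As the
  groups \<open>G\<^sub>I\<close> are finite, every sufficiently divisible \<open>N\<close> qualifies.\<close>

definition q_denominator ::
  "nat \<Rightarrow> 'v::real_vector set \<Rightarrow> nat \<Rightarrow> ('i, 'v) multi_fan \<Rightarrow> ('i \<Rightarrow> 'v) \<Rightarrow> bool" where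
  "q_denominator N L n \<Delta> v \<longleftrightarrow> N > 0 \<and>
     (\<forall>I\<in>k_simplices \<Delta> n. \<forall>g\<in>G_group L \<Delta> v I. \<forall>i. real N * g i \<in> \<int>)"

end

theory Submission imports Defs "HOL-Complex_Analysis.Laurent_Convergence" begin

text \<open>By Kronecker's identity, \<open>\<phi>\<^sub>s\<^sub>t\<close> is the bilateral series
  \<open>\<Sum>\<^sub>k T\<^sup>k s\<^bsup>ek\<^esup> / (1 - \<zeta> s\<^bsup>Nk\<^esup>)\<close> (with \<open>t = T s\<^sup>e\<close>, \<open>q = s\<^sup>N\<close>). Evaluate the local contribution of a top
  simplex \<open>I\<close> at a generic point \<open>y w\<close>, \<open>y > 0\<close>. Multiplying the series for \<open>i \<in> I\<close> and summing over the
  second group element, the orthogonality of characters selects the exponents that come from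
  \<open>m \<in> L\<^sup>*\<close>, so the contribution divided by \<open>\<bar>H\<^sub>I\<bar> u\<^sub>I\<close> becomes \<open>\<Sum>\<^sub>m e\<^bsup>- m(w) y\<^esup> R\<^sub>I(m)\<close>. Here \<open>R\<^sub>I(m)\<close> is the
  generating function, at the character \<open>x \<mapsto> \<zeta>\<^bsup>\<xi>(x)\<^esup> q\<^bsup>m(x)\<^esup>\<close>, of the lattice points of the half-open
  cone of those \<open>x\<close> for which \<open>x + \<delta> w\<close> lies in \<open>C(I)\<close> for small \<open>\<delta> > 0\<close>. For a subdivision these half-open
  cones form a partition, and \<open>\<rho>\<^sup>*\<xi>\<close> induces the same character, so the \<open>R\<close> add up; hence so do the
  contributions. Agreement on all generic rays gives the identity of power series, and the classes
  are determined by their restrictions to the top simplices.\<close>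

section \<open>Kronecker's identity for Laurent series\<close>

text \<open>\<open>phi_st\<close> is formal: it lives in Laurent series in \<open>s\<close> over
  Laurent series in \<open>x\<close>. The classical proof of Kronecker's identity by poles and
  periods is therefore replaced by an exact partial fraction identity for the truncated product over
  any field, followed by an s-adic limit. Analysis enters only afterwards: each coefficient in
  \<open>s\<close> is a rational expression in \<open>T = e^(-x) * cis (- 2 * pi * b)\<close> with
  at most a simple pole at \<open>x = 0\<close>, so it can be evaluated at points
  \<open>y w\<close>.

  The obstacle is convergence. For \<open>e = 0\<close> the coefficient of \<open>s^0\<close>
  contains \<open>T / (1 - T)\<close>, to be expanded in \<open>T\<close> if \<open>|T| < 1\<close>
  and in \<open>1 / T\<close> if \<open>|T| > 1\<close>; the sign of the i-th coordinate of
  \<open>w\<close> decides which. Changing sides subtracts 1 from every coefficient of the bilateral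
  series, and this turns the numerator 1 over \<open>1 - z s^(N k)\<close> into
  \<open>z s^(N k)\<close>: the lattice coordinate 0 becomes 1. The side of the expansion and the
  facets that belong to the half-open cone are thus one and the same choice. This is why half-open
  cones appear, and why \<open>w\<close> must avoid the facet hyperplanes of the top cones of both
  fans.\<close>

lemma degree_prod_linear_le:
  fixes f :: "'i \<Rightarrow> 'a::comm_ring_1"
  assumes "finite A"
  shows "degree (\<Prod>i\<in>A. [:1, f i:]) \<le> card A"
proof -
  have "degree (\<Prod>i\<in>A. [:1, f i:]) \<le> (\<Sum>i\<in>A. degree [:1, f i:])"
    using degree_prod_sum_le[OF assms, of "\<lambda>i. [:1, f i:]"] by (simp add: o_def)
  also have "\<dots> \<le> (\<Sum>i\<in>A. 1)" by (intro sum_mono) simp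
  finally show ?thesis by simp
qed

text \<open>Lagrange interpolation of \<open>\<Prod>\<^sub>i (1 - z Q\<^sup>i t)\<close> at the points \<open>Q\<^sup>-\<^sup>j\<close> and its zero \<open>(z Q\<^sup>M)\<^sup>-\<^sup>1\<close>. With \<open>n = 2M\<close> and
  \<open>t\<close> rescaled by \<open>Q\<^sup>-\<^sup>M\<close> this is the partial fraction expansion of the truncated product.\<close>

lemma lagrange_theta_quotient:
  fixes Q z t :: "'a::field"
  assumes Q: "Q \<noteq> 0" "\<And>j. j \<ge> 1 \<Longrightarrow> Q ^ j \<noteq> 1"
    and z: "z \<noteq> 0" "\<And>j k. z * Q ^ j \<noteq> Q ^ k"
    and t: "\<And>i. t * Q ^ i \<noteq> 1"
    and "M \<le> n"
  shows "(\<Prod>i\<le>n. (1 - z * Q ^ i * t) / (1 - Q ^ i * t)) =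
    (\<Sum>j\<le>n. (\<Prod>i\<le>n. 1 - z * Q ^ i / Q ^ j) / (\<Prod>i\<in>{..n} - {j}. 1 - Q ^ i / Q ^ j) *
       ((1 - z * Q ^ M * t) / ((1 - Q ^ j * t) * (1 - z * Q ^ M / Q ^ j))))"
proof -
  define x where "x = (\<lambda>j. inverse (Q ^ j))"
  define w where "w = inverse (z * Q ^ M)"
  define p where "p = (\<Prod>i\<le>n. [:1, - (z * Q ^ i):])"
  define c where "c = (\<lambda>j. poly p (x j) / (\<Prod>i\<in>{..n} - {j}. 1 - Q ^ i / Q ^ j) / (1 - z * Q ^ M / Q ^ j))"
  define l where "l = (\<lambda>j. [:1, - (z * Q ^ M):] * (\<Prod>i\<in>{..n} - {j}. [:1, - (Q ^ i):]))"
  define q where "q = (\<Sum>j\<le>n. smult (c j) (l j))"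
  have Qpow: "i = j" if "Q ^ i = Q ^ j" for i j
  proof (rule ccontr)
    assume "i \<noteq> j"
    then consider "i < j" | "j < i" by linarith
    then show False
    proof cases
      case 1
      then have "Q ^ j = Q ^ i * Q ^ (j - i)" by (simp flip: power_add)
      then show False using that Q(1) Q(2)[of "j - i"] 1 by auto
    next
      case 2
      then have "Q ^ i = Q ^ j * Q ^ (i - j)" by (simp flip: power_add)
      then show False using that Q(1) Q(2)[of "i - j"] 2 by auto
    qed
  qed
  have injx: "inj_on x {..n}"
    by (rule inj_onI) (auto simp: x_def dest: Qpow)
  have wx: "w \<notin> x ` {..n}"
  proof
    assume "w \<in> x ` {..n}"
    then obtain j where j: "w = x j" by blast
    have "z * Q ^ M = inverse w" unfolding w_def by simp
    also have "\<dots> = Q ^ j" unfolding j x_def by simp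
    finally show False using z(2) by blast
  qed
  \<comment> \<open>A polynomial of degree at most \<open>n + 1\<close> needs \<open>n + 2\<close>
    nodes. The \<open>n + 1\<close> points \<open>x j\<close> are completed by the zero
    \<open>w\<close> of \<open>p\<close>, which exists because \<open>M \<le> n\<close>; choosing a
    zero gives every \<open>l j\<close> the same factor and adds no term to the interpolant.\<close>
  have "p = q"
  proof (rule poly_eqI_degree)
    have card: "card (insert w (x ` {..n})) = n + 2"
      using wx injx by (simp add: card_image)
    have "degree p \<le> n + 1"
      using degree_prod_linear_le[of "{..n}" "\<lambda>i. - (z * Q ^ i)"] by (simp add: p_def)
    then show "degree p < card (insert w (x ` {..n}))" using card by simp
    have dl: "degree (l j) \<le> n + 1" if "j \<le> n" for j
    proof -
      have "degree (\<Prod>i\<in>{..n} - {j}. [:1, - (Q ^ i):]) \<le> n"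
        using degree_prod_linear_le[of "{..n} - {j}" "\<lambda>i. - (Q ^ i)"] that by simp
      moreover have "degree [:1, - (z * Q ^ M):] \<le> 1" by simp
      ultimately show ?thesis unfolding l_def
        by (intro order_trans[OF degree_mult_le]) linarith
    qed
    have "degree q \<le> n + 1" unfolding q_def
      by (rule degree_sum_le) (use dl in \<open>auto intro!: order_trans[OF degree_smult_le]\<close>)
    then show "degree q < card (insert w (x ` {..n}))" using card by simp
  next
    fix y assume "y \<in> insert w (x ` {..n})"
    then consider "y = w" | j where "j \<le> n" "y = x j" by auto
    then show "poly p y = poly q y"
    proof cases
      case 1
      have nz: "z * Q ^ M * w = 1" unfolding w_def using z(1) Q(1) by (intro right_inverse) simp
      have "poly p w = 0" unfolding p_def poly_prod
        by (rule prod_zero) (use nz \<open>M \<le> n\<close> in \<open>auto simp: mult_ac intro!: bexI[of _ M]\<close>)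
      moreover have "poly q w = 0" unfolding q_def poly_sum
        by (rule sum.neutral) (use nz in \<open>auto simp: l_def mult_ac\<close>)
      ultimately show ?thesis using 1 by simp
    next
      case 2
      have "poly (l i) (x j) = 0" if "i \<le> n" "i \<noteq> j" for i
      proof -
        have "poly (\<Prod>i\<in>{..n} - {i}. [:1, - (Q ^ i):]) (x j) = 0"
          unfolding poly_prod by (rule prod_zero) (use Q 2 that in \<open>auto simp: x_def intro!: bexI[of _ j]\<close>)
        then show ?thesis by (simp add: l_def)
      qed
      then have "poly q (x j) = (\<Sum>i\<in>{j}. c i * poly (l i) (x j))"
        unfolding q_def poly_sum using 2 by (intro sum.mono_neutral_cong_right) auto
      moreover have "poly (l j) (x j) = (1 - z * Q ^ M / Q ^ j) * (\<Prod>i\<in>{..n} - {j}. 1 - Q ^ i / Q ^ j)"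
        by (simp add: l_def poly_prod x_def divide_inverse algebra_simps)
      moreover have nz1: "1 - z * Q ^ M / Q ^ j \<noteq> 0"
        using z(2)[of M j] Q(1) by (metis divide_eq_1_iff eq_iff_diff_eq_0)
      moreover have "1 - Q ^ i / Q ^ j \<noteq> 0" if "i \<noteq> j" for i
        using Qpow[of i j] that by (metis divide_eq_1_iff eq_iff_diff_eq_0)
      then have "(\<Prod>i\<in>{..n} - {j}. 1 - Q ^ i / Q ^ j) \<noteq> 0"
        by (subst prod_zero_iff) auto
      then have "poly p (x j) / (\<Prod>i\<in>{..n} - {j}. 1 - Q ^ i / Q ^ j) / (1 - z * Q ^ M / Q ^ j) *
          ((1 - z * Q ^ M / Q ^ j) * (\<Prod>i\<in>{..n} - {j}. 1 - Q ^ i / Q ^ j)) = poly p (x j)"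
        using nz1 by (metis (no_types, lifting) divide_divide_eq_left mult.commute no_zero_divisors nonzero_divide_eq_eq)
      ultimately show ?thesis unfolding c_def 2(2) by simp
    qed
  qed
  have den: "(\<Prod>i\<le>n. 1 - Q ^ i * t) \<noteq> 0"
    using t by (auto simp: mult.commute)
  have split: "(\<Prod>i\<le>n. 1 - Q ^ i * t) = (1 - Q ^ j * t) * (\<Prod>i\<in>{..n} - {j}. 1 - Q ^ i * t)" if "j \<le> n" for j
    using that by (intro prod.remove) auto
  have "(\<Prod>i\<le>n. (1 - z * Q ^ i * t) / (1 - Q ^ i * t)) = poly p t / (\<Prod>i\<le>n. 1 - Q ^ i * t)"
    by (simp add: p_def poly_prod prod_dividef mult.commute mult.left_commute)
  also have "\<dots> = (\<Sum>j\<le>n. c j * poly (l j) t / (\<Prod>i\<le>n. 1 - Q ^ i * t))"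
    by (simp add: \<open>p = q\<close> q_def poly_sum sum_divide_distrib)
  also have "\<dots> = (\<Sum>j\<le>n. (\<Prod>i\<le>n. 1 - z * Q ^ i / Q ^ j) / (\<Prod>i\<in>{..n} - {j}. 1 - Q ^ i / Q ^ j) *
       ((1 - z * Q ^ M * t) / ((1 - Q ^ j * t) * (1 - z * Q ^ M / Q ^ j))))"
  proof (rule sum.cong)
    fix j assume j: "j \<in> {..n}"
    have pj: "poly p (x j) = (\<Prod>i\<le>n. 1 - z * Q ^ i / Q ^ j)"
      by (simp add: p_def poly_prod x_def divide_inverse mult.commute)
    have nz: "(\<Prod>i\<in>{..n} - {j}. 1 - Q ^ i * t) \<noteq> 0" using t by (auto simp: mult.commute)
    have e: "poly (l j) t / (\<Prod>i\<le>n. 1 - Q ^ i * t) = (1 - z * Q ^ M * t) / (1 - Q ^ j * t)"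
    proof -
      have "poly (l j) t = (1 - z * Q ^ M * t) * (\<Prod>i\<in>{..n} - {j}. 1 - Q ^ i * t)"
        by (simp add: l_def poly_prod algebra_simps)
      then show ?thesis using split[of j] j nz by simp
    qed
    have "c j * poly (l j) t / (\<Prod>i\<le>n. 1 - Q ^ i * t) =
        c j * (poly (l j) t / (\<Prod>i\<le>n. 1 - Q ^ i * t))" by simp
    then show "c j * poly (l j) t / (\<Prod>i\<le>n. 1 - Q ^ i * t) =
      (\<Prod>i\<le>n. 1 - z * Q ^ i / Q ^ j) / (\<Prod>i\<in>{..n} - {j}. 1 - Q ^ i / Q ^ j) *
       ((1 - z * Q ^ M * t) / ((1 - Q ^ j * t) * (1 - z * Q ^ M / Q ^ j)))"
      unfolding e c_def pj by simp
  qed simp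
  finally show ?thesis .
qed

text \<open>The quotient \<open>(zQ; Q)_n / (Q; Q)_n\<close> of q-Pochhammer symbols.\<close>

definition qpoch_ratio :: "'a::field \<Rightarrow> 'a \<Rightarrow> nat \<Rightarrow> 'a" where
  "qpoch_ratio Q z n = (\<Prod>i=1..n. (1 - z * Q ^ i) / (1 - Q ^ i))"

text \<open>The factor with \<open>i = j\<close> gives \<open>1 - z\<close> and those with
  \<open>i > j\<close> give \<open>qpoch_ratio Q z (n - j)\<close>. For \<open>i < j\<close> the
  powers of \<open>Q\<close> are negative; the rule
  \<open>(1 - z/x) / (1 - 1/x) = z (1 - x/z) / (1 - x)\<close> inverts them at the cost of one
  \<open>z\<close> per factor.\<close>

lemma lagrange_weight:
  fixes Q z :: "'a::field"
  assumes Q: "Q \<noteq> 0" "\<And>j. j \<ge> 1 \<Longrightarrow> Q ^ j \<noteq> 1" and z: "z \<noteq> 0" and j: "j \<le> n"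
  shows "(\<Prod>i\<le>n. 1 - z * Q ^ i / Q ^ j) / (\<Prod>i\<in>{..n} - {j}. 1 - Q ^ i / Q ^ j) =
     (1 - z) * z ^ j * qpoch_ratio Q (inverse z) j * qpoch_ratio Q z (n - j)"
proof -
  have split: "(\<Prod>i\<in>{..n} - {j}. f i) = (\<Prod>i=1..j. f (j - i)) * (\<Prod>i=1..n - j. f (j + i))"
    for f :: "nat \<Rightarrow> 'a"
  proof -
    have "(\<Prod>i\<in>{..n} - {j}. f i) = (\<Prod>i\<in>{..<j} \<union> {j<..n}. f i)"
      by (rule prod.cong) (use j in auto)
    also have "\<dots> = (\<Prod>i<j. f i) * (\<Prod>i\<in>{j<..n}. f i)" by (rule prod.union_disjoint) auto
    also have "(\<Prod>i<j. f i) = (\<Prod>i=1..j. f (j - i))"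
      by (rule prod.reindex_bij_witness[of _ "\<lambda>i. j - i" "\<lambda>i. j - i"]) auto
    also have "(\<Prod>i\<in>{j<..n}. f i) = (\<Prod>i=1..n - j. f (j + i))"
      by (rule prod.reindex_bij_witness[of _ "\<lambda>i. j + i" "\<lambda>i. i - j"]) auto
    finally show ?thesis .
  qed
  have up: "Q ^ (j + i) / Q ^ j = Q ^ i" for i using Q by (simp add: power_add)
  have dn: "Q ^ (j - i) / Q ^ j = inverse (Q ^ i)" if "i \<le> j" for i
    using Q that by (simp add: power_diff field_simps)
  have e1: "(\<Prod>i\<in>{..n} - {j}. 1 - z * Q ^ i / Q ^ j) =
      (\<Prod>i=1..j. 1 - z * inverse (Q ^ i)) * (\<Prod>i=1..n - j. 1 - z * Q ^ i)"
    unfolding split times_divide_eq_right[symmetric] up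
    by (intro arg_cong2[where f = "(*)"] prod.cong) (auto simp: dn)
  have e2: "(\<Prod>i\<in>{..n} - {j}. 1 - Q ^ i / Q ^ j) =
      (\<Prod>i=1..j. 1 - inverse (Q ^ i)) * (\<Prod>i=1..n - j. 1 - Q ^ i)"
    unfolding split up by (intro arg_cong2[where f = "(*)"] prod.cong) (auto simp: dn)
  have e3: "(\<Prod>i\<le>n. 1 - z * Q ^ i / Q ^ j) = (1 - z) * (\<Prod>i\<in>{..n} - {j}. 1 - z * Q ^ i / Q ^ j)"
    using j Q by (subst prod.remove[of _ j]) auto
  have e4: "(\<Prod>i=1..j. 1 - z * inverse (Q ^ i)) / (\<Prod>i=1..j. 1 - inverse (Q ^ i)) =
     z ^ j * qpoch_ratio Q (inverse z) j"
  proof -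
    have "(1 - z * inverse (Q ^ i)) / (1 - inverse (Q ^ i)) = z * ((1 - inverse z * Q ^ i) / (1 - Q ^ i))"
      if "i \<in> {1..j}" for i
    proof -
      have alg: "(1 - z * inverse x) / (1 - inverse x) = z * ((1 - inverse z * x) / (1 - x))"
        if "x \<noteq> 0" "x \<noteq> 1" for x
      proof -
        have "1 - x \<noteq> 0" "x - 1 \<noteq> 0" using that by auto
        then show ?thesis using z that by (simp add: divide_simps) (simp add: algebra_simps)
      qed
      show ?thesis by (rule alg) (use Q(1) Q(2)[of i] that in auto)
    qed
    then have "(\<Prod>i=1..j. (1 - z * inverse (Q ^ i)) / (1 - inverse (Q ^ i))) =
        (\<Prod>i=1..j. z * ((1 - inverse z * Q ^ i) / (1 - Q ^ i)))" by (rule prod.cong[OF refl])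
    then show ?thesis by (simp add: prod_dividef prod.distrib qpoch_ratio_def)
  qed
  have e5: "(\<Prod>i=1..n - j. 1 - z * Q ^ i) / (\<Prod>i=1..n - j. 1 - Q ^ i) = qpoch_ratio Q z (n - j)"
    by (simp add: qpoch_ratio_def prod_dividef)
  have assoc: "(1 - z) * (p * q) / (r * s) = (1 - z) * (p / r) * (q / s)" for p q r s
    by simp
  show ?thesis
    unfolding e3 e1 e2 assoc e4 e5 by (simp only: mult.assoc)
qed

definition phi_trunc :: "nat \<Rightarrow> 'a::field \<Rightarrow> 'a \<Rightarrow> 'a \<Rightarrow> 'a" where
  "phi_trunc M t q z = (1 - z * t) / ((1 - z) * (1 - t)) *
     (\<Prod>k<M. ((1 - q ^ Suc k)\<^sup>2 * (1 - z * t * q ^ Suc k) *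
              (1 - inverse z * inverse t * q ^ Suc k)) /
            ((1 - z * q ^ Suc k) * (1 - inverse z * q ^ Suc k) *
              (1 - t * q ^ Suc k) * (1 - inverse t * q ^ Suc k)))"

text \<open>Rescaling by \<open>Q ^ M\<close> centres the product, so that the indices
  \<open>M + l\<close> and \<open>M - l\<close> pair up to the factors in \<open>t * Q ^ l\<close>
  and \<open>inverse t * Q ^ l\<close>. All weights are divided by the one at \<open>j = M\<close>;
  the remaining quotients of \<open>a\<close> and \<open>b\<close> tend to 1 in the application,
  which leaves Kronecker's series.\<close>

lemma phi_trunc_partial_fractions:
  fixes Q z t :: "'a::field"
  assumes Q: "Q \<noteq> 0" "\<And>j. j \<ge> 1 \<Longrightarrow> Q ^ j \<noteq> 1"
    and z: "z \<noteq> 0" "\<And>j k. z * Q ^ j \<noteq> Q ^ k"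
    and t: "t \<noteq> 0" "\<And>j k. t * Q ^ j \<noteq> Q ^ k"
  defines "a \<equiv> qpoch_ratio Q z" and "b \<equiv> qpoch_ratio Q (inverse z)"
  shows "phi_trunc M t Q z = 1 / (1 - t) + z / (1 - z) +
     (\<Sum>l=1..M. z ^ l * (b (M + l) * a (M - l) / (b M * a M)) *
          (t * Q ^ l / (1 - t * Q ^ l) - inverse z * Q ^ l / (1 - inverse z * Q ^ l)) +
        inverse z ^ l * (b (M - l) * a (M + l) / (b M * a M)) *
          (z * Q ^ l / (1 - z * Q ^ l) - inverse t * Q ^ l / (1 - inverse t * Q ^ l)))"
proof -
  have Qi: "Q ^ i \<noteq> 0" for i using Q by simp
  have nz1: "1 - Q ^ i \<noteq> 0" if "i \<ge> 1" for i using Q(2)[OF that] by simp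
  have nz2: "1 - z * Q ^ i \<noteq> 0" for i using z(2)[of i 0] by simp
  have nz3: "1 - inverse z * Q ^ i \<noteq> 0" for i using z(2)[of 0 i] z(1) by (auto simp: field_simps)
  have nz4: "1 - t * Q ^ i \<noteq> 0" for i using t(2)[of i 0] by simp
  have nz5: "1 - inverse t * Q ^ i \<noteq> 0" for i using t(2)[of 0 i] t(1) by (auto simp: field_simps)
  have aM: "a i \<noteq> 0" for i unfolding a_def qpoch_ratio_def using nz1 nz2 by simp
  have bM: "b i \<noteq> 0" for i unfolding b_def qpoch_ratio_def using nz1 nz3 by simp
  define t' where "t' = t / Q ^ M"
  have t't: "Q ^ M * t' = t" using Qi by (simp add: t'_def)
  define g where "g = (\<lambda>i. (1 - z * Q ^ i * t') / (1 - Q ^ i * t'))"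
  define E where "E = (\<lambda>j. (1 - z * Q ^ M * t') / ((1 - Q ^ j * t') * (1 - z * Q ^ M / Q ^ j)))"
  have "(\<Prod>i\<le>2*M. g i) = (\<Sum>j\<le>2*M. (\<Prod>i\<le>2*M. 1 - z * Q ^ i / Q ^ j) / (\<Prod>i\<in>{..2*M} - {j}. 1 - Q ^ i / Q ^ j) * E j)"
    unfolding g_def E_def
  proof (rule lagrange_theta_quotient)
    show "t' * Q ^ i \<noteq> 1" for i
      using t(2)[of i M] Qi by (simp add: t'_def field_simps)
  qed (use Q z in auto)
  also have "\<dots> = (\<Sum>j\<le>2*M. (1 - z) * z ^ j * b j * a (2*M - j) * E j)"
    by (rule sum.cong) (auto simp: lagrange_weight[OF Q z(1)] a_def b_def)
  finally have lag: "(\<Prod>i\<le>2*M. g i) = (\<Sum>j\<le>2*M. (1 - z) * z ^ j * b j * a (2*M - j) * E j)" .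
  have split: "{..2*M} = insert M ((\<lambda>l. M + l) ` {1..M} \<union> (\<lambda>l. M - l) ` {1..M})"
  proof (intro equalityI subsetI)
    fix x assume "x \<in> {..2*M}"
    then show "x \<in> insert M ((\<lambda>l. M + l) ` {1..M} \<union> (\<lambda>l. M - l) ` {1..M})"
      by (cases "x = M"; cases "x < M") (auto intro!: image_eqI[of _ _ "x - M"] image_eqI[of _ _ "M - x"])
  qed auto
  have disj: "(\<lambda>l. M + l) ` {1..M} \<inter> (\<lambda>l. M - l) ` {1..M} = {}"
    "M \<notin> (\<lambda>l. M + l) ` {1..M} \<union> (\<lambda>l. M - l) ` {1..M}"
    and inj: "inj_on (\<lambda>l. M + l) {1..M}" "inj_on (\<lambda>l. M - l) {1..M}"
    by (auto simp: inj_on_def)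
  have psplit: "(\<Prod>i\<le>2*M. f i) = f M * (\<Prod>l=1..M. f (M + l) * f (M - l))" for f :: "nat \<Rightarrow> 'a"
    unfolding split prod.distrib
    by (simp only: prod.insert prod.union_disjoint disj prod.reindex inj finite_UnI finite_imageI
        finite_atLeastAtMost not_False_eq_True o_def)
  have ssplit: "(\<Sum>i\<le>2*M. f i) = f M + (\<Sum>l=1..M. f (M + l) + f (M - l))" for f :: "nat \<Rightarrow> 'a"
    unfolding split sum.distrib
    by (simp only: sum.insert sum.union_disjoint disj sum.reindex inj finite_UnI finite_imageI
        finite_atLeastAtMost not_False_eq_True o_def)
  have gM: "g M = (1 - z * t) / (1 - t)" by (simp add: g_def t't mult.assoc)
  have up: "Q ^ (M + l) * t' = t * Q ^ l" for l using t't by (simp add: power_add mult_ac)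
  have dn: "Q ^ (M - l) * t' = t / Q ^ l" if "l \<le> M" for l
    using that Qi by (simp add: t'_def power_diff Q)
  have gp: "g (M + l) = (1 - z * t * Q ^ l) / (1 - t * Q ^ l)" for l
    by (simp add: g_def mult.assoc up)
  have alg1: "(1 - z * (t / x)) / (1 - t / x) = z * ((1 - inverse z * inverse t * x) / (1 - inverse t * x))"
    if "x \<noteq> 0" "x \<noteq> t" for x
  proof -
    have "t - x \<noteq> 0" "x - t \<noteq> 0" using that by auto
    then show ?thesis using that t(1) z(1) by (simp add: divide_simps) (simp add: algebra_simps)
  qed
  have gm: "g (M - l) = z * ((1 - inverse z * inverse t * Q ^ l) / (1 - inverse t * Q ^ l))" if "l \<le> M" for l
    unfolding g_def mult.assoc dn[OF that] using alg1[OF Qi, of l] t(2)[of 0 l] by simp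
  have lhs: "(\<Prod>i\<le>2*M. g i) = (1 - z) * z ^ M * a M * b M * phi_trunc M t Q z"
  proof -
    have 2: "phi_trunc M t Q z * (a M * b M) = (1 - z * t) / ((1 - z) * (1 - t)) *
      (\<Prod>k=1..M. ((1 - Q ^ k)\<^sup>2 * (1 - z * t * Q ^ k) * (1 - inverse z * inverse t * Q ^ k)) /
            ((1 - z * Q ^ k) * (1 - inverse z * Q ^ k) * (1 - t * Q ^ k) * (1 - inverse t * Q ^ k)) *
            ((1 - z * Q ^ k) / (1 - Q ^ k) * ((1 - inverse z * Q ^ k) / (1 - Q ^ k))))"
    proof -
      have "phi_trunc M t Q z = (1 - z * t) / ((1 - z) * (1 - t)) *
        (\<Prod>k=1..M. ((1 - Q ^ k)\<^sup>2 * (1 - z * t * Q ^ k) * (1 - inverse z * inverse t * Q ^ k)) /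
            ((1 - z * Q ^ k) * (1 - inverse z * Q ^ k) * (1 - t * Q ^ k) * (1 - inverse t * Q ^ k)))"
        unfolding phi_trunc_def One_nat_def prod.atLeast1_atMost_eq ..
      then show ?thesis
        by (simp only: a_def b_def qpoch_ratio_def prod.distrib mult.assoc)
    qed
    have 3: "(\<Prod>k=1..M. ((1 - Q ^ k)\<^sup>2 * (1 - z * t * Q ^ k) * (1 - inverse z * inverse t * Q ^ k)) /
            ((1 - z * Q ^ k) * (1 - inverse z * Q ^ k) * (1 - t * Q ^ k) * (1 - inverse t * Q ^ k)) *
            ((1 - z * Q ^ k) / (1 - Q ^ k) * ((1 - inverse z * Q ^ k) / (1 - Q ^ k)))) =
       (\<Prod>k=1..M. (1 - z * t * Q ^ k) / (1 - t * Q ^ k) * ((1 - inverse z * inverse t * Q ^ k) / (1 - inverse t * Q ^ k)))"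
    proof (rule prod.cong[OF refl])
      fix k assume k: "k \<in> {1..M}"
      have alg: "(x\<^sup>2 * p * r) / (u * v * y * w) * (u / x * (v / x)) = p / y * (r / w)"
        if "x \<noteq> 0" "u \<noteq> 0" "v \<noteq> 0" "y \<noteq> 0" "w \<noteq> 0" for x p r u v y w :: 'a
        using that by (simp add: field_simps power2_eq_square)
      show "((1 - Q ^ k)\<^sup>2 * (1 - z * t * Q ^ k) * (1 - inverse z * inverse t * Q ^ k)) /
            ((1 - z * Q ^ k) * (1 - inverse z * Q ^ k) * (1 - t * Q ^ k) * (1 - inverse t * Q ^ k)) *
            ((1 - z * Q ^ k) / (1 - Q ^ k) * ((1 - inverse z * Q ^ k) / (1 - Q ^ k))) =
            (1 - z * t * Q ^ k) / (1 - t * Q ^ k) * ((1 - inverse z * inverse t * Q ^ k) / (1 - inverse t * Q ^ k))"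
        by (rule alg) (use nz1[of k] k nz2 nz3 nz4 nz5 in auto)
    qed
    have 1: "phi_trunc M t Q z * (a M * b M) = (1 - z * t) / ((1 - z) * (1 - t)) *
       (\<Prod>k=1..M. (1 - z * t * Q ^ k) / (1 - t * Q ^ k) * ((1 - inverse z * inverse t * Q ^ k) / (1 - inverse t * Q ^ k)))"
      unfolding 2 3 ..
    have 4: "(\<Prod>i\<le>2*M. g i) = (1 - z * t) / (1 - t) *
        (\<Prod>l=1..M. (1 - z * t * Q ^ l) / (1 - t * Q ^ l) * (z * ((1 - inverse z * inverse t * Q ^ l) / (1 - inverse t * Q ^ l))))"
    proof -
      have "g (M + l) * g (M - l) = (1 - z * t * Q ^ l) / (1 - t * Q ^ l) *
          (z * ((1 - inverse z * inverse t * Q ^ l) / (1 - inverse t * Q ^ l)))" if "l \<in> {1..M}" for l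
        using that by (simp only: gp gm atLeastAtMost_iff)
      then show ?thesis unfolding psplit gM by (simp only: cong: prod.cong)
    qed
    have 5: "(1 - z * t) / (1 - t) *
        (\<Prod>l=1..M. (1 - z * t * Q ^ l) / (1 - t * Q ^ l) * (z * ((1 - inverse z * inverse t * Q ^ l) / (1 - inverse t * Q ^ l)))) =
       (1 - z) * z ^ M * ((1 - z * t) / ((1 - z) * (1 - t)) *
       (\<Prod>k=1..M. (1 - z * t * Q ^ k) / (1 - t * Q ^ k) * ((1 - inverse z * inverse t * Q ^ k) / (1 - inverse t * Q ^ k))))"
    proof -
      have alg: "p / r * (u * (w * v)) = c * w * (p / (c * r) * (u * v))" if "c \<noteq> 0" for p r u v w c :: 'a
        using that by simp
      have "1 - z \<noteq> 0" using nz2[of 0] by simp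
      then show ?thesis
        by (simp only: prod.distrib prod_constant card_atLeastAtMost diff_Suc_1 alg)
    qed
    show ?thesis unfolding 4 5 1[symmetric] by (simp only: mult_ac)
  qed
  \<comment> \<open>\<open>alg2\<close> and \<open>alg3\<close> separate the pole in
    \<open>t\<close> from the pole in \<open>z\<close>, so that each part is a geometric
    series.\<close>
  have alg2: "(1 - z * t) / ((1 - t * x) * (1 - z / x)) = t * x / (1 - t * x) - inverse z * x / (1 - inverse z * x)"
    if "x \<noteq> 0" "t * x \<noteq> 1" "x \<noteq> z" for x
  proof -
    have "1 - t * x \<noteq> 0" "x - z \<noteq> 0" "z - x \<noteq> 0" using that by auto
    then show ?thesis using that z(1) by (simp add: divide_simps) (simp add: algebra_simps)
  qed
  have alg3: "(1 - z * t) / ((1 - t / x) * (1 - z * x)) = z * x / (1 - z * x) - inverse t * x / (1 - inverse t * x)"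
    if "x \<noteq> 0" "z * x \<noteq> 1" "x \<noteq> t" for x
  proof -
    have "1 - z * x \<noteq> 0" "x - t \<noteq> 0" "t - x \<noteq> 0" using that by auto
    then show ?thesis using that t(1) by (simp add: divide_simps) (simp add: algebra_simps)
  qed
  have EM: "E M = 1 / (1 - t) + z / (1 - z)"
  proof -
    have "1 - z \<noteq> 0" "1 - t \<noteq> 0" using nz2[of 0] nz4[of 0] by auto
    then have "(1 - z * t) / ((1 - t) * (1 - z)) = 1 / (1 - t) + z / (1 - z)"
      by (simp add: divide_simps) (simp add: algebra_simps)
    moreover have "E M = (1 - z * t) / ((1 - t) * (1 - z))"
      unfolding E_def using t't Qi[of M] by (simp add: mult.assoc Q)
    ultimately show ?thesis by simp
  qed
  have Ep: "E (M + l) = t * Q ^ l / (1 - t * Q ^ l) - inverse z * Q ^ l / (1 - inverse z * Q ^ l)" for l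
  proof -
    have "z * Q ^ M / Q ^ (M + l) = z / Q ^ l" using Q by (simp add: power_add)
    then have "E (M + l) = (1 - z * t) / ((1 - t * Q ^ l) * (1 - z / Q ^ l))"
      unfolding E_def using t't up by (simp add: mult.assoc)
    then show ?thesis using alg2[OF Qi, of l] z(2)[of 0 l] t(2)[of l 0] by simp
  qed
  have Em: "E (M - l) = z * Q ^ l / (1 - z * Q ^ l) - inverse t * Q ^ l / (1 - inverse t * Q ^ l)" if "l \<le> M" for l
  proof -
    have "z * Q ^ M / Q ^ (M - l) = z * Q ^ l" using Q that by (simp add: power_diff)
    then have "E (M - l) = (1 - z * t) / ((1 - t / Q ^ l) * (1 - z * Q ^ l))"
      unfolding E_def using t't dn[OF that] by (simp add: mult.assoc)
    then show ?thesis using alg3[OF Qi, of l] z(2)[of l 0] t(2)[of 0 l] by simp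
  qed
  \<comment> \<open>The weight of the central node, and by \<open>lhs\<close> also the factor
    between the centred product and \<open>phi_trunc\<close>.\<close>
  define K where "K = (1 - z) * z ^ M * a M * b M"
  have K: "K \<noteq> 0" using nz2[of 0] z aM bM by (simp add: K_def)
  define F where "F = (\<lambda>j. (1 - z) * z ^ j * b j * a (2*M - j) * E j)"
  have z1: "1 - z \<noteq> 0" using nz2[of 0] by simp
  have alg: "c * (w * u) * x * y * e / (c * w * r * s) = u * (x * y / (s * r)) * e"
    if "c \<noteq> 0" "w \<noteq> 0" for c w u x y e r s :: 'a
    using that by (simp add: mult_ac)
  have zM: "z ^ M \<noteq> 0" using z(1) by simp
  have FM: "F M / K = E M"
  proof -
    have "2 * M - M = M" by simp
    moreover have "c * w * y * x * e / (c * w * x * y) = e" if "c * w * x * y \<noteq> 0" for c w x y e :: 'a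
      using that by simp
    ultimately show ?thesis using K unfolding F_def K_def by (simp only:)
  qed
  have Fp: "F (M + l) / K = z ^ l * (b (M + l) * a (M - l) / (b M * a M)) * E (M + l)" for l
  proof -
    have "2 * M - (M + l) = M - l" by simp
    then show ?thesis unfolding F_def K_def power_add by (simp only: alg[OF z1 zM])
  qed
  have Fm: "F (M - l) / K = inverse z ^ l * (b (M - l) * a (M + l) / (b M * a M)) * E (M - l)"
    if "l \<le> M" for l
  proof -
    have "2 * M - (M - l) = M + l" using that by simp
    moreover have "z ^ (M - l) = z ^ M * inverse z ^ l"
      using z(1) that by (simp add: power_diff power_inverse divide_inverse)
    ultimately show ?thesis unfolding F_def K_def by (simp only: alg[OF z1 zM])
  qed
  have "phi_trunc M t Q z = (\<Prod>i\<le>2*M. g i) / K"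
    using K unfolding lhs K_def by simp
  also have "\<dots> = (\<Sum>j\<le>2*M. F j) / K" unfolding lag F_def ..
  also have "\<dots> = F M / K + (\<Sum>l=1..M. F (M + l) / K + F (M - l) / K)"
    by (simp only: ssplit add_divide_distrib sum_divide_distrib)
  also have "(\<Sum>l=1..M. F (M + l) / K + F (M - l) / K) =
     (\<Sum>l=1..M. z ^ l * (b (M + l) * a (M - l) / (b M * a M)) * E (M + l) +
        inverse z ^ l * (b (M - l) * a (M + l) / (b M * a M)) * E (M - l))"
    by (rule sum.cong[OF refl]) (simp only: Fp Fm atLeastAtMost_iff)
  also have "\<dots> = (\<Sum>l=1..M. z ^ l * (b (M + l) * a (M - l) / (b M * a M)) *
          (t * Q ^ l / (1 - t * Q ^ l) - inverse z * Q ^ l / (1 - inverse z * Q ^ l)) +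
        inverse z ^ l * (b (M - l) * a (M + l) / (b M * a M)) *
          (z * Q ^ l / (1 - z * Q ^ l) - inverse t * Q ^ l / (1 - inverse t * Q ^ l)))"
    by (rule sum.cong[OF refl]) (simp only: Ep Em atLeastAtMost_iff)
  finally show ?thesis unfolding FM EM .
qed

section \<open>Orders and congruences of Laurent series\<close>

definition fls_ge :: "int \<Rightarrow> 'a::zero fls \<Rightarrow> bool" where
  "fls_ge r f \<longleftrightarrow> (\<forall>j<r. fls_nth f j = 0)"

definition fls_monom :: "'a::field \<Rightarrow> int \<Rightarrow> 'a fls" where
  "fls_monom c a = fls_const c * fls_X_intpow a"

lemma fls_nth_monom [simp]: "fls_nth (fls_monom c a) k = (if k = a then c else 0)"
  by (simp add: fls_monom_def)

lemma fls_monom_0 [simp]: "fls_monom 0 a = 0"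
  by (rule fls_eqI) simp

lemma fls_monom_1: "fls_monom 1 0 = 1"
  by (rule fls_eqI) simp

lemma fls_monom_mult: "fls_monom c a * fls_monom d b = fls_monom (c * d) (a + b)"
  by (simp add: fls_monom_def fls_X_intpow_times_fls_X_intpow mult_ac flip: fls_const_mult_const)

lemma fls_monom_power: "fls_monom c a ^ n = fls_monom (c ^ n) (int n * a)"
  by (induction n) (simp_all add: fls_monom_1 fls_monom_mult algebra_simps)

lemma fls_monom_eq_iff: "c \<noteq> 0 \<Longrightarrow> fls_monom c a = fls_monom d b \<longleftrightarrow> c = d \<and> a = b"
  by (metis fls_nth_monom)

lemma fls_monom_inverse: "inverse (fls_monom c a) = fls_monom (inverse c) (- a)"
proof (cases "c = 0")
  case False
  then have "fls_monom c a * fls_monom (inverse c) (- a) = 1"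
    by (simp add: fls_monom_mult fls_monom_1)
  then show ?thesis by (rule inverse_unique)
qed simp

lemma fls_ge_zero [simp]: "fls_ge r 0"
  by (simp add: fls_ge_def)

lemma fls_ge_mono: "fls_ge r f \<Longrightarrow> r' \<le> r \<Longrightarrow> fls_ge r' f"
  by (auto simp: fls_ge_def)

lemma fls_ge_add: "fls_ge r f \<Longrightarrow> fls_ge r g \<Longrightarrow> fls_ge r (f + g)" for f :: "'a::group_add fls"
  by (simp add: fls_ge_def)

lemma fls_ge_diff: "fls_ge r f \<Longrightarrow> fls_ge r g \<Longrightarrow> fls_ge r (f - g)" for f :: "'a::group_add fls"
  by (simp add: fls_ge_def)

lemma fls_ge_uminus: "fls_ge r f \<Longrightarrow> fls_ge r (- f)" for f :: "'a::group_add fls"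
  by (simp add: fls_ge_def)

lemma fls_ge_sum: "(\<And>i. i \<in> A \<Longrightarrow> fls_ge r (f i)) \<Longrightarrow> fls_ge r (sum f A)"
  for f :: "'i \<Rightarrow> 'a::ab_group_add fls"
  by (induction A rule: infinite_finite_induct) (auto intro: fls_ge_add)

lemma fls_ge_iff: "fls_ge r f \<longleftrightarrow> f = 0 \<or> r \<le> fls_subdegree f"
  unfolding fls_ge_def using fls_eq0_below_subdegree[of _ f] nth_fls_subdegree_nonzero[of f]
  by (metis fls_subdegree_geI fls_zero_nth linorder_not_le order_less_le_trans)

lemma fls_ge_mult: "fls_ge r f \<Longrightarrow> fls_ge s g \<Longrightarrow> fls_ge (r + s) (f * g)" for f :: "'a::field fls"
  by (cases "f = 0 \<or> g = 0") (auto simp: fls_ge_iff)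

lemma fls_ge_monom: "r \<le> a \<Longrightarrow> fls_ge r (fls_monom c a)"
  by (simp add: fls_ge_def)

lemma fls_ge_1: "fls_ge 0 (1 :: 'a::field fls)"
  by (simp add: fls_ge_def)

definition fls_cong1 :: "int \<Rightarrow> 'a::field fls \<Rightarrow> bool" where
  "fls_cong1 r f \<longleftrightarrow> fls_ge r (f - 1)"

lemma fls_cong1_mono: "fls_cong1 r f \<Longrightarrow> r' \<le> r \<Longrightarrow> fls_cong1 r' f"
  unfolding fls_cong1_def by (rule fls_ge_mono)

lemma fls_cong1_ge_0:
  assumes "fls_cong1 r f" "r \<ge> 1" shows "fls_ge 0 f" "fls_ge 0 (inverse f)" "f \<noteq> 0"
proof -
  have *: "fls_nth f j = (if j = 0 then 1 else 0)" if "j < 1" for j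
    using assms that by (auto simp: fls_cong1_def fls_ge_def split: if_splits)
  then have "fls_subdegree f = 0" by (intro fls_subdegree_eqI) auto
  then show "fls_ge 0 f" "fls_ge 0 (inverse f)" by (simp_all add: fls_ge_iff fls_inverse_subdegree)
  show "f \<noteq> 0" using *[of 0] by auto
qed

lemma fls_cong1_1 [simp]: "fls_cong1 r 1"
  by (simp add: fls_cong1_def)

lemma fls_cong1_mult:
  assumes "fls_cong1 r f" "fls_cong1 r g" "r \<ge> 1" shows "fls_cong1 r (f * g)"
proof -
  have "f * g - 1 = (f - 1) * g + (g - 1)" by (simp add: algebra_simps)
  moreover have "fls_ge r ((f - 1) * g)"
    using fls_ge_mult[of r "f - 1" 0 g] assms fls_cong1_ge_0[of r g] by (simp add: fls_cong1_def)
  ultimately show ?thesis using assms(2) unfolding fls_cong1_def by (metis fls_ge_add)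
qed

lemma fls_cong1_inverse:
  assumes "fls_cong1 r f" "r \<ge> 1" shows "fls_cong1 r (inverse f)"
proof -
  have "inverse f - 1 = - ((f - 1) * inverse f)"
    using fls_cong1_ge_0(3)[OF assms] by (simp add: algebra_simps)
  moreover have "fls_ge r ((f - 1) * inverse f)"
    using fls_ge_mult[of r "f - 1" 0 "inverse f"] assms fls_cong1_ge_0[of r f] by (simp add: fls_cong1_def)
  ultimately show ?thesis by (simp add: fls_cong1_def fls_ge_uminus)
qed

lemma fls_cong1_divide:
  assumes "fls_cong1 r f" "fls_cong1 r g" "r \<ge> 1" shows "fls_cong1 r (f / g)"
  unfolding divide_inverse by (intro fls_cong1_mult fls_cong1_inverse assms)

lemma fls_cong1_prod:
  assumes "\<And>i. i \<in> A \<Longrightarrow> fls_cong1 r (f i)" "r \<ge> 1" shows "fls_cong1 r (prod f A)"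
  using assms by (induction A rule: infinite_finite_induct) (auto intro: fls_cong1_mult)

lemma fls_cong1_monom: "r \<le> a \<Longrightarrow> fls_cong1 r (1 - fls_monom c a)"
  unfolding fls_cong1_def by (simp add: fls_ge_uminus fls_ge_monom)

text \<open>The remainder is \<open>x ^ Suc M / (1 - x)\<close>, and \<open>1 - x\<close> is a unit
  of order 0.\<close>

lemma geometric_fls:
  fixes x :: "'a::field fls"
  assumes "fls_ge a x" "a \<ge> 1"
  shows "fls_ge (int M + 1) (x / (1 - x) - (\<Sum>k=1..M. x ^ k))"
proof -
  have c: "fls_cong1 1 (1 - x)"
    using assms unfolding fls_cong1_def by (simp add: fls_ge_uminus fls_ge_mono)
  have nz: "1 - x \<noteq> 0" using fls_cong1_ge_0(3)[OF c] by simp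
  have "(\<Sum>k=1..M. x ^ k) * (1 - x) = x - x ^ Suc M"
  proof (induction M)
    case (Suc M)
    have "(\<Sum>k=1..Suc M. x ^ k) * (1 - x) = (\<Sum>k=1..M. x ^ k) * (1 - x) + x ^ Suc M * (1 - x)"
      by (simp add: distrib_right)
    also have "\<dots> = x - x ^ Suc (Suc M)" unfolding Suc.IH by (simp add: algebra_simps)
    finally show ?case .
  qed simp
  then have "(\<Sum>k=1..M. x ^ k) = (x - x ^ Suc M) / (1 - x)"
    using nz by (simp add: eq_divide_eq)
  then have eq: "x / (1 - x) - (\<Sum>k=1..M. x ^ k) = x ^ Suc M * inverse (1 - x)"
    by (simp add: divide_inverse algebra_simps)
  have "fls_ge (int k * 1) (x ^ k)" for k
  proof (induction k)
    case 0 show ?case by (simp add: fls_ge_1)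
  next
    case (Suc k)
    have "fls_ge (1 + int k * 1) (x * x ^ k)"
      using assms by (intro fls_ge_mult Suc) (rule fls_ge_mono)
    then show ?case by (simp add: algebra_simps)
  qed
  from fls_ge_mult[OF this[of "Suc M"] fls_cong1_ge_0(2)[OF c]]
  show ?thesis unfolding eq by (simp add: algebra_simps)
qed

text \<open>The coefficient of \<open>s\<^sup>r\<close> in \<open>\<phi>\<^sub>s\<^sub>t\<close> at \<open>t = T s\<^sup>e\<close>, \<open>q = s\<^sup>N\<close>: double sum over \<open>k, l\<close> with \<open>k (N l \<plusminus> e) = r\<close>.
  For \<open>e = 0\<close> the part \<open>l = 0\<close> is summed to \<open>T / (1 - T)\<close>.\<close>

definition kronecker_coeff :: "nat \<Rightarrow> nat \<Rightarrow> 'a::field \<Rightarrow> 'a \<Rightarrow> nat \<Rightarrow> 'a" where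
  "kronecker_coeff N e z T r =
     (if r = 0 then 1 / (1 - z) + (if e = 0 then T / (1 - T) else 0) else 0) +
     (if e = 0 then 0 else \<Sum>k=1..r. if k * e = r then T ^ k else 0) +
     (\<Sum>l=1..r. \<Sum>k=1..r. (if k * (N * l + e) = r then z ^ l * T ^ k else 0) -
        (if k * (N * l - e) = r then inverse z ^ l * inverse T ^ k else 0))"

text \<open>The hypotheses keep all denominators away from zero: as \<open>e < N\<close>, the
  element \<open>t = T s^e\<close> can be a power of \<open>Q = s^N\<close> only if
  \<open>e = 0\<close> and \<open>T = 1\<close>.\<close>

locale kronecker =
  fixes N e :: nat and T z :: "'a::field"
  assumes eN: "e < N" and T0: "T \<noteq> 0" and z0: "z \<noteq> 0" and z1: "z \<noteq> 1"
    and T1: "e = 0 \<Longrightarrow> T \<noteq> 1"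
begin

definition "t = fls_monom T (int e)"
definition "Q = fls_monom (1::'a) (int N)"
definition "Z = fls_monom z 0"

lemma Qpow: "Q ^ l = fls_monom 1 (int (N * l))"
  by (simp add: Q_def fls_monom_power algebra_simps)

lemma Zpow: "Z ^ l = fls_monom (z ^ l) 0" "inverse Z ^ l = fls_monom (inverse z ^ l) 0"
  by (simp_all add: Z_def fls_monom_power fls_monom_inverse)

lemma monomial_forms:
  "t * Q ^ l = fls_monom T (int (N * l + e))" "Z * Q ^ l = fls_monom z (int (N * l))"
  "inverse Z * Q ^ l = fls_monom (inverse z) (int (N * l))"
  "inverse t * Q ^ l = fls_monom (inverse T) (int (N * l) - int e)"
  by (simp_all add: t_def Z_def Qpow fls_monom_mult fls_monom_inverse add.commute)

text \<open>This growth in \<open>l\<close>, due to \<open>e < N\<close>, makes the sums over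
  \<open>l\<close> converge s-adically in spite of the factors \<open>inverse t\<close>.\<close>

lemma Nl_minus_e_ge: "int (N * l) - int e \<ge> int l" if "l \<ge> 1" for l
proof -
  have "int (N * l) = int N * (int l - 1) + int N" by (simp add: algebra_simps)
  moreover have "int N * (int l - 1) \<ge> 1 * (int l - 1)" using eN that by (intro mult_right_mono) auto
  ultimately show ?thesis using eN by (simp only: mult_1)
qed

lemma Nl_ge: "int (N * l) \<ge> int l" for l
  using eN by (cases "l = 0") (auto simp: Suc_le_eq simp flip: of_nat_mult)

lemma fls_monom_ne_0: "c \<noteq> 0 \<Longrightarrow> fls_monom c k \<noteq> 0"
  by (metis fls_nth_monom fls_zero_nth)

lemma Q_ne: "Q \<noteq> 0" "j \<ge> 1 \<Longrightarrow> Q ^ j \<noteq> 1"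
proof -
  show "Q \<noteq> 0" unfolding Q_def by (rule fls_monom_ne_0) simp
  show "Q ^ j \<noteq> 1" if "j \<ge> 1"
    using fls_monom_eq_iff[of "1::'a" "int (N * j)" 1 0] eN that
    unfolding Qpow fls_monom_1[symmetric] by auto
qed

lemma Z_ne: "Z \<noteq> 0" "Z * Q ^ j \<noteq> Q ^ k"
proof -
  show "Z \<noteq> 0" unfolding Z_def by (rule fls_monom_ne_0) (rule z0)
  show "Z * Q ^ j \<noteq> Q ^ k"
    unfolding monomial_forms unfolding Qpow using fls_monom_eq_iff[OF z0] z1 by auto
qed

lemma t_ne: "t \<noteq> 0" "t * Q ^ j \<noteq> Q ^ k"
proof -
  show "t \<noteq> 0" unfolding t_def by (rule fls_monom_ne_0) (rule T0)
  show "t * Q ^ j \<noteq> Q ^ k"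
  proof
    assume "t * Q ^ j = Q ^ k"
    then have "T = 1 \<and> N * j + e = N * k"
      unfolding monomial_forms unfolding Qpow fls_monom_eq_iff[OF T0] of_nat_eq_iff .
    moreover from this have "(N * j + e) mod N = (N * k) mod N" by simp
    then have "e = 0" using eN by simp
    ultimately show False using T1 by simp
  qed
qed

definition "a = qpoch_ratio Q Z"
definition "b = qpoch_ratio Q (inverse Z)"

lemma factor_congN: "l \<ge> 1 \<Longrightarrow> fls_cong1 (int (N * l)) ((1 - Z * Q ^ l) / (1 - Q ^ l))"
  "l \<ge> 1 \<Longrightarrow> fls_cong1 (int (N * l)) ((1 - inverse Z * Q ^ l) / (1 - Q ^ l))"
  unfolding monomial_forms unfolding Qpow using Nl_ge[of l]
  by (intro fls_cong1_divide fls_cong1_monom; linarith)+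

text \<open>The quotient is the product of the \<open>g i\<close> with \<open>m < i \<le> n\<close>,
  and the worst of these is congruent to 1 to order \<open>N * Suc m\<close>.\<close>

lemma ratio_cong:
  fixes c :: "nat \<Rightarrow> 'a fls"
  assumes "\<And>l. l \<ge> 1 \<Longrightarrow> fls_cong1 (int (N * l)) (g l)" "\<And>n. c n = (\<Prod>i=1..n. g i)" "m \<le> n"
  shows "fls_cong1 (int (N * Suc m)) (c n / c m)" "fls_cong1 (int (N * Suc m)) (c m / c n)"
proof -
  have N: "int (N * Suc m) \<ge> 1" using Nl_ge[of "Suc m"] by simp
  have cm: "fls_cong1 (int (N * Suc 0)) (c k)" for k
    unfolding assms(2)
  proof (rule fls_cong1_prod)
    show "int (N * Suc 0) \<ge> 1" using eN by simp
    fix i assume "i \<in> {1..k}"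
    then show "fls_cong1 (int (N * Suc 0)) (g i)"
      by (intro fls_cong1_mono[OF assms(1)]) (auto simp del: of_nat_mult)
  qed
  have nz: "c k \<noteq> 0" for k using fls_cong1_ge_0(3)[OF cm] eN by simp
  have "c n = c m * (\<Prod>i=Suc m..n. g i)"
    unfolding assms(2) using prod.ub_add_nat[of 1 m g "n - m"] assms(3) by simp
  then have eq: "c n / c m = (\<Prod>i=Suc m..n. g i)" using nz[of m] by simp
  have 1: "fls_cong1 (int (N * Suc m)) (\<Prod>i=Suc m..n. g i)"
  proof (rule fls_cong1_prod)
    fix i assume "i \<in> {Suc m..n}"
    then show "fls_cong1 (int (N * Suc m)) (g i)"
      by (intro fls_cong1_mono[OF assms(1)]) (auto simp del: of_nat_mult mult_Suc_right)
  qed (rule N)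
  then show "fls_cong1 (int (N * Suc m)) (c n / c m)" by (simp add: eq)
  have "c m / c n = inverse (c n / c m)" by simp
  then show "fls_cong1 (int (N * Suc m)) (c m / c n)"
    unfolding eq using fls_cong1_inverse[OF 1 N] by simp
qed

lemmas a_cong = ratio_cong[OF factor_congN(1), of a, unfolded a_def qpoch_ratio_def, OF _ refl, folded qpoch_ratio_def a_def]
lemmas b_cong = ratio_cong[OF factor_congN(2), of b, unfolded b_def qpoch_ratio_def, OF _ refl, folded qpoch_ratio_def b_def]

lemma weight_cong:
  assumes "1 \<le> l" "l \<le> M"
  shows "fls_cong1 (int (N * Suc (M - l))) (b (M + l) * a (M - l) / (b M * a M))"
    "fls_cong1 (int (N * Suc (M - l))) (b (M - l) * a (M + l) / (b M * a M))"
proof -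
  have N: "int (N * Suc (M - l)) \<ge> 1" using Nl_ge[of "Suc (M - l)"] by simp
  have le: "int (N * Suc (M - l)) \<le> int (N * Suc M)" unfolding of_nat_le_iff by (rule mult_le_mono) auto
  show "fls_cong1 (int (N * Suc (M - l))) (b (M + l) * a (M - l) / (b M * a M))"
    unfolding times_divide_times_eq[symmetric]
    by (intro fls_cong1_mult[OF _ _ N] a_cong(2) fls_cong1_mono[OF b_cong(1) le]) auto
  show "fls_cong1 (int (N * Suc (M - l))) (b (M - l) * a (M + l) / (b M * a M))"
    unfolding times_divide_times_eq[symmetric]
    by (intro fls_cong1_mult[OF _ _ N] b_cong(2) fls_cong1_mono[OF a_cong(1) le]) auto
qed

definition "El l = t * Q ^ l / (1 - t * Q ^ l) - inverse Z * Q ^ l / (1 - inverse Z * Q ^ l)"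
definition "Fl l = Z * Q ^ l / (1 - Z * Q ^ l) - inverse t * Q ^ l / (1 - inverse t * Q ^ l)"

lemma geometric_quotient_ge: "r \<le> c \<Longrightarrow> 1 \<le> c \<Longrightarrow> fls_ge r (fls_monom d c / (1 - fls_monom d c))"
  using fls_ge_mult[OF fls_ge_monom[of r c d] fls_cong1_ge_0(2)[OF fls_cong1_monom[of 1 c d]]]
  by (simp add: divide_inverse)

lemma El_ge: "l \<ge> 1 \<Longrightarrow> fls_ge (int (N * l)) (El l)"
  and Fl_ge: "l \<ge> 1 \<Longrightarrow> fls_ge (int (N * l) - int e) (Fl l)"
  unfolding El_def Fl_def monomial_forms using Nl_minus_e_ge[of l] Nl_ge[of l] by (auto intro!: fls_ge_diff geometric_quotient_ge)

text \<open>For \<open>l\<close> near \<open>M\<close> the weights are only weakly congruent to 1,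
  but there \<open>El l\<close> and \<open>Fl l\<close> are small: the orders
  \<open>N (M - l + 1)\<close> and \<open>N l\<close> (less \<open>e\<close> for \<open>Fl\<close>)
  add up to at least \<open>M\<close> for every \<open>l\<close>.\<close>

lemma phi_trunc_weights_removed:
  "fls_ge (int M) (phi_trunc M t Q Z -
     (1 / (1 - t) + Z / (1 - Z) + (\<Sum>l=1..M. Z ^ l * El l + inverse Z ^ l * Fl l)))"
proof -
  have eq: "phi_trunc M t Q Z - (1 / (1 - t) + Z / (1 - Z) + (\<Sum>l=1..M. Z ^ l * El l + inverse Z ^ l * Fl l)) =
    (\<Sum>l=1..M. Z ^ l * ((b (M + l) * a (M - l) / (b M * a M) - 1) * El l) +
        inverse Z ^ l * ((b (M - l) * a (M + l) / (b M * a M) - 1) * Fl l))"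
  proof -
    have "phi_trunc M t Q Z = 1 / (1 - t) + Z / (1 - Z) +
      (\<Sum>l=1..M. Z ^ l * (b (M + l) * a (M - l) / (b M * a M)) * El l +
        inverse Z ^ l * (b (M - l) * a (M + l) / (b M * a M)) * Fl l)"
      unfolding El_def Fl_def a_def b_def
      by (rule phi_trunc_partial_fractions) (fact Q_ne Z_ne t_ne)+
    moreover have "x + y - (x + w) = y - w" for x y w :: "'a fls" by simp
    ultimately show ?thesis
      by (simp only: sum_subtractf[symmetric]) (rule sum.cong, simp_all add: algebra_simps)
  qed
  show ?thesis unfolding eq
  proof (intro fls_ge_sum fls_ge_add)
    fix l assume l: "l \<in> {1..M}"
    have s: "int (N * Suc (M - l)) + int (N * l) = int N * (int M + 1)"
    proof -
      have "Suc (M - l) + l = M + 1" using l by simp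
      then have "N * Suc (M - l) + N * l = N * (M + 1)" by (metis distrib_left)
      then show ?thesis by (metis of_nat_add of_nat_mult of_nat_1)
    qed
    have s2: "int N * (int M + 1) \<ge> int M + int N"
    proof -
      have "int N * int M \<ge> 1 * int M" using eN by (intro mult_right_mono) auto
      then show ?thesis by (simp add: algebra_simps)
    qed
    have Zge: "fls_ge 0 (Z ^ l)" "fls_ge 0 (inverse Z ^ l)" by (simp_all add: Zpow fls_ge_monom)
    have "fls_ge (0 + (int (N * Suc (M - l)) + int (N * l)))
        (Z ^ l * ((b (M + l) * a (M - l) / (b M * a M) - 1) * El l))"
      using weight_cong(1)[of l M] El_ge[of l] l Zge unfolding fls_cong1_def by (intro fls_ge_mult) auto
    then show "fls_ge (int M) (Z ^ l * ((b (M + l) * a (M - l) / (b M * a M) - 1) * El l))"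
      by (rule fls_ge_mono) (use s s2 in linarith)
    have "fls_ge (0 + (int (N * Suc (M - l)) + (int (N * l) - int e)))
        (inverse Z ^ l * ((b (M - l) * a (M + l) / (b M * a M) - 1) * Fl l))"
      using weight_cong(2)[of l M] Fl_ge[of l] l Zge unfolding fls_cong1_def by (intro fls_ge_mult) auto
    then show "fls_ge (int M) (inverse Z ^ l * ((b (M - l) * a (M + l) / (b M * a M) - 1) * Fl l))"
      by (rule fls_ge_mono) (use s s2 eN in linarith)
  qed
qed

text \<open>The truncated Kronecker series. It has no double sum in \<open>z\<close> alone, because
  the two such sums coming from \<open>El\<close> and \<open>Fl\<close> cancel.\<close>

definition "S M = fls_monom (1 / (1 - z) + (if e = 0 then T / (1 - T) else 0)) 0 +
   (if e = 0 then 0 else \<Sum>k=1..M. fls_monom (T ^ k) (int (k * e))) +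
   (\<Sum>l=1..M. \<Sum>k=1..M. fls_monom (z ^ l * T ^ k) (int (k * (N * l + e))) -
      fls_monom (inverse z ^ l * inverse T ^ k) (int (k * (N * l - e))))"

text \<open>The left part equals \<open>1 / (1 - Z) + t / (1 - t)\<close>. For \<open>e > 0\<close>
  the second summand is a convergent geometric series; for \<open>e = 0\<close> it is a constant and
  has to stay closed.\<close>

lemma const_part: "fls_ge (int M) (1 / (1 - t) + Z / (1 - Z) -
   (fls_monom (1 / (1 - z) + (if e = 0 then T / (1 - T) else 0)) 0 +
   (if e = 0 then 0 else \<Sum>k=1..M. fls_monom (T ^ k) (int (k * e)))))"
proof -
  have nz: "1 - Z \<noteq> 0" "1 - t \<noteq> 0" using Z_ne(2)[of 0 0] t_ne(2)[of 0 0] by auto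
  then have "1 / (1 - t) + Z / (1 - Z) = 1 / (1 - Z) + t / (1 - t)"
    by (simp add: divide_simps) (simp add: algebra_simps)
  moreover have one: "1 - fls_monom c 0 = fls_monom (1 - c) 0" for c :: 'a
    by (rule fls_eqI) (auto simp: fls_monom_1[symmetric] simp del: fls_one_nth)
  have Z1: "1 / (1 - Z) = fls_monom (1 / (1 - z)) 0"
    by (simp add: Z_def one divide_inverse fls_monom_inverse)
  moreover have add: "fls_monom c k + fls_monom d k = fls_monom (c + d) k" for c d :: 'a and k
    by (rule fls_eqI) simp
  moreover have "t / (1 - t) = fls_monom (T / (1 - T)) 0" if "e = 0"
    unfolding t_def unfolding that by (simp add: one divide_inverse fls_monom_inverse fls_monom_mult)
  moreover have "fls_ge (int M) (t / (1 - t) - (\<Sum>k=1..M. fls_monom (T ^ k) (int (k * e))))" if "e \<noteq> 0"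
  proof -
    have "fls_ge (int e) t" unfolding t_def by (rule fls_ge_monom) simp
    then have "fls_ge (int M + 1) (t / (1 - t) - (\<Sum>k=1..M. t ^ k))"
      using that by (intro geometric_fls) auto
    moreover have "t ^ k = fls_monom (T ^ k) (int (k * e))" for k
      by (simp add: t_def fls_monom_power)
    ultimately show ?thesis by (simp add: fls_ge_mono)
  qed
  ultimately show ?thesis by (cases "e = 0") (simp_all flip: add)
qed

lemma phi_trunc_cong: "fls_ge (int M) (phi_trunc M t Q Z - S M)"
proof -
  \<comment> \<open>The geometric series are cut at the same \<open>M\<close> as the sum over
    \<open>l\<close>; only this makes the cancellation below exact.\<close>
  define ge where "ge = (\<lambda>x. (\<Sum>k=1..M. x ^ k :: 'a fls))"
  define R where "R = (\<Sum>l=1..M. Z ^ l * (ge (t * Q ^ l) - ge (inverse Z * Q ^ l)) +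
     inverse Z ^ l * (ge (Z * Q ^ l) - ge (inverse t * Q ^ l)))"
  have step2: "fls_ge (int M) ((\<Sum>l=1..M. Z ^ l * El l + inverse Z ^ l * Fl l) - R)"
    unfolding R_def sum_subtractf[symmetric]
  proof (rule fls_ge_sum)
    fix l assume l: "l \<in> {1..M}"
    have Zge: "fls_ge 0 (Z ^ l)" "fls_ge 0 (inverse Z ^ l)" by (simp_all add: Zpow fls_ge_monom)
    have 1: "int (N * l) \<ge> 1" "int (N * l) - int e \<ge> 1" "int (N * l + e) \<ge> 1"
      using Nl_minus_e_ge[of l] l by auto
    have g: "fls_ge (int M) (fls_monom c r / (1 - fls_monom c r) - ge (fls_monom c r))" if "r \<ge> 1" for c r
      unfolding ge_def by (rule fls_ge_mono[OF geometric_fls[of r]]) (use that in \<open>auto simp: fls_ge_monom\<close>)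
    have "fls_ge (0 + int M) (Z ^ l * (El l - (ge (t * Q ^ l) - ge (inverse Z * Q ^ l))))"
    proof (rule fls_ge_mult[OF Zge(1)])
      have "fls_ge (int M) ((t * Q ^ l / (1 - t * Q ^ l) - ge (t * Q ^ l)) -
         (inverse Z * Q ^ l / (1 - inverse Z * Q ^ l) - ge (inverse Z * Q ^ l)))"
        unfolding monomial_forms by (intro fls_ge_diff g 1)
      then show "fls_ge (int M) (El l - (ge (t * Q ^ l) - ge (inverse Z * Q ^ l)))"
        by (simp add: El_def algebra_simps)
    qed
    moreover have "fls_ge (0 + int M) (inverse Z ^ l * (Fl l - (ge (Z * Q ^ l) - ge (inverse t * Q ^ l))))"
    proof (rule fls_ge_mult[OF Zge(2)])
      have "fls_ge (int M) ((Z * Q ^ l / (1 - Z * Q ^ l) - ge (Z * Q ^ l)) -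
         (inverse t * Q ^ l / (1 - inverse t * Q ^ l) - ge (inverse t * Q ^ l)))"
        unfolding monomial_forms by (intro fls_ge_diff g 1)
      then show "fls_ge (int M) (Fl l - (ge (Z * Q ^ l) - ge (inverse t * Q ^ l)))"
        by (simp add: Fl_def algebra_simps)
    qed
    ultimately have "fls_ge (int M) (Z ^ l * (El l - (ge (t * Q ^ l) - ge (inverse Z * Q ^ l))) +
       inverse Z ^ l * (Fl l - (ge (Z * Q ^ l) - ge (inverse t * Q ^ l))))"
      by (intro fls_ge_add) auto
    then show "fls_ge (int M) (Z ^ l * El l + inverse Z ^ l * Fl l -
       (Z ^ l * (ge (t * Q ^ l) - ge (inverse Z * Q ^ l)) +
         inverse Z ^ l * (ge (Z * Q ^ l) - ge (inverse t * Q ^ l))))"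
      by (simp add: algebra_simps)
  qed
  \<comment> \<open>Both sides are the sum of \<open>z^(l - k) s^(N l k)\<close> over a square, with
    the roles of \<open>l\<close> and \<open>k\<close> exchanged.\<close>
  have cancel: "(\<Sum>l=1..M. Z ^ l * ge (inverse Z * Q ^ l)) = (\<Sum>l=1..M. inverse Z ^ l * ge (Z * Q ^ l))"
  proof -
    have z': "z ^ l * inverse z ^ k = inverse z ^ k * z ^ l" for l k by (simp add: mult.commute)
    have "(\<Sum>l=1..M. Z ^ l * ge (inverse Z * Q ^ l)) =
        (\<Sum>l=1..M. \<Sum>k=1..M. fls_monom (z ^ l * inverse z ^ k) (int (N * l * k)))"
      unfolding ge_def monomial_forms unfolding Zpow by (simp add: sum_distrib_left fls_monom_power fls_monom_mult mult_ac)
    also have "\<dots> = (\<Sum>k=1..M. \<Sum>l=1..M. fls_monom (z ^ l * inverse z ^ k) (int (N * l * k)))"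
      by (rule sum.swap)
    also have "\<dots> = (\<Sum>l=1..M. inverse Z ^ l * ge (Z * Q ^ l))"
      unfolding ge_def monomial_forms unfolding Zpow by (simp add: sum_distrib_left fls_monom_power fls_monom_mult mult_ac)
    finally show ?thesis .
  qed
  have R: "R = (\<Sum>l=1..M. \<Sum>k=1..M. fls_monom (z ^ l * T ^ k) (int (k * (N * l + e))) -
      fls_monom (inverse z ^ l * inverse T ^ k) (int (k * (N * l - e))))"
  proof -
    have "R = (\<Sum>l=1..M. Z ^ l * ge (t * Q ^ l) - inverse Z ^ l * ge (inverse t * Q ^ l))"
      using cancel unfolding R_def by (simp add: sum.distrib sum_subtractf right_diff_distrib)
    also have "\<dots> = (\<Sum>l=1..M. \<Sum>k=1..M. fls_monom (z ^ l * T ^ k) (int (k * (N * l + e))) -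
      fls_monom (inverse z ^ l * inverse T ^ k) (int (k * (N * l - e))))"
    proof (rule sum.cong[OF refl])
      fix l assume "l \<in> {1..M}"
      then have "l \<ge> 1" by simp
      then have "e \<le> N * l" using Nl_minus_e_ge[of l] by linarith
      then have "int (N * l - e) = int (N * l) - int e" by (rule of_nat_diff)
      then have "fls_monom (inverse T) (int (N * l) - int e) = fls_monom (inverse T) (int (N * l - e))" by simp
      then show "Z ^ l * ge (t * Q ^ l) - inverse Z ^ l * ge (inverse t * Q ^ l) =
        (\<Sum>k=1..M. fls_monom (z ^ l * T ^ k) (int (k * (N * l + e))) -
      fls_monom (inverse z ^ l * inverse T ^ k) (int (k * (N * l - e))))"
        unfolding ge_def monomial_forms unfolding Zpow
        by (simp add: sum_distrib_left fls_monom_power fls_monom_mult sum_subtractf del: of_nat_add of_nat_diff of_nat_mult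
            flip: of_nat_mult)
    qed
    finally show ?thesis .
  qed
  have "phi_trunc M t Q Z - S M =
    (phi_trunc M t Q Z - (1 / (1 - t) + Z / (1 - Z) + (\<Sum>l=1..M. Z ^ l * El l + inverse Z ^ l * Fl l))) +
    ((\<Sum>l=1..M. Z ^ l * El l + inverse Z ^ l * Fl l) - R) +
    (1 / (1 - t) + Z / (1 - Z) - (fls_monom (1 / (1 - z) + (if e = 0 then T / (1 - T) else 0)) 0 +
      (if e = 0 then 0 else \<Sum>k=1..M. fls_monom (T ^ k) (int (k * e)))))"
    unfolding S_def R by (simp only: algebra_simps)
  then show ?thesis
    using fls_ge_add[OF fls_ge_add[OF phi_trunc_weights_removed step2] const_part] by metis
qed

text \<open>Since \<open>k (N l - e)\<close> and \<open>k (N l + e)\<close> are at least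
  \<open>k l\<close>, indices beyond \<open>r\<close> cannot contribute to the coefficient of
  \<open>s^r\<close>.\<close>

lemma S_nth:
  assumes "r \<le> M"
  shows "fls_nth (S M) (int r) = kronecker_coeff N e z T r"
proof -
  have nsum: "fls_nth (sum f A) k = (\<Sum>i\<in>A. fls_nth (f i) k)" for f :: "nat \<Rightarrow> 'a fls" and A k
    by (induction A rule: infinite_finite_induct) auto
  have ind: "(\<Sum>k=1..M. g k) = (\<Sum>k=1..r. g k)" if "\<And>k. k > r \<Longrightarrow> g k = (0::'a)" for g
    using assms that by (intro sum.mono_neutral_right) auto
  have pos: "N * l - e \<ge> l" if "l \<ge> 1" for l using Nl_minus_e_ge[OF that] by linarith
  have big1: "k * (N * l + e) \<noteq> r" if "l \<ge> 1" "k \<ge> 1" "l > r \<or> k > r" for l k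
  proof -
    have "k * (N * l + e) \<ge> k * l" using pos[OF that(1)] by (intro mult_le_mono) auto
    moreover have "k * l \<ge> k" "k * l \<ge> l" using that by auto
    ultimately show ?thesis using that by linarith
  qed
  have big2: "k * (N * l - e) \<noteq> r" if "l \<ge> 1" "k \<ge> 1" "l > r \<or> k > r" for l k
  proof -
    have "k * (N * l - e) \<ge> k * l" using pos[OF that(1)] by (intro mult_le_mono) auto
    moreover have "k * l \<ge> k" "k * l \<ge> l" using that by auto
    ultimately show ?thesis using that by linarith
  qed
  have dbl: "(\<Sum>l=1..M. \<Sum>k=1..M. f l k) = (\<Sum>l=1..r. \<Sum>k=1..r. f l k)"
    if f0: "\<And>l k. l \<ge> 1 \<Longrightarrow> k \<ge> 1 \<Longrightarrow> l > r \<or> k > r \<Longrightarrow> f l k = (0::'a)" for f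
  proof -
    have "(\<Sum>l=1..M. \<Sum>k=1..M. f l k) = (\<Sum>l=1..r. \<Sum>k=1..M. f l k)"
      using assms by (intro sum.mono_neutral_right) (auto intro!: sum.neutral f0)
    also have "\<dots> = (\<Sum>l=1..r. \<Sum>k=1..r. f l k)"
      using assms by (intro sum.cong refl sum.mono_neutral_right) (auto intro!: f0)
    finally show ?thesis .
  qed
  have "(if e = 0 then 0 else \<Sum>k=1..M. if k * e = r then T ^ k else 0) =
      (if e = 0 then 0 else \<Sum>k=1..r. if k * e = r then T ^ k else 0)"
  proof (cases "e = 0")
    case False
    have "k * e \<noteq> r" if "k > r" for k using mult_le_mono2[of 1 e k] that False by auto
    then have "(\<Sum>k=1..M. if k * e = r then T ^ k else 0) = (\<Sum>k=1..r. if k * e = r then T ^ k else 0)"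
      by (intro ind) simp
    then show ?thesis using False by simp
  qed simp
  moreover have "(\<Sum>l=1..M. \<Sum>k=1..M. (if k * (N * l + e) = r then z ^ l * T ^ k else 0) -
        (if k * (N * l - e) = r then inverse z ^ l * inverse T ^ k else 0)) =
     (\<Sum>l=1..r. \<Sum>k=1..r. (if k * (N * l + e) = r then z ^ l * T ^ k else 0) -
        (if k * (N * l - e) = r then inverse z ^ l * inverse T ^ k else 0))"
    by (rule dbl) (simp only: big1 big2 if_False diff_zero)
  moreover have "fls_nth (S M) (int r) = (if r = 0 then 1 / (1 - z) + (if e = 0 then T / (1 - T) else 0) else 0) +
     (if e = 0 then 0 else \<Sum>k=1..M. if k * e = r then T ^ k else 0) +
     (\<Sum>l=1..M. \<Sum>k=1..M. (if k * (N * l + e) = r then z ^ l * T ^ k else 0) -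
        (if k * (N * l - e) = r then inverse z ^ l * inverse T ^ k else 0))"
  proof -
    have nif: "fls_nth (if c then x else y) j = (if c then fls_nth x j else fls_nth y j)"
      for c j and x y :: "'a fls" by simp
    have mn: "fls_nth (fls_monom c (int k)) (int r) = (if k = r then c else 0)" for c :: 'a and k
      by auto
    have mn0: "fls_nth (fls_monom c 0) (int r) = (if r = 0 then c else 0)" for c :: 'a
      by simp
    show ?thesis
      unfolding S_def fls_plus_nth nif nsum fls_minus_nth mn mn0 fls_zero_nth ..
  qed
  ultimately show ?thesis unfolding kronecker_coeff_def by simp
qed

lemma phi_trunc_nth: "r < M \<Longrightarrow> fls_nth (phi_trunc M t Q Z) (int r) = kronecker_coeff N e z T r"
  and phi_trunc_nth_neg: "j < 0 \<Longrightarrow> fls_nth (phi_trunc M t Q Z) j = 0"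
proof -
  have "fls_nth (S M) j = 0" if "j < 0" for j
    using that unfolding S_def fls_plus_nth by (auto simp: fls_nth_sum simp del: of_nat_mult of_nat_add)
  then show "j < 0 \<Longrightarrow> fls_nth (phi_trunc M t Q Z) j = 0"
    using phi_trunc_cong[of M] by (auto simp: fls_ge_def)
  show "r < M \<Longrightarrow> fls_nth (phi_trunc M t Q Z) (int r) = kronecker_coeff N e z T r"
    using phi_trunc_cong[of M] S_nth[of r M] by (auto simp: fls_ge_def)
qed

text \<open>\<open>has_prod\<close> also admits products with a vanishing factor, but there the
  partial products are eventually 0, which a nonzero limit excludes.\<close>

lemma (in -) prodinf_eqI:
  fixes f :: "nat \<Rightarrow> 'b::{field, t2_space}"
  assumes lim: "(\<lambda>n. prod f {..<n}) \<longlonglongrightarrow> p" and "p \<noteq> 0"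
  shows "prodinf f = p"
  unfolding prodinf_def
proof (rule the_equality)
  have lim': "(\<lambda>n. \<Prod>i\<le>n. f (i + 0)) \<longlonglongrightarrow> p"
    using LIMSEQ_Suc[OF lim] by (simp add: lessThan_Suc_atMost)
  then show "f has_prod p" using \<open>p \<noteq> 0\<close> by (simp add: has_prod_def raw_has_prod_def)
  fix q assume "f has_prod q"
  then consider "raw_has_prod f 0 q" | i where "f i = 0" by (auto simp: has_prod_def)
  then show "q = p"
  proof cases
    case 1
    then show ?thesis using lim' LIMSEQ_unique unfolding raw_has_prod_def by blast
  next
    case 2
    have "\<forall>\<^sub>F n in sequentially. prod f {..<n} = 0"
      using eventually_gt_at_top[of i] by eventually_elim (use 2 in auto)
    then have "(\<lambda>n. prod f {..<n}) \<longlonglongrightarrow> 0" by (simp add: tendsto_eventually)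
    then show ?thesis using lim \<open>p \<noteq> 0\<close> LIMSEQ_unique by blast
  qed
qed

text \<open>The coefficient of index \<open>r\<close> in \<open>phi_trunc M\<close> is stationary
  for \<open>M > r\<close>, so the truncations converge to \<open>K\<close> in the metric of Laurent
  series. The hypothesis keeps the prefactor nonzero, so that this limit can be divided by
  it.\<close>

lemma phi_st_nth:
  assumes zT: "e = 0 \<Longrightarrow> z * T \<noteq> 1"
  shows "fls_nth (phi_st t Q Z) (int r) = kronecker_coeff N e z T r"
proof -
  define f where "f = (\<lambda>k. ((1 - Q ^ Suc k)\<^sup>2 * (1 - Z * t * Q ^ Suc k) *
              (1 - inverse Z * inverse t * Q ^ Suc k)) /
            ((1 - Z * Q ^ Suc k) * (1 - inverse Z * Q ^ Suc k) *
              (1 - t * Q ^ Suc k) * (1 - inverse t * Q ^ Suc k)))"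
  define pre where "pre = (1 - Z * t) / ((1 - Z) * (1 - t))"
  define K where "K = fps_to_fls (Abs_fps (kronecker_coeff N e z T))"
  have trunc: "phi_trunc M t Q Z = pre * prod f {..<M}" for M
    by (simp add: phi_trunc_def pre_def f_def)
  have Zt: "Z * t = fls_monom (z * T) (int e)" by (simp add: Z_def t_def fls_monom_mult)
  have "pre \<noteq> 0"
  proof -
    have "fls_monom (z * T) (int e) \<noteq> fls_monom 1 0"
      using zT T0 z0 by (subst fls_monom_eq_iff) auto
    then have "1 - Z * t \<noteq> 0" unfolding Zt fls_monom_1 by auto
    moreover have "1 - Z \<noteq> 0" "1 - t \<noteq> 0" using Z_ne(2)[of 0 0] t_ne(2)[of 0 0] by auto
    ultimately show ?thesis by (simp add: pre_def)
  qed
  have Kge: "fls_ge (int M) (phi_trunc M t Q Z - K)" for M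
    unfolding fls_ge_def
  proof (intro allI impI)
    fix j assume "j < int M"
    then show "fls_nth (phi_trunc M t Q Z - K) j = 0"
      using phi_trunc_nth[of "nat j" M] phi_trunc_nth_neg[of j M]
      by (cases "j < 0") (auto simp: K_def)
  qed
  define c where "c = fls_subdegree (inverse pre)"
  have ge: "fls_ge (int M + c) (prod f {..<M} - K / pre)" for M
  proof -
    have "prod f {..<M} - K / pre = (phi_trunc M t Q Z - K) * inverse pre"
      using \<open>pre \<noteq> 0\<close> by (simp add: trunc divide_inverse algebra_simps)
    moreover have "fls_ge c (inverse pre)" by (simp add: fls_ge_iff c_def)
    ultimately show ?thesis using fls_ge_mult[OF Kge] by metis
  qed
  have lim: "(\<lambda>M. prod f {..<M}) \<longlonglongrightarrow> K / pre"
  proof (rule metric_LIMSEQ_I)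
    fix r :: real assume "r > 0"
    then obtain m where m: "(1/2) ^ m < r" using real_arch_pow_inv[of r "1/2"] by auto
    have "dist (prod f {..<n}) (K / pre) < r" if n: "n \<ge> nat \<bar>c\<bar> + m" for n
    proof (cases "prod f {..<n} = K / pre")
      case False
      define s where "s = fls_subdegree (prod f {..<n} - K / pre)"
      have "int n + c \<le> s" using ge[of n] False by (simp add: fls_ge_iff s_def)
      then have s: "int m \<le> s" using n by linarith
      have "dist (prod f {..<n}) (K / pre) = inverse (2 ^ nat s)"
        using False s unfolding dist_fls_def s_def[symmetric] by simp
      also have "\<dots> = (1/2) ^ nat s" by (simp add: power_one_over inverse_eq_divide)
      also have "\<dots> \<le> (1/2) ^ m" using s by (intro power_decreasing) auto
      finally show ?thesis using m by simp
    qed (use \<open>r > 0\<close> in simp)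
    then show "\<exists>no. \<forall>n\<ge>no. dist (prod f {..<n}) (K / pre) < r" by blast
  qed
  \<comment> \<open>Every factor of the product is congruent to 1 modulo \<open>s\<close>, so the
    constant coefficient of the limit is 1. \<open>M\<close> is taken large enough for the error, of
    order at least \<open>M + c\<close>, not to reach this coefficient.\<close>
  have "K / pre \<noteq> 0"
  proof
    assume K0: "K / pre = 0"
    define M where "M = nat \<bar>c\<bar> + 1"
    have "fls_cong1 1 (prod f {..<M})"
    proof (rule fls_cong1_prod)
      fix k
      have 1: "inverse Z * inverse t * Q ^ Suc k = fls_monom (inverse z * inverse T) (int (N * Suc k) - int e)"
        using monomial_forms(4)[of "Suc k"] by (simp add: mult.assoc Z_def fls_monom_inverse fls_monom_mult)
      have 2: "Z * t * Q ^ Suc k = fls_monom (z * T) (int (N * Suc k) + int e)"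
        unfolding Zt Qpow fls_monom_mult by (simp add: add.commute)
      have 3: "int (N * Suc k) \<ge> 1" "int (N * Suc k) - int e \<ge> 1" "int (N * Suc k) + int e \<ge> 1"
        "int (N * Suc k + e) \<ge> 1"
        using Nl_minus_e_ge[of "Suc k"] by linarith+
      show "fls_cong1 1 (f k)"
        unfolding f_def 1 2 unfolding monomial_forms unfolding Qpow power2_eq_square
        by (intro fls_cong1_divide fls_cong1_mult fls_cong1_monom 3) auto
    qed simp
    then have "fls_nth (prod f {..<M}) 0 = 1" by (auto simp: fls_cong1_def fls_ge_def)
    moreover have "int M + c > 0" by (simp add: M_def)
    then have "fls_nth (prod f {..<M} - K / pre) 0 = 0" using ge[of M] by (auto simp: fls_ge_def)
    ultimately show False using K0 by simp
  qed
  then have "prodinf f = K / pre" by (intro prodinf_eqI lim)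
  then have "phi_st t Q Z = K"
    using \<open>pre \<noteq> 0\<close> by (simp add: phi_st_def f_def pre_def)
  then show ?thesis by (simp add: K_def)
qed

end

section \<open>Half-open cones in a subdivision\<close>

definition cone_comb :: "('i \<Rightarrow> 'v::real_vector) \<Rightarrow> 'i set \<Rightarrow> 'v set" where
  "cone_comb v J = {\<Sum>i\<in>J. c i *\<^sub>R v i | c. \<forall>i\<in>J. 0 \<le> c i}"

lemma cone_comb_convex_cone: "convex_cone (cone_comb v J)"
  unfolding convex_cone_iff
proof (intro conjI ballI allI impI)
  show "0 \<in> cone_comb v J" unfolding cone_comb_def by (auto intro!: exI[of _ "\<lambda>_. 0"])
  fix x y assume "x \<in> cone_comb v J" "y \<in> cone_comb v J"
  then obtain c d where "x = (\<Sum>i\<in>J. c i *\<^sub>R v i)" "\<forall>i\<in>J. 0 \<le> c i"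
    "y = (\<Sum>i\<in>J. d i *\<^sub>R v i)" "\<forall>i\<in>J. 0 \<le> d i" unfolding cone_comb_def by blast
  then show "x + y \<in> cone_comb v J" unfolding cone_comb_def
    by (auto intro!: exI[of _ "\<lambda>i. c i + d i"] simp: scaleR_add_left sum.distrib)
next
  fix x and r :: real assume "x \<in> cone_comb v J" "0 \<le> r"
  then obtain c where "x = (\<Sum>i\<in>J. c i *\<^sub>R v i)" "\<forall>i\<in>J. 0 \<le> c i" unfolding cone_comb_def by blast
  then show "r *\<^sub>R x \<in> cone_comb v J" using \<open>0 \<le> r\<close> unfolding cone_comb_def
    by (auto intro!: exI[of _ "\<lambda>i. r * c i"] simp: scaleR_right.sum)
qed

lemma cone_comb_generator: "finite J \<Longrightarrow> i \<in> J \<Longrightarrow> v i \<in> cone_comb v J"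
  unfolding cone_comb_def
  by (auto intro!: exI[of _ "\<lambda>j. if j = i then 1 else 0"] simp: if_distrib[of "\<lambda>c. c *\<^sub>R _"] cong: if_cong)

lemma convex_cone_sum:
  assumes "convex_cone C" "\<And>i. i \<in> J \<Longrightarrow> v i \<in> C" "\<And>i. i \<in> J \<Longrightarrow> 0 \<le> c i"
  shows "(\<Sum>i\<in>J. c i *\<^sub>R v i) \<in> C"
  using assms(2,3)
proof (induction J rule: infinite_finite_induct)
  case (insert i J)
  then show ?case using assms(1) by (simp add: convex_cone_add convex_cone_scaleR)
qed (use assms(1) in \<open>auto intro: convex_cone_contains_0\<close>)

lemma cone_comb_subset: "convex_cone C \<Longrightarrow> v ` J \<subseteq> C \<Longrightarrow> cone_comb v J \<subseteq> C"
  unfolding cone_comb_def by (auto intro!: convex_cone_sum)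

lemma convex_cone_hull_finite: "finite S \<Longrightarrow> convex_cone hull S = cone_comb id S"
proof (rule hull_unique)
  show "finite S \<Longrightarrow> S \<subseteq> cone_comb id S" using cone_comb_generator[of S _ id] by auto
qed (auto intro: cone_comb_convex_cone cone_comb_subset[of _ id, simplified, THEN subsetD])

lemma span_cone_comb: "finite J \<Longrightarrow> span (cone_comb v J) = span (v ` J)"
proof (intro equalityI)
  show "span (cone_comb v J) \<subseteq> span (v ` J)"
  proof (rule span_minimal[OF _ subspace_span], rule subsetI)
    fix x assume "x \<in> cone_comb v J"
    then obtain c where "x = (\<Sum>i\<in>J. c i *\<^sub>R v i)" unfolding cone_comb_def by blast
    then show "x \<in> span (v ` J)" by (auto intro!: span_sum span_scale intro: span_base)
  qed
  show "finite J \<Longrightarrow> span (v ` J) \<subseteq> span (cone_comb v J)"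
    by (rule span_mono) (auto intro: cone_comb_generator)
qed

text \<open>Split the ends of a segment through the ray into multiples of \<open>s\<close> and parts
  \<open>a'\<close>, \<open>b'\<close> in the cone \<open>D\<close> of the other generators. Then
  \<open>g s\<close> lies in \<open>D\<close>: \<open>g > 0\<close> would make \<open>s\<close>
  redundant, \<open>g < 0\<close> would put \<open>- s\<close> into \<open>C\<close>. So
  \<open>g = 0\<close>, and strong convexity forces the positive combination of \<open>a'\<close>
  and \<open>b'\<close>, hence both of them, to vanish.\<close>

lemma extreme_ray:
  assumes fin: "finite S" and C: "C = cone_comb id S" and sc: "strongly_convex C"
    and s: "s \<in> S" "s \<notin> cone_comb id (S - {s})"
  shows "cone_comb id {s} face_of C"
  unfolding face_of_def
proof (intro conjI ballI impI)
  have cc: "convex_cone C" by (simp add: C cone_comb_convex_cone)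
  have sC: "s \<in> C" using cone_comb_generator[of S s id] fin s by (simp add: C)
  show "cone_comb id {s} \<subseteq> C" using sC by (intro cone_comb_subset cc) auto
  show "convex (cone_comb id {s})" using cone_comb_convex_cone[of id "{s}"] by (simp add: convex_cone_def)
  define D where "D = cone_comb id (S - {s})"
  have ccD: "convex_cone D" by (simp add: D_def cone_comb_convex_cone)
  have DC: "D \<subseteq> C" unfolding D_def
    using cone_comb_generator[OF fin, of _ id] by (intro cone_comb_subset cc) (auto simp: C)
  have s0: "s \<noteq> 0" using s convex_cone_contains_0[OF ccD] unfolding D_def by auto
  have split: "\<exists>\<alpha> a'. \<alpha> \<ge> 0 \<and> a' \<in> D \<and> a = \<alpha> *\<^sub>R s + a'" if aC: "a \<in> C" for a
  proof -
    obtain c where "a = (\<Sum>i\<in>S. c i *\<^sub>R i)" and c0: "\<forall>i\<in>S. 0 \<le> c i"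
      using aC unfolding C cone_comb_def by auto
    then have "a = c s *\<^sub>R s + (\<Sum>i\<in>S - {s}. c i *\<^sub>R i)" using fin s by (simp add: sum.remove)
    moreover have "(\<Sum>i\<in>S - {s}. c i *\<^sub>R i) \<in> D" using c0 unfolding D_def cone_comb_def by auto
    ultimately show ?thesis using c0 s by blast
  qed
  fix a b x assume ab: "a \<in> C" "b \<in> C" and x: "x \<in> cone_comb id {s}" "x \<in> open_segment a b"
  obtain c where c: "c \<ge> 0" "x = c *\<^sub>R s" using x(1) by (auto simp: cone_comb_def)
  obtain u where u: "0 < u" "u < 1" "x = (1 - u) *\<^sub>R a + u *\<^sub>R b" using x(2) by (auto simp: in_segment)
  obtain \<alpha> a' where a: "\<alpha> \<ge> 0" "a' \<in> D" "a = \<alpha> *\<^sub>R s + a'" using split[OF ab(1)] by blast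
  obtain \<beta> b' where b: "\<beta> \<ge> 0" "b' \<in> D" "b = \<beta> *\<^sub>R s + b'" using split[OF ab(2)] by blast
  define g where "g = c - (1 - u) * \<alpha> - u * \<beta>"
  have eq: "(1 - u) *\<^sub>R a' + u *\<^sub>R b' = g *\<^sub>R s"
    using c u a b by (simp add: g_def algebra_simps)
  have zD: "g *\<^sub>R s \<in> D" unfolding eq[symmetric]
    using u a b by (intro convex_cone_add[OF ccD] convex_cone_scaleR[OF ccD]) auto
  have "g = 0"
  proof (rule ccontr)
    assume "g \<noteq> 0"
    then consider "g > 0" | "g < 0" by linarith
    then show False
    proof cases
      case 1
      have "(1 / g) *\<^sub>R g *\<^sub>R s \<in> D" using 1 by (intro convex_cone_scaleR[OF ccD] zD) auto
      then show False using 1 s by (simp add: D_def)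
    next
      case 2
      have "(1 / - g) *\<^sub>R g *\<^sub>R s \<in> D" using 2 by (intro convex_cone_scaleR[OF ccD] zD) auto
      then have "- s \<in> C" using 2 DC by auto
      then show False using sc sC s0 by (auto simp: strongly_convex_def)
    qed
  qed
  then have eq0: "(1 - u) *\<^sub>R a' + u *\<^sub>R b' = 0" using eq by simp
  have za: "(1 - u) *\<^sub>R a' \<in> C" "u *\<^sub>R b' \<in> C"
    using u a b DC by (auto intro!: convex_cone_scaleR[OF cc])
  then have "(1 - u) *\<^sub>R a' = 0" "u *\<^sub>R b' = 0"
    using sc eq0 unfolding strongly_convex_def by (metis add_eq_0_iff add_eq_0_iff2)+
  then have "a' = 0" "b' = 0" using u by auto
  then show "a \<in> cone_comb id {s}" "b \<in> cone_comb id {s}" using a b by (auto simp: cone_comb_def)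
qed

lemma dim_ray: "s \<noteq> 0 \<Longrightarrow> dim (cone_comb id {s}) = 1"
  using dim_eq_card[of "{s}" "cone_comb id {s}"] span_cone_comb[of "{s}" id] by simp

lemma independent_of_dim:
  assumes "finite J" "dim (v ` J) = card J"
  shows "inj_on v J" "independent (v ` J)"
proof -
  obtain B where B: "B \<subseteq> v ` J" "independent B" "v ` J \<subseteq> span B" using maximal_independent_subset by blast
  have "span B = span (v ` J)" using B by (metis span_mono span_span subset_antisym)
  then have "card B = card J" using dim_eq_card[of B "v ` J"] B assms by simp
  moreover have "card B \<le> card (v ` J)" using B assms by (intro card_mono) auto
  moreover have "card (v ` J) \<le> card J" using assms by (intro card_image_le)
  ultimately have c: "card (v ` J) = card J" "card B = card (v ` J)" by auto
  then show "inj_on v J" using assms by (intro eq_card_imp_inj_on) auto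
  have "B = v ` J" using c B assms by (intro card_subset_eq) auto
  then show "independent (v ` J)" using B by simp
qed

lemma multi_fan_props:
  assumes "simplicial_multi_fan L n \<Delta>"
  shows "finite (simplices \<Delta>)" "\<forall>J\<in>simplices \<Delta>. finite J \<and> card J \<le> n"
    "\<forall>J\<in>simplices \<Delta>. \<forall>K\<subseteq>J. K \<in> simplices \<Delta>"
    "\<forall>J\<in>simplices \<Delta>. \<exists>I\<in>k_simplices \<Delta> n. J \<subseteq> I"
    "\<forall>J\<in>simplices \<Delta>. rational_cone L (mf_cone \<Delta> J) \<and> strongly_convex (mf_cone \<Delta> J) \<and>
        dim (mf_cone \<Delta> J) = card J"
    "\<forall>I\<in>simplices \<Delta>. bij_betw (mf_cone \<Delta>) (Pow I) (cone_faces (mf_cone \<Delta> I)) \<and>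
        (\<forall>J\<in>Pow I. \<forall>K\<in>Pow I. J \<subseteq> K \<longleftrightarrow> mf_cone \<Delta> J \<subseteq> mf_cone \<Delta> K)"
proof -
  note d = assms[unfolded simplicial_multi_fan_def]
  note d1 = d[THEN conjunct2] and d2 = d[THEN conjunct2, THEN conjunct2]
  note d3 = d2[THEN conjunct2] and d4 = d2[THEN conjunct2, THEN conjunct2]
  note d5 = d4[THEN conjunct2] and d6 = d4[THEN conjunct2, THEN conjunct2]
  note d7 = d6[THEN conjunct2, THEN conjunct2]
  show "finite (simplices \<Delta>)" by (rule d[THEN conjunct1])
  show "\<forall>J\<in>simplices \<Delta>. finite J \<and> card J \<le> n" by (rule d2[THEN conjunct1])
  show "\<forall>J\<in>simplices \<Delta>. \<forall>K\<subseteq>J. K \<in> simplices \<Delta>" by (rule d3[THEN conjunct1])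
  show "\<forall>J\<in>simplices \<Delta>. \<exists>I\<in>k_simplices \<Delta> n. J \<subseteq> I" by (rule d5[THEN conjunct1])
  show "\<forall>J\<in>simplices \<Delta>. rational_cone L (mf_cone \<Delta> J) \<and> strongly_convex (mf_cone \<Delta> J) \<and>
        dim (mf_cone \<Delta> J) = card J" by (rule d6[THEN conjunct1])
  show "\<forall>I\<in>simplices \<Delta>. bij_betw (mf_cone \<Delta>) (Pow I) (cone_faces (mf_cone \<Delta> I)) \<and>
        (\<forall>J\<in>Pow I. \<forall>K\<in>Pow I. J \<subseteq> K \<longleftrightarrow> mf_cone \<Delta> J \<subseteq> mf_cone \<Delta> K)" by (rule d7)
qed

text \<open>The cones are only known through their faces. A generator in a generating set of least
  size spans an extreme ray, hence a face, hence the cone of some \<open>K \<subseteq> J\<close>;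
  its dimension 1 forces \<open>K = {i}\<close>, so that the generator is a positive multiple of
  \<open>v i\<close>. Independence then follows from the dimension of the cone.\<close>

lemma simplex_cone:
  assumes mf: "simplicial_multi_fan L n \<Delta>" and ev: "edge_vectors L \<Delta> v" and J: "J \<in> simplices \<Delta>"
  shows "mf_cone \<Delta> J = cone_comb v J" "inj_on v J" "independent (v ` J)" "finite J"
proof -
  note fins = multi_fan_props(2)[OF mf] and subs = multi_fan_props(3)[OF mf]
    and cones = multi_fan_props(5)[OF mf] and faces = multi_fan_props(6)[OF mf]
  have fJ: "finite J" and sub: "\<And>K. K \<subseteq> J \<Longrightarrow> K \<in> simplices \<Delta>"
    using fins subs J by blast+
  have rat: "rational_cone L (mf_cone \<Delta> J)" and sc: "strongly_convex (mf_cone \<Delta> J)"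
    and dimJ: "\<And>K. K \<in> simplices \<Delta> \<Longrightarrow> dim (mf_cone \<Delta> K) = card K"
    using cones J by blast+
  have bij: "bij_betw (mf_cone \<Delta>) (Pow J) (cone_faces (mf_cone \<Delta> J))"
    using faces J by blast
  have mono: "mf_cone \<Delta> K \<subseteq> mf_cone \<Delta> J" if "K \<subseteq> J" for K
    using faces J that by blast
  show "finite J" by (rule fJ)
  define C where "C = mf_cone \<Delta> J"
  have "\<exists>S. finite S \<and> C = cone_comb id S"
  proof -
    obtain S where S: "finite S" "mf_cone \<Delta> J = convex_cone hull S"
      using rat unfolding rational_cone_def by (elim exE conjE)
    show ?thesis unfolding C_def S(2) convex_cone_hull_finite[OF S(1)] using S(1) by auto
  qed
  then obtain S0 where S0: "finite S0 \<and> C = cone_comb id S0" ..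
  define P where "P S \<longleftrightarrow> finite S \<and> C = cone_comb id S" for S
  have "P S0" using S0 by (simp only: P_def)
  then have "\<exists>S. P S \<and> (\<forall>S'. P S' \<longrightarrow> card S \<le> card S')" by (rule ex_has_least_nat)
  then obtain S where S': "P S \<and> (\<forall>S'. P S' \<longrightarrow> card S \<le> card S')" ..
  then have S: "finite S" "C = cone_comb id S" by (simp_all only: P_def)
  have min: "card S \<le> card S'" if "finite S'" "C = cone_comb id S'" for S'
    using S' that by (simp only: P_def)
  have cc: "convex_cone C" unfolding S(2) by (rule cone_comb_convex_cone)
  have extr: "s \<notin> cone_comb id (S - {s})" if "s \<in> S" for s
  proof
    assume s: "s \<in> cone_comb id (S - {s})"
    have "cone_comb id S \<subseteq> cone_comb id (S - {s})"
      using s cone_comb_generator[of "S - {s}" _ id] S(1)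
      by (intro cone_comb_subset cone_comb_convex_cone) auto
    moreover have "cone_comb id (S - {s}) \<subseteq> cone_comb id S"
      using cone_comb_generator[of S _ id] S(1) by (intro cone_comb_subset cone_comb_convex_cone) auto
    ultimately have "C = cone_comb id (S - {s})" using S by simp
    then have "card S \<le> card (S - {s})" using S by (intro min) auto
    then show False using card_Diff1_less[OF S(1) that] by simp
  qed
  have vi: "v i \<in> mf_cone \<Delta> {i}" "v i \<noteq> 0" if "i \<in> J" for i
    using ev sub[of "{i}"] that unfolding edge_vectors_def verts_def by auto
  have viC: "v i \<in> C" if "i \<in> J" for i using vi(1)[OF that] mono[of "{i}"] that by (auto simp: C_def)
  have ray: "s \<in> cone_comb v J" if s: "s \<in> S" for s
  proof -
    have s0: "s \<noteq> 0" using extr[OF s] convex_cone_contains_0[OF cone_comb_convex_cone] by metis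
    have "cone_comb id {s} \<in> cone_faces C"
      unfolding cone_faces_def using extreme_ray[OF S(1) S(2) _ s extr[OF s]] sc
        convex_cone_contains_0[OF cone_comb_convex_cone[of id "{s}"]] by (auto simp: C_def)
    then have "cone_comb id {s} \<in> mf_cone \<Delta> ` Pow J"
      using bij by (simp only: bij_betw_def C_def)
    then obtain K where "K \<in> Pow J" "cone_comb id {s} = mf_cone \<Delta> K" by (elim imageE)
    then have K: "K \<subseteq> J" "mf_cone \<Delta> K = cone_comb id {s}" by simp_all
    have "card K = 1" using dimJ[OF sub[OF K(1)]] dim_ray[OF s0] K by simp
    then obtain i where i: "K = {i}" by (meson card_1_singletonE)
    have "v i \<in> cone_comb id {s}" using vi(1)[of i] K i by auto
    then obtain c where c: "c \<ge> 0" "v i = c *\<^sub>R s" by (auto simp: cone_comb_def)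
    have "c \<noteq> 0" using vi(2)[of i] c K i by auto
    have s_eq: "s = (1 / c) *\<^sub>R v i" unfolding c(2) using \<open>c \<noteq> 0\<close> by simp
    have "i \<in> J" using K(1) unfolding i by simp
    then have "v i \<in> cone_comb v J" by (rule cone_comb_generator[OF fJ])
    then have "(1 / c) *\<^sub>R v i \<in> cone_comb v J"
      using c(1) by (intro convex_cone_scaleR[OF cone_comb_convex_cone]) auto
    then show ?thesis unfolding s_eq[symmetric] .
  qed
  show eq: "mf_cone \<Delta> J = cone_comb v J"
  proof
    show "mf_cone \<Delta> J \<subseteq> cone_comb v J"
      unfolding C_def[symmetric] S(2)
      by (rule cone_comb_subset[OF cone_comb_convex_cone]) (use ray in auto)
    show "cone_comb v J \<subseteq> mf_cone \<Delta> J"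
      unfolding C_def[symmetric] by (rule cone_comb_subset[OF cc]) (use viC in auto)
  qed
  have "dim (v ` J) = card J"
  proof -
    have "dim (v ` J) = dim (span (cone_comb v J))" unfolding span_cone_comb[OF fJ] by (rule dim_span[symmetric])
    also have "\<dots> = dim (cone_comb v J)" by (rule dim_span)
    also have "\<dots> = card J" using dimJ[OF J] by (simp only: eq)
    finally show ?thesis .
  qed
  then show "inj_on v J" "independent (v ` J)" using independent_of_dim[OF fJ] by auto
qed

section \<open>Coordinates and lattice points in a full-dimensional simplicial cone\<close>

locale cone_basis =
  fixes I :: "'i set" and v :: "'i \<Rightarrow> 'v::real_vector"
  assumes fin: "finite I" and inj: "inj_on v I" and ind: "independent (v ` I)" and span: "span (v ` I) = UNIV"
begin

abbreviation "co \<equiv> dual_vec v I"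

lemma co_expand: "(\<Sum>i\<in>I. co i x *\<^sub>R v i) = x"
proof -
  have "(\<Sum>b\<in>v ` I. representation (v ` I) x b *\<^sub>R b) = x"
    using fin ind span by (intro sum_representation_eq) auto
  then show ?thesis by (simp add: sum.reindex[OF inj] dual_vec_def)
qed

lemma co_add: "co i (x + y) = co i x + co i y"
  unfolding dual_vec_def using representation_add[OF ind, of y x] span by (simp add: add.commute)

lemma co_scale: "co i (r *\<^sub>R x) = r * co i x"
  unfolding dual_vec_def using representation_scale[OF ind, of x r] span by simp

lemma co_diff: "co i (x - y) = co i x - co i y"
  using co_add[of i x "(-1) *\<^sub>R y"] co_scale[of i "-1" y] by simp

lemma co_zero: "co i 0 = 0" using co_scale[of i 0 0] by simp

lemma co_sum: "co i (sum f A) = (\<Sum>j\<in>A. co i (f j))"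
  by (induction A rule: infinite_finite_induct) (simp_all add: co_zero co_add)

lemma co_basis: "i \<in> I \<Longrightarrow> j \<in> I \<Longrightarrow> co i (v j) = (if i = j then 1 else 0)"
  unfolding dual_vec_def using representation_basis[OF ind, of "v j"] inj
  by (auto simp: inj_on_def)

lemma co_comb: "i \<in> I \<Longrightarrow> co i (\<Sum>j\<in>I. c j *\<^sub>R v j) = c i"
  using fin by (simp add: co_sum co_scale co_basis if_distrib[of "\<lambda>x. _ * x"] cong: if_cong)

lemma co_eqI: "(\<And>i. i \<in> I \<Longrightarrow> co i x = co i y) \<Longrightarrow> x = y"
  using co_expand[of x] co_expand[of y] by (metis (no_types, lifting) sum.cong)

lemma mem_cone_comb: "x \<in> cone_comb v I \<longleftrightarrow> (\<forall>i\<in>I. 0 \<le> co i x)"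
proof
  assume "x \<in> cone_comb v I"
  then show "\<forall>i\<in>I. 0 \<le> co i x" unfolding cone_comb_def by (auto simp: co_comb)
next
  assume "\<forall>i\<in>I. 0 \<le> co i x"
  then show "x \<in> cone_comb v I" unfolding cone_comb_def using co_expand[of x]
    by (auto intro!: exI[of _ "\<lambda>i. co i x"])
qed

text \<open>From an interior point \<open>x\<close> the segment from any \<open>y\<close> can be
  prolonged a little beyond \<open>x\<close> inside the cone; the definition of a face then puts
  \<open>y\<close> into \<open>F\<close>.\<close>

lemma face_interior:
  assumes F: "F face_of cone_comb v I" and x: "x \<in> F" "\<And>i. i \<in> I \<Longrightarrow> co i x > 0"
  shows "F = cone_comb v I"
proof
  show "F \<subseteq> cone_comb v I" using F by (simp add: face_of_imp_subset)
  show "cone_comb v I \<subseteq> F"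
  proof
    fix y assume y: "y \<in> cone_comb v I"
    show "y \<in> F"
    proof (cases "y = x")
      case False
      \<comment> \<open>Small enough for \<open>\<eta> (co i y + 1) \<le> co i x\<close>; the
        summand 1 avoids a zero denominator, and the inserted 1 covers empty
        \<open>I\<close>.\<close>
      define \<eta> where "\<eta> = Min (insert 1 ((\<lambda>i. co i x / (co i y + 1)) ` I))"
      have y0: "co i y \<ge> 0" if "i \<in> I" for i using y that by (simp add: mem_cone_comb)
      have "\<eta> > 0" unfolding \<eta>_def using fin x(2) y0 by (subst Min_gr_iff) (auto simp: add_nonneg_pos)
      have le: "\<eta> \<le> co i x / (co i y + 1)" if "i \<in> I" for i unfolding \<eta>_def using fin that by (intro Min_le) auto
      define x' where "x' = x + \<eta> *\<^sub>R (x - y)"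
      have "x' \<in> cone_comb v I" unfolding mem_cone_comb
      proof
        fix i assume i: "i \<in> I"
        have "\<eta> * (co i y + 1) \<le> co i x" using le[OF i] y0[OF i] by (simp add: pos_le_divide_eq)
        then have "\<eta> * co i y \<le> co i x" using \<open>\<eta> > 0\<close> by (simp add: algebra_simps)
        moreover have "0 \<le> \<eta> * co i x" using \<open>\<eta> > 0\<close> x(2)[OF i] by simp
        ultimately show "0 \<le> co i x'" by (simp add: x'_def co_add co_scale co_diff algebra_simps)
      qed
      moreover have "x \<in> open_segment y x'"
      proof -
        define u where "u = 1 / (1 + \<eta>)"
        have u: "0 < u" "u < 1" "u * (1 + \<eta>) = 1" using \<open>\<eta> > 0\<close> by (auto simp: u_def)
        have "(1 - u) *\<^sub>R y + u *\<^sub>R x' = (1 - u * (1 + \<eta>)) *\<^sub>R y + (u * (1 + \<eta>)) *\<^sub>R x"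
          by (simp add: x'_def algebra_simps)
        then have "x = (1 - u) *\<^sub>R y + u *\<^sub>R x'" using u by simp
        moreover have "y \<noteq> x'"
        proof
          assume "y = x'"
          then have "(1 + \<eta>) *\<^sub>R (x - y) = 0" by (simp add: x'_def algebra_simps)
          then show False using \<open>\<eta> > 0\<close> False by simp
        qed
        ultimately show ?thesis using u by (auto simp: in_segment)
      qed
      ultimately show ?thesis using F x(1) y unfolding face_of_def by blast
    qed (use x in simp)
  qed
qed

end

lemma top_simplex_basis:
  assumes B: "lattice_basis B L" "card B = n"
    and mf: "simplicial_multi_fan L n \<Delta>" and ev: "edge_vectors L \<Delta> v" and I: "I \<in> k_simplices \<Delta> n"
  shows "cone_basis I v"
proof -
  have I': "I \<in> simplices \<Delta>" "card I = n" using I by (auto simp: k_simplices_def)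
  note sc = simplex_cone[OF mf ev I'(1)]
  have fB: "finite B" "independent B" "span B = UNIV" using B by (auto simp: lattice_basis_def)
  have "card (v ` I) = card B" using sc I' B by (simp add: card_image)
  have "b \<in> span (v ` I)" for b
  proof (rule ccontr)
    assume b: "b \<notin> span (v ` I)"
    then have "independent (insert b (v ` I))" using sc(3) by (simp add: independent_insert)
    then have "card (insert b (v ` I)) \<le> card B"
      using independent_span_bound[of B "insert b (v ` I)"] fB by simp
    moreover have "b \<notin> v ` I" using b span_base[of b "v ` I"] by metis
    ultimately show False using \<open>card (v ` I) = card B\<close> sc(4) by simp
  qed
  then have "span (v ` I) = UNIV" by auto
  then show ?thesis using sc by (unfold_locales) auto
qed

lemma lattice_add_closed:
  assumes "lattice_basis B L"
  shows "0 \<in> L" "x \<in> L \<Longrightarrow> y \<in> L \<Longrightarrow> x + y \<in> L" "x \<in> L \<Longrightarrow> - x \<in> L"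
proof -
  have L: "L = int_span B" using assms by (simp add: lattice_basis_def)
  show "0 \<in> L" unfolding L int_span_def by (auto intro!: exI[of _ "\<lambda>_. 0"])
  show "x + y \<in> L" if xy: "x \<in> L" "y \<in> L"
  proof -
    obtain c :: "'a \<Rightarrow> int" where c: "x = (\<Sum>b\<in>B. of_int (c b) *\<^sub>R b)"
      using xy(1) unfolding L int_span_def mem_Collect_eq by (elim exE conjE)
    obtain d :: "'a \<Rightarrow> int" where d: "y = (\<Sum>b\<in>B. of_int (d b) *\<^sub>R b)"
      using xy(2) unfolding L int_span_def mem_Collect_eq by (elim exE conjE)
    have "x + y = (\<Sum>b\<in>B. of_int (c b + d b) *\<^sub>R b)"
      by (simp add: c d scaleR_add_left sum.distrib)
    then show ?thesis unfolding L int_span_def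
      by (intro CollectI exI[of _ "\<lambda>b. c b + d b"] conjI TrueI)
  qed
  show "- x \<in> L" if x: "x \<in> L"
  proof -
    obtain c :: "'a \<Rightarrow> int" where c: "x = (\<Sum>b\<in>B. of_int (c b) *\<^sub>R b)"
      using x unfolding L int_span_def mem_Collect_eq by (elim exE conjE)
    have "- x = (\<Sum>b\<in>B. of_int (- c b) *\<^sub>R b)"
      by (simp add: c sum_negf)
    then show ?thesis unfolding L int_span_def
      by (intro CollectI exI[of _ "\<lambda>b. - c b"] conjI TrueI)
  qed
qed

text \<open>\<open>Nco\<close> says that \<open>N\<close> clears the denominators of the coordinates
  of lattice points, so that the fractional powers of \<open>q\<close> are powers of
  \<open>s\<close>.\<close>

locale lattice_cone = cone_basis I v for I :: "'i set" and v :: "'i \<Rightarrow> 'v::real_vector" +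
  fixes L :: "'v set" and N :: nat
  assumes L0: "0 \<in> L" and Ladd: "x \<in> L \<Longrightarrow> y \<in> L \<Longrightarrow> x + y \<in> L" and Lneg: "x \<in> L \<Longrightarrow> - x \<in> L"
    and vL: "i \<in> I \<Longrightarrow> v i \<in> L" and N0: "N > 0"
    and Nco: "x \<in> L \<Longrightarrow> i \<in> I \<Longrightarrow> real N * dual_vec v I i x \<in> \<int>"
begin

lemma Ldiff: "x \<in> L \<Longrightarrow> y \<in> L \<Longrightarrow> x - y \<in> L"
  using Ladd[of x "- y"] Lneg[of y] by simp

lemma Lscale_nat: "x \<in> L \<Longrightarrow> real k *\<^sub>R x \<in> L"
  by (induction k) (auto simp: L0 Ladd scaleR_add_left)

lemma Lscale_int: "x \<in> L \<Longrightarrow> of_int k *\<^sub>R x \<in> L"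
proof (cases "k \<ge> 0")
  case True
  then show "x \<in> L \<Longrightarrow> ?thesis" using Lscale_nat[of x "nat k"] by simp
next
  case False
  then show "x \<in> L \<Longrightarrow> ?thesis" using Lscale_nat[of "- x" "nat (- k)"] Lneg by simp
qed

lemma Lsum: "(\<And>i. i \<in> A \<Longrightarrow> f i \<in> L) \<Longrightarrow> sum f A \<in> L"
  by (induction A rule: infinite_finite_induct) (auto simp: L0 Ladd)

text \<open>The facet \<open>co i = 0\<close> belongs to the set exactly if \<open>w\<close> lies on
  its positive side. This coordinate form suits the generating functions; \<open>half_openI\<close>
  and \<open>half_openD\<close> relate it to small displacements along \<open>w\<close>, which suit
  the subdivision.\<close>

definition half_open :: "'v \<Rightarrow> 'v set" where
  "half_open w = {x \<in> L. \<forall>i\<in>I. co i x > 0 \<or> (co i x = 0 \<and> co i w > 0)}"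

text \<open>Arbitrarily small displacements are enough, rather than all small ones: a pigeonhole
  argument over finitely many cones yields no more.\<close>

lemma half_openI:
  assumes x: "x \<in> L" and w: "\<And>i. i \<in> I \<Longrightarrow> co i w \<noteq> 0"
    and small: "\<And>\<epsilon>. \<epsilon> > 0 \<Longrightarrow> \<exists>\<delta>. 0 < \<delta> \<and> \<delta> < \<epsilon> \<and> x + \<delta> *\<^sub>R w \<in> cone_comb v I"
  shows "x \<in> half_open w"
  unfolding half_open_def
proof (intro CollectI conjI ballI x)
  fix i assume i: "i \<in> I"
  have near: "\<exists>\<delta>. 0 < \<delta> \<and> \<delta> < \<epsilon> \<and> co i x + \<delta> * co i w \<ge> 0" if "\<epsilon> > 0" for \<epsilon>
  proof -
    obtain \<delta> where "0 < \<delta>" "\<delta> < \<epsilon>" "x + \<delta> *\<^sub>R w \<in> cone_comb v I" using small[OF \<open>\<epsilon> > 0\<close>] by auto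
    then show ?thesis using i by (auto simp: mem_cone_comb co_add co_scale intro!: exI[of _ \<delta>])
  qed
  have "co i x \<ge> 0"
  proof (rule ccontr)
    assume neg: "\<not> co i x \<ge> 0"
    define \<epsilon> where "\<epsilon> = - co i x / (\<bar>co i w\<bar> + 1)"
    have "\<epsilon> > 0" unfolding \<epsilon>_def using neg by (intro divide_pos_pos) auto
    then obtain \<delta> where d: "0 < \<delta>" "\<delta> < \<epsilon>" "co i x + \<delta> * co i w \<ge> 0" using near by auto
    have "\<delta> * co i w \<le> \<delta> * (\<bar>co i w\<bar> + 1)" using d by (intro mult_left_mono) auto
    also have "\<dots> < \<epsilon> * (\<bar>co i w\<bar> + 1)" using d by (intro mult_strict_right_mono) auto
    also have "\<dots> = - co i x" by (simp add: \<epsilon>_def add_nonneg_eq_0_iff)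
    finally show False using d by simp
  qed
  moreover have "co i w > 0" if "co i x = 0"
  proof -
    obtain \<delta> where "0 < \<delta>" "co i x + \<delta> * co i w \<ge> 0" using near[of 1] by auto
    then have "co i w \<ge> 0" using that by (simp add: zero_le_mult_iff)
    then show ?thesis using w[OF i] by simp
  qed
  ultimately show "co i x > 0 \<or> (co i x = 0 \<and> co i w > 0)" by force
qed

lemma half_openD:
  assumes "x \<in> half_open w"
  obtains \<epsilon> where "\<epsilon> > 0" "\<And>\<delta> i. 0 < \<delta> \<Longrightarrow> \<delta> < \<epsilon> \<Longrightarrow> i \<in> I \<Longrightarrow> co i (x + \<delta> *\<^sub>R w) > 0"
proof -
  define f where "f = (\<lambda>i. if co i x > 0 then co i x / (\<bar>co i w\<bar> + 1) else 1)"
  define \<epsilon> where "\<epsilon> = Min (insert 1 (f ` I))"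
  have f: "f i > 0" for i by (auto simp: f_def intro!: divide_pos_pos)
  have "\<epsilon> > 0" unfolding \<epsilon>_def using fin f by (subst Min_gr_iff) auto
  moreover have "co i (x + \<delta> *\<^sub>R w) > 0" if d: "0 < \<delta>" "\<delta> < \<epsilon>" and i: "i \<in> I" for \<delta> i
  proof (cases "co i x > 0")
    case True
    have "\<epsilon> \<le> f i" unfolding \<epsilon>_def using fin i by (intro Min_le) auto
    then have lt: "\<delta> < co i x / (\<bar>co i w\<bar> + 1)" using d True by (simp add: f_def)
    have "- (\<delta> * co i w) \<le> \<delta> * (\<bar>co i w\<bar> + 1)"
      using mult_left_mono[of "- co i w" "\<bar>co i w\<bar> + 1" \<delta>] d by (simp add: abs_if split: if_splits)
    also have "\<dots> < co i x" using lt by (simp add: pos_less_divide_eq add_nonneg_pos)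
    finally show ?thesis by (simp add: co_add co_scale)
  next
    case False
    then have "co i x = 0" "co i w > 0" using assms i by (auto simp: half_open_def)
    then show ?thesis using d by (simp add: co_add co_scale)
  qed
  ultimately show ?thesis using that by blast
qed

end

section \<open>Top cones over a top cone, and the partition into half-open cones\<close>

locale birational_setting =
  fixes B L :: "'v::real_vector set" and n N :: nat
    and \<Delta> :: "('i, 'v) multi_fan" and v :: "'i \<Rightarrow> 'v"
    and \<Delta>' :: "('j, 'v) multi_fan" and v' :: "'j \<Rightarrow> 'v"
    and \<rho> :: "'j set \<Rightarrow> 'i set"
  assumes basis: "lattice_basis B L" "card B = n"
    and mf: "simplicial_multi_fan L n \<Delta>" and ev: "edge_vectors L \<Delta> v"
    and mf': "simplicial_multi_fan L n \<Delta>'" and ev': "edge_vectors L \<Delta>' v'"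
    and bir: "birational_morphism \<Delta>' \<Delta> \<rho>"
    and qd: "q_denominator N L n \<Delta> v" and qd': "q_denominator N L n \<Delta>' v'"

text \<open>The coordinates of a lattice point modulo 1 form an element of \<open>G_group\<close>,
  so \<open>q_denominator\<close> bounds their denominators; the integral parts do no harm.\<close>

lemma top_simplex_lattice_cone:
  assumes B: "lattice_basis B L" "card B = n"
    and mf: "simplicial_multi_fan L n \<Delta>" and ev: "edge_vectors L \<Delta> v" and I: "I \<in> k_simplices \<Delta> n"
    and qd: "q_denominator N L n \<Delta> v"
  shows "lattice_cone I v L N"
proof -
  interpret cone_basis I v using top_simplex_basis[OF B mf ev I] .
  have IS: "I \<in> simplices \<Delta>" using I by (simp add: k_simplices_def)
  have verts: "i \<in> verts \<Delta>" if "i \<in> I" for i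
    using multi_fan_props(3)[OF mf] IS that unfolding verts_def by blast
  have finv: "finite (verts \<Delta>)"
  proof -
    have "finite ((\<lambda>i. {i}) ` verts \<Delta>)"
      using multi_fan_props(1)[OF mf] by (rule finite_subset[rotated]) (auto simp: verts_def)
    then show ?thesis by (rule finite_imageD) (auto simp: inj_on_def)
  qed
  show ?thesis
  proof
    show "v i \<in> L" if "i \<in> I" for i using ev verts[OF that] unfolding edge_vectors_def by blast
    show "N > 0" using qd by (simp add: q_denominator_def)
    fix x i assume x: "x \<in> L" and i: "i \<in> I"
    define a where "a = (\<lambda>j. if j \<in> I then co j x else 0)"
    have "(\<Sum>j\<in>verts \<Delta>. a j *\<^sub>R v j) = (\<Sum>j\<in>I. a j *\<^sub>R v j)"
      using finv verts by (intro sum.mono_neutral_right) (auto simp: a_def)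
    also have "\<dots> = x" using co_expand[of x] by (simp add: a_def)
    finally have mem: "(\<lambda>j. frac (a j)) \<in> G_group L \<Delta> v I"
      unfolding G_group_def using x by (intro imageI) (auto simp: a_def)
    have "\<forall>g\<in>G_group L \<Delta> v I. \<forall>i. real N * g i \<in> \<int>"
      using qd I by (simp add: q_denominator_def)
    from bspec[OF this mem] have "real N * frac (a i) \<in> \<int>" by simp
    then have "real N * frac (a i) + real N * of_int \<lfloor>a i\<rfloor> \<in> \<int>" by (intro Ints_add) auto
    also have "real N * frac (a i) + real N * of_int \<lfloor>a i\<rfloor> = real N * a i"
      by (simp add: frac_def algebra_simps)
    finally show "real N * co i x \<in> \<int>" using i by (simp add: a_def)
  qed (use lattice_add_closed[OF B(1)] in auto)
qed

context birational_setting
begin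

lemma cone: "I \<in> k_simplices \<Delta> n \<Longrightarrow> lattice_cone I v L N"
  using top_simplex_lattice_cone[OF basis mf ev _ qd] .

lemma cone': "I \<in> k_simplices \<Delta>' n \<Longrightarrow> lattice_cone I v' L N"
  using top_simplex_lattice_cone[OF basis mf' ev' _ qd'] .

lemma bir_props:
  shows "J' \<in> simplices \<Delta>' \<Longrightarrow> \<rho> J' \<in> simplices \<Delta>"
    "J \<in> simplices \<Delta>' \<Longrightarrow> K \<in> simplices \<Delta>' \<Longrightarrow> J \<subseteq> K \<Longrightarrow> \<rho> J \<subseteq> \<rho> K"
    "J' \<in> simplices \<Delta>' \<Longrightarrow> mf_cone \<Delta>' J' \<subseteq> mf_cone \<Delta> (\<rho> J')"
    "K1 \<in> simplices \<Delta> \<Longrightarrow> inj_on (mf_cone \<Delta>') {J'\<in>simplices \<Delta>'. \<rho> J' \<subseteq> K1}"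
    "K1 \<in> simplices \<Delta> \<Longrightarrow> cone_subdivision (mf_cone \<Delta>' ` {J'\<in>simplices \<Delta>'. \<rho> J' \<subseteq> K1}) (mf_cone \<Delta> K1)"
proof -
  note d = bir[unfolded birational_morphism_def]
  note d1 = d[THEN conjunct1] and d2 = d[THEN conjunct2, THEN conjunct1]
  note d3 = d[THEN conjunct2, THEN conjunct2, THEN conjunct2]
  note d4 = d3[THEN conjunct1] and d5 = d3[THEN conjunct2]
  show "J' \<in> simplices \<Delta>' \<Longrightarrow> \<rho> J' \<in> simplices \<Delta>" by (rule subsetD[OF d1 imageI])
  show "J \<in> simplices \<Delta>' \<Longrightarrow> K \<in> simplices \<Delta>' \<Longrightarrow> J \<subseteq> K \<Longrightarrow> \<rho> J \<subseteq> \<rho> K"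
    by (rule d2[rule_format])
  show "J' \<in> simplices \<Delta>' \<Longrightarrow> mf_cone \<Delta>' J' \<subseteq> mf_cone \<Delta> (\<rho> J')"
    by (rule d4[THEN bspec, THEN conjunct1])
  show "K1 \<in> simplices \<Delta> \<Longrightarrow> inj_on (mf_cone \<Delta>') {J'\<in>simplices \<Delta>'. \<rho> J' \<subseteq> K1}"
    by (rule d5[THEN bspec, THEN conjunct1])
  show "K1 \<in> simplices \<Delta> \<Longrightarrow> cone_subdivision (mf_cone \<Delta>' ` {J'\<in>simplices \<Delta>'. \<rho> J' \<subseteq> K1}) (mf_cone \<Delta> K1)"
    by (rule d5[THEN bspec, THEN conjunct2])
qed

definition over :: "'i set \<Rightarrow> 'j set set" where
  "over I = {I'. I' \<in> k_simplices \<Delta>' n \<and> \<rho> I' = I}"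

lemma finite_over: "finite (over I)"
  using multi_fan_props(1)[OF mf'] by (rule finite_subset[rotated]) (auto simp: over_def k_simplices_def)

text \<open>The \<open>n\<close> independent edge vectors of \<open>I'\<close> lie in the span of
  those of \<open>\<rho> I'\<close>, which therefore has at least \<open>n\<close> vertices.\<close>

lemma rho_eq:
  assumes I: "I \<in> k_simplices \<Delta> n" and I': "I' \<in> k_simplices \<Delta>' n" and sub: "\<rho> I' \<subseteq> I"
  shows "\<rho> I' = I"
proof -
  interpret C': lattice_cone I' v' L N using cone'[OF I'] .
  interpret C: lattice_cone I v L N using cone[OF I] .
  have s: "I' \<in> simplices \<Delta>'" "card I' = n" "I \<in> simplices \<Delta>" "card I = n"
    using I I' by (auto simp: k_simplices_def)
  have r: "\<rho> I' \<in> simplices \<Delta>" using bir_props(1) s by simp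
  note sc = simplex_cone[OF mf ev r] and sc' = simplex_cone[OF mf' ev' s(1)]
  have "span (v' ` I') \<subseteq> span (v ` \<rho> I')"
    using span_mono[OF bir_props(3)[OF s(1)]] unfolding sc(1) sc'(1) span_cone_comb[OF sc(4)] span_cone_comb[OF sc'(4)] .
  then have sub1: "v' ` I' \<subseteq> span (v ` \<rho> I')" by (rule order_trans[OF span_superset])
  have "finite (v ` \<rho> I')" using sc(4) by simp
  from independent_span_bound[OF this C'.ind sub1]
  have "card (v' ` I') \<le> card (v ` \<rho> I')" by (rule conjunct2)
  then have "n \<le> card (\<rho> I')" using C'.inj sc(2) s by (simp add: card_image)
  then have "card I \<le> card (\<rho> I')" using s by simp
  then show ?thesis by (rule card_seteq[OF C.fin sub])
qed

lemma over_subset: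
  assumes "I \<in> k_simplices \<Delta> n" "I' \<in> over I"
  shows "cone_comb v' I' \<subseteq> cone_comb v I"
proof -
  have I: "I \<in> simplices \<Delta>" "I' \<in> simplices \<Delta>'" "\<rho> I' = I"
    using assms by (simp_all add: over_def k_simplices_def)
  show ?thesis
    using bir_props(3)[OF I(2)]
    unfolding I(3) simplex_cone(1)[OF mf ev I(1)] simplex_cone(1)[OF mf' ev' I(2)] .
qed

definition generic :: "'v \<Rightarrow> bool" where
  "generic w \<longleftrightarrow> (\<forall>I\<in>k_simplices \<Delta> n. \<forall>i\<in>I. dual_vec v I i w \<noteq> 0) \<and>
     (\<forall>I'\<in>k_simplices \<Delta>' n. \<forall>i\<in>I'. dual_vec v' I' i w \<noteq> 0)"

text \<open>Displaced by a small multiple of \<open>w\<close>, a point of a half-open cone lies in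
  the interior of the cone. Covering by the subdivision gives the union, and the fact that its cones
  meet in common faces gives disjointness; genericity excludes the cones of lower dimension.\<close>

lemma half_open_decomposition:
  assumes I: "I \<in> k_simplices \<Delta> n" and w: "generic w"
  shows "lattice_cone.half_open I v L w = (\<Union>I'\<in>over I. lattice_cone.half_open I' v' L w)"
    "disjoint_family_on (\<lambda>I'. lattice_cone.half_open I' v' L w) (over I)"
proof -
  interpret C: lattice_cone I v L N using cone[OF I] .
  have IS: "I \<in> simplices \<Delta>" using I by (simp add: k_simplices_def)
  define F where "F = {J'\<in>simplices \<Delta>'. \<rho> J' \<subseteq> I}"
  have finF: "finite F" unfolding F_def using multi_fan_props(1)[OF mf'] by simp
  have sub: "cone_subdivision (mf_cone \<Delta>' ` F) (mf_cone \<Delta> I)" and injF: "inj_on (mf_cone \<Delta>') F"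
    unfolding F_def using bir_props(5)[OF IS] bir_props(4)[OF IS] .
  have overF: "I' \<in> F" if "I' \<in> over I" for I' using that by (auto simp: F_def over_def k_simplices_def)
  have cone_eq: "mf_cone \<Delta>' I' = cone_comb v' I'" if "I' \<in> F" for I'
    using simplex_cone(1)[OF mf' ev'] that by (auto simp: F_def)
  have cov: "\<exists>J'\<in>F. x \<in> cone_comb v' J'" if "x \<in> cone_comb v I" for x
  proof -
    have "x \<in> \<Union> (mf_cone \<Delta>' ` F)"
      using sub that simplex_cone(1)[OF mf ev IS] unfolding cone_subdivision_def by simp
    then show ?thesis using cone_eq by auto
  qed
  have wC: "C.co i w \<noteq> 0" if "i \<in> I" for i using w I that by (auto simp: generic_def)
  have L: "lattice_cone I' v' L N" "\<And>i. i \<in> I' \<Longrightarrow> dual_vec v' I' i w \<noteq> 0" if "I' \<in> over I" for I'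
    using that cone' w by (auto simp: over_def generic_def)
  show "C.half_open w = (\<Union>I'\<in>over I. lattice_cone.half_open I' v' L w)"
  proof (intro equalityI subsetI)
    fix x assume x: "x \<in> C.half_open w"
    obtain \<epsilon> where e: "\<epsilon> > 0" "\<And>\<delta> i. 0 < \<delta> \<Longrightarrow> \<delta> < \<epsilon> \<Longrightarrow> i \<in> I \<Longrightarrow> C.co i (x + \<delta> *\<^sub>R w) > 0"
      using C.half_openD[OF x] by blast
    \<comment> \<open>Pigeonhole: if every one of the finitely many cones missed all small
      displacements, half of the least bound would give a point of the big cone covered by
      none.\<close>
    have "\<exists>J'\<in>F. \<forall>\<eta>>0. \<exists>\<delta>. 0 < \<delta> \<and> \<delta> < \<eta> \<and> x + \<delta> *\<^sub>R w \<in> cone_comb v' J'"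
    proof (rule ccontr)
      assume "\<not> ?thesis"
      then have "\<forall>J'\<in>F. \<exists>\<eta>>0. \<forall>\<delta>. 0 < \<delta> \<longrightarrow> \<delta> < \<eta> \<longrightarrow> x + \<delta> *\<^sub>R w \<notin> cone_comb v' J'" by blast
      then obtain \<eta> where \<eta>: "\<forall>J'\<in>F. \<eta> J' > 0 \<and> (\<forall>\<delta>. 0 < \<delta> \<longrightarrow> \<delta> < \<eta> J' \<longrightarrow> x + \<delta> *\<^sub>R w \<notin> cone_comb v' J')"
        using bchoice[of F "\<lambda>J' \<eta>. \<eta> > 0 \<and> (\<forall>\<delta>. 0 < \<delta> \<longrightarrow> \<delta> < \<eta> \<longrightarrow> x + \<delta> *\<^sub>R w \<notin> cone_comb v' J')"] by auto
      define m where "m = Min (insert \<epsilon> (\<eta> ` F))"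
      have m: "m > 0" "m \<le> \<epsilon>" unfolding m_def using finF \<eta> e by auto
      have mF: "m \<le> \<eta> J'" if "J' \<in> F" for J' unfolding m_def using finF that by (intro Min_le) auto
      have "x + (m/2) *\<^sub>R w \<in> cone_comb v I"
        unfolding C.mem_cone_comb using e(2)[of "m/2"] m by (auto intro: less_imp_le)
      then obtain J' where J': "J' \<in> F" "x + (m/2) *\<^sub>R w \<in> cone_comb v' J'" using cov by auto
      have "m/2 < \<eta> J'" using mF[OF J'(1)] m by linarith
      then show False using \<eta> J' m by auto
    qed
    then obtain J' where J': "J' \<in> F" and near: "\<And>\<eta>. \<eta> > 0 \<Longrightarrow> \<exists>\<delta>. 0 < \<delta> \<and> \<delta> < \<eta> \<and> x + \<delta> *\<^sub>R w \<in> cone_comb v' J'"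
      by auto
    have JS: "J' \<in> simplices \<Delta>'" using J' by (simp add: F_def)
    have fJ: "finite J'" using simplex_cone(4)[OF mf' ev' JS] .
    \<comment> \<open>Two different displacements lie in the same cone, and their difference is a
      multiple of \<open>w\<close>.\<close>
    have spanJ: "w \<in> span (v' ` J')"
    proof -
      obtain \<delta>1 where d1: "0 < \<delta>1" "x + \<delta>1 *\<^sub>R w \<in> cone_comb v' J'" using near[of 1] by auto
      obtain \<delta>2 where d2: "0 < \<delta>2" "\<delta>2 < \<delta>1" "x + \<delta>2 *\<^sub>R w \<in> cone_comb v' J'" using near[OF d1(1)] by auto
      have "y \<in> span (v' ` J')" if "y \<in> cone_comb v' J'" for y
        using span_base[OF that] by (simp add: span_cone_comb[OF fJ])
      then have "(x + \<delta>1 *\<^sub>R w) - (x + \<delta>2 *\<^sub>R w) \<in> span (v' ` J')" using d1 d2 by (intro span_diff) auto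
      also have "(x + \<delta>1 *\<^sub>R w) - (x + \<delta>2 *\<^sub>R w) = (\<delta>1 - \<delta>2) *\<^sub>R w" by (simp add: scaleR_diff_left)
      finally have "(1 / (\<delta>1 - \<delta>2)) *\<^sub>R (\<delta>1 - \<delta>2) *\<^sub>R w \<in> span (v' ` J')"
        by (rule span_scale)
      then show ?thesis using d2 by simp
    qed
    obtain I'' where I'': "I'' \<in> k_simplices \<Delta>' n" "J' \<subseteq> I''"
      using multi_fan_props(4)[OF mf'] JS by auto
    interpret C'': lattice_cone I'' v' L N using cone'[OF I''(1)] .
    \<comment> \<open>On the span of a proper face some coordinate with respect to
      \<open>I''\<close> vanishes, which a generic \<open>w\<close> does not allow.\<close>
    have "J' = I''"
    proof (rule ccontr)
      assume "J' \<noteq> I''"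
      then obtain i where i: "i \<in> I''" "i \<notin> J'" using I'' by auto
      have "C''.co i y = 0" if "y \<in> span (v' ` J')" for y
        using that
      proof (induction rule: span_induct_alt)
        case (step c x y)
        then obtain j where j: "j \<in> J'" "x = v' j" by auto
        have "j \<in> I''" "i \<noteq> j" using j i I''(2) by auto
        then have "C''.co i (v' j) = 0" using C''.co_basis[OF i(1)] by simp
        then show ?case using step j by (simp add: C''.co_add C''.co_scale)
      qed (simp add: C''.co_zero)
      then have "C''.co i w = 0" using spanJ by simp
      moreover have "C''.co i w \<noteq> 0" using w i(1) I''(1) unfolding generic_def by blast
      ultimately show False by simp
    qed
    then have "J' \<in> k_simplices \<Delta>' n" using I'' by simp
    then have Jo: "J' \<in> over I" using rho_eq[OF I] J' by (auto simp: over_def F_def)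
    have "x \<in> lattice_cone.half_open J' v' L w"
      using x near L(2)[OF Jo] by (intro lattice_cone.half_openI[OF L(1)[OF Jo]]) (auto simp: C.half_open_def)
    then show "x \<in> (\<Union>I'\<in>over I. lattice_cone.half_open I' v' L w)" using Jo by auto
  next
    fix x assume "x \<in> (\<Union>I'\<in>over I. lattice_cone.half_open I' v' L w)"
    then obtain I' where I': "I' \<in> over I" "x \<in> lattice_cone.half_open I' v' L w" by auto
    interpret C': lattice_cone I' v' L N using L(1)[OF I'(1)] .
    obtain \<epsilon> where e: "\<epsilon> > 0" "\<And>\<delta> i. 0 < \<delta> \<Longrightarrow> \<delta> < \<epsilon> \<Longrightarrow> i \<in> I' \<Longrightarrow> C'.co i (x + \<delta> *\<^sub>R w) > 0"
      using C'.half_openD[OF I'(2)] by blast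
    show "x \<in> C.half_open w"
    proof (rule C.half_openI[OF _ wC])
      show "x \<in> L" using I'(2) by (simp add: C'.half_open_def)
      fix \<eta> :: real assume "\<eta> > 0"
      define \<delta> where "\<delta> = min \<epsilon> \<eta> / 2"
      have d: "0 < \<delta>" "\<delta> < \<epsilon>" "\<delta> < \<eta>" using e(1) \<open>\<eta> > 0\<close> by (auto simp: \<delta>_def)
      have "x + \<delta> *\<^sub>R w \<in> cone_comb v' I'" unfolding C'.mem_cone_comb
        using e(2)[OF d(1,2)] by (auto intro: less_imp_le)
      then have "x + \<delta> *\<^sub>R w \<in> cone_comb v I" using over_subset[OF I I'(1)] by auto
      then show "\<exists>\<delta>. 0 < \<delta> \<and> \<delta> < \<eta> \<and> x + \<delta> *\<^sub>R w \<in> cone_comb v I" using d by auto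
    qed
  qed
  show "disjoint_family_on (\<lambda>I'. lattice_cone.half_open I' v' L w) (over I)"
    unfolding disjoint_family_on_def
  proof (intro ballI impI)
    fix I1 I2 assume o: "I1 \<in> over I" "I2 \<in> over I" and ne: "I1 \<noteq> I2"
    interpret C1: lattice_cone I1 v' L N using L(1)[OF o(1)] .
    interpret C2: lattice_cone I2 v' L N using L(1)[OF o(2)] .
    show "C1.half_open w \<inter> C2.half_open w = {}"
    proof (rule ccontr)
      assume "C1.half_open w \<inter> C2.half_open w \<noteq> {}"
      then obtain x where x: "x \<in> C1.half_open w" "x \<in> C2.half_open w" by auto
      obtain \<epsilon>1 where e1: "\<epsilon>1 > 0" "\<And>\<delta> i. 0 < \<delta> \<Longrightarrow> \<delta> < \<epsilon>1 \<Longrightarrow> i \<in> I1 \<Longrightarrow> C1.co i (x + \<delta> *\<^sub>R w) > 0"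
        using C1.half_openD[OF x(1)] by blast
      obtain \<epsilon>2 where e2: "\<epsilon>2 > 0" "\<And>\<delta> i. 0 < \<delta> \<Longrightarrow> \<delta> < \<epsilon>2 \<Longrightarrow> i \<in> I2 \<Longrightarrow> C2.co i (x + \<delta> *\<^sub>R w) > 0"
        using C2.half_openD[OF x(2)] by blast
      \<comment> \<open>One displacement small enough for both cones. \<open>y\<close> is interior
        to both, so their intersection, a face of each, is all of each; injectivity of
        \<open>mf_cone\<close> on \<open>F\<close> then identifies the simplices.\<close>
      define y where "y = x + (min \<epsilon>1 \<epsilon>2 / 2) *\<^sub>R w"
      have y1: "C1.co i y > 0" if "i \<in> I1" for i unfolding y_def using e1 e2 that by (intro e1(2)) auto
      have y2: "C2.co i y > 0" if "i \<in> I2" for i unfolding y_def using e1 e2 that by (intro e2(2)) auto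
      define A1 where "A1 = cone_comb v' I1"
      define A2 where "A2 = cone_comb v' I2"
      have A: "A1 \<in> mf_cone \<Delta>' ` F" "A2 \<in> mf_cone \<Delta>' ` F"
        unfolding A1_def A2_def cone_eq[OF overF[OF o(1)], symmetric] cone_eq[OF overF[OF o(2)], symmetric]
        using overF o by auto
      have faces: "A1 \<inter> A2 \<in> cone_faces A1" "A1 \<inter> A2 \<in> cone_faces A2"
        using sub A unfolding cone_subdivision_def by blast+
      have y: "y \<in> A1 \<inter> A2"
        using y1 y2 by (auto simp: A1_def A2_def C1.mem_cone_comb C2.mem_cone_comb intro: less_imp_le)
      have "A1 \<inter> A2 = A1" unfolding A1_def
        by (rule C1.face_interior[of _ y]) (use faces y y1 in \<open>auto simp: cone_faces_def A1_def\<close>)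
      moreover have "A1 \<inter> A2 = A2" unfolding A2_def
        by (rule C2.face_interior[of _ y]) (use faces y y2 in \<open>auto simp: cone_faces_def A2_def\<close>)
      ultimately have "mf_cone \<Delta>' I1 = mf_cone \<Delta>' I2"
        using cone_eq[OF overF[OF o(1)]] cone_eq[OF overF[OF o(2)]] by (simp add: A1_def A2_def)
      then show False using injF overF o ne using inj_onD by metis
    qed
  qed
qed

text \<open>\<open>edge_coeff\<close> uses the basis of the smaller simplex
  \<open>\<rho> {i'}\<close>, whose span contains \<open>v' i'\<close>. Extending this basis to that
  of \<open>I\<close> keeps the coordinates and adds only zeros.\<close>

lemma pull_back_eq:
  assumes I: "I \<in> k_simplices \<Delta> n" and I': "I' \<in> over I" and i': "i' \<in> I'"
  shows "pull_back \<Delta> v' v \<rho> d i' = (\<Sum>i\<in>I. d i * dual_vec v I i (v' i'))"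
proof -
  interpret C: lattice_cone I v L N using cone[OF I] .
  have S: "I \<in> simplices \<Delta>" "I' \<in> simplices \<Delta>'" "\<rho> I' = I"
    using I I' by (auto simp: over_def k_simplices_def)
  have i'S: "{i'} \<in> simplices \<Delta>'" using multi_fan_props(3)[OF mf'] S(2) i' by blast
  have rS: "\<rho> {i'} \<in> simplices \<Delta>" by (rule bir_props(1)[OF i'S])
  have sub: "\<rho> {i'} \<subseteq> I" using bir_props(2)[OF i'S S(2)] i' S(3) by simp
  have finv: "finite (verts \<Delta>)"
  proof -
    have "finite ((\<lambda>i. {i}) ` verts \<Delta>)"
      using multi_fan_props(1)[OF mf] by (rule finite_subset[rotated]) (auto simp: verts_def)
    then show ?thesis by (rule finite_imageD) (auto simp: inj_on_def)
  qed
  have vsub: "I \<subseteq> verts \<Delta>" using multi_fan_props(3)[OF mf] S(1) unfolding verts_def by blast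
  have "v' i' \<in> mf_cone \<Delta>' {i'}"
    using ev' i'S unfolding edge_vectors_def verts_def by blast
  then have "v' i' \<in> cone_comb v (\<rho> {i'})"
    using bir_props(3)[OF i'S] simplex_cone(1)[OF mf ev rS] by blast
  then have "v' i' \<in> span (v ` \<rho> {i'})"
    using span_base[of "v' i'" "cone_comb v (\<rho> {i'})"] span_cone_comb[OF simplex_cone(4)[OF mf ev rS]] by metis
  then have rep: "representation (v ` I) (v' i') = representation (v ` \<rho> {i'}) (v' i')"
    using sub by (intro representation_extend C.ind) auto
  have coeff: "edge_coeff v' v \<rho> i' i = dual_vec v I i (v' i')" if "i \<in> I" for i
  proof (cases "i \<in> \<rho> {i'}")
    case False
    have "v i \<notin> v ` \<rho> {i'}" using False sub that C.inj by (auto simp: inj_on_def)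
    then have "representation (v ` \<rho> {i'}) (v' i') (v i) = 0"
      using representation_ne_zero by metis
    then show ?thesis using False by (simp add: edge_coeff_def dual_vec_def rep)
  qed (simp add: edge_coeff_def dual_vec_def rep)
  have zero: "edge_coeff v' v \<rho> i' i = 0" if "i \<notin> I" for i
    using that sub by (auto simp: edge_coeff_def)
  have "pull_back \<Delta> v' v \<rho> d i' = (\<Sum>i\<in>I. d i * edge_coeff v' v \<rho> i' i)"
    unfolding pull_back_def using finv vsub zero by (intro sum.mono_neutral_right) auto
  then show ?thesis by (simp add: coeff cong: sum.cong)
qed

text \<open>A nonzero vector with nonnegative coordinates has positive coordinate sum. This lets one
  functional grade the cone of \<open>I\<close> and all cones over it.\<close>

lemma ray_positive:
  assumes I: "I \<in> k_simplices \<Delta> n" and I': "I' \<in> over I" and i': "i' \<in> I'"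
  shows "(\<Sum>i\<in>I. dual_vec v I i (v' i')) > 0"
proof -
  interpret C: lattice_cone I v L N using cone[OF I] .
  have I'S: "I' \<in> k_simplices \<Delta>' n" using I' by (simp add: over_def)
  interpret C': lattice_cone I' v' L N using cone'[OF I'S] .
  have "v' i' \<in> cone_comb v I"
    using over_subset[OF I I'] cone_comb_generator[OF C'.fin i', of v'] by blast
  then have nn: "\<forall>i\<in>I. 0 \<le> C.co i (v' i')" by (simp only: C.mem_cone_comb)
  have "v' i' \<noteq> 0" using C'.co_basis[OF i' i'] C'.co_zero by auto
  then have "\<exists>i\<in>I. C.co i (v' i') \<noteq> 0" using C.co_eqI[of "v' i'" 0] C.co_zero by auto
  then obtain i where "i \<in> I" "C.co i (v' i') > 0" using nn by force
  then show ?thesis using nn C.fin by (intro sum_pos2) auto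
qed

end

section \<open>Generating functions of half-open cones\<close>

definition gen_series :: "('v \<Rightarrow> 'e::field) \<Rightarrow> ('v \<Rightarrow> nat) \<Rightarrow> 'v set \<Rightarrow> 'e fps" where
  "gen_series ch p S = Abs_fps (\<lambda>j. \<Sum>x | x \<in> S \<and> p x = j. ch x)"

text \<open>The translate of \<open>S\<close> by \<open>u\<close> has generating series
  \<open>ch u * X ^ p u\<close> times that of \<open>S\<close>; multiplication by the linear factor
  removes it.\<close>

lemma gen_series_shift:
  fixes u :: "'v::group_add" and ch :: "'v \<Rightarrow> 'e::field"
  assumes fib: "\<And>j. finite {x \<in> S. p x = j}" and sub: "(\<lambda>x. x + u) ` S \<subseteq> S"
    and chi: "\<And>x. x \<in> S \<Longrightarrow> ch (x + u) = ch x * ch u" and p: "\<And>x. x \<in> S \<Longrightarrow> p (x + u) = p x + p u"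
  shows "gen_series ch p S * (1 - fps_const (ch u) * fps_X ^ p u) = gen_series ch p (S - (\<lambda>x. x + u) ` S)"
proof (rule fps_ext)
  fix j
  define S' where "S' = (\<lambda>x. x + u) ` S"
  have *: "(\<Sum>x | x \<in> S' \<and> p x = j. ch x) = (if j < p u then 0 else ch u * (\<Sum>x | x \<in> S \<and> p x = j - p u. ch x))"
  proof (cases "j < p u")
    case True
    have e: "{x. x \<in> S' \<and> p x = j} = {}" using True p by (auto simp: S'_def)
    show ?thesis unfolding e using True by simp
  next
    case False
    have "{x. x \<in> S' \<and> p x = j} = (\<lambda>x. x + u) ` {x. x \<in> S \<and> p x = j - p u}"
      using False p by (auto simp: S'_def)
    then have "(\<Sum>x | x \<in> S' \<and> p x = j. ch x) = (\<Sum>x | x \<in> S \<and> p x = j - p u. ch (x + u))"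
      by (simp add: sum.reindex inj_on_def)
    also have "\<dots> = ch u * (\<Sum>x | x \<in> S \<and> p x = j - p u. ch x)"
      unfolding sum_distrib_left by (rule sum.cong) (auto simp: chi mult.commute)
    finally show ?thesis using False by simp
  qed
  have "(\<Sum>x | x \<in> S \<and> p x = j. ch x) = (\<Sum>x | x \<in> S - S' \<and> p x = j. ch x) + (\<Sum>x | x \<in> S' \<and> p x = j. ch x)"
  proof -
    have f: "finite {x. x \<in> S - S' \<and> p x = j}" "finite {x. x \<in> S' \<and> p x = j}"
      using sub by (auto intro!: finite_subset[OF _ fib[of j]] simp: S'_def)
    have e: "{x. x \<in> S \<and> p x = j} = {x. x \<in> S - S' \<and> p x = j} \<union> {x. x \<in> S' \<and> p x = j}"
      using sub by (auto simp: S'_def)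
    show ?thesis unfolding e by (rule sum.union_disjoint[OF f]) auto
  qed
  then have "(\<Sum>x | x \<in> S - S' \<and> p x = j. ch x) = (\<Sum>x | x \<in> S \<and> p x = j. ch x) -
      (if j < p u then 0 else ch u * (\<Sum>x | x \<in> S \<and> p x = j - p u. ch x))"
    unfolding * by simp
  moreover have "fps_nth (F * (1 - fps_const c * fps_X ^ k)) j =
      fps_nth F j - (if j < k then 0 else c * fps_nth F (j - k))" for F :: "'e fps" and c k
  proof -
    have "F * (1 - fps_const c * fps_X ^ k) = F - fps_const c * (F * fps_X ^ k)" by (simp add: algebra_simps)
    then show ?thesis by (simp add: fps_X_power_mult_right_nth)
  qed
  ultimately show "fps_nth (gen_series ch p S * (1 - fps_const (ch u) * fps_X ^ p u)) j =
      fps_nth (gen_series ch p (S - (\<lambda>x. x + u) ` S)) j"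
    unfolding S'_def by (simp add: gen_series_def)
qed

context lattice_cone
begin

text \<open>The half-open fundamental domain: \<open>half_open w\<close> without its translates by \<open>v i\<close>, \<open>i \<in> J\<close>, if \<open>J \<subseteq> I\<close>
  and \<open>w\<close> has no zero coordinate.\<close>

definition half_open_fund :: "'v \<Rightarrow> 'i set \<Rightarrow> 'v set" where
  "half_open_fund w J = {x \<in> half_open w. \<forall>i\<in>J. co i x < 1 \<or> (co i x = 1 \<and> co i w < 0)}"

text \<open>A point of the set is a translate by \<open>v i\<close> within it exactly if subtracting
  \<open>v i\<close> leaves the i-th coordinate positive, or zero with \<open>co i w > 0\<close>.
  The points left over have coordinate below 1, or equal to 1 with
  \<open>co i w < 0\<close>.\<close>

lemma half_open_fund_insert:
  assumes i: "i \<in> I" "i \<notin> J" and J: "J \<subseteq> I" and w: "co i w \<noteq> 0"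
  shows "(\<lambda>x. x + v i) ` half_open_fund w J \<subseteq> half_open_fund w J" "half_open_fund w (insert i J) = half_open_fund w J - (\<lambda>x. x + v i) ` half_open_fund w J"
proof -
  have cov: "co j (x + v i) = (if j = i then co j x + 1 else co j x)" if "j \<in> I" for j x
    using that i by (simp add: co_add co_basis)
  have cov': "co j (x - v i) = (if j = i then co j x - 1 else co j x)" if "j \<in> I" for j x
    using that i by (simp add: co_diff co_basis)
  show 1: "(\<lambda>x. x + v i) ` half_open_fund w J \<subseteq> half_open_fund w J"
  proof (rule image_subsetI)
    fix x assume x: "x \<in> half_open_fund w J"
    have "co j (x + v i) > 0 \<or> (co j (x + v i) = 0 \<and> co j w > 0)" if "j \<in> I" for j
      using x that by (auto simp: cov half_open_fund_def half_open_def)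
    moreover have "co j (x + v i) < 1 \<or> (co j (x + v i) = 1 \<and> co j w < 0)" if "j \<in> J" for j
    proof -
      have "j \<noteq> i" "j \<in> I" using that i J by auto
      then show ?thesis using x that by (simp add: cov half_open_fund_def)
    qed
    moreover have "x + v i \<in> L" using x vL[OF i(1)] by (auto simp: half_open_fund_def half_open_def intro: Ladd)
    ultimately show "x + v i \<in> half_open_fund w J" by (simp add: half_open_fund_def half_open_def)
  qed
  show "half_open_fund w (insert i J) = half_open_fund w J - (\<lambda>x. x + v i) ` half_open_fund w J"
  proof (intro equalityI subsetI)
    fix x assume x: "x \<in> half_open_fund w (insert i J)"
    have "x \<notin> (\<lambda>x. x + v i) ` half_open_fund w J"
    proof
      assume "x \<in> (\<lambda>x. x + v i) ` half_open_fund w J"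
      then obtain y where y: "y \<in> half_open_fund w J" "x = y + v i" by auto
      have "co i y > 0 \<or> (co i y = 0 \<and> co i w > 0)" using y i by (auto simp: half_open_fund_def half_open_def)
      moreover have "co i x = co i y + 1" using y i by (simp add: cov)
      ultimately show False using x by (auto simp: half_open_fund_def)
    qed
    then show "x \<in> half_open_fund w J - (\<lambda>x. x + v i) ` half_open_fund w J" using x by (simp add: half_open_fund_def)
  next
    fix x assume x: "x \<in> half_open_fund w J - (\<lambda>x. x + v i) ` half_open_fund w J"
    show "x \<in> half_open_fund w (insert i J)"
    proof (rule ccontr)
      assume "x \<notin> half_open_fund w (insert i J)"
      then have ci: "\<not> (co i x < 1 \<or> (co i x = 1 \<and> co i w < 0))" using x unfolding half_open_fund_def by blast
      have "x - v i \<in> half_open_fund w J"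
      proof -
        have "co j (x - v i) > 0 \<or> (co j (x - v i) = 0 \<and> co j w > 0)" if "j \<in> I" for j
        proof (cases "j = i")
          case True
          have "co i (x - v i) = co i x - 1" using cov'[OF i(1)] by simp
          then show ?thesis unfolding True using ci w by linarith
        next
          case False
          then show ?thesis using x that by (simp add: cov' half_open_fund_def half_open_def)
        qed
        moreover have "co j (x - v i) < 1 \<or> (co j (x - v i) = 1 \<and> co j w < 0)" if "j \<in> J" for j
        proof -
          have "j \<noteq> i" "j \<in> I" using that i J by auto
          then show ?thesis using x that by (simp add: cov' half_open_fund_def)
        qed
        moreover have "x - v i \<in> L" using x vL[OF i(1)] by (auto simp: half_open_fund_def half_open_def intro: Ldiff)
        ultimately show ?thesis by (simp add: half_open_fund_def half_open_def)
      qed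
      then have "(x - v i) + v i \<in> (\<lambda>x. x + v i) ` half_open_fund w J" by (rule imageI)
      then show False using x by simp
    qed
  qed
qed

text \<open>Multiplied by \<open>N\<close>, the coordinates are integers in a bounded range, and
  they determine the point.\<close>

lemma finite_bounded: "finite {x \<in> L. \<forall>i\<in>I. 0 \<le> co i x \<and> co i x \<le> real b}"
proof (rule finite_imageD)
  let ?f = "\<lambda>x. restrict (\<lambda>i. \<lfloor>real N * co i x\<rfloor>) I"
  show "finite (?f ` {x \<in> L. \<forall>i\<in>I. 0 \<le> co i x \<and> co i x \<le> real b})"
  proof (rule finite_subset)
    show "finite (PiE I (\<lambda>_. {0..int (N * b)}))" using fin by (intro finite_PiE) auto
    show "?f ` {x \<in> L. \<forall>i\<in>I. 0 \<le> co i x \<and> co i x \<le> real b} \<subseteq> PiE I (\<lambda>_. {0..int (N * b)})"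
    proof (rule image_subsetI, rule PiE_I)
      fix x i assume x: "x \<in> {x \<in> L. \<forall>i\<in>I. 0 \<le> co i x \<and> co i x \<le> real b}" and i: "i \<in> I"
      have "real N * co i x \<le> real N * real b" using x i by (intro mult_left_mono) auto
      moreover have "0 \<le> real N * co i x" using x i by simp
      ultimately show "?f x i \<in> {0..int (N * b)}" using i by (simp add: floor_le_iff)
    qed auto
  qed
  show "inj_on ?f {x \<in> L. \<forall>i\<in>I. 0 \<le> co i x \<and> co i x \<le> real b}"
  proof (rule inj_onI)
    fix x y assume x: "x \<in> {x \<in> L. \<forall>i\<in>I. 0 \<le> co i x \<and> co i x \<le> real b}"
      and y: "y \<in> {x \<in> L. \<forall>i\<in>I. 0 \<le> co i x \<and> co i x \<le> real b}" and eq: "?f x = ?f y"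
    show "x = y"
    proof (rule co_eqI)
      fix i assume i: "i \<in> I"
      have "\<lfloor>real N * co i x\<rfloor> = \<lfloor>real N * co i y\<rfloor>" using fun_cong[OF eq, of i] i by simp
      moreover have "real N * co i x \<in> \<int>" "real N * co i y \<in> \<int>" using x y i by (auto intro: Nco)
      ultimately have "real N * co i x = real N * co i y" by (metis of_int_floor)
      then show "co i x = co i y" using N0 by simp
    qed
  qed
qed

lemma finite_fund: "finite (half_open_fund w I)"
  by (rule finite_subset[OF _ finite_bounded[of 1]]) (auto simp: half_open_fund_def half_open_def intro: less_imp_le)

text \<open>Each factor \<open>1 - ch (v i) X ^ p (v i)\<close> strips off the translates in one
  direction, until the finite fundamental domain is left. The fibres of \<open>p\<close> are finite
  because \<open>P (v i)\<close> is a positive integer, hence at least 1: on the level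
  \<open>j\<close> every coordinate is at most \<open>j\<close>.\<close>

lemma gen_series_half_open:
  fixes ch :: "'v \<Rightarrow> 'e::field" and P :: "'v \<Rightarrow> real"
  assumes chi: "\<And>x y. x \<in> L \<Longrightarrow> y \<in> L \<Longrightarrow> ch (x + y) = ch x * ch y"
    and P: "linear P" "\<And>x. x \<in> L \<Longrightarrow> P x \<in> \<int>" "\<And>i. i \<in> I \<Longrightarrow> P (v i) > 0"
    and w: "\<And>i. i \<in> I \<Longrightarrow> co i w \<noteq> 0"
  defines "p \<equiv> \<lambda>x. nat \<lfloor>P x\<rfloor>"
  shows "gen_series ch p (half_open w) * fps_of_poly (\<Prod>i\<in>I. 1 - monom (ch (v i)) (p (v i))) =
      fps_of_poly (\<Sum>x\<in>half_open_fund w I. monom (ch x) (p x))" (is ?T1)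
    and "\<And>j. finite {x \<in> half_open w. p x = j}"
proof -
  have Pint: "real_of_int \<lfloor>P x\<rfloor> = P x" if "x \<in> L" for x using P(2)[OF that] by simp
  have P1: "P (v i) \<ge> 1" if "i \<in> I" for i
  proof -
    have "\<lfloor>P (v i)\<rfloor> > 0" using P(3)[OF that] Pint[OF vL[OF that]] by linarith
    then show ?thesis using Pint[OF vL[OF that]] by linarith
  qed
  have Pexp: "P x = (\<Sum>i\<in>I. co i x * P (v i))" for x
  proof -
    have "P x = P (\<Sum>i\<in>I. co i x *\<^sub>R v i)" by (simp add: co_expand)
    also have "\<dots> = (\<Sum>i\<in>I. co i x * P (v i))"
      using P(1) by (simp add: linear_sum linear_cmul)
    finally show ?thesis .
  qed
  have h0: "x \<in> L" "\<And>i. i \<in> I \<Longrightarrow> co i x \<ge> 0" if "x \<in> half_open w" for x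
    using that by (auto simp: half_open_def intro: less_imp_le)
  have term_ge: "co i x * P (v i) \<ge> 0" if "x \<in> half_open w" "i \<in> I" for x i
    using h0(2)[OF that] P1[OF that(2)] by simp
  have P0: "P x \<ge> 0" if "x \<in> half_open w" for x
    unfolding Pexp[of x] using term_ge[OF that] by (intro sum_nonneg) auto
  have preal: "real (p x) = P x" if "x \<in> half_open w" for x
  proof -
    have "real (nat \<lfloor>P x\<rfloor>) = real_of_int \<lfloor>P x\<rfloor>" using P0[OF that] by (intro of_nat_nat) simp
    then show ?thesis unfolding p_def Pint[OF h0(1)[OF that]] .
  qed
  have fib: "finite {x \<in> half_open w. p x = j}" for j
  proof (rule finite_subset[OF _ finite_bounded[of j]], intro subsetI CollectI conjI ballI)
    fix x assume x: "x \<in> {x \<in> half_open w. p x = j}"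
    then have xh: "x \<in> half_open w" and xj: "p x = j" by simp_all
    show "x \<in> L" using h0(1)[OF xh] .
    fix i assume i: "i \<in> I"
    show "0 \<le> co i x" using h0(2)[OF xh i] .
    have "co i x \<le> co i x * P (v i)" using P1[OF i] h0(2)[OF xh i] mult_left_mono[of 1 "P (v i)" "co i x"] by simp
    also have "\<dots> \<le> P x" unfolding Pexp[of x] using term_ge[OF xh] i fin by (intro member_le_sum) auto
    also have "\<dots> = real j" using preal[OF xh] xj by simp
    finally show "co i x \<le> real j" .
  qed
  then show "\<And>j. finite {x \<in> half_open w. p x = j}" .
  have padd: "p (x + v i) = p x + p (v i)" if "x \<in> half_open w" "i \<in> I" for x i
  proof -
    have "P (x + v i) = P x + P (v i)" using P(1) by (rule linear_add)
    also have "\<dots> = real_of_int (\<lfloor>P x\<rfloor> + \<lfloor>P (v i)\<rfloor>)"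
      unfolding of_int_add Pint[OF h0(1)[OF that(1)]] Pint[OF vL[OF that(2)]] ..
    finally have "\<lfloor>P (x + v i)\<rfloor> = \<lfloor>P x\<rfloor> + \<lfloor>P (v i)\<rfloor>" by (simp only: floor_of_int)
    then show ?thesis using P0[OF that(1)] P1[OF that(2)] by (simp add: p_def nat_add_distrib)
  qed
  have mono: "fps_of_poly (1 - monom c k) = 1 - fps_const c * fps_X ^ k" for c :: 'e and k
    by (simp add: fps_of_poly_diff fps_of_poly_monom)
  have peel: "gen_series ch p (half_open w) * fps_of_poly (\<Prod>i\<in>J. 1 - monom (ch (v i)) (p (v i))) =
      gen_series ch p (half_open_fund w J)" if "J \<subseteq> I" for J
    using finite_subset[OF that fin] that
  proof (induction J rule: finite_induct)
    case empty
    show ?case by (simp add: half_open_fund_def)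
  next
    case (insert i J)
    have i: "i \<in> I" and J: "J \<subseteq> I" using insert by auto
    have sub: "half_open_fund w J \<subseteq> half_open w" by (auto simp: half_open_fund_def)
    have "gen_series ch p (half_open_fund w (insert i J)) =
        gen_series ch p (half_open_fund w J) * (1 - fps_const (ch (v i)) * fps_X ^ p (v i))"
      unfolding half_open_fund_insert(2)[OF i insert(2) J w[OF i]]
    proof (rule gen_series_shift[symmetric, where p = p and ch = ch])
      show "finite {x \<in> half_open_fund w J. p x = j}" for j by (rule finite_subset[OF _ fib[of j]]) (use sub in auto)
      show "(\<lambda>x. x + v i) ` half_open_fund w J \<subseteq> half_open_fund w J" by (rule half_open_fund_insert(1)[OF i insert(2) J w[OF i]])
      fix x assume "x \<in> half_open_fund w J"
      then have x: "x \<in> half_open w" using sub by auto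
      show "ch (x + v i) = ch x * ch (v i)" by (rule chi[OF h0(1)[OF x] vL[OF i]])
      show "p (x + v i) = p x + p (v i)" by (rule padd[OF x i])
    qed
    also have "gen_series ch p (half_open_fund w J) = gen_series ch p (half_open w) * fps_of_poly (\<Prod>i\<in>J. 1 - monom (ch (v i)) (p (v i)))"
      by (rule insert.IH[OF J, symmetric])
    finally show ?case
      unfolding prod.insert[OF insert(1,2)] fps_of_poly_mult mono by (simp only: mult_ac)
  qed
  have "gen_series ch p (half_open_fund w I) = fps_of_poly (\<Sum>x\<in>half_open_fund w I. monom (ch x) (p x))"
  proof (rule fps_ext)
    fix j
    have "(\<Sum>x | x \<in> half_open_fund w I \<and> p x = j. ch x) = (\<Sum>x\<in>half_open_fund w I. if p x = j then ch x else 0)"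
      using finite_fund[of w] by (intro sum.mono_neutral_cong_left) auto
    then show "fps_nth (gen_series ch p (half_open_fund w I)) j = fps_nth (fps_of_poly (\<Sum>x\<in>half_open_fund w I. monom (ch x) (p x))) j"
      by (simp add: gen_series_def coeff_sum)
  qed
  then show ?T1 using peel[OF subset_refl] by simp
qed

end

text \<open>Recovers a sum of fractions from its form with cleared denominators; used for values of
  generating functions and again in the fraction field of a power series ring.\<close>

lemma sum_divide_eq:
  fixes a b :: "'e::field"
  assumes "finite K" "b \<noteq> 0" "\<And>k. k \<in> K \<Longrightarrow> d k \<noteq> 0"
    and eq: "a * (\<Prod>k\<in>K. d k) = b * (\<Sum>k\<in>K. c k * (\<Prod>l\<in>K - {k}. d l))"
  shows "a / b = (\<Sum>k\<in>K. c k / d k)"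
proof -
  define D where "D = (\<Prod>k\<in>K. d k)"
  have D: "D \<noteq> 0" using assms by (simp add: D_def)
  have "(\<Sum>k\<in>K. c k / d k) * D = (\<Sum>k\<in>K. c k * (\<Prod>l\<in>K - {k}. d l))"
    unfolding sum_distrib_right
  proof (rule sum.cong[OF refl])
    fix k assume k: "k \<in> K"
    have "D = d k * (\<Prod>l\<in>K - {k}. d l)" unfolding D_def using k assms(1) by (rule prod.remove[rotated])
    then show "c k / d k * D = c k * (\<Prod>l\<in>K - {k}. d l)" using assms(3)[OF k] by simp
  qed
  then have "a * D = b * ((\<Sum>k\<in>K. c k / d k) * D)" using eq by (simp only: D_def)
  then have "a = b * (\<Sum>k\<in>K. c k / d k)" using D by (simp add: mult.assoc[symmetric])
  then show ?thesis using assms(2) by simp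
qed

context birational_setting
begin

text \<open>The generating functions of the half-open cones need not converge at \<open>ch\<close>. They are made into power
  series by an additional variable with exponent \<open>p\<close>, a functional that is positive on \<open>C(I)\<close>; the
  resulting identity of rational functions is then specialised to 1.\<close>

theorem fund_sum_decomposition:
  fixes ch :: "'v \<Rightarrow> 'e::field"
  assumes I: "I \<in> k_simplices \<Delta> n" and w: "generic w"
    and chi: "\<And>x y. x \<in> L \<Longrightarrow> y \<in> L \<Longrightarrow> ch (x + y) = ch x * ch y"
    and c1: "\<And>i. i \<in> I \<Longrightarrow> ch (v i) \<noteq> 1"
    and c2: "\<And>I' i. I' \<in> over I \<Longrightarrow> i \<in> I' \<Longrightarrow> ch (v' i) \<noteq> 1"
  shows "(\<Sum>x\<in>lattice_cone.half_open_fund I v L w I. ch x) / (\<Prod>i\<in>I. 1 - ch (v i)) =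
    (\<Sum>I'\<in>over I. (\<Sum>x\<in>lattice_cone.half_open_fund I' v' L w I'. ch x) / (\<Prod>i\<in>I'. 1 - ch (v' i)))"
proof -
  interpret C: lattice_cone I v L N using cone[OF I] .
  \<comment> \<open>\<open>N\<close> times the coordinate sum: integral on \<open>L\<close>, and
    positive on the rays of \<open>I\<close> and on those of every simplex over
    \<open>I\<close>.\<close>
  define P where "P = (\<lambda>x. real N * (\<Sum>i\<in>I. C.co i x))"
  define p where "p = (\<lambda>x. nat \<lfloor>P x\<rfloor>)"
  have P: "linear P"
    by (rule linearI) (simp_all add: P_def C.co_add C.co_scale sum.distrib sum_distrib_left algebra_simps)
  have PZ: "P x \<in> \<int>" if "x \<in> L" for x
    unfolding P_def sum_distrib_left using C.Nco[OF that] by (intro Ints_sum) auto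
  have Pv: "P (v i) > 0" if "i \<in> I" for i
  proof -
    have "(\<Sum>j\<in>I. C.co j (v i)) = (\<Sum>j\<in>I. if j = i then 1 else 0)"
      using that by (intro sum.cong) (auto simp: C.co_basis)
    then show ?thesis using that C.N0 C.fin by (simp add: P_def)
  qed
  have Pv': "P (v' i) > 0" if "I' \<in> over I" "i \<in> I'" for I' i
    using ray_positive[OF I that] C.N0 by (simp add: P_def)
  have wC: "C.co i w \<noteq> 0" if "i \<in> I" for i using w I that unfolding generic_def by blast
  have oS: "I' \<in> k_simplices \<Delta>' n" if "I' \<in> over I" for I' using that by (simp add: over_def)
  have wC': "dual_vec v' I' i w \<noteq> 0" if "I' \<in> over I" "i \<in> I'" for I' i
    using w oS[OF that(1)] that(2) unfolding generic_def by blast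
  define D where "D = (\<Prod>i\<in>I. 1 - monom (ch (v i)) (p (v i)))"
  define D' where "D' = (\<lambda>I'. \<Prod>i\<in>I'. 1 - monom (ch (v' i)) (p (v' i)))"
  define A where "A = (\<Sum>x\<in>C.half_open_fund w I. monom (ch x) (p x))"
  define A' where "A' = (\<lambda>I'. \<Sum>x\<in>lattice_cone.half_open_fund I' v' L w I'. monom (ch x) (p x))"
  define G where "G = gen_series ch p (C.half_open w)"
  define G' where "G' = (\<lambda>I'. gen_series ch p (lattice_cone.half_open I' v' L w))"
  have GA: "G * fps_of_poly D = fps_of_poly A"
    unfolding G_def D_def A_def p_def by (rule C.gen_series_half_open(1)[OF chi P PZ Pv wC])
  have GA': "G' I' * fps_of_poly (D' I') = fps_of_poly (A' I')" if "I' \<in> over I" for I'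
    unfolding G'_def D'_def A'_def p_def
    by (rule lattice_cone.gen_series_half_open(1)[OF cone'[OF oS[OF that]] chi P PZ Pv'[OF that] wC'[OF that]])
  have fib: "finite {x \<in> lattice_cone.half_open I' v' L w. p x = j}" if "I' \<in> over I" for I' j
    unfolding p_def
    by (rule lattice_cone.gen_series_half_open(2)[OF cone'[OF oS[OF that]] chi P PZ Pv'[OF that] wC'[OF that]])
  have GG': "G = (\<Sum>I'\<in>over I. G' I')"
  proof (rule fps_ext)
    fix j
    have e: "{x. x \<in> C.half_open w \<and> p x = j} =
        (\<Union>I'\<in>over I. {x. x \<in> lattice_cone.half_open I' v' L w \<and> p x = j})"
      unfolding half_open_decomposition(1)[OF I w] by auto
    have "(\<Sum>x | x \<in> C.half_open w \<and> p x = j. ch x) =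
      (\<Sum>I'\<in>over I. \<Sum>x | x \<in> lattice_cone.half_open I' v' L w \<and> p x = j. ch x)"
      unfolding e
    proof (rule sum.UNION_disjoint[OF finite_over])
      show "\<forall>I'\<in>over I. finite {x. x \<in> lattice_cone.half_open I' v' L w \<and> p x = j}" using fib by simp
      have "lattice_cone.half_open I1 v' L w \<inter> lattice_cone.half_open I2 v' L w = {}"
        if "I1 \<in> over I" "I2 \<in> over I" "I1 \<noteq> I2" for I1 I2
        using half_open_decomposition(2)[OF I w] that unfolding disjoint_family_on_def by simp
      then show "\<forall>I1\<in>over I. \<forall>I2\<in>over I. I1 \<noteq> I2 \<longrightarrow>
        {x. x \<in> lattice_cone.half_open I1 v' L w \<and> p x = j} \<inter> {x. x \<in> lattice_cone.half_open I2 v' L w \<and> p x = j} = {}"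
        by blast
    qed
    then show "fps_nth G j = fps_nth (\<Sum>I'\<in>over I. G' I') j"
      by (simp add: G_def G'_def gen_series_def fps_sum_nth)
  qed
  have rem: "(\<Prod>K\<in>over I. D' K) = D' I' * (\<Prod>K\<in>over I - {I'}. D' K)" if "I' \<in> over I" for I'
    using finite_over that by (rule prod.remove)
  \<comment> \<open>Cross-multiplication eliminates the infinite series \<open>G\<close> and
    \<open>G'\<close>. What remains is an identity between polynomials, which, unlike these series,
    can be evaluated at 1.\<close>
  have "fps_of_poly (A * (\<Prod>K\<in>over I. D' K)) = G * fps_of_poly D * fps_of_poly (\<Prod>K\<in>over I. D' K)"
    by (simp add: fps_of_poly_mult GA)
  also have "\<dots> = fps_of_poly D * (\<Sum>I'\<in>over I. G' I' * fps_of_poly (\<Prod>K\<in>over I. D' K))"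
    unfolding GG' by (simp add: sum_distrib_right sum_distrib_left mult_ac)
  also have "(\<Sum>I'\<in>over I. G' I' * fps_of_poly (\<Prod>K\<in>over I. D' K)) =
      (\<Sum>I'\<in>over I. fps_of_poly (A' I' * (\<Prod>K\<in>over I - {I'}. D' K)))"
  proof (rule sum.cong[OF refl])
    fix I' assume I': "I' \<in> over I"
    have "G' I' * fps_of_poly (\<Prod>K\<in>over I. D' K) =
        (G' I' * fps_of_poly (D' I')) * fps_of_poly (\<Prod>K\<in>over I - {I'}. D' K)"
      unfolding rem[OF I'] fps_of_poly_mult by (simp only: mult.assoc)
    then show "G' I' * fps_of_poly (\<Prod>K\<in>over I. D' K) = fps_of_poly (A' I' * (\<Prod>K\<in>over I - {I'}. D' K))"
      unfolding GA'[OF I'] fps_of_poly_mult .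
  qed
  also have "fps_of_poly D * (\<Sum>I'\<in>over I. fps_of_poly (A' I' * (\<Prod>K\<in>over I - {I'}. D' K))) =
      fps_of_poly (D * (\<Sum>I'\<in>over I. A' I' * (\<Prod>K\<in>over I - {I'}. D' K)))"
    by (simp only: fps_of_poly_mult fps_of_poly_sum)
  finally have "A * (\<Prod>K\<in>over I. D' K) = D * (\<Sum>I'\<in>over I. A' I' * (\<Prod>K\<in>over I - {I'}. D' K))"
    by (simp only: fps_of_poly_eq_iff)
  then have "poly (A * (\<Prod>K\<in>over I. D' K)) 1 = poly (D * (\<Sum>I'\<in>over I. A' I' * (\<Prod>K\<in>over I - {I'}. D' K))) 1"
    by (simp only:)
  then have "poly A 1 * (\<Prod>K\<in>over I. poly (D' K) 1) =
      poly D 1 * (\<Sum>I'\<in>over I. poly (A' I') 1 * (\<Prod>K\<in>over I - {I'}. poly (D' K) 1))"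
    by (simp only: poly_mult poly_prod poly_sum)
  moreover have "poly D 1 \<noteq> 0" "\<And>K. K \<in> over I \<Longrightarrow> poly (D' K) 1 \<noteq> 0"
    using c1 c2 C.fin lattice_cone.axioms(1)[OF cone'[OF oS]] unfolding cone_basis_def
    by (auto simp: D_def D'_def poly_prod poly_monom)
  ultimately have "poly A 1 / poly D 1 = (\<Sum>I'\<in>over I. poly (A' I') 1 / poly (D' I') 1)"
    using finite_over by (intro sum_divide_eq)
  then show ?thesis by (simp add: A_def A'_def D_def D'_def poly_prod poly_sum poly_monom)
qed

end

section \<open>Coefficientwise summation\<close>

text \<open>Unconditional convergence of each coefficient in the complex topology, with no
  uniformity in \<open>r\<close>; products need only finitely many coefficients at a time.\<close>

definition fps_has_sum :: "('k \<Rightarrow> complex fps) \<Rightarrow> 'k set \<Rightarrow> complex fps \<Rightarrow> bool" where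
  "fps_has_sum f A F \<longleftrightarrow> (\<forall>r. ((\<lambda>k. fps_nth (f k) r) has_sum fps_nth F r) A)"

text \<open>Unconditional convergence of complex numbers is absolute, so the product family is
  summable by comparison of norms.\<close>

lemma has_sum_mult_complex:
  fixes f :: "'a \<Rightarrow> complex" and g :: "'b \<Rightarrow> complex"
  assumes f: "(f has_sum a) A" and g: "(g has_sum b) B"
  shows "((\<lambda>(x, y). f x * g y) has_sum (a * b)) (A \<times> B)"
proof (rule has_sum_SigmaI[where g = "\<lambda>x. f x * b"])
  show "((\<lambda>y. case (x, y) of (x, y) \<Rightarrow> f x * g y) has_sum f x * b) B" for x
    using has_sum_cmult_right[OF g, of "f x"] by simp
  show "((\<lambda>x. f x * b) has_sum a * b) A" using has_sum_cmult_left[OF f] .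
  have nf: "(\<lambda>x. norm (f x)) summable_on A" and ng: "(\<lambda>x. norm (g x)) summable_on B"
    using has_sum_imp_summable[OF f] has_sum_imp_summable[OF g]
    unfolding summable_on_iff_abs_summable_on_complex .
  obtain a' where a': "((\<lambda>x. norm (f x)) has_sum a') A" using nf by (auto simp: summable_on_def)
  obtain b' where b': "((\<lambda>x. norm (g x)) has_sum b') B" using ng by (auto simp: summable_on_def)
  have "(\<lambda>(x, y). norm (f x) * norm (g y)) summable_on (A \<times> B)"
  proof (rule summable_on_SigmaI[where g = "\<lambda>x. norm (f x) * b'"])
    show "((\<lambda>y. case (x, y) of (x, y) \<Rightarrow> norm (f x) * norm (g y)) has_sum norm (f x) * b') B" for x
      using has_sum_cmult_right[OF b', of "norm (f x)"] by simp
    show "(\<lambda>x. norm (f x) * b') summable_on A"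
      using has_sum_cmult_left[OF a', of b'] by (rule has_sum_imp_summable)
  qed auto
  then show "(\<lambda>(x, y). f x * g y) summable_on (A \<times> B)"
    unfolding summable_on_iff_abs_summable_on_complex by (simp add: case_prod_unfold norm_mult)
qed

lemma has_sum_finite_sum:
  fixes f :: "'i \<Rightarrow> 'k \<Rightarrow> 'b::{topological_comm_monoid_add}"
  assumes "finite J" "\<And>j. j \<in> J \<Longrightarrow> (f j has_sum S j) A"
  shows "((\<lambda>k. \<Sum>j\<in>J. f j k) has_sum (\<Sum>j\<in>J. S j)) A"
  using assms by (induction J rule: finite_induct) (auto intro: has_sum_add)

lemma fps_has_sum_mult:
  assumes "fps_has_sum f A F" "fps_has_sum g B G"
  shows "fps_has_sum (\<lambda>(x, y). f x * g y) (A \<times> B) (F * G)"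
  unfolding fps_has_sum_def
proof
  fix r
  have "((\<lambda>p. \<Sum>i=0..r. (case p of (x, y) \<Rightarrow> fps_nth (f x) i * fps_nth (g y) (r - i))) has_sum
     (\<Sum>i=0..r. fps_nth F i * fps_nth G (r - i))) (A \<times> B)"
    using assms unfolding fps_has_sum_def by (intro has_sum_finite_sum has_sum_mult_complex) auto
  then show "((\<lambda>p. fps_nth (case p of (x, y) \<Rightarrow> f x * g y) r) has_sum fps_nth (F * G) r) (A \<times> B)"
    by (simp add: fps_mult_nth case_prod_unfold)
qed

lemma fps_has_sum_cmult: "fps_has_sum f A F \<Longrightarrow> fps_has_sum (\<lambda>x. C * f x) A (C * F)"
  unfolding fps_has_sum_def fps_mult_nth
  by (intro allI has_sum_finite_sum has_sum_cmult_right) auto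

lemma fps_has_sum_sum:
  "finite J \<Longrightarrow> (\<And>j. j \<in> J \<Longrightarrow> fps_has_sum (f j) A (S j)) \<Longrightarrow>
    fps_has_sum (\<lambda>k. \<Sum>j\<in>J. f j k) A (\<Sum>j\<in>J. S j)"
  unfolding fps_has_sum_def fps_sum_nth by (intro allI has_sum_finite_sum) auto

lemma fps_has_sum_prod:
  assumes "finite I" "\<And>i. i \<in> I \<Longrightarrow> fps_has_sum (f i) (A i) (F i)"
  shows "fps_has_sum (\<lambda>k. \<Prod>i\<in>I. f i (k i)) (PiE I A) (\<Prod>i\<in>I. F i)"
  using assms
proof (induction I rule: finite_induct)
  case empty
  show ?case unfolding fps_has_sum_def by (intro allI has_sum_finiteI) auto
next
  case (insert i I)
  let ?h = "\<lambda>(k, x). k(i := x)"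
  have bij: "bij_betw ?h (PiE I A \<times> A i) (PiE (insert i I) A)"
    unfolding bij_betw_def
  proof
    show "inj_on ?h (PiE I A \<times> A i)"
      using inj_combinator'[OF insert(2), of A] by (simp add: case_prod_unfold)
    show "?h ` (PiE I A \<times> A i) = PiE (insert i I) A"
      unfolding PiE_insert_eq by force
  qed
  have "fps_has_sum (\<lambda>(k, x). (\<Prod>j\<in>I. f j (k j)) * f i x) (PiE I A \<times> A i) ((\<Prod>j\<in>I. F j) * F i)"
    using insert by (intro fps_has_sum_mult) auto
  moreover have "(\<Prod>j\<in>insert i I. f j (?h p j)) = (case p of (k, x) \<Rightarrow> (\<Prod>j\<in>I. f j (k j)) * f i x)" for p
  proof -
    have "(\<Prod>j\<in>I. f j (?h p j)) = (\<Prod>j\<in>I. f j (fst p j))"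
      using insert(2) by (intro prod.cong) (auto simp: case_prod_unfold)
    then show ?thesis unfolding prod.insert[OF insert(1,2)] by (simp add: case_prod_unfold mult.commute)
  qed
  ultimately have "fps_has_sum (\<lambda>p. \<Prod>j\<in>insert i I. f j (?h p j)) (PiE I A \<times> A i) (\<Prod>j\<in>insert i I. F j)"
    unfolding prod.insert[OF insert(1,2), of F] by (simp only: mult.commute)
  then show ?case
    unfolding fps_has_sum_def
    using has_sum_reindex_bij_betw[OF bij, of "\<lambda>k. fps_nth (\<Prod>j\<in>insert i I. f j (k j)) _"] by simp
qed

section \<open>The Kronecker series\<close>

definition geometric_fps :: "'a::field \<Rightarrow> nat \<Rightarrow> 'a fps" where
  "geometric_fps c a = Abs_fps (\<lambda>r. if a dvd r then c ^ (r div a) else 0)"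

lemma geometric_fps_mult: "a \<ge> 1 \<Longrightarrow> geometric_fps c a * (1 - fps_const c * fps_X ^ a) = 1"
proof (rule fps_ext)
  fix r assume a: "a \<ge> 1"
  have "geometric_fps c a * (1 - fps_const c * fps_X ^ a) = geometric_fps c a - fps_const c * (geometric_fps c a * fps_X ^ a)"
    by (simp add: algebra_simps)
  then have "fps_nth (geometric_fps c a * (1 - fps_const c * fps_X ^ a)) r =
     fps_nth (geometric_fps c a) r - (if r < a then 0 else c * fps_nth (geometric_fps c a) (r - a))"
    by (simp add: fps_X_power_mult_right_nth)
  also have "\<dots> = fps_nth (1 :: 'a fps) r"
  proof (cases "r < a")
    case True
    then show ?thesis using a by (cases "r = 0") (auto simp: geometric_fps_def dvd_imp_le leD)
  next
    case False
    then have "(a dvd r - a) = (a dvd r)" "r div a = Suc ((r - a) div a)"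
      using a by (auto simp: dvd_minus_self le_div_geq)
    then show ?thesis using False a by (auto simp: geometric_fps_def)
  qed
  finally show "fps_nth (geometric_fps c a * (1 - fps_const c * fps_X ^ a)) r = fps_nth 1 r" .
qed

text \<open>The expansion in \<open>s\<close> of \<open>s\<^bsup>ek\<^esup> / (1 - z s\<^bsup>Nk\<^esup>)\<close>, diminished by 1 if \<open>neg\<close> and \<open>e = 0\<close>: the
  coefficient of \<open>T\<^sup>k\<close> in the Kronecker series, expanded for \<open>\<bar>T\<bar> < 1\<close> or (if \<open>neg\<close>) for \<open>\<bar>T\<bar> > 1\<close>.\<close>

definition kron_term :: "nat \<Rightarrow> nat \<Rightarrow> complex \<Rightarrow> bool \<Rightarrow> int \<Rightarrow> complex fps" where
  "kron_term N e z neg k =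
     (if k = 0 then fps_const (1 / (1 - z))
      else if k > 0 then fps_X ^ (e * nat k) * geometric_fps z (N * nat k)
      else - fps_const (inverse z) * fps_X ^ ((N - e) * nat (- k)) * geometric_fps (inverse z) (N * nat (- k))) -
     (if neg \<and> e = 0 then 1 else 0)"

text \<open>The numerators decide which lattice point is counted. Subtracting 1 when
  \<open>e = 0\<close> changes \<open>1 / (1 - z s^(N k))\<close> into
  \<open>z s^(N k) / (1 - z s^(N k))\<close>, that is, it moves the i-th coordinate of the point
  from 0 to 1.\<close>

lemma kron_term_fls:
  assumes e: "e < N" and z: "z \<noteq> 0" "z \<noteq> 1"
  shows "fps_to_fls (kron_term N e z neg k) * (1 - fls_monom z (int N * k)) =
    (if neg \<and> e = 0 then fls_monom z (int N * k) else fls_monom 1 (int e * k))"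
proof -
  define b where "b = (if neg \<and> e = 0 then 1 else (0 :: complex fls))"
  define h where "h = (if k = 0 then fps_const (1 / (1 - z))
      else if k > 0 then fps_X ^ (e * nat k) * geometric_fps z (N * nat k)
      else - fps_const (inverse z) * fps_X ^ ((N - e) * nat (- k)) * geometric_fps (inverse z) (N * nat (- k)))"
  have X: "fps_to_fls (fps_const c * fps_X ^ a) = fls_monom c (int a)" for c :: complex and a
    by (rule fls_eqI) (auto simp: fls_monom_def split: if_splits)
  have geometric_fps: "fps_to_fls (geometric_fps c a) * (1 - fls_monom c (int a)) = 1" if "a \<ge> 1" for c :: complex and a
  proof -
    have "fps_to_fls (geometric_fps c a * (1 - fps_const c * fps_X ^ a)) = fps_to_fls 1" unfolding geometric_fps_mult[OF that] ..
    then show ?thesis by (simp only: X[symmetric] fls_times_fps_to_fls fps_to_fls_minus fps_one_to_fls)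
  qed
  have main: "fps_to_fls h * (1 - fls_monom z (int N * k)) = fls_monom 1 (int e * k)"
  proof -
    consider "k = 0" | "k > 0" | "k < 0" by linarith
    then show ?thesis
    proof cases
      case 1
      have "fps_to_fls (fps_const (1 / (1 - z))) = fls_monom (1 / (1 - z)) 0"
        using X[of "1 / (1 - z)" 0] by simp
      moreover have "1 - fls_monom z 0 = fls_monom (1 - z) 0"
        unfolding fls_monom_1[symmetric] by (rule fls_eqI) simp
      ultimately have "fps_to_fls (fps_const (1 / (1 - z))) * (1 - fls_monom z 0) = fls_monom 1 0"
        using z by (simp add: fls_monom_mult)
      then show ?thesis using 1 by (simp add: h_def)
    next
      case 2
      have ek: "int (e * nat k) = int e * k" and Nk: "int (N * nat k) = int N * k" and pos: "N * nat k \<ge> 1"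
        using 2 e by auto
      have "fps_to_fls h = fls_monom 1 (int e * k) * fps_to_fls (geometric_fps z (N * nat k))"
        using 2 X[of 1 "e * nat k"] ek by (simp add: h_def fls_times_fps_to_fls)
      then show ?thesis using geometric_fps[OF pos, of z] unfolding Nk by (simp only: mult.assoc mult_1_right)
    next
      case 3
      \<comment> \<open>For negative \<open>k\<close> the fraction is rewritten by extracting
        \<open>- z s^(N k)\<close> from its denominator, so that only nonnegative powers of
        \<open>s\<close> occur: \<open>e k - N k = (N - e) (- k)\<close>.\<close>
      have Nk: "int (N * nat (- k)) = - (int N * k)" and pos: "N * nat (- k) \<ge> 1"
        and ek: "int ((N - e) * nat (- k)) = int e * k - int N * k"
        using 3 e by (auto simp: of_nat_diff algebra_simps)
      have "fps_to_fls h = - (fls_monom (inverse z) (int e * k - int N * k) * fps_to_fls (geometric_fps (inverse z) (N * nat (- k))))"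
        using 3 X[of "inverse z" "(N - e) * nat (- k)"] ek by (simp add: h_def fls_times_fps_to_fls flip: mult.assoc)
      moreover have "1 - fls_monom z (int N * k) = - (fls_monom z (int N * k) * (1 - fls_monom (inverse z) (- (int N * k))))"
        using z by (simp add: right_diff_distrib fls_monom_mult fls_monom_1)
      ultimately have "fps_to_fls h * (1 - fls_monom z (int N * k)) =
          (fls_monom (inverse z) (int e * k - int N * k) * fls_monom z (int N * k)) *
          (fps_to_fls (geometric_fps (inverse z) (N * nat (- k))) * (1 - fls_monom (inverse z) (- (int N * k))))"
        by (simp add: mult_ac)
      also have "\<dots> = fls_monom 1 (int e * k)"
        using geometric_fps[OF pos, of "inverse z"] Nk z by (simp add: fls_monom_mult)
      finally show ?thesis .
    qed
  qed
  have "fps_to_fls (kron_term N e z neg k) = fps_to_fls h - b"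
    by (simp add: kron_term_def h_def b_def)
  then show ?thesis using main by (auto simp: b_def left_diff_distrib fls_monom_1)
qed

text \<open>The geometric series is read off in the shape of \<open>kronecker_coeff\<close>. On the
  positive side the sum starts at \<open>l = 0\<close>, which accounts for the single sum there; on
  the negative side the exponent \<open>N - e\<close> shifts the start to
  \<open>l = 1\<close>.\<close>

lemma kron_term_nth:
  assumes e: "e < N" and m: "m \<ge> 1"
  shows "fps_nth (kron_term N e z neg (int m)) r =
      (\<Sum>l=0..r. if m * (N * l + e) = r then z ^ l else 0) - (if r = 0 \<and> neg \<and> e = 0 then 1 else 0)"
    "fps_nth (kron_term N e z neg (- int m)) r =
      - (\<Sum>l=1..r. if m * (N * l - e) = r then inverse z ^ l else 0) - (if r = 0 \<and> neg \<and> e = 0 then 1 else 0)"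
proof -
  have N: "N \<ge> 1" using e by simp
  have eqN: "N * m * l = N * m * l' \<longleftrightarrow> l = l'" for l l' using N m by simp
  have "(if r < e * m then 0 else fps_nth (geometric_fps z (N * m)) (r - e * m)) =
      (\<Sum>l=0..r. if m * (N * l + e) = r then z ^ l else 0)"
  proof (cases "\<exists>l. m * (N * l + e) = r")
    case True
    then obtain l where l: "r = N * m * l + e * m" by (auto simp: algebra_simps)
    have "l \<le> N * m * l" using N m by simp
    then have lr: "l \<le> r" using l by linarith
    have "(\<Sum>l'=0..r. if m * (N * l' + e) = r then z ^ l' else 0) = (\<Sum>l'=0..r. if l' = l then z ^ l' else 0)"
    proof (rule sum.cong[OF refl])
      fix l'
      have "m * (N * l' + e) = N * m * l' + e * m" by (simp add: algebra_simps)
      then have "m * (N * l' + e) = r \<longleftrightarrow> l' = l" unfolding l using eqN by simp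
      then show "(if m * (N * l' + e) = r then z ^ l' else 0) = (if l' = l then z ^ l' else 0)" by simp
    qed
    also have "\<dots> = z ^ l" using lr by simp
    finally show ?thesis using l N m by (simp add: geometric_fps_def)
  next
    case False
    have "\<not> N * m dvd r - e * m" if "\<not> r < e * m"
    proof
      assume "N * m dvd r - e * m"
      then obtain l where "r - e * m = N * m * l" by (auto elim: dvdE)
      then have "m * (N * l + e) = r" using that by (simp add: algebra_simps)
      then show False using False by auto
    qed
    then show ?thesis using False by (auto simp: geometric_fps_def)
  qed
  then show "fps_nth (kron_term N e z neg (int m)) r =
      (\<Sum>l=0..r. if m * (N * l + e) = r then z ^ l else 0) - (if r = 0 \<and> neg \<and> e = 0 then 1 else 0)"
    using m by (auto simp: kron_term_def fps_X_power_mult_nth)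
  have sub: "m * (N * Suc l - e) = N * m * l + (N - e) * m" for l
  proof -
    have "N * Suc l - e = N * l + (N - e)" using e by simp
    then show ?thesis by (simp add: algebra_simps)
  qed
  have "(if r < (N - e) * m then 0 else inverse z * fps_nth (geometric_fps (inverse z) (N * m)) (r - (N - e) * m)) =
      (\<Sum>l=1..r. if m * (N * l - e) = r then inverse z ^ l else 0)"
  proof (cases "\<exists>l. N * m * l + (N - e) * m = r")
    case True
    then obtain l where l: "r = N * m * l + (N - e) * m" by auto
    have "l \<le> N * m * l" "1 \<le> (N - e) * m" using N m e by simp_all
    then have lr: "Suc l \<le> r" using l by linarith
    have "(\<Sum>l'=1..r. if m * (N * l' - e) = r then inverse z ^ l' else 0) =
        (\<Sum>l'=1..r. if l' = Suc l then inverse z ^ l' else 0)"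
    proof (rule sum.cong[OF refl])
      fix l' assume "l' \<in> {1..r}"
      then obtain l'' where l'': "l' = Suc l''" by (cases l') auto
      have "m * (N * l' - e) = r \<longleftrightarrow> l' = Suc l" unfolding l l'' sub using eqN by simp
      then show "(if m * (N * l' - e) = r then inverse z ^ l' else 0) = (if l' = Suc l then inverse z ^ l' else 0)" by simp
    qed
    also have "\<dots> = inverse z ^ Suc l" using lr by simp
    finally show ?thesis using l N m by (simp add: geometric_fps_def)
  next
    case False
    have "\<not> N * m dvd r - (N - e) * m" if "\<not> r < (N - e) * m"
    proof
      assume "N * m dvd r - (N - e) * m"
      then obtain l where "r - (N - e) * m = N * m * l" by (auto elim: dvdE)
      then have "N * m * l + (N - e) * m = r" using that by simp
      then show False using False by auto
    qed
    moreover have "(\<Sum>l=1..r. if m * (N * l - e) = r then inverse z ^ l else 0) = 0"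
    proof (rule sum.neutral, rule ballI)
      fix l' assume "l' \<in> {1..r}"
      then obtain l'' where l'': "l' = Suc l''" by (cases l') auto
      show "(if m * (N * l' - e) = r then inverse z ^ l' else 0) = 0"
        unfolding l'' sub using False by auto
    qed
    ultimately show ?thesis by (auto simp: geometric_fps_def)
  qed
  then show "fps_nth (kron_term N e z neg (- int m)) r =
      - (\<Sum>l=1..r. if m * (N * l - e) = r then inverse z ^ l else 0) - (if r = 0 \<and> neg \<and> e = 0 then 1 else 0)"
    using m by (auto simp: kron_term_def fps_X_power_mult_nth mult.assoc)
qed

lemma has_sum_int_split:
  fixes f :: "int \<Rightarrow> complex"
  assumes "((\<lambda>n. f (int (Suc n))) has_sum a) UNIV" "((\<lambda>n. f (- int (Suc n))) has_sum b) UNIV"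
  shows "(f has_sum (f 0 + a + b)) UNIV"
proof -
  have p: "bij_betw (\<lambda>n. int (Suc n)) UNIV {1..}"
    by (rule bij_betwI[of _ _ _ "\<lambda>k. nat k - 1"]) auto
  have n: "bij_betw (\<lambda>n. - int (Suc n)) UNIV {..-1}"
    by (rule bij_betwI[of _ _ _ "\<lambda>k. nat (- k) - 1"]) auto
  have "(f has_sum a) {1..}" by (rule iffD1[OF has_sum_reindex_bij_betw[OF p] assms(1)])
  moreover have "(f has_sum b) {..-1}" by (rule iffD1[OF has_sum_reindex_bij_betw[OF n] assms(2)])
  ultimately have h1: "(f has_sum (a + b)) ({1..} \<union> {..-1})" by (rule has_sum_Un_disjoint) auto
  have h0: "(f has_sum (f 0)) {0}" by (rule has_sum_finiteI) auto
  have "(f has_sum (f 0 + (a + b))) ({0} \<union> ({1..} \<union> {..-1}))" by (rule has_sum_Un_disjoint[OF h0 h1]) auto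
  moreover have "{0} \<union> ({1..} \<union> {..-1}) = (UNIV :: int set)" by auto
  ultimately show ?thesis by (simp add: add.assoc)
qed

lemma has_sum_geometric_Suc:
  fixes c :: complex
  assumes "norm c < 1" shows "((\<lambda>n. c ^ Suc n) has_sum (c / (1 - c))) UNIV"
proof (rule norm_summable_imp_has_sum)
  have "summable (\<lambda>n. norm c * norm c ^ n)" using assms by (intro summable_mult summable_geometric) auto
  then show "summable (\<lambda>n. norm (c ^ Suc n))" by (simp add: norm_mult norm_power)
  show "(\<lambda>n. c ^ Suc n) sums (c / (1 - c))"
    using sums_mult[OF geometric_sums[OF assms], of c] by simp
qed

text \<open>For \<open>r > 0\<close> only indices with \<open>|k| \<le> r\<close> contribute. For
  \<open>r = 0\<close> and \<open>e = 0\<close> one geometric series remains: over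
  \<open>k > 0\<close> in powers of \<open>T\<close>, or, once 1 has been subtracted everywhere,
  over \<open>k \<le> 0\<close> in powers of \<open>1 / T\<close> with a minus sign. Both represent
  \<open>T / (1 - T)\<close>.\<close>

lemma kron_term_has_sum:
  assumes e: "e < N" and T0: "T \<noteq> 0"
    and T: "if neg then norm T > 1 else norm T < 1"
  shows "fps_has_sum (\<lambda>k. fps_const (T powi k) * kron_term N e z neg k) UNIV (Abs_fps (kronecker_coeff N e z T))"
  unfolding fps_has_sum_def
proof
  fix r
  let ?f = "\<lambda>k. T powi k * fps_nth (kron_term N e z neg k) r"
  have fS: "?f (int (Suc n)) = T ^ Suc n * ((\<Sum>l=0..r. if Suc n * (N * l + e) = r then z ^ l else 0) -
       (if r = 0 \<and> neg \<and> e = 0 then 1 else 0))" for n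
    using kron_term_nth(1)[OF e, of "Suc n" z neg r] by (simp del: of_nat_Suc mult_Suc power_Suc)
  have fN: "?f (- int (Suc n)) = inverse T ^ Suc n * (- (\<Sum>l=1..r. if Suc n * (N * l - e) = r then inverse z ^ l else 0) -
       (if r = 0 \<and> neg \<and> e = 0 then 1 else 0))" for n
    using kron_term_nth(2)[OF e, of "Suc n" z neg r]
    by (simp add: power_int_minus power_inverse del: of_nat_Suc mult_Suc power_Suc)
  have f0: "?f 0 = (if r = 0 then 1 / (1 - z) - (if neg \<and> e = 0 then 1 else 0) else 0)"
    by (simp add: kron_term_def)
  have "(?f has_sum kronecker_coeff N e z T r) UNIV"
  proof (cases "r = 0")
    case True
    have K: "kronecker_coeff N e z T r = 1 / (1 - z) + (if e = 0 then T / (1 - T) else 0)"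
      using True by (simp add: kronecker_coeff_def)
    have fS0: "?f (int (Suc n)) = (if e = 0 \<and> \<not> neg then T ^ Suc n else 0)" for n
      unfolding fS using True by auto
    have fN0: "?f (- int (Suc n)) = (if e = 0 \<and> neg then - (inverse T ^ Suc n) else 0)" for n
      unfolding fN using True by auto
    show ?thesis
    proof (cases "e = 0")
      case False
      have "(?f has_sum (?f 0 + 0 + 0)) UNIV"
        by (rule has_sum_int_split) (simp_all only: fS0 fN0 False simp_thms if_False has_sum_0)
      then show ?thesis unfolding K f0 using False True by simp
    next
      case e0: True
      show ?thesis
      proof (cases neg)
        case False
        have a: "?f (int (Suc n)) = T ^ Suc n" for n unfolding fS0 using e0 False by simp
        have b: "?f (- int (Suc n)) = 0" for n unfolding fN0 using e0 False by simp
        have "norm T < 1" using T False by simp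
        then have "(?f has_sum (?f 0 + T / (1 - T) + 0)) UNIV"
          by (intro has_sum_int_split; unfold a b) (auto intro: has_sum_geometric_Suc simp del: power_Suc)
        then show ?thesis unfolding K f0 using e0 True False by simp
      next
        case n: True
        have T1: "norm T > 1" using T n by simp
        have "norm (inverse T) < 1" using T1 by (simp add: norm_inverse inverse_less_1_iff)
        then have g: "((\<lambda>n. - (inverse T ^ Suc n)) has_sum (- (inverse T / (1 - inverse T)))) UNIV"
          unfolding has_sum_uminus minus_minus by (rule has_sum_geometric_Suc)
        have a: "?f (int (Suc n)) = 0" for n unfolding fS0 using e0 n by simp
        have b: "?f (- int (Suc n)) = - (inverse T ^ Suc n)" for n unfolding fN0 using e0 \<open>neg\<close> by simp
        have "(?f has_sum (?f 0 + 0 + - (inverse T / (1 - inverse T)))) UNIV"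
          by (intro has_sum_int_split; unfold a b) (rule has_sum_0 g, simp?)+
        \<comment> \<open>The 1 subtracted at \<open>k = 0\<close> is the first term of the series:
          \<open>- 1 - 1/T - 1/T^2 - ... = T / (1 - T)\<close> for \<open>|T| > 1\<close>.\<close>
        moreover have "?f 0 + 0 + - (inverse T / (1 - inverse T)) = 1 / (1 - z) + T / (1 - T)"
        proof -
          have "T \<noteq> 1" "1 - T \<noteq> 0" "T - 1 \<noteq> 0" using T1 by auto
          then have "- 1 - inverse T / (1 - inverse T) = T / (1 - T)"
            using T0 by (simp add: divide_simps) (simp add: algebra_simps)
          moreover have "a - 1 + 0 + - b = a + c" if "- 1 - b = c" for a b c :: complex
            unfolding that[symmetric] by simp
          ultimately have "1 / (1 - z) - 1 + 0 + - (inverse T / (1 - inverse T)) = 1 / (1 - z) + T / (1 - T)" by blast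
          then show ?thesis unfolding f0 using True n e0 by simp
        qed
        ultimately show ?thesis unfolding K using e0 by simp
      qed
    qed
  next
    case r: False
    have zero1: "(\<Sum>l=0..r. if Suc n * (N * l + e) = r then z ^ l else 0) = 0" if "n \<ge> r" for n
    proof (rule sum.neutral, rule ballI)
      fix l
      have "Suc n * (N * l + e) \<noteq> r"
      proof
        assume eq: "Suc n * (N * l + e) = r"
        then have "N * l + e \<noteq> 0" using r by auto
        then have "Suc n * 1 \<le> Suc n * (N * l + e)" by (intro mult_le_mono2) (simp only: One_nat_def Suc_le_eq neq0_conv)
        then show False using eq that by simp
      qed
      then show "(if Suc n * (N * l + e) = r then z ^ l else 0) = 0" by simp
    qed
    have zero2: "(\<Sum>l=1..r. if Suc n * (N * l - e) = r then inverse z ^ l else 0) = 0" if "n \<ge> r" for n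
    proof (rule sum.neutral, rule ballI)
      fix l
      have "Suc n * (N * l - e) \<noteq> r"
      proof
        assume eq: "Suc n * (N * l - e) = r"
        then have "N * l - e \<noteq> 0" using r by auto
        then have "Suc n * 1 \<le> Suc n * (N * l - e)" by (intro mult_le_mono2) (simp only: One_nat_def Suc_le_eq neq0_conv)
        then show False using eq that by simp
      qed
      then show "(if Suc n * (N * l - e) = r then inverse z ^ l else 0) = 0" by simp
    qed
    have h1: "((\<lambda>n. ?f (int (Suc n))) has_sum (\<Sum>n<r. ?f (int (Suc n)))) UNIV"
      by (rule has_sum_finite_neutralI[of "{..<r}"]) (use r in \<open>auto simp only: fS zero1 Diff_iff lessThan_iff not_less\<close>, auto)
    have h2: "((\<lambda>n. ?f (- int (Suc n))) has_sum (\<Sum>n<r. ?f (- int (Suc n)))) UNIV"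
      by (rule has_sum_finite_neutralI[of "{..<r}"]) (use r in \<open>auto simp only: fN zero2 Diff_iff lessThan_iff not_less\<close>, auto)
    have re: "(\<Sum>n<r. g (Suc n)) = (\<Sum>k=1..r. g k)" for g :: "nat \<Rightarrow> complex"
      unfolding One_nat_def sum.atLeast1_atMost_eq ..
    have s1: "(\<Sum>n<r. ?f (int (Suc n))) = (\<Sum>k=1..r. T ^ k * (\<Sum>l=0..r. if k * (N * l + e) = r then z ^ l else 0))"
      unfolding fS using r re[of "\<lambda>k. T ^ k * (\<Sum>l=0..r. if k * (N * l + e) = r then z ^ l else 0)"] by simp
    have s2: "(\<Sum>n<r. ?f (- int (Suc n))) = - (\<Sum>k=1..r. inverse T ^ k * (\<Sum>l=1..r. if k * (N * l - e) = r then inverse z ^ l else 0))"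
      unfolding fN using r re[of "\<lambda>k. inverse T ^ k * (\<Sum>l=1..r. if k * (N * l - e) = r then inverse z ^ l else 0)"]
      by (simp add: sum_negf)
    have l0: "(\<Sum>l=0..r. g l) = g 0 + (\<Sum>l=1..r. g l)" for g :: "nat \<Rightarrow> complex"
      by (simp add: sum.atLeast_Suc_atMost)
    have t1: "(\<Sum>k=1..r. T ^ k * (\<Sum>l=0..r. if k * (N * l + e) = r then z ^ l else 0)) =
        (if e = 0 then 0 else \<Sum>k=1..r. if k * e = r then T ^ k else 0) +
        (\<Sum>l=1..r. \<Sum>k=1..r. if k * (N * l + e) = r then z ^ l * T ^ k else 0)"
    proof -
      have "(\<Sum>k=1..r. T ^ k * (\<Sum>l=0..r. if k * (N * l + e) = r then z ^ l else 0)) =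
        (\<Sum>k=1..r. if k * e = r then T ^ k else 0) +
        (\<Sum>k=1..r. \<Sum>l=1..r. if k * (N * l + e) = r then z ^ l * T ^ k else 0)"
        unfolding l0 sum.distrib[symmetric] by (rule sum.cong) (auto simp: distrib_left sum_distrib_left mult.commute intro!: sum.cong)
      also have "(\<Sum>k=1..r. \<Sum>l=1..r. if k * (N * l + e) = r then z ^ l * T ^ k else 0) =
        (\<Sum>l=1..r. \<Sum>k=1..r. if k * (N * l + e) = r then z ^ l * T ^ k else 0)" by (rule sum.swap)
      also have "(\<Sum>k=1..r. if k * e = r then T ^ k else 0) = (if e = 0 then 0 else \<Sum>k=1..r. if k * e = r then T ^ k else 0)"
        using r by simp
      finally show ?thesis .
    qed
    have t2: "(\<Sum>k=1..r. inverse T ^ k * (\<Sum>l=1..r. if k * (N * l - e) = r then inverse z ^ l else 0)) =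
        (\<Sum>l=1..r. \<Sum>k=1..r. if k * (N * l - e) = r then inverse z ^ l * inverse T ^ k else 0)"
      unfolding sum_distrib_left by (subst sum.swap) (auto intro!: sum.cong simp: mult.commute)
    have "(?f has_sum (?f 0 + (\<Sum>n<r. ?f (int (Suc n))) + (\<Sum>n<r. ?f (- int (Suc n))))) UNIV"
      by (rule has_sum_int_split[OF h1 h2])
    moreover have "?f 0 + (\<Sum>n<r. ?f (int (Suc n))) + (\<Sum>n<r. ?f (- int (Suc n))) = kronecker_coeff N e z T r"
      unfolding f0 s1 s2 t1 t2 kronecker_coeff_def sum_subtractf using r by simp
    ultimately show ?thesis by simp
  qed
  then show "((\<lambda>k. fps_nth (fps_const (T powi k) * kron_term N e z neg k) r) has_sum
      fps_nth (Abs_fps (kronecker_coeff N e z T)) r) UNIV" by simp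
qed

section \<open>Local contributions as sums over the dual lattice\<close>

lemma zeta_pow_add: "zeta_pow \<sigma> (a + b) = zeta_pow \<sigma> a * zeta_pow \<sigma> b"
  by (simp add: zeta_pow_def algebra_simps flip: exp_add)

lemma zeta_pow_0 [simp]: "zeta_pow \<sigma> 0 = 1"
  by (simp add: zeta_pow_def)

lemma zeta_pow_nonzero [simp]: "zeta_pow \<sigma> a \<noteq> 0"
  by (simp add: zeta_pow_def)

lemma zeta_pow_sum: "finite A \<Longrightarrow> zeta_pow \<sigma> (\<Sum>i\<in>A. f i) = (\<Prod>i\<in>A. zeta_pow \<sigma> (f i))"
  by (induction A rule: finite_induct) (simp_all add: zeta_pow_add)

lemma fls_monom_prod: "finite A \<Longrightarrow> (\<Prod>i\<in>A. fls_monom (c i) (n i)) = fls_monom (\<Prod>i\<in>A. c i) (\<Sum>i\<in>A. n i)"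
  by (induction A rule: finite_induct) (simp_all add: fls_monom_1 fls_monom_mult)

lemma fps_to_fls_prod: "fps_to_fls (\<Prod>i\<in>A. f i) = (\<Prod>i\<in>A. fps_to_fls (f i :: 'a::comm_ring_1 fps))"
  by (induction A rule: infinite_finite_induct) (simp_all add: fls_times_fps_to_fls)

lemma fps_to_fls_sum: "fps_to_fls (\<Sum>i\<in>A. f i) = (\<Sum>i\<in>A. fps_to_fls (f i :: 'a::comm_ring_1 fps))"
  by (induction A rule: infinite_finite_induct) simp_all

lemma cis_sum_roots: "x \<in> \<int> \<Longrightarrow> cis (2 * pi * x) = 1"
  by (auto elim!: Ints_cases simp: cis_multiple_2pi)

context lattice_cone
begin

text \<open>The representatives in \<open>[0,1)\<close> of \<open>G_group\<close>: coordinates of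
  the lattice points in the fundamental parallelepiped, one for each class in
  \<open>H_I\<close>.\<close>

definition G :: "('i \<Rightarrow> real) set" where
  "G = {g. (\<forall>i. 0 \<le> g i \<and> g i < 1) \<and> (\<forall>i. i \<notin> I \<longrightarrow> g i = 0) \<and> (\<Sum>i\<in>I. g i *\<^sub>R v i) \<in> L}"

text \<open>The dual lattice \<open>L^*\<close>. It depends on \<open>L\<close> alone, so that sums
  belonging to different simplices run over the same index set and can be compared termwise.\<close>

definition dual :: "('v \<Rightarrow> real) set" where
  "dual = {m. linear m \<and> (\<forall>x\<in>L. m x \<in> \<int>)}"

lemma finite_G: "finite G"
proof (rule finite_imageD)
  let ?f = "\<lambda>g. \<Sum>i\<in>I. g i *\<^sub>R v i"
  show "finite (?f ` G)"
    by (rule finite_subset[OF _ finite_bounded[of 1]]) (auto simp: G_def co_comb intro: less_imp_le)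
  show "inj_on ?f G"
  proof (rule inj_onI, rule ext)
    fix g h i assume g: "g \<in> G" and h: "h \<in> G" and eq: "?f g = ?f h"
    show "g i = h i"
    proof (cases "i \<in> I")
      case True
      then show ?thesis using co_comb[OF True, of g] co_comb[OF True, of h] eq by simp
    qed (use g h in \<open>simp add: G_def\<close>)
  qed
qed

lemma zero_in_G: "(\<lambda>_. 0) \<in> G"
  by (simp add: G_def L0)

lemma card_G: "card G > 0"
  using finite_G zero_in_G by (auto simp: card_gt_0_iff)

lemma G_frac:
  assumes "x \<in> L"
  shows "(\<lambda>i. if i \<in> I then frac (co i x) else 0) \<in> G"
proof -
  have "(\<Sum>i\<in>I. frac (co i x) *\<^sub>R v i) = (\<Sum>i\<in>I. co i x *\<^sub>R v i) - (\<Sum>i\<in>I. of_int \<lfloor>co i x\<rfloor> *\<^sub>R v i)"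
    unfolding sum_subtractf[symmetric] by (rule sum.cong) (auto simp: frac_def scaleR_diff_left)
  also have "\<dots> \<in> L"
    unfolding co_expand by (intro Ldiff assms Lsum Lscale_int vL)
  finally show ?thesis by (simp add: G_def frac_lt_1)
qed

lemma G_N: "g \<in> G \<Longrightarrow> i \<in> I \<Longrightarrow> real N * g i \<in> \<int>"
  using Nco[of "\<Sum>i\<in>I. g i *\<^sub>R v i" i] by (simp add: G_def co_comb)

lemma dual_basis_int: "m \<in> dual \<Longrightarrow> i \<in> I \<Longrightarrow> real_of_int \<lfloor>m (v i)\<rfloor> = m (v i)"
  using vL by (simp add: dual_def)

lemma dual_expand: "m \<in> dual \<Longrightarrow> m x = (\<Sum>i\<in>I. co i x * m (v i))"
proof -
  assume "m \<in> dual"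
  then have lin: "linear m" by (simp add: dual_def)
  have "m x = m (\<Sum>i\<in>I. co i x *\<^sub>R v i)" by (simp add: co_expand)
  also have "\<dots> = (\<Sum>i\<in>I. co i x * m (v i))" using lin by (simp add: linear_sum linear_cmul)
  finally show ?thesis .
qed

definition dual_coords :: "('i \<Rightarrow> int) set" where
  "dual_coords = {k \<in> PiE I (\<lambda>_. UNIV). \<forall>g\<in>G. (\<Sum>i\<in>I. of_int (k i) * g i) \<in> \<int>}"

text \<open>\<open>L\<close> is generated by the \<open>v i\<close> and the points given by
  \<open>G\<close>, so integral values on both make a functional integral on \<open>L\<close>. The
  inverse map sends \<open>k\<close> to the combination of the dual basis with coefficients
  \<open>k i\<close>.\<close>

lemma bij_dual: "bij_betw (\<lambda>m. restrict (\<lambda>i. \<lfloor>m (v i)\<rfloor>) I) dual dual_coords"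
proof (rule bij_betwI[where g = "\<lambda>k x. \<Sum>i\<in>I. of_int (k i) * co i x"])
  show "(\<lambda>m. restrict (\<lambda>i. \<lfloor>m (v i)\<rfloor>) I) \<in> dual \<rightarrow> dual_coords"
  proof
    fix m assume m: "m \<in> dual"
    have "(\<Sum>i\<in>I. of_int (restrict (\<lambda>i. \<lfloor>m (v i)\<rfloor>) I i) * g i) \<in> \<int>" if g: "g \<in> G" for g
    proof -
      have "(\<Sum>i\<in>I. of_int (restrict (\<lambda>i. \<lfloor>m (v i)\<rfloor>) I i) * g i) =
          (\<Sum>i\<in>I. co i (\<Sum>j\<in>I. g j *\<^sub>R v j) * m (v i))"
        by (rule sum.cong) (simp_all add: dual_basis_int[OF m] co_comb)
      also have "\<dots> = m (\<Sum>j\<in>I. g j *\<^sub>R v j)" using dual_expand[OF m] by (rule sym)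
      also have "\<dots> \<in> \<int>" using m g by (simp add: dual_def G_def)
      finally show ?thesis .
    qed
    then show "restrict (\<lambda>i. \<lfloor>m (v i)\<rfloor>) I \<in> dual_coords" by (simp add: dual_coords_def)
  qed
  show "(\<lambda>k x. \<Sum>i\<in>I. of_int (k i) * co i x) \<in> dual_coords \<rightarrow> dual"
  proof
    fix k assume k: "k \<in> dual_coords"
    have "(\<Sum>i\<in>I. of_int (k i) * co i x) \<in> \<int>" if x: "x \<in> L" for x
    proof -
      have "(\<Sum>i\<in>I. of_int (k i) * co i x) = (\<Sum>i\<in>I. of_int (k i) * (if i \<in> I then frac (co i x) else 0)) +
          (\<Sum>i\<in>I. of_int (k i) * of_int \<lfloor>co i x\<rfloor>)"
        unfolding sum.distrib[symmetric] by (rule sum.cong) (simp_all add: frac_def algebra_simps)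
      also have "\<dots> \<in> \<int>"
      proof (rule Ints_add)
        have "\<forall>g\<in>G. (\<Sum>i\<in>I. of_int (k i) * g i) \<in> \<int>" using k by (simp add: dual_coords_def)
        from bspec[OF this G_frac[OF x]]
        show "(\<Sum>i\<in>I. of_int (k i) * (if i \<in> I then frac (co i x) else 0)) \<in> \<int>" .
        show "(\<Sum>i\<in>I. of_int (k i) * of_int \<lfloor>co i x\<rfloor>) \<in> (\<int> :: real set)"
          by (intro Ints_sum) auto
      qed
      finally show ?thesis .
    qed
    moreover have "linear (\<lambda>x. \<Sum>i\<in>I. of_int (k i) * co i x)"
      by (rule linearI) (simp_all add: co_add co_scale sum.distrib sum_distrib_left algebra_simps)
    ultimately show "(\<lambda>x. \<Sum>i\<in>I. of_int (k i) * co i x) \<in> dual" by (simp add: dual_def)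
  qed
  show "(\<lambda>x. \<Sum>i\<in>I. of_int (restrict (\<lambda>i. \<lfloor>m (v i)\<rfloor>) I i) * co i x) = m" if m: "m \<in> dual" for m
    by (rule ext, subst dual_expand[OF m], rule sum.cong) (simp_all add: dual_basis_int[OF m])
  show "restrict (\<lambda>i. \<lfloor>\<Sum>j\<in>I. of_int (k j) * co j (v i)\<rfloor>) I = k" if k: "k \<in> dual_coords" for k
  proof
    fix i
    show "restrict (\<lambda>i. \<lfloor>\<Sum>j\<in>I. of_int (k j) * co j (v i)\<rfloor>) I i = k i"
    proof (cases "i \<in> I")
      case True
      have "(\<Sum>j\<in>I. of_int (k j) * co j (v i)) = (\<Sum>j\<in>I. if j = i then of_int (k j) else 0)"
        using True by (intro sum.cong) (simp_all add: co_basis)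
      also have "\<dots> = real_of_int (k i)" using True fin by simp
      finally show ?thesis using True by simp
    next
      case False
      then show ?thesis using k by (auto simp: dual_coords_def PiE_def extensional_def)
    qed
  qed
qed

text \<open>If some \<open>h\<close> pairs nonintegrally with \<open>k\<close>, translation by
  \<open>h\<close> permutes \<open>G\<close> and multiplies the sum by a number different from
  1.\<close>

lemma character_sum:
  fixes k :: "'i \<Rightarrow> int"
  shows "(\<Sum>g\<in>G. cis (- 2 * pi * (\<Sum>i\<in>I. of_int (k i) * g i))) =
    (if \<forall>g\<in>G. (\<Sum>i\<in>I. of_int (k i) * g i) \<in> \<int> then of_nat (card G) else 0)"
proof (cases "\<forall>g\<in>G. (\<Sum>i\<in>I. of_int (k i) * g i) \<in> \<int>")
  case True
  have "cis (- 2 * pi * (\<Sum>i\<in>I. of_int (k i) * g i)) = 1" if "g \<in> G" for g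
    using cis_sum_roots[of "- (\<Sum>i\<in>I. of_int (k i) * g i)"] True that by simp
  then show ?thesis using True by simp
next
  case False
  define p where "p = (\<lambda>g. \<Sum>i\<in>I. of_int (k i) * (g i :: real))"
  obtain h where h: "h \<in> G" "p h \<notin> \<int>" using False by (auto simp: p_def)
  \<comment> \<open>Addition of \<open>h\<close> in the group, that is modulo 1 in every coordinate,
    since \<open>G\<close> consists of reduced representatives.\<close>
  define s where "s = (\<lambda>g i. frac (g i + h i :: real))"
  have sG: "s g \<in> G" if g: "g \<in> G" for g
  proof -
    have "(\<Sum>i\<in>I. s g i *\<^sub>R v i) = (\<Sum>i\<in>I. g i *\<^sub>R v i) + (\<Sum>i\<in>I. h i *\<^sub>R v i) - (\<Sum>i\<in>I. of_int \<lfloor>g i + h i\<rfloor> *\<^sub>R v i)"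
      unfolding sum.distrib[symmetric] sum_subtractf[symmetric]
      by (rule sum.cong) (simp_all add: s_def frac_def algebra_simps)
    also have "\<dots> \<in> L"
    proof (rule Ldiff[OF Ladd])
      show "(\<Sum>i\<in>I. g i *\<^sub>R v i) \<in> L" "(\<Sum>i\<in>I. h i *\<^sub>R v i) \<in> L" using g h(1) by (simp_all add: G_def)
      show "(\<Sum>i\<in>I. of_int \<lfloor>g i + h i\<rfloor> *\<^sub>R v i) \<in> L" by (intro Lsum Lscale_int vL)
    qed
    finally show ?thesis using g h(1) by (simp add: G_def s_def frac_lt_1)
  qed
  have "inj_on s G"
  proof (rule inj_onI, rule ext)
    fix g g' i assume g: "g \<in> G" "g' \<in> G" and eq: "s g = s g'"
    have e: "frac (g i + h i) = frac (g' i + h i)" using fun_cong[OF eq, of i] by (simp add: s_def)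
    have "g i - g' i = of_int (\<lfloor>g i + h i\<rfloor> - \<lfloor>g' i + h i\<rfloor>)" using e by (simp add: frac_def)
    moreover have "\<bar>g i - g' i\<bar> < 1" using g by (auto simp: G_def abs_less_iff) (smt (verit))+
    ultimately have "\<lfloor>g i + h i\<rfloor> - \<lfloor>g' i + h i\<rfloor> = 0" by linarith
    then show "g i = g' i" using \<open>g i - g' i = of_int (\<lfloor>g i + h i\<rfloor> - \<lfloor>g' i + h i\<rfloor>)\<close> by simp
  qed
  then have "s ` G = G" using sG finite_G by (intro endo_inj_surj) auto
  have ps: "cis (- 2 * pi * p (s g)) = cis (- 2 * pi * p h) * cis (- 2 * pi * p g)" for g
  proof -
    have e: "p (s g) = p g + p h - (\<Sum>i\<in>I. of_int (k i) * of_int \<lfloor>g i + h i\<rfloor>)"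
      unfolding p_def sum.distrib[symmetric] sum_subtractf[symmetric]
      by (rule sum.cong) (simp_all add: s_def frac_def algebra_simps)
    have "- 2 * pi * p (s g) = - 2 * pi * p h + - 2 * pi * p g + 2 * pi * (\<Sum>i\<in>I. of_int (k i) * of_int \<lfloor>g i + h i\<rfloor>)"
      unfolding e by (simp add: algebra_simps)
    moreover have "cis (2 * pi * (\<Sum>i\<in>I. of_int (k i) * of_int \<lfloor>g i + h i\<rfloor>)) = 1"
      by (rule cis_sum_roots) (auto intro: Ints_sum)
    ultimately show ?thesis by (simp only: cis_mult[symmetric] mult_1_right)
  qed
  have "(\<Sum>g\<in>G. cis (- 2 * pi * p g)) = (\<Sum>g\<in>s ` G. cis (- 2 * pi * p g))" using \<open>s ` G = G\<close> by simp
  also have "\<dots> = cis (- 2 * pi * p h) * (\<Sum>g\<in>G. cis (- 2 * pi * p g))"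
    unfolding sum.reindex[OF \<open>inj_on s G\<close>] o_def ps sum_distrib_left ..
  finally have "(1 - cis (- 2 * pi * p h)) * (\<Sum>g\<in>G. cis (- 2 * pi * p g)) = 0" by (simp add: algebra_simps)
  moreover have "cis (- 2 * pi * p h) \<noteq> 1"
  proof
    assume "cis (- 2 * pi * p h) = 1"
    then have "cos (2 * pi * p h) = 1" by (simp add: complex_eq_iff)
    then obtain x :: int where "2 * pi * p h = of_int x * 2 * pi" by (auto simp: cos_one_2pi_int)
    then have "p h = of_int x" by simp
    then show False using h(2) by simp
  qed
  ultimately have "(\<Sum>g\<in>G. cis (- 2 * pi * p g)) = 0" by simp
  then show ?thesis unfolding p_def if_not_P[OF False] .
qed

text \<open>The representative that lies in the half-open fundamental domain: on a facet excluded by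
  \<open>w\<close> the coordinate 0 is replaced by 1.\<close>

definition lift_point :: "'v \<Rightarrow> ('i \<Rightarrow> real) \<Rightarrow> 'i \<Rightarrow> real" where
  "lift_point w g i = (if g i = 0 \<and> co i w < 0 then 1 else g i)"

lemma bij_fund:
  assumes w: "\<And>i. i \<in> I \<Longrightarrow> co i w \<noteq> 0"
  shows "bij_betw (\<lambda>g. \<Sum>i\<in>I. lift_point w g i *\<^sub>R v i) G (half_open_fund w I)"
proof (rule bij_betwI[where g = "\<lambda>x i. if i \<in> I then frac (co i x) else 0"])
  show "(\<lambda>g. \<Sum>i\<in>I. lift_point w g i *\<^sub>R v i) \<in> G \<rightarrow> half_open_fund w I"
  proof
    fix g assume g: "g \<in> G"
    have "(\<Sum>i\<in>I. lift_point w g i *\<^sub>R v i) = (\<Sum>i\<in>I. g i *\<^sub>R v i) +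
        (\<Sum>i\<in>I. of_int (if g i = 0 \<and> co i w < 0 then 1 else 0) *\<^sub>R v i)"
      unfolding sum.distrib[symmetric] by (rule sum.cong) (auto simp: lift_point_def)
    also have "\<dots> \<in> L"
    proof (rule Ladd)
      show "(\<Sum>i\<in>I. g i *\<^sub>R v i) \<in> L" using g by (simp add: G_def)
      show "(\<Sum>i\<in>I. of_int (if g i = 0 \<and> co i w < 0 then 1 else 0) *\<^sub>R v i) \<in> L"
        by (intro Lsum Lscale_int vL)
    qed
    finally have "(\<Sum>i\<in>I. lift_point w g i *\<^sub>R v i) \<in> L" .
    moreover have "g i \<ge> 0" "g i < 1" for i using g by (auto simp: G_def)
    ultimately show "(\<Sum>i\<in>I. lift_point w g i *\<^sub>R v i) \<in> half_open_fund w I"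
      unfolding half_open_fund_def half_open_def using w
      by (auto simp: co_comb lift_point_def less_le not_less)
  qed
  show "(\<lambda>x i. if i \<in> I then frac (co i x) else 0) \<in> half_open_fund w I \<rightarrow> G"
    using G_frac by (auto simp: half_open_fund_def half_open_def)
  show "(\<lambda>i. if i \<in> I then frac (co i (\<Sum>i\<in>I. lift_point w g i *\<^sub>R v i)) else 0) = g" if g: "g \<in> G" for g
  proof
    fix i
    have "g i \<ge> 0" "g i < 1" using g by (auto simp: G_def)
    then have "frac (g i) = g i" by (simp add: frac_eq)
    then show "(if i \<in> I then frac (co i (\<Sum>i\<in>I. lift_point w g i *\<^sub>R v i)) else 0) = g i"
      using g by (auto simp: co_comb lift_point_def G_def)
  qed
  show "(\<Sum>i\<in>I. lift_point w (\<lambda>i. if i \<in> I then frac (co i x) else 0) i *\<^sub>R v i) = x" if x: "x \<in> half_open_fund w I" for x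
  proof (rule co_eqI)
    fix i assume i: "i \<in> I"
    have a: "co i x > 0 \<or> (co i x = 0 \<and> co i w > 0)" "co i x < 1 \<or> (co i x = 1 \<and> co i w < 0)"
      using x i by (auto simp: half_open_fund_def half_open_def)
    have fr: "frac (co i x) = (if co i x = 1 then 0 else co i x)"
    proof (cases "co i x = 1")
      case False
      then have "0 \<le> co i x \<and> co i x < 1" using a by linarith
      then show ?thesis using False by (simp add: frac_eq)
    qed simp
    show "co i (\<Sum>i\<in>I. lift_point w (\<lambda>i. if i \<in> I then frac (co i x) else 0) i *\<^sub>R v i) = co i x"
      unfolding co_comb[OF i] unfolding lift_point_def if_P[OF i] fr using a by auto
  qed
qed

text \<open>The character \<open>x \<mapsto> \<zeta>^(\<xi>(x)) q^(m(x))\<close> with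
  \<open>q = s^N\<close>; its values are Laurent monomials because \<open>m x\<close> may be
  negative.\<close>

definition lat_char :: "complex \<Rightarrow> ('i \<Rightarrow> real) \<Rightarrow> ('v \<Rightarrow> real) \<Rightarrow> 'v \<Rightarrow> complex fls" where
  "lat_char \<sigma> d m x = fls_monom (zeta_pow \<sigma> (\<Sum>i\<in>I. d i * co i x)) \<lfloor>real N * m x\<rfloor>"

lemma lat_char_add:
  assumes "m \<in> dual" "x \<in> L" "y \<in> L"
  shows "lat_char \<sigma> d m (x + y) = lat_char \<sigma> d m x * lat_char \<sigma> d m y"
proof -
  have Z: "real N * m x \<in> \<int>" "real N * m y \<in> \<int>" using assms by (auto simp: dual_def)
  have "real N * m (x + y) = real N * m x + real N * m y"
    using assms(1) by (simp add: dual_def linear_add distrib_left)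
  also have "\<dots> = of_int (\<lfloor>real N * m x\<rfloor> + \<lfloor>real N * m y\<rfloor>)" using Z by simp
  finally have "\<lfloor>real N * m (x + y)\<rfloor> = \<lfloor>real N * m x\<rfloor> + \<lfloor>real N * m y\<rfloor>" by (simp only: floor_of_int)
  then show ?thesis
    by (simp add: lat_char_def fls_monom_mult co_add distrib_left sum.distrib zeta_pow_add)
qed

lemma lat_char_basis:
  assumes m: "m \<in> dual" and i: "i \<in> I"
  shows "lat_char \<sigma> d m (v i) = fls_monom (zeta_pow \<sigma> (d i)) (int N * \<lfloor>m (v i)\<rfloor>)"
proof -
  have "(\<Sum>j\<in>I. d j * co j (v i)) = (\<Sum>j\<in>I. if j = i then d j else 0)"
    using i by (intro sum.cong) (simp_all add: co_basis)
  then have "(\<Sum>j\<in>I. d j * co j (v i)) = d i" using i fin by simp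
  moreover have "real N * m (v i) = of_int (int N * \<lfloor>m (v i)\<rfloor>)"
    unfolding of_int_mult of_int_of_nat_eq dual_basis_int[OF m i] ..
  then have "\<lfloor>real N * m (v i)\<rfloor> = int N * \<lfloor>m (v i)\<rfloor>" by (simp only: floor_of_int)
  ultimately show ?thesis by (simp add: lat_char_def)
qed

text \<open>The coefficient of \<open>e\<^bsup>- m(w) y\<^esup>\<close> in \<open>Ell\<close>, up to the order of \<open>G\<close>, where \<open>k i = m (v i)\<close>.\<close>

definition dual_coeff :: "complex \<Rightarrow> ('i \<Rightarrow> real) \<Rightarrow> 'v \<Rightarrow> ('i \<Rightarrow> int) \<Rightarrow> complex fps" where
  "dual_coeff \<sigma> d w k = (\<Sum>g\<in>G. \<Prod>i\<in>I. fps_const (zeta_pow \<sigma> (d i * g i)) *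
      kron_term N (nat \<lfloor>real N * g i\<rfloor>) (zeta_pow \<sigma> (d i)) (co i w < 0) (k i))"

lemma nat_floor_G:
  assumes "g \<in> G" "i \<in> I"
  shows "real (nat \<lfloor>real N * g i\<rfloor>) = real N * g i" "nat \<lfloor>real N * g i\<rfloor> < N"
    "nat \<lfloor>real N * g i\<rfloor> = 0 \<longleftrightarrow> g i = 0"
proof -
  have g: "0 \<le> g i" "g i < 1" using assms by (auto simp: G_def)
  have 1: "real_of_int \<lfloor>real N * g i\<rfloor> = real N * g i" using G_N[OF assms] by simp
  have "real N * g i \<ge> 0" using g by simp
  then have "\<lfloor>real N * g i\<rfloor> \<ge> 0" by simp
  then show 2: "real (nat \<lfloor>real N * g i\<rfloor>) = real N * g i" using 1 by (metis of_nat_nat)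
  have "real N * g i < real N" using g N0 by simp
  then show "nat \<lfloor>real N * g i\<rfloor> < N" using 2 by (metis of_nat_less_iff)
  show "nat \<lfloor>real N * g i\<rfloor> = 0 \<longleftrightarrow> g i = 0" using 2 N0 by (metis mult_eq_0_iff of_nat_0 of_nat_0_less_iff of_nat_eq_0_iff less_irrefl)
qed

text \<open>By \<open>kron_term_fls\<close> each factor is a monomial over
  \<open>1 - lat_char \<sigma> d m (v i)\<close>. The monomials of one \<open>g\<close> multiply to
  the character at the point with coordinates \<open>lift_point w g\<close>, and these points run
  through the fundamental domain. The denominators are nonzero because \<zeta> to the power
  \<open>d i\<close> is not 1, whatever \<open>m (v i)\<close> is.\<close>

lemma dual_coeff_fund:
  assumes m: "m \<in> dual" and w: "\<And>i. i \<in> I \<Longrightarrow> co i w \<noteq> 0" and z: "\<And>i. i \<in> I \<Longrightarrow> zeta_pow \<sigma> (d i) \<noteq> 1"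
  shows "fps_to_fls (dual_coeff \<sigma> d w (\<lambda>i. \<lfloor>m (v i)\<rfloor>)) =
    (\<Sum>x\<in>half_open_fund w I. lat_char \<sigma> d m x) / (\<Prod>i\<in>I. 1 - lat_char \<sigma> d m (v i))"
    and "\<And>i. i \<in> I \<Longrightarrow> lat_char \<sigma> d m (v i) \<noteq> 1"
proof -
  show ne: "lat_char \<sigma> d m (v i) \<noteq> 1" if "i \<in> I" for i
    unfolding lat_char_basis[OF m that] fls_monom_1[symmetric]
    using fls_monom_eq_iff[OF zeta_pow_nonzero] z[OF that] by auto
  have fac: "fps_to_fls (fps_const (zeta_pow \<sigma> (d i * g i)) *
      kron_term N (nat \<lfloor>real N * g i\<rfloor>) (zeta_pow \<sigma> (d i)) (co i w < 0) \<lfloor>m (v i)\<rfloor>) =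
      fls_monom (zeta_pow \<sigma> (d i * lift_point w g i)) (\<lfloor>real N * lift_point w g i\<rfloor> * \<lfloor>m (v i)\<rfloor>) / (1 - lat_char \<sigma> d m (v i))"
    if g: "g \<in> G" and i: "i \<in> I" for g i
  proof -
    note n = nat_floor_G[OF g i]
    have "fps_to_fls (fps_const (zeta_pow \<sigma> (d i * g i))) = fls_monom (zeta_pow \<sigma> (d i * g i)) 0"
      by (simp add: fls_monom_def)
    then have "fps_to_fls (fps_const (zeta_pow \<sigma> (d i * g i)) *
      kron_term N (nat \<lfloor>real N * g i\<rfloor>) (zeta_pow \<sigma> (d i)) (co i w < 0) \<lfloor>m (v i)\<rfloor>) * (1 - lat_char \<sigma> d m (v i)) =
      fls_monom (zeta_pow \<sigma> (d i * g i)) 0 *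
      (fps_to_fls (kron_term N (nat \<lfloor>real N * g i\<rfloor>) (zeta_pow \<sigma> (d i)) (co i w < 0) \<lfloor>m (v i)\<rfloor>) *
        (1 - fls_monom (zeta_pow \<sigma> (d i)) (int N * \<lfloor>m (v i)\<rfloor>)))"
      by (simp only: fls_times_fps_to_fls lat_char_basis[OF m i] mult.assoc)
    also have "\<dots> = fls_monom (zeta_pow \<sigma> (d i * g i)) 0 *
        (if co i w < 0 \<and> nat \<lfloor>real N * g i\<rfloor> = 0 then fls_monom (zeta_pow \<sigma> (d i)) (int N * \<lfloor>m (v i)\<rfloor>)
         else fls_monom 1 (int (nat \<lfloor>real N * g i\<rfloor>) * \<lfloor>m (v i)\<rfloor>))"
      by (subst kron_term_fls[OF n(2) zeta_pow_nonzero z[OF i]]) (rule refl)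
    also have "\<dots> = fls_monom (zeta_pow \<sigma> (d i * lift_point w g i)) (\<lfloor>real N * lift_point w g i\<rfloor> * \<lfloor>m (v i)\<rfloor>)"
    proof (cases "g i = 0 \<and> co i w < 0")
      case True
      then show ?thesis by (simp add: lift_point_def fls_monom_mult)
    next
      case False
      have "real N * g i \<ge> 0" using g by (simp add: G_def)
      then have "int (nat \<lfloor>real N * g i\<rfloor>) = \<lfloor>real N * g i\<rfloor>" by simp
      then show ?thesis using False n(3) by (auto simp: lift_point_def fls_monom_mult)
    qed
    finally show ?thesis using ne[OF i] by (simp add: eq_divide_eq)
  qed
  have pr: "(\<Prod>i\<in>I. fls_monom (zeta_pow \<sigma> (d i * lift_point w g i)) (\<lfloor>real N * lift_point w g i\<rfloor> * \<lfloor>m (v i)\<rfloor>)) =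
      lat_char \<sigma> d m (\<Sum>i\<in>I. lift_point w g i *\<^sub>R v i)" if g: "g \<in> G" for g
  proof -
    have lp: "real_of_int \<lfloor>real N * lift_point w g i\<rfloor> = real N * lift_point w g i" if "i \<in> I" for i
      using G_N[OF g that] by (auto simp: lift_point_def)
    have "real N * m (\<Sum>i\<in>I. lift_point w g i *\<^sub>R v i) = (\<Sum>i\<in>I. real N * lift_point w g i * m (v i))"
      by (subst dual_expand[OF m]) (simp add: co_comb sum_distrib_left mult.assoc)
    also have "\<dots> = (\<Sum>i\<in>I. real_of_int (\<lfloor>real N * lift_point w g i\<rfloor> * \<lfloor>m (v i)\<rfloor>))"
      by (rule sum.cong) (simp_all add: lp dual_basis_int[OF m])
    also have "\<dots> = real_of_int (\<Sum>i\<in>I. \<lfloor>real N * lift_point w g i\<rfloor> * \<lfloor>m (v i)\<rfloor>)" by simp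
    finally have "\<lfloor>real N * m (\<Sum>i\<in>I. lift_point w g i *\<^sub>R v i)\<rfloor> = (\<Sum>i\<in>I. \<lfloor>real N * lift_point w g i\<rfloor> * \<lfloor>m (v i)\<rfloor>)"
      by (simp only: floor_of_int)
    moreover have "(\<Sum>i\<in>I. d i * co i (\<Sum>i\<in>I. lift_point w g i *\<^sub>R v i)) = (\<Sum>i\<in>I. d i * lift_point w g i)"
      by (rule sum.cong) (simp_all add: co_comb)
    ultimately show ?thesis
      unfolding lat_char_def fls_monom_prod[OF fin] by (simp add: zeta_pow_sum[OF fin])
  qed
  have "fps_to_fls (dual_coeff \<sigma> d w (\<lambda>i. \<lfloor>m (v i)\<rfloor>)) = (\<Sum>g\<in>G. \<Prod>i\<in>I.
      fls_monom (zeta_pow \<sigma> (d i * lift_point w g i)) (\<lfloor>real N * lift_point w g i\<rfloor> * \<lfloor>m (v i)\<rfloor>) / (1 - lat_char \<sigma> d m (v i)))"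
    unfolding dual_coeff_def fps_to_fls_sum fps_to_fls_prod by (intro sum.cong prod.cong refl fac)
  also have "\<dots> = (\<Sum>g\<in>G. lat_char \<sigma> d m (\<Sum>i\<in>I. lift_point w g i *\<^sub>R v i)) / (\<Prod>i\<in>I. 1 - lat_char \<sigma> d m (v i))"
    unfolding prod_dividef sum_divide_distrib by (rule sum.cong) (simp_all add: pr)
  also have "(\<Sum>g\<in>G. lat_char \<sigma> d m (\<Sum>i\<in>I. lift_point w g i *\<^sub>R v i)) = (\<Sum>x\<in>half_open_fund w I. lat_char \<sigma> d m x)"
    by (rule sum.reindex_bij_betw[OF bij_fund[OF w]])
  finally show "fps_to_fls (dual_coeff \<sigma> d w (\<lambda>i. \<lfloor>m (v i)\<rfloor>)) =
    (\<Sum>x\<in>half_open_fund w I. lat_char \<sigma> d m x) / (\<Prod>i\<in>I. 1 - lat_char \<sigma> d m (v i))" .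
qed

text \<open>The local contribution of \<open>I\<close> at \<open>y w\<close>, without the factors \<open>x\<^sub>i\<close>.\<close>

definition Ell :: "complex \<Rightarrow> ('i \<Rightarrow> real) \<Rightarrow> 'v \<Rightarrow> complex \<Rightarrow> complex fps" where
  "Ell \<sigma> d w y = (\<Sum>g1\<in>G. \<Sum>g2\<in>G. \<Prod>i\<in>I. fps_const (zeta_pow \<sigma> (d i * g1 i)) *
     Abs_fps (kronecker_coeff N (nat \<lfloor>real N * g1 i\<rfloor>) (zeta_pow \<sigma> (d i))
       (exp (- (of_real (co i w) * y)) * cis (- 2 * pi * g2 i))))"

text \<open>At \<open>y w\<close> with real \<open>y > 0\<close> the norm of the variable
  \<open>T\<close> of index \<open>i\<close> is \<open>exp (- (co i w * y))\<close>, so the sign of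
  \<open>co i w\<close> selects the convergent expansion, in agreement with the flag
  \<open>neg\<close> in \<open>dual_coeff\<close>.\<close>

lemma Ell_has_sum:
  assumes w: "\<And>i. i \<in> I \<Longrightarrow> co i w \<noteq> 0" and y: "y > 0"
  shows "fps_has_sum (\<lambda>m. fps_const (of_nat (card G) * of_real (exp (- (m w * y)))) *
     dual_coeff \<sigma> d w (\<lambda>i. \<lfloor>m (v i)\<rfloor>)) dual (Ell \<sigma> d w (of_real y))"
proof -
  define T where "T = (\<lambda>i g. exp (- (of_real (co i w) * of_real y)) * cis (- 2 * pi * g) :: complex)"
  have Texp: "T i g = exp (of_real (- (co i w * y)) + \<i> * of_real (- 2 * pi * g))" for i g
    unfolding T_def cis_conv_exp exp_add by simp
  have Tpow: "T i g powi k = exp (of_real (of_int k * - (co i w * y))) * cis (- 2 * pi * (of_int k * g))" for i g k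
    unfolding Texp exp_power_int cis_conv_exp exp_of_real[symmetric] exp_add[symmetric] by (simp add: algebra_simps)
  have Tn: "norm (T i g) = exp (- (co i w * y))" for i g
    unfolding Texp norm_exp_eq_Re by simp
  define K where "K = (\<lambda>g1 i k. fps_const (zeta_pow \<sigma> (d i * g1 i)) *
      kron_term N (nat \<lfloor>real N * g1 i\<rfloor>) (zeta_pow \<sigma> (d i)) (co i w < 0) k)"
  have one: "fps_has_sum (\<lambda>k. fps_const (T i (g2 i) powi k) * K g1 i k) UNIV
      (fps_const (zeta_pow \<sigma> (d i * g1 i)) * Abs_fps (kronecker_coeff N (nat \<lfloor>real N * g1 i\<rfloor>) (zeta_pow \<sigma> (d i)) (T i (g2 i))))"
    if g: "g1 \<in> G" and i: "i \<in> I" for g1 g2 i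
  proof -
    have "if co i w < 0 then norm (T i (g2 i)) > 1 else norm (T i (g2 i)) < 1"
      using w[OF i] y by (auto simp: Tn mult_neg_pos)
    moreover have "T i (g2 i) \<noteq> 0" by (simp add: T_def)
    ultimately have "fps_has_sum (\<lambda>k. fps_const (T i (g2 i) powi k) *
        kron_term N (nat \<lfloor>real N * g1 i\<rfloor>) (zeta_pow \<sigma> (d i)) (co i w < 0) k) UNIV
        (Abs_fps (kronecker_coeff N (nat \<lfloor>real N * g1 i\<rfloor>) (zeta_pow \<sigma> (d i)) (T i (g2 i))))"
      by (intro kron_term_has_sum[OF nat_floor_G(2)[OF g i]])
    from fps_has_sum_cmult[OF this, of "fps_const (zeta_pow \<sigma> (d i * g1 i))"]
    show ?thesis unfolding K_def by (simp only: mult.left_commute)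
  qed
  have Ell_eq: "Ell \<sigma> d w (of_real y) = (\<Sum>g1\<in>G. \<Sum>g2\<in>G. \<Prod>i\<in>I. fps_const (zeta_pow \<sigma> (d i * g1 i)) *
     Abs_fps (kronecker_coeff N (nat \<lfloor>real N * g1 i\<rfloor>) (zeta_pow \<sigma> (d i)) (T i (g2 i))))"
    unfolding Ell_def T_def ..
  have "fps_has_sum (\<lambda>k. \<Sum>g1\<in>G. \<Sum>g2\<in>G. \<Prod>i\<in>I. fps_const (T i (g2 i) powi k i) * K g1 i (k i))
      (PiE I (\<lambda>_. UNIV)) (Ell \<sigma> d w (of_real y))"
    unfolding Ell_eq
    by (intro fps_has_sum_sum finite_G fps_has_sum_prod fin one)
  moreover have "(\<Sum>g1\<in>G. \<Sum>g2\<in>G. \<Prod>i\<in>I. fps_const (T i (g2 i) powi k i) * K g1 i (k i)) =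
     fps_const (of_real (exp (- ((\<Sum>i\<in>I. of_int (k i) * co i w) * y))) *
       (if \<forall>g\<in>G. (\<Sum>i\<in>I. of_int (k i) * g i) \<in> \<int> then of_nat (card G) else 0)) * dual_coeff \<sigma> d w k" for k
  proof -
    have fcp: "(\<Prod>i\<in>I. fps_const (c i)) = fps_const (\<Prod>i\<in>I. c i)" for c :: "'i \<Rightarrow> complex"
      using fin by (induction I rule: finite_induct) simp_all
    have fcs: "(\<Sum>g\<in>A. fps_const (c g)) = fps_const (\<Sum>g\<in>A. c g)" for c :: "('i \<Rightarrow> real) \<Rightarrow> complex" and A
      by (induction A rule: infinite_finite_induct) simp_all
    have P: "(\<Prod>i\<in>I. T i (g2 i) powi k i) = of_real (exp (- ((\<Sum>i\<in>I. of_int (k i) * co i w) * y))) *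
        cis (- 2 * pi * (\<Sum>i\<in>I. of_int (k i) * g2 i))" for g2
    proof -
      have "(\<Prod>i\<in>I. exp (of_real (of_int (k i) * - (co i w * y)))) = (exp (of_real (\<Sum>i\<in>I. of_int (k i) * - (co i w * y))) :: complex)"
        using fin by (simp add: exp_sum)
      also have "(\<Sum>i\<in>I. of_int (k i) * - (co i w * y)) = - ((\<Sum>i\<in>I. of_int (k i) * co i w) * y)"
        by (simp add: sum_distrib_right sum_negf mult.assoc)
      finally have 1: "(\<Prod>i\<in>I. exp (of_real (of_int (k i) * - (co i w * y)))) =
          (of_real (exp (- ((\<Sum>i\<in>I. of_int (k i) * co i w) * y))) :: complex)" by (simp only: exp_of_real)
      have 2: "(\<Prod>i\<in>I. cis (- 2 * pi * (of_int (k i) * g2 i))) = cis (\<Sum>i\<in>I. - 2 * pi * (of_int (k i) * g2 i))"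
        using fin by (induction I rule: finite_induct) (simp_all add: cis_mult)
      show ?thesis unfolding Tpow prod.distrib 1 2 by (simp only: sum_distrib_left)
    qed
    \<comment> \<open>\<open>g2\<close> enters only through the powers of \<open>T\<close> and
      \<open>g1\<close> only through the Kronecker terms, so the double sum factors; the sum over
      \<open>g2\<close> is a character sum.\<close>
    have "(\<Sum>g1\<in>G. \<Sum>g2\<in>G. \<Prod>i\<in>I. fps_const (T i (g2 i) powi k i) * K g1 i (k i)) =
      (\<Sum>g2\<in>G. fps_const (\<Prod>i\<in>I. T i (g2 i) powi k i)) * (\<Sum>g1\<in>G. \<Prod>i\<in>I. K g1 i (k i))"
      unfolding prod.distrib fcp sum_product by (rule sum.swap)
    also have "(\<Sum>g1\<in>G. \<Prod>i\<in>I. K g1 i (k i)) = dual_coeff \<sigma> d w k" by (simp add: dual_coeff_def K_def)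
    also have "(\<Sum>g2\<in>G. fps_const (\<Prod>i\<in>I. T i (g2 i) powi k i)) =
       fps_const (of_real (exp (- ((\<Sum>i\<in>I. of_int (k i) * co i w) * y))) *
       (if \<forall>g\<in>G. (\<Sum>i\<in>I. of_int (k i) * g i) \<in> \<int> then of_nat (card G) else 0))"
      unfolding fcs P sum_distrib_left[symmetric] character_sum ..
    finally show ?thesis .
  qed
  ultimately have "fps_has_sum (\<lambda>k. fps_const (of_real (exp (- ((\<Sum>i\<in>I. of_int (k i) * co i w) * y))) *
       (if \<forall>g\<in>G. (\<Sum>i\<in>I. of_int (k i) * g i) \<in> \<int> then of_nat (card G) else 0)) * dual_coeff \<sigma> d w k)
      (PiE I (\<lambda>_. UNIV)) (Ell \<sigma> d w (of_real y))" by (simp only:)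
  then have "fps_has_sum (\<lambda>k. fps_const (of_nat (card G) * of_real (exp (- ((\<Sum>i\<in>I. of_int (k i) * co i w) * y)))) * dual_coeff \<sigma> d w k)
      dual_coords (Ell \<sigma> d w (of_real y))"
    unfolding fps_has_sum_def
    by (elim all_forward, subst (asm) has_sum_cong_neutral[where T = dual_coords])
      (auto simp: dual_coords_def mult.commute)
  then have "fps_has_sum (\<lambda>m. fps_const (of_nat (card G) * of_real (exp (- ((\<Sum>i\<in>I. of_int (restrict (\<lambda>i. \<lfloor>m (v i)\<rfloor>) I i) * co i w) * y)))) *
     dual_coeff \<sigma> d w (restrict (\<lambda>i. \<lfloor>m (v i)\<rfloor>) I)) dual (Ell \<sigma> d w (of_real y))"
    unfolding fps_has_sum_def
    using has_sum_reindex_bij_betw[OF bij_dual, of "\<lambda>k. fps_nth (fps_const (of_nat (card G) *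
      of_real (exp (- ((\<Sum>i\<in>I. of_int (k i) * co i w) * y)))) * dual_coeff \<sigma> d w k) _"] by simp
  moreover have "dual_coeff \<sigma> d w (restrict (\<lambda>i. \<lfloor>m (v i)\<rfloor>) I) = dual_coeff \<sigma> d w (\<lambda>i. \<lfloor>m (v i)\<rfloor>)" for m :: "'v \<Rightarrow> real"
    unfolding dual_coeff_def by (intro sum.cong prod.cong refl) simp
  moreover have "(\<Sum>i\<in>I. of_int (restrict (\<lambda>i. \<lfloor>m (v i)\<rfloor>) I i) * co i w) = m w" if "m \<in> dual" for m
    by (subst dual_expand[OF that, of w], rule sum.cong) (simp_all add: dual_basis_int[OF that])
  ultimately show ?thesis
    unfolding fps_has_sum_def by (simp cong: has_sum_cong)
qed

end

context birational_setting
begin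

text \<open>The divisor is a function linear on each cone and \<open>pull_back\<close> is its
  restriction to the finer fan: both exponents are linear in \<open>x\<close> and agree on the edge
  vectors of \<open>I'\<close>.\<close>

lemma pull_back_char:
  assumes I: "I \<in> k_simplices \<Delta> n" and I': "I' \<in> over I"
  shows "lattice_cone.lat_char I' v' N \<sigma> (pull_back \<Delta> v' v \<rho> d) m = lattice_cone.lat_char I v N \<sigma> d m"
proof -
  interpret C: lattice_cone I v L N using cone[OF I] .
  have I'S: "I' \<in> k_simplices \<Delta>' n" using I' by (simp add: over_def)
  interpret C': lattice_cone I' v' L N using cone'[OF I'S] .
  have "(\<Sum>i'\<in>I'. pull_back \<Delta> v' v \<rho> d i' * C'.co i' x) = (\<Sum>i\<in>I. d i * C.co i x)" for x
  proof -
    have "(\<Sum>i\<in>I. d i * C.co i x) = (\<Sum>i\<in>I. d i * C.co i (\<Sum>i'\<in>I'. C'.co i' x *\<^sub>R v' i'))"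
      by (simp only: C'.co_expand)
    also have "\<dots> = (\<Sum>i\<in>I. \<Sum>i'\<in>I'. d i * C.co i (v' i') * C'.co i' x)"
      by (simp add: C.co_sum C.co_scale sum_distrib_left mult_ac)
    also have "\<dots> = (\<Sum>i'\<in>I'. (\<Sum>i\<in>I. d i * C.co i (v' i')) * C'.co i' x)"
      unfolding sum_distrib_right by (rule sum.swap)
    also have "\<dots> = (\<Sum>i'\<in>I'. pull_back \<Delta> v' v \<rho> d i' * C'.co i' x)"
      by (rule sum.cong) (simp_all add: pull_back_eq[OF I I'])
    finally show ?thesis by (rule sym)
  qed
  then show ?thesis by (intro ext) (simp add: C.lat_char_def C'.lat_char_def)
qed

text \<open>Both sides are sums over \<open>L^*\<close> with the same weights
  \<open>exp (- (m w * y))\<close>. For each \<open>m\<close> the coefficients agree by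
  \<open>fund_sum_decomposition\<close> for \<open>lat_char\<close>, with the Laurent series in
  \<open>s\<close> as field of values.\<close>

theorem Ell_decomposition:
  assumes I: "I \<in> k_simplices \<Delta> n" and w: "generic w" and y: "y > 0"
    and z: "\<And>i. i \<in> I \<Longrightarrow> zeta_pow \<sigma> (d i) \<noteq> 1"
    and z': "\<And>I' i'. I' \<in> over I \<Longrightarrow> i' \<in> I' \<Longrightarrow> zeta_pow \<sigma> (pull_back \<Delta> v' v \<rho> d i') \<noteq> 1"
  shows "fps_nth (lattice_cone.Ell I v L N \<sigma> d w (of_real y)) r / of_nat (card (lattice_cone.G I v L)) =
    (\<Sum>I'\<in>over I. fps_nth (lattice_cone.Ell I' v' L N \<sigma> (pull_back \<Delta> v' v \<rho> d) w (of_real y)) r /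
       of_nat (card (lattice_cone.G I' v' L)))"
proof -
  interpret C: lattice_cone I v L N using cone[OF I] .
  let ?d = "pull_back \<Delta> v' v \<rho> d"
  have oS: "I' \<in> k_simplices \<Delta>' n" if "I' \<in> over I" for I' using that by (simp add: over_def)
  have wC: "C.co i w \<noteq> 0" if "i \<in> I" for i using w I that unfolding generic_def by blast
  have wC': "dual_vec v' I' i w \<noteq> 0" if "I' \<in> over I" "i \<in> I'" for I' i
    using w oS[OF that(1)] that(2) unfolding generic_def by blast
  have dual_eq: "lattice_cone.dual L = C.dual" by (rule refl)
  \<comment> \<open>Stated for an arbitrary index type, since it is applied to \<open>I\<close> as
    well as to the simplices over it.\<close>
  have norm: "((\<lambda>m. of_real (exp (- (m w * y))) * fps_nth (lattice_cone.dual_coeff J u L N \<sigma> dd w (\<lambda>i. \<lfloor>m (u i)\<rfloor>)) r) has_sum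
      fps_nth (lattice_cone.Ell J u L N \<sigma> dd w (of_real y)) r / of_nat (card (lattice_cone.G J u L))) C.dual"
    if J: "lattice_cone J u L N" "\<And>i. i \<in> J \<Longrightarrow> dual_vec u J i w \<noteq> 0" for J :: "'k set" and u dd
  proof -
    interpret J: lattice_cone J u L N by (rule J(1))
    have c: "of_nat (card J.G) \<noteq> (0::complex)" using J.card_G by simp
    have "((\<lambda>m. fps_nth (fps_const (of_nat (card J.G) * of_real (exp (- (m w * y)))) *
       J.dual_coeff \<sigma> dd w (\<lambda>i. \<lfloor>m (u i)\<rfloor>)) r) has_sum fps_nth (J.Ell \<sigma> dd w (of_real y)) r) J.dual"
      using J.Ell_has_sum[OF J(2) y] unfolding fps_has_sum_def by blast
    from has_sum_cmult_right[OF this, of "1 / of_nat (card J.G)"] show ?thesis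
      using c by simp
  qed
  have "((\<lambda>m. \<Sum>I'\<in>over I. of_real (exp (- (m w * y))) * fps_nth (lattice_cone.dual_coeff I' v' L N \<sigma> ?d w (\<lambda>i. \<lfloor>m (v' i)\<rfloor>)) r) has_sum
     (\<Sum>I'\<in>over I. fps_nth (lattice_cone.Ell I' v' L N \<sigma> ?d w (of_real y)) r / of_nat (card (lattice_cone.G I' v' L)))) C.dual"
    by (intro has_sum_finite_sum finite_over norm cone'[OF oS] wC')
  moreover have "(\<Sum>I'\<in>over I. of_real (exp (- (m w * y))) * fps_nth (lattice_cone.dual_coeff I' v' L N \<sigma> ?d w (\<lambda>i. \<lfloor>m (v' i)\<rfloor>)) r) =
      of_real (exp (- (m w * y))) * fps_nth (C.dual_coeff \<sigma> d w (\<lambda>i. \<lfloor>m (v i)\<rfloor>)) r" if m: "m \<in> C.dual" for m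
  proof -
    have R': "fps_to_fls (lattice_cone.dual_coeff I' v' L N \<sigma> ?d w (\<lambda>i. \<lfloor>m (v' i)\<rfloor>)) =
        (\<Sum>x\<in>lattice_cone.half_open_fund I' v' L w I'. C.lat_char \<sigma> d m x) / (\<Prod>i\<in>I'. 1 - C.lat_char \<sigma> d m (v' i))"
      and ne': "\<And>i. i \<in> I' \<Longrightarrow> C.lat_char \<sigma> d m (v' i) \<noteq> 1" if I': "I' \<in> over I" for I'
    proof -
      interpret C': lattice_cone I' v' L N using cone'[OF oS[OF I']] .
      show "fps_to_fls (lattice_cone.dual_coeff I' v' L N \<sigma> ?d w (\<lambda>i. \<lfloor>m (v' i)\<rfloor>)) =
        (\<Sum>x\<in>lattice_cone.half_open_fund I' v' L w I'. C.lat_char \<sigma> d m x) / (\<Prod>i\<in>I'. 1 - C.lat_char \<sigma> d m (v' i))"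
        unfolding pull_back_char[OF I I', symmetric]
        by (rule C'.dual_coeff_fund(1)) (use m wC' z' I' in auto)
      show "C.lat_char \<sigma> d m (v' i) \<noteq> 1" if "i \<in> I'" for i
        unfolding pull_back_char[OF I I', symmetric]
        by (rule C'.dual_coeff_fund(2)[where w = w]) (use m wC' z' I' that in auto)
    qed
    have "fps_to_fls (C.dual_coeff \<sigma> d w (\<lambda>i. \<lfloor>m (v i)\<rfloor>)) =
        fps_to_fls (\<Sum>I'\<in>over I. lattice_cone.dual_coeff I' v' L N \<sigma> ?d w (\<lambda>i. \<lfloor>m (v' i)\<rfloor>))"
    proof -
      have "fps_to_fls (C.dual_coeff \<sigma> d w (\<lambda>i. \<lfloor>m (v i)\<rfloor>)) =
          (\<Sum>x\<in>C.half_open_fund w I. C.lat_char \<sigma> d m x) / (\<Prod>i\<in>I. 1 - C.lat_char \<sigma> d m (v i))"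
        by (rule C.dual_coeff_fund(1)) (use m wC z in auto)
      also have "\<dots> = (\<Sum>I'\<in>over I. (\<Sum>x\<in>lattice_cone.half_open_fund I' v' L w I'. C.lat_char \<sigma> d m x) /
          (\<Prod>i\<in>I'. 1 - C.lat_char \<sigma> d m (v' i)))"
      proof (rule fund_sum_decomposition[OF I w C.lat_char_add[OF m]])
        show "C.lat_char \<sigma> d m (v i) \<noteq> 1" if "i \<in> I" for i
          by (rule C.dual_coeff_fund(2)[where w = w]) (use m wC z that in auto)
      qed (use ne' in auto)
      also have "\<dots> = fps_to_fls (\<Sum>I'\<in>over I. lattice_cone.dual_coeff I' v' L N \<sigma> ?d w (\<lambda>i. \<lfloor>m (v' i)\<rfloor>))"
        unfolding fps_to_fls_sum by (rule sum.cong[OF refl], rule R'[symmetric])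
      finally show ?thesis .
    qed
    then have "C.dual_coeff \<sigma> d w (\<lambda>i. \<lfloor>m (v i)\<rfloor>) = (\<Sum>I'\<in>over I. lattice_cone.dual_coeff I' v' L N \<sigma> ?d w (\<lambda>i. \<lfloor>m (v' i)\<rfloor>))"
      by simp
    then show ?thesis by (simp add: fps_sum_nth sum_distrib_left)
  qed
  ultimately have "((\<lambda>m. of_real (exp (- (m w * y))) * fps_nth (C.dual_coeff \<sigma> d w (\<lambda>i. \<lfloor>m (v i)\<rfloor>)) r) has_sum
     (\<Sum>I'\<in>over I. fps_nth (lattice_cone.Ell I' v' L N \<sigma> ?d w (of_real y)) r / of_nat (card (lattice_cone.G I' v' L)))) C.dual"
    by (simp cong: has_sum_cong)
  moreover have "((\<lambda>m. of_real (exp (- (m w * y))) * fps_nth (C.dual_coeff \<sigma> d w (\<lambda>i. \<lfloor>m (v i)\<rfloor>)) r) has_sum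
     fps_nth (C.Ell \<sigma> d w (of_real y)) r / of_nat (card C.G)) C.dual"
    by (rule norm[OF cone[OF I] wC])
  ultimately show ?thesis by (rule has_sum_unique[symmetric])
qed

end

section \<open>Evaluation of power series along a line\<close>

text \<open>\<open>mps_ev V c\<close> is the substitution \<open>x\<^sub>i \<mapsto> c\<^sub>i y\<close> for \<open>i \<in> V\<close>, a power series in \<open>y\<close>.\<close>

lemma mps_nth_Abs [simp]: "mps_nth (Abs_mps f) m = f m"
  by (simp add: Abs_mps_inverse)

lemma mps_nth_sum: "mps_nth (\<Sum>i\<in>A. f i) m = (\<Sum>i\<in>A. mps_nth (f i :: ('i, 'r::comm_ring_1) mps) m)"
  by (induction A rule: infinite_finite_induct) (simp_all add: mps_nth_simps)

definition monv :: "'i set \<Rightarrow> ('i \<Rightarrow> complex) \<Rightarrow> ('i \<Rightarrow>\<^sub>0 nat) \<Rightarrow> complex" where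
  "monv V c m = (\<Prod>i\<in>V. c i ^ Poly_Mapping.lookup m i)"

definition mons :: "'i set \<Rightarrow> nat \<Rightarrow> ('i \<Rightarrow>\<^sub>0 nat) set" where
  "mons V k = {m. Poly_Mapping.keys m \<subseteq> V \<and> mdeg m = k}"

definition mps_ev :: "'i set \<Rightarrow> ('i \<Rightarrow> complex) \<Rightarrow> ('i, complex) mps \<Rightarrow> complex fps" where
  "mps_ev V c f = Abs_fps (\<lambda>k. \<Sum>m\<in>mons V k. mps_nth f m * monv V c m)"

lemma mdeg_V: "finite V \<Longrightarrow> Poly_Mapping.keys m \<subseteq> V \<Longrightarrow> mdeg m = (\<Sum>i\<in>V. Poly_Mapping.lookup m i)"
  unfolding mdeg_def by (rule sum.mono_neutral_left) (auto simp: in_keys_iff)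

lemma keys_add_nat: "Poly_Mapping.keys (a + b) = Poly_Mapping.keys a \<union> Poly_Mapping.keys (b :: 'i \<Rightarrow>\<^sub>0 nat)"
  by (auto simp: in_keys_iff lookup_add)

lemma mdeg_add: "mdeg (a + b) = mdeg a + mdeg b"
proof -
  let ?V = "Poly_Mapping.keys a \<union> Poly_Mapping.keys b"
  have "finite ?V" by simp
  then show ?thesis
    using mdeg_V[of ?V "a + b"] mdeg_V[of ?V a] mdeg_V[of ?V b]
    by (simp add: keys_add_nat lookup_add sum.distrib)
qed

lemma monv_add: "monv V c (a + b) = monv V c a * monv V c b"
  by (simp add: monv_def lookup_add power_add prod.distrib)

lemma finite_mons_le:
  assumes "finite V" shows "finite {m. Poly_Mapping.keys m \<subseteq> V \<and> mdeg m \<le> k}"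
proof (rule finite_imageD)
  let ?S = "{m. Poly_Mapping.keys m \<subseteq> V \<and> mdeg m \<le> k}"
  show "finite (Poly_Mapping.lookup ` ?S)"
  proof (rule finite_subset)
    show "finite {f. \<forall>x. (x \<in> V \<longrightarrow> f x \<in> {..k}) \<and> (x \<notin> V \<longrightarrow> f x = (0::nat))}"
      by (rule finite_set_of_finite_funs[OF assms]) simp
    show "Poly_Mapping.lookup ` ?S \<subseteq> {f. \<forall>x. (x \<in> V \<longrightarrow> f x \<in> {..k}) \<and> (x \<notin> V \<longrightarrow> f x = (0::nat))}"
    proof (rule image_subsetI, rule CollectI, rule allI)
      fix m x assume m: "m \<in> ?S"
      have "Poly_Mapping.lookup m x \<le> (\<Sum>i\<in>V. Poly_Mapping.lookup m i)" if "x \<in> V"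
        using assms that by (intro member_le_sum) auto
      moreover have "mdeg m = (\<Sum>i\<in>V. Poly_Mapping.lookup m i)" using assms m by (intro mdeg_V) auto
      moreover have "Poly_Mapping.lookup m x = 0" if "x \<notin> V" using m that by (auto simp: in_keys_iff)
      ultimately show "(x \<in> V \<longrightarrow> Poly_Mapping.lookup m x \<in> {..k}) \<and> (x \<notin> V \<longrightarrow> Poly_Mapping.lookup m x = 0)"
        using m by auto
    qed
  qed
  show "inj_on Poly_Mapping.lookup ?S" by (simp add: inj_on_def lookup_inject)
qed

lemma finite_mons: "finite V \<Longrightarrow> finite (mons V k)"
  by (rule finite_subset[OF _ finite_mons_le[of V k]]) (auto simp: mons_def)

lemma mps_ev_add: "mps_ev V c (f + g) = mps_ev V c f + mps_ev V c g"
  by (rule fps_ext) (simp add: mps_ev_def mps_nth_simps distrib_right sum.distrib)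

lemma mps_ev_diff: "mps_ev V c (f - g) = mps_ev V c f - mps_ev V c g"
  by (rule fps_ext) (simp add: mps_ev_def mps_nth_simps left_diff_distrib sum_subtractf)

lemma mps_ev_0 [simp]: "mps_ev V c 0 = 0"
  by (rule fps_ext) (simp add: mps_ev_def mps_nth_simps)

lemma mps_ev_sum: "mps_ev V c (\<Sum>i\<in>A. f i) = (\<Sum>i\<in>A. mps_ev V c (f i))"
  by (induction A rule: infinite_finite_induct) (simp_all add: mps_ev_add)

lemma mps_ev_mult:
  assumes V: "finite V"
  shows "mps_ev V c (f * g) = mps_ev V c f * mps_ev V c g"
proof (rule fps_ext)
  fix k
  let ?F = "\<lambda>a. mps_nth f a * monv V c a" and ?G = "\<lambda>b. mps_nth g b * monv V c b"
  have "fps_nth (mps_ev V c (f * g)) k = (\<Sum>m\<in>mons V k. \<Sum>(a, b) | a + b = m. ?F a * ?G b)"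
    unfolding mps_ev_def fps_nth_Abs_fps times_mps.rep_eq sum_distrib_right
    by (intro sum.cong refl) (auto simp: monv_add mult_ac)
  also have "\<dots> = (\<Sum>(m, p)\<in>(SIGMA m:mons V k. {(a, b). a + b = m}). ?F (fst p) * ?G (snd p))"
    by (subst sum.Sigma[symmetric]) (use finite_mons[OF V] finite_monomial_pairs in \<open>auto simp: case_prod_unfold\<close>)
  also have "\<dots> = (\<Sum>(i, p)\<in>(SIGMA i:{0..k}. mons V i \<times> mons V (k - i)). ?F (fst p) * ?G (snd p))"
    by (rule sum.reindex_bij_witness[of _ "\<lambda>(i, p). (fst p + snd p, p)" "\<lambda>(m, p). (mdeg (fst p), p)"])
       (auto simp: mons_def mdeg_add keys_add_nat)
  also have "\<dots> = (\<Sum>i=0..k. \<Sum>(a, b)\<in>mons V i \<times> mons V (k - i). ?F a * ?G b)"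
    by (subst sum.Sigma[symmetric]) (use finite_mons[OF V] in \<open>auto simp: case_prod_unfold\<close>)
  also have "\<dots> = (\<Sum>i=0..k. (\<Sum>a\<in>mons V i. ?F a) * (\<Sum>b\<in>mons V (k - i). ?G b))"
    by (simp only: sum_product sum.cartesian_product)
  also have "\<dots> = fps_nth (mps_ev V c f * mps_ev V c g) k"
    by (simp add: fps_mult_nth mps_ev_def)
  finally show "fps_nth (mps_ev V c (f * g)) k = fps_nth (mps_ev V c f * mps_ev V c g) k" .
qed

lemma mdeg_0 [simp]: "mdeg 0 = 0"
  by (simp add: mdeg_def)

lemma mps_ev_const: "finite V \<Longrightarrow> mps_ev V c (mps_const a) = fps_const a"
proof (rule fps_ext)
  fix k assume V: "finite V"
  have "(\<Sum>m\<in>mons V k. mps_nth (mps_const a) m * monv V c m) = (\<Sum>m\<in>mons V k. if m = 0 then a else 0)"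
    by (rule sum.cong) (auto simp: mps_const_def monv_def)
  also have "\<dots> = (if k = 0 then a else 0)"
    using finite_mons[OF V, of k] by (simp add: mons_def)
  finally show "fps_nth (mps_ev V c (mps_const a)) k = fps_nth (fps_const a) k"
    by (simp add: mps_ev_def)
qed

lemma mps_const_1: "mps_const 1 = 1"
  by (rule mps_eqI) (simp add: mps_const_def mps_nth_simps)

lemma mps_ev_1: "finite V \<Longrightarrow> mps_ev V c 1 = 1"
  using mps_ev_const[of V c 1] by (simp add: mps_const_1)

lemma mps_ev_of_nat: "finite V \<Longrightarrow> mps_ev V c (of_nat k) = of_nat k"
  by (induction k) (simp_all add: mps_ev_add mps_ev_1)

lemma mps_ev_prod: "finite V \<Longrightarrow> mps_ev V c (\<Prod>i\<in>A. f i) = (\<Prod>i\<in>A. mps_ev V c (f i))"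
  by (induction A rule: infinite_finite_induct) (simp_all add: mps_ev_mult mps_ev_1)

lemma mps_ev_power: "finite V \<Longrightarrow> mps_ev V c (f ^ k) = mps_ev V c f ^ k"
  by (induction k) (simp_all add: mps_ev_mult mps_ev_1)

lemma mps_ev_var:
  assumes V: "finite V" and i: "i \<in> V"
  shows "mps_ev V c (mps_var i) = fps_const (c i) * fps_X"
proof (rule fps_ext)
  fix k
  let ?s = "Poly_Mapping.single i (1::nat)"
  have keys: "Poly_Mapping.keys ?s = {i}" by simp
  have deg: "mdeg ?s = 1" unfolding mdeg_def keys by simp
  have mon: "monv V c ?s = c i"
  proof -
    have "monv V c ?s = (\<Prod>j\<in>V. if j = i then c j else 1)"
      unfolding monv_def by (rule prod.cong) (auto simp: lookup_single when_def)
    then show ?thesis using V i by simp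
  qed
  have "(\<Sum>m\<in>mons V k. mps_nth (mps_var i) m * monv V c m) = (\<Sum>m\<in>mons V k. if m = ?s then c i else 0)"
    by (rule sum.cong) (auto simp: mps_var_def mon[unfolded One_nat_def])
  also have "\<dots> = (if k = 1 then c i else 0)"
    using finite_mons[OF V, of k] i deg by (auto simp: mons_def)
  finally show "fps_nth (mps_ev V c (mps_var i)) k = fps_nth (fps_const (c i) * fps_X) k"
    by (simp add: mps_ev_def)
qed

lemma mps_ev_of_fps:
  assumes V: "finite V" and i: "i \<in> V"
  shows "mps_ev V c (mps_of_fps i p) = Abs_fps (\<lambda>k. fps_nth p k * c i ^ k)"
proof (rule fps_ext)
  fix k
  let ?s = "Poly_Mapping.single i (k::nat)"
  have mem: "?s \<in> mons V k"
    using i by (cases "k = 0") (auto simp: mons_def mdeg_def)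
  have mon: "monv V c ?s = c i ^ k"
  proof -
    have "monv V c ?s = (\<Prod>j\<in>V. if j = i then c j ^ k else 1)"
      unfolding monv_def by (rule prod.cong) (auto simp: lookup_single when_def)
    then show ?thesis using V i by simp
  qed
  have eq: "m = ?s" if "m \<in> mons V k" "Poly_Mapping.keys m \<subseteq> {i}" for m
  proof (rule poly_mapping_eqI)
    fix j
    have "mdeg m = Poly_Mapping.lookup m i" using mdeg_V[of "{i}" m] that by simp
    then have "Poly_Mapping.lookup m i = k" using that by (simp add: mons_def)
    then show "Poly_Mapping.lookup m j = Poly_Mapping.lookup ?s j"
      using that by (cases "j = i") (auto simp: lookup_single in_keys_iff)
  qed
  have "(\<Sum>m\<in>mons V k. mps_nth (mps_of_fps i p) m * monv V c m) =
      (\<Sum>m\<in>{?s}. mps_nth (mps_of_fps i p) m * monv V c m)"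
  proof (rule sum.mono_neutral_right[OF finite_mons[OF V]])
    show "\<forall>m\<in>mons V k - {?s}. mps_nth (mps_of_fps i p) m * monv V c m = 0"
      using eq by (auto simp: mps_of_fps_def)
  qed (use mem in simp)
  also have "\<dots> = fps_nth p k * c i ^ k"
    by (simp add: mps_of_fps_def mon)
  finally show "fps_nth (mps_ev V c (mps_of_fps i p)) k = fps_nth (Abs_fps (\<lambda>k. fps_nth p k * c i ^ k)) k"
    by (simp add: mps_ev_def)
qed

text \<open>Along the line a monomial of degree \<open>k\<close> becomes a multiple of
  \<open>y^k\<close>, so the degree bound in \<open>mps_subst\<close> loses nothing and the two
  substitutions compose.\<close>

lemma mps_ev_subst:
  assumes V: "finite V" and B: "finite B"
    and h: "\<And>i. i \<in> V \<Longrightarrow> mps_ev B w (h i) = fps_const (e i) * fps_X"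
  shows "mps_ev B w (mps_subst V h f) = mps_ev V e f"
proof (rule fps_ext)
  fix k
  let ?H = "\<lambda>m'. \<Prod>i\<in>V. h i ^ Poly_Mapping.lookup m' i"
  let ?D = "{m'. Poly_Mapping.keys m' \<subseteq> V \<and> mdeg m' \<le> k}"
  have evH: "fps_nth (mps_ev B w (?H m')) k = (if mdeg m' = k then monv V e m' else 0)" if "m' \<in> ?D" for m'
  proof -
    have fcp: "(\<Prod>i\<in>V. fps_const (x i)) = fps_const (\<Prod>i\<in>V. x i)" for x :: "'a \<Rightarrow> complex"
      using V by (induction V rule: finite_induct) simp_all
    have "mps_ev B w (?H m') = (\<Prod>i\<in>V. (fps_const (e i) * fps_X) ^ Poly_Mapping.lookup m' i)"
      using h by (simp add: mps_ev_prod[OF B] mps_ev_power[OF B] cong: prod.cong)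
    also have "\<dots> = fps_const (monv V e m') * fps_X ^ mdeg m'"
      using that mdeg_V[OF V, of m']
      by (simp add: power_mult_distrib prod.distrib fcp monv_def power_sum)
    finally show ?thesis by simp
  qed
  have "fps_nth (mps_ev B w (mps_subst V h f)) k =
      (\<Sum>m\<in>mons B k. \<Sum>m'\<in>?D. mps_nth f m' * (mps_nth (?H m') m * monv B w m))"
    unfolding mps_ev_def fps_nth_Abs_fps mps_subst_def mps_nth_Abs sum_distrib_right
    by (intro sum.cong refl) (auto simp: mons_def mult.assoc)
  also have "\<dots> = (\<Sum>m'\<in>?D. mps_nth f m' * fps_nth (mps_ev B w (?H m')) k)"
    unfolding mps_ev_def fps_nth_Abs_fps sum_distrib_left by (rule sum.swap)
  also have "\<dots> = (\<Sum>m'\<in>?D. if mdeg m' = k then mps_nth f m' * monv V e m' else 0)"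
    by (rule sum.cong[OF refl], subst evH) simp_all
  also have "\<dots> = (\<Sum>m'\<in>mons V k. mps_nth f m' * monv V e m')"
    using finite_mons_le[OF V, of k] by (intro sum.mono_neutral_cong_right) (auto simp: mons_def)
  finally show "fps_nth (mps_ev B w (mps_subst V h f)) k = fps_nth (mps_ev V e f) k"
    by (simp add: mps_ev_def)
qed

text \<open>Induction on the variables: with the others fixed, the sum is a polynomial in one
  variable that vanishes at all real numbers, so the part with a given exponent of that variable
  vanishes as well.\<close>

lemma vanishing_monomial_sum:
  fixes a :: "'m \<Rightarrow> 'i \<Rightarrow> nat" and F :: "'m \<Rightarrow> complex"
  assumes "finite V" "finite M"
    and "\<And>m m'. m \<in> M \<Longrightarrow> m' \<in> M \<Longrightarrow> (\<And>i. i \<in> V \<Longrightarrow> a m i = a m' i) \<Longrightarrow> m = m'"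
    and "\<And>c :: 'i \<Rightarrow> real. (\<Sum>m\<in>M. F m * (\<Prod>i\<in>V. of_real (c i) ^ a m i)) = 0"
    and "m \<in> M"
  shows "F m = 0"
  using assms
proof (induction V arbitrary: M m rule: finite_induct)
  case empty
  then have "M = {m}" by auto
  then show ?case using empty(3)[of "\<lambda>_. 0"] by simp
next
  case (insert i V)
  define M' where "M' = {m' \<in> M. a m' i = a m i}"
  show ?case
  proof (rule insert.IH[of M'])
    show "finite M'" "m \<in> M'" using insert.prems by (auto simp: M'_def)
    fix m1 m2 assume m12: "m1 \<in> M'" "m2 \<in> M'" and eq: "\<And>j. j \<in> V \<Longrightarrow> a m1 j = a m2 j"
    show "m1 = m2"
    proof (rule insert.prems(2))
      show "m1 \<in> M" "m2 \<in> M" using m12 by (auto simp: M'_def)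
      show "a m1 j = a m2 j" if "j \<in> insert i V" for j using that eq m12 by (auto simp: M'_def)
    qed
  next
    fix c :: "'i \<Rightarrow> real"
    define p where "p = (\<Sum>m'\<in>M. monom (F m' * (\<Prod>j\<in>V. of_real (c j) ^ a m' j)) (a m' i) :: complex poly)"
    have "poly p (of_real t) = 0" for t :: real
    proof -
      have "(\<Prod>j\<in>V. of_real ((c(i := t)) j) ^ a m' j) = (\<Prod>j\<in>V. of_real (c j) ^ a m' j :: complex)" for m'
        using insert.hyps(2) by (intro prod.cong) auto
      then have "(\<Prod>j\<in>insert i V. of_real ((c(i := t)) j) ^ a m' j) = of_real t ^ a m' i * (\<Prod>j\<in>V. of_real (c j) ^ a m' j :: complex)" for m'
        unfolding prod.insert[OF insert.hyps(1,2)] by simp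
      then have "poly p (of_real t) = (\<Sum>m\<in>M. F m * (\<Prod>j\<in>insert i V. of_real ((c(i := t)) j) ^ a m j))"
        by (simp add: p_def poly_sum poly_monom mult_ac)
      then show ?thesis using insert.prems(3)[of "c(i := t)"] by simp
    qed
    then have "range (of_real :: real \<Rightarrow> complex) \<subseteq> {x. poly p x = 0}" by auto
    moreover have "infinite (range (of_real :: real \<Rightarrow> complex))"
      using infinite_UNIV_char_0 finite_imageD[of "of_real :: real \<Rightarrow> complex" UNIV] by (auto simp: inj_on_def)
    ultimately have "p = 0" using poly_roots_finite finite_subset by blast
    then have "coeff p (a m i) = 0" by simp
    moreover have "coeff p (a m i) = (\<Sum>m'\<in>M. if a m' i = a m i then F m' * (\<Prod>j\<in>V. of_real (c j) ^ a m' j) else 0)"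
      by (simp add: p_def coeff_sum)
    moreover have "\<dots> = (\<Sum>m'\<in>M'. F m' * (\<Prod>j\<in>V. of_real (c j) ^ a m' j))"
      using insert.prems(1) by (intro sum.mono_neutral_cong_right) (auto simp: M'_def)
    ultimately show "(\<Sum>m'\<in>M'. F m' * (\<Prod>j\<in>V. of_real (c j) ^ a m' j)) = 0" by simp
  qed
qed

text \<open>The coefficient of \<open>y^k\<close> on the line through \<open>c\<close> is the
  homogeneous part of degree \<open>k\<close> at \<open>c\<close>; real directions suffice to detect
  it.\<close>

lemma mps_ev_inj:
  assumes V: "finite V" and f: "\<And>m. mps_nth f m \<noteq> 0 \<Longrightarrow> Poly_Mapping.keys m \<subseteq> V"
    and ev: "\<And>c :: 'i \<Rightarrow> real. mps_ev V (\<lambda>i. of_real (c i)) f = 0"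
  shows "f = 0"
proof (rule mps_eqI)
  fix m
  show "mps_nth f m = mps_nth 0 m"
  proof (cases "Poly_Mapping.keys m \<subseteq> V")
    case True
    have "mps_nth f m = 0"
    proof (rule vanishing_monomial_sum[OF V finite_mons[OF V], where a = Poly_Mapping.lookup])
      show "m \<in> mons V (mdeg m)" using True by (simp add: mons_def)
      show "m1 = m2" if "m1 \<in> mons V (mdeg m)" "m2 \<in> mons V (mdeg m)"
        "\<And>i. i \<in> V \<Longrightarrow> Poly_Mapping.lookup m1 i = Poly_Mapping.lookup m2 i" for m1 m2
      proof (rule poly_mapping_eqI)
        fix i
        show "Poly_Mapping.lookup m1 i = Poly_Mapping.lookup m2 i"
        proof (cases "i \<in> V")
          case False
          then have "i \<notin> Poly_Mapping.keys m1" "i \<notin> Poly_Mapping.keys m2" using that(1,2) by (auto simp: mons_def)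
          then show ?thesis by (simp add: in_keys_iff)
        qed (rule that(3))
      qed
      show "(\<Sum>m'\<in>mons V (mdeg m). mps_nth f m' * (\<Prod>i\<in>V. of_real (c i) ^ Poly_Mapping.lookup m' i)) = 0" for c :: "'i \<Rightarrow> real"
        using arg_cong[OF ev[of c], of "\<lambda>F. fps_nth F (mdeg m)"] by (simp add: mps_ev_def monv_def)
    qed
    then show ?thesis by (simp add: mps_nth_simps)
  qed (use f in \<open>auto simp: mps_nth_simps\<close>)
qed

section \<open>Series in a given set of variables\<close>

definition supp :: "'i set \<Rightarrow> ('i, complex) mps set" where
  "supp V = {f. \<forall>m. mps_nth f m \<noteq> 0 \<longrightarrow> Poly_Mapping.keys m \<subseteq> V}"

lemma supp_0 [simp]: "0 \<in> supp V" and supp_1 [simp]: "1 \<in> supp V"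
  and supp_const [simp]: "mps_const a \<in> supp V"
  and supp_var: "i \<in> V \<Longrightarrow> mps_var i \<in> supp V"
  and supp_of_fps: "i \<in> V \<Longrightarrow> mps_of_fps i p \<in> supp V"
  by (auto simp: supp_def mps_nth_simps mps_const_def mps_var_def mps_of_fps_def split: if_splits)

lemma supp_add: "f \<in> supp V \<Longrightarrow> g \<in> supp V \<Longrightarrow> f + g \<in> supp V"
  unfolding supp_def by (auto simp: mps_nth_simps) (metis add.right_neutral subsetD)

lemma supp_uminus: "f \<in> supp V \<Longrightarrow> - f \<in> supp V"
  unfolding supp_def by (auto simp: mps_nth_simps)

lemma supp_diff: "f \<in> supp V \<Longrightarrow> g \<in> supp V \<Longrightarrow> f - g \<in> supp V"
  unfolding diff_conv_add_uminus by (intro supp_add supp_uminus)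

lemma supp_mult: "f \<in> supp V \<Longrightarrow> g \<in> supp V \<Longrightarrow> f * g \<in> supp V"
  unfolding supp_def
proof (intro CollectI allI impI)
  fix m assume f: "f \<in> {f. \<forall>m. mps_nth f m \<noteq> 0 \<longrightarrow> Poly_Mapping.keys m \<subseteq> V}"
    and g: "g \<in> {f. \<forall>m. mps_nth f m \<noteq> 0 \<longrightarrow> Poly_Mapping.keys m \<subseteq> V}" and m: "mps_nth (f * g) m \<noteq> 0"
  obtain p where p: "p \<in> {(a, b). a + b = m}" "(case p of (a, b) \<Rightarrow> mps_nth f a * mps_nth g b) \<noteq> 0"
    using m unfolding times_mps.rep_eq by (rule sum.not_neutral_contains_not_neutral)
  then obtain a b where "a + b = m" "mps_nth f a \<noteq> 0" "mps_nth g b \<noteq> 0" by (cases p) auto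
  then show "Poly_Mapping.keys m \<subseteq> V" using f g keys_add_nat[of a b] by auto
qed

lemma supp_sum: "(\<And>i. i \<in> A \<Longrightarrow> f i \<in> supp V) \<Longrightarrow> (\<Sum>i\<in>A. f i) \<in> supp V"
  by (induction A rule: infinite_finite_induct) (auto intro: supp_add)

lemma supp_prod: "(\<And>i. i \<in> A \<Longrightarrow> f i \<in> supp V) \<Longrightarrow> (\<Prod>i\<in>A. f i) \<in> supp V"
  by (induction A rule: infinite_finite_induct) (auto intro: supp_mult)

lemma supp_power: "f \<in> supp V \<Longrightarrow> f ^ k \<in> supp V"
  by (induction k) (auto intro: supp_mult)

lemma supp_of_nat: "of_nat k \<in> supp V"
  by (induction k) (auto intro: supp_add)

lemma supp_subst:
  assumes "\<And>i. i \<in> V \<Longrightarrow> h i \<in> supp B"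
  shows "mps_subst V h f \<in> supp B"
  unfolding supp_def
proof (intro CollectI allI impI)
  fix m assume "mps_nth (mps_subst V h f) m \<noteq> 0"
  then obtain m' where "mps_nth (\<Prod>i\<in>V. h i ^ Poly_Mapping.lookup m' i) m \<noteq> 0"
    unfolding mps_subst_def mps_nth_Abs by (elim sum.not_neutral_contains_not_neutral) auto
  moreover have "(\<Prod>i\<in>V. h i ^ Poly_Mapping.lookup m' i) \<in> supp B"
    using assms by (intro supp_prod supp_power)
  ultimately show "Poly_Mapping.keys m \<subseteq> B" by (simp add: supp_def)
qed

section \<open>The Stanley--Reisner ideal\<close>

lemma power_series_ring_simps [simp]:
  "carrier (power_series_ring V) = supp V"
  "x \<otimes>\<^bsub>power_series_ring V\<^esub> y = x * y" "\<one>\<^bsub>power_series_ring V\<^esub> = 1" "\<zero>\<^bsub>power_series_ring V\<^esub> = 0"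
  "x \<oplus>\<^bsub>power_series_ring V\<^esub> y = x + y"
  by (simp_all add: power_series_ring_def supp_def)

lemma cring_power_series_ring: "cring (power_series_ring V)"
proof (rule cringI)
  show "abelian_group (power_series_ring V)"
  proof (rule abelian_groupI)
    fix x assume "x \<in> carrier (power_series_ring V)"
    then show "\<exists>y\<in>carrier (power_series_ring V). y \<oplus>\<^bsub>power_series_ring V\<^esub> x = \<zero>\<^bsub>power_series_ring V\<^esub>"
      by (auto intro!: bexI[of _ "- x"] supp_uminus)
  qed (auto intro: supp_add)
  show "comm_monoid (power_series_ring V)"
    by (rule comm_monoidI) (auto intro: supp_mult simp: mult_ac)
qed (simp add: distrib_right)

locale finite_complex =
  fixes \<Delta> :: "('i, 'v::real_vector) multi_fan"
  assumes fin_verts: "finite (verts \<Delta>)"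
    and sub_closed: "J \<in> simplices \<Delta> \<Longrightarrow> K \<subseteq> J \<Longrightarrow> K \<in> simplices \<Delta>"
begin

text \<open>An explicit form of the Stanley-Reisner ideal: the series without any monomial supported
  on a simplex.\<close>

definition sr_zero :: "('i, complex) mps set" where
  "sr_zero = {f \<in> supp (verts \<Delta>). \<forall>m. Poly_Mapping.keys m \<in> simplices \<Delta> \<longrightarrow> mps_nth f m = 0}"

lemma sr_zero_add: "f \<in> sr_zero \<Longrightarrow> g \<in> sr_zero \<Longrightarrow> f + g \<in> sr_zero"
  and sr_zero_uminus: "f \<in> sr_zero \<Longrightarrow> - f \<in> sr_zero"
  and sr_zero_0: "0 \<in> sr_zero"
  by (auto simp: sr_zero_def mps_nth_simps intro: supp_add supp_uminus)

lemma sr_zero_mult: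
  assumes "f \<in> sr_zero" "g \<in> supp (verts \<Delta>)" shows "g * f \<in> sr_zero"
proof -
  have "mps_nth (g * f) m = 0" if m: "Poly_Mapping.keys m \<in> simplices \<Delta>" for m
    unfolding times_mps.rep_eq
  proof (rule sum.neutral, rule ballI)
    fix p assume "p \<in> {(a, b). a + b = m}"
    then obtain a b where p: "p = (a, b)" "a + b = m" by auto
    then have "Poly_Mapping.keys b \<subseteq> Poly_Mapping.keys m" using keys_add_nat[of a b] by auto
    then have "Poly_Mapping.keys b \<in> simplices \<Delta>" using sub_closed[OF m] by simp
    then show "(case p of (a, b) \<Rightarrow> mps_nth g a * mps_nth f b) = 0"
      using assms(1) p by (simp add: sr_zero_def)
  qed
  then show ?thesis using assms by (auto simp: sr_zero_def intro: supp_mult)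
qed

definition nonfaces :: "'i set set" where
  "nonfaces = {J. J \<subseteq> verts \<Delta> \<and> J \<notin> simplices \<Delta>}"

lemma finite_nonfaces: "finite nonfaces"
  using fin_verts by (auto simp: nonfaces_def)

definition unit_mon :: "'i set \<Rightarrow> 'i \<Rightarrow>\<^sub>0 nat" where
  "unit_mon J = (\<Sum>i\<in>J. Poly_Mapping.single i 1)"

lemma lookup_unit_mon: "finite J \<Longrightarrow> Poly_Mapping.lookup (unit_mon J) i = (if i \<in> J then 1 else 0)"
  unfolding unit_mon_def by (induction J rule: finite_induct) (auto simp: lookup_add lookup_single when_def)

lemma keys_unit_mon: "finite J \<Longrightarrow> Poly_Mapping.keys (unit_mon J) = J"
  by (auto simp: in_keys_iff lookup_unit_mon split: if_splits)

lemma prod_var_nth: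
  "finite J \<Longrightarrow> mps_nth ((\<Prod>i\<in>J. mps_var i) * g) m =
     (\<Sum>(a, b) | a + b = m. if a = unit_mon J then mps_nth (g :: ('i, complex) mps) b else 0)"
proof -
  assume J: "finite J"
  have 1: "mps_nth (\<Prod>i\<in>J. mps_var i :: ('i, complex) mps) a = (if a = unit_mon J then 1 else 0)" for a
    using J
  proof (induction J arbitrary: a rule: finite_induct)
    case empty
    show ?case by (simp add: unit_mon_def mps_nth_simps)
  next
    case (insert i J)
    define s where "s = Poly_Mapping.single i (1::nat)"
    have var: "mps_nth (mps_var i :: ('i, complex) mps) x = (if x = s then 1 else 0)" for x
      by (simp add: mps_var_def s_def)
    have "mps_nth (mps_var i * (\<Prod>i\<in>J. mps_var i) :: ('i, complex) mps) a =
        (\<Sum>p | fst p + snd p = a. if p = (s, unit_mon J) then 1 else 0)"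
      unfolding times_mps.rep_eq
    proof (rule sum.cong)
      fix p assume "p \<in> {p. fst p + snd p = a}"
      obtain x y where p: "p = (x, y)" by (cases p)
      show "(case p of (b, c) \<Rightarrow> mps_nth (mps_var i :: ('i, complex) mps) b *
          mps_nth (\<Prod>i\<in>J. mps_var i :: ('i, complex) mps) c) = (if p = (s, unit_mon J) then 1 else 0)"
        unfolding p prod.case var insert.IH by simp
    qed auto
    also have "\<dots> = (if s + unit_mon J = a then 1 else 0)"
      using finite_monomial_pairs[of a] by (simp add: case_prod_unfold)
    also have "s + unit_mon J = unit_mon (insert i J)"
      using insert.hyps by (simp add: unit_mon_def s_def)
    finally show ?case using insert.hyps by auto
  qed
  show ?thesis unfolding times_mps.rep_eq by (rule sum.cong) (auto simp: 1)
qed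

lemma sr_generator_in: "J \<in> nonfaces \<Longrightarrow> (\<Prod>i\<in>J. mps_var i) \<in> sr_zero"
proof -
  assume J: "J \<in> nonfaces"
  then have fJ: "finite J" using fin_verts finite_subset by (auto simp: nonfaces_def)
  have "mps_nth (\<Prod>i\<in>J. mps_var i :: ('i, complex) mps) m = 0" if "Poly_Mapping.keys m \<in> simplices \<Delta>" for m
  proof -
    have "(if a = unit_mon J then mps_nth (1 :: ('i, complex) mps) b else 0) = 0" if "a + b = m" for a b
    proof -
      have "a = unit_mon J \<Longrightarrow> b = 0 \<Longrightarrow> Poly_Mapping.keys m = J" using \<open>a + b = m\<close> keys_unit_mon[OF fJ] by auto
      then show ?thesis using J \<open>Poly_Mapping.keys m \<in> simplices \<Delta>\<close> by (auto simp: nonfaces_def mps_nth_simps)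
    qed
    then have "mps_nth ((\<Prod>i\<in>J. mps_var i) * 1 :: ('i, complex) mps) m = 0"
      unfolding prod_var_nth[OF fJ] by (intro sum.neutral) auto
    then show ?thesis by simp
  qed
  moreover have "(\<Prod>i\<in>J. mps_var i) \<in> supp (verts \<Delta>)"
    using J by (intro supp_prod supp_var) (auto simp: nonfaces_def)
  ultimately show ?thesis by (simp add: sr_zero_def)
qed

text \<open>The monomials are sorted by their exact support \<open>J\<close>, a nonface, and divided
  by the product of the variables in \<open>J\<close>. There are only finitely many supports, so an
  infinite series still needs only finitely many generators.\<close>

lemma sr_zero_decomp:
  assumes f: "f \<in> sr_zero"
  shows "\<exists>g. (\<forall>J\<in>nonfaces. g J \<in> supp (verts \<Delta>)) \<and> f = (\<Sum>J\<in>nonfaces. (\<Prod>i\<in>J. mps_var i) * g J)"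
proof -
  define g :: "'i set \<Rightarrow> ('i, complex) mps" where
    "g = (\<lambda>J. Abs_mps (\<lambda>b. if Poly_Mapping.keys (unit_mon J + b) = J then mps_nth f (unit_mon J + b) else 0))"
  have fJ: "finite J" if "J \<in> nonfaces" for J
    using that fin_verts finite_subset by (auto simp: nonfaces_def)
  have gsupp: "g J \<in> supp (verts \<Delta>)" if "J \<in> nonfaces" for J
    unfolding supp_def
  proof (intro CollectI allI impI)
    fix m assume "mps_nth (g J) m \<noteq> 0"
    then have "Poly_Mapping.keys (unit_mon J + m) = J" by (auto simp: g_def split: if_splits)
    then show "Poly_Mapping.keys m \<subseteq> verts \<Delta>" using that by (auto simp: nonfaces_def keys_add_nat)
  qed
  have term_nth: "mps_nth ((\<Prod>i\<in>J. mps_var i) * g J) m = (if Poly_Mapping.keys m = J then mps_nth f m else 0)"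
    if J: "J \<in> nonfaces" for J m
  proof (cases "Poly_Mapping.keys m = J")
    case True
    define b where "b = m - unit_mon J"
    have mb: "unit_mon J + b = m"
    proof (rule poly_mapping_eqI)
      fix i
      have "i \<in> J \<Longrightarrow> Poly_Mapping.lookup m i \<ge> 1" using True by (auto simp: in_keys_iff)
      then show "Poly_Mapping.lookup (unit_mon J + b) i = Poly_Mapping.lookup m i"
        by (simp add: b_def lookup_add lookup_minus lookup_unit_mon[OF fJ[OF J]])
    qed
    have "(\<Sum>(a, b) | a + b = m. if a = unit_mon J then mps_nth (g J) b else 0) =
      (\<Sum>p | fst p + snd p = m. if p = (unit_mon J, b) then mps_nth f m else 0)"
    proof (rule sum.cong)
      fix p assume "p \<in> {p. fst p + snd p = m}"
      moreover obtain a c where p: "p = (a, c)" by (cases p)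
      ultimately have ac: "a + c = m" by simp
      show "(case p of (a, b) \<Rightarrow> if a = unit_mon J then mps_nth (g J) b else 0) = (if p = (unit_mon J, b) then mps_nth f m else 0)"
      proof (cases "a = unit_mon J")
        case a: True
        then have "c = b" using ac mb by (metis add_left_cancel)
        then show ?thesis using a p mb True by (simp add: g_def)
      qed (simp add: p)
    qed (auto simp: case_prod_unfold)
    also have "\<dots> = mps_nth f m"
      using finite_monomial_pairs[of m] mb by (simp add: case_prod_unfold)
    finally show ?thesis using True unfolding prod_var_nth[OF fJ[OF J]] by simp
  next
    case False
    have "(case p of (a, b) \<Rightarrow> if a = unit_mon J then mps_nth (g J) b else 0) = 0" if "p \<in> {(a, b). a + b = m}" for p
      using that False by (auto simp: g_def split: if_splits)
    then show ?thesis unfolding prod_var_nth[OF fJ[OF J]] using False by (simp add: sum.neutral)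
  qed
  have "f = (\<Sum>J\<in>nonfaces. (\<Prod>i\<in>J. mps_var i) * g J)"
  proof (rule mps_eqI)
    fix m
    have "mps_nth (\<Sum>J\<in>nonfaces. (\<Prod>i\<in>J. mps_var i) * g J) m = (\<Sum>J\<in>nonfaces. if Poly_Mapping.keys m = J then mps_nth f m else 0)"
      unfolding mps_nth_sum by (rule sum.cong[OF refl]) (rule term_nth)
    also have "\<dots> = (if Poly_Mapping.keys m \<in> nonfaces then mps_nth f m else 0)"
      using finite_nonfaces by simp
    also have "\<dots> = mps_nth f m"
      using f by (auto simp: sr_zero_def nonfaces_def supp_def)
    finally show "mps_nth f m = mps_nth (\<Sum>J\<in>nonfaces. (\<Prod>i\<in>J. mps_var i) * g J) m" by simp
  qed
  then show ?thesis using gsupp by blast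
qed

lemma SR_ideal_eq: "SR_ideal \<Delta> = sr_zero"
proof -
  let ?R = "power_series_ring (verts \<Delta>)"
  interpret R: cring ?R by (rule cring_power_series_ring)
  let ?S = "{\<Prod>i\<in>J. mps_var i | J. J \<subseteq> verts \<Delta> \<and> J \<notin> simplices \<Delta>} :: ('i, complex) mps set"
  have idl: "ideal sr_zero ?R"
  proof (rule idealI)
    show "ring ?R" by (rule R.ring_axioms)
    show "subgroup sr_zero (add_monoid ?R)"
    proof (rule R.add.subgroupI)
      show "sr_zero \<subseteq> carrier ?R" by (auto simp: sr_zero_def)
      show "sr_zero \<noteq> {}" using sr_zero_0 by auto
      show "\<ominus>\<^bsub>?R\<^esub> a \<in> sr_zero" if a: "a \<in> sr_zero" for a
      proof -
        have "a \<in> supp (verts \<Delta>)" using a by (simp add: sr_zero_def)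
        then have "\<ominus>\<^bsub>?R\<^esub> a = - a"
          using R.add.inv_equality[of "- a" a] supp_uminus[of a] by simp
        then show ?thesis using sr_zero_uminus[OF a] by simp
      qed
      show "a \<oplus>\<^bsub>?R\<^esub> b \<in> sr_zero" if "a \<in> sr_zero" "b \<in> sr_zero" for a b using sr_zero_add[OF that] by simp
    qed
    show "x \<otimes>\<^bsub>?R\<^esub> a \<in> sr_zero" "a \<otimes>\<^bsub>?R\<^esub> x \<in> sr_zero" if "a \<in> sr_zero" "x \<in> carrier ?R" for a x
      using sr_zero_mult[of a x] that by (simp_all add: mult.commute)
  qed
  have "genideal ?R ?S \<subseteq> sr_zero"
    by (rule R.genideal_minimal[OF idl]) (use sr_generator_in in \<open>auto simp: nonfaces_def\<close>)
  moreover have "sr_zero \<subseteq> genideal ?R ?S"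
  proof
    fix f assume "f \<in> sr_zero"
    then obtain g where g: "\<forall>J\<in>nonfaces. g J \<in> supp (verts \<Delta>)" "f = (\<Sum>J\<in>nonfaces. (\<Prod>i\<in>J. mps_var i) * g J)"
      using sr_zero_decomp by blast
    have Ssub: "?S \<subseteq> carrier ?R" by (auto intro!: supp_prod supp_var)
    interpret I: ideal "genideal ?R ?S" ?R by (rule R.genideal_ideal[OF Ssub])
    have "(\<Sum>J\<in>A. (\<Prod>i\<in>J. mps_var i) * g J) \<in> genideal ?R ?S" if "A \<subseteq> nonfaces" for A
      using finite_subset[OF that finite_nonfaces] that
    proof (induction A rule: finite_induct)
      case empty
      show ?case using I.zero_closed by simp
    next
      case (insert J A)
      have "(\<Prod>i\<in>J. mps_var i) \<in> ?S" using insert.prems by (auto simp: nonfaces_def)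
      then have "(\<Prod>i\<in>J. mps_var i) \<in> genideal ?R ?S" using R.genideal_self[OF Ssub] by (rule subsetD[rotated])
      then have "(\<Prod>i\<in>J. mps_var i) * g J \<in> genideal ?R ?S"
        using I.I_r_closed[of "\<Prod>i\<in>J. mps_var i" "g J"] g(1) insert.prems by simp
      then show ?case using insert I.a_closed[of "(\<Prod>i\<in>J. mps_var i) * g J" "\<Sum>J\<in>A. (\<Prod>i\<in>J. mps_var i) * g J"] by simp
    qed
    then show "f \<in> genideal ?R ?S" using g(2) by simp
  qed
  ultimately show ?thesis unfolding SR_ideal_def by (rule equalityI)
qed

lemma HT_class_eq: "HT_class \<Delta> f = (\<lambda>h. h + f) ` sr_zero"
  unfolding HT_class_def SR_ideal_eq a_r_coset_def r_coset_def by (auto simp: power_series_ring_def)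

lemma HT_carrier: "carrier (HT_ring \<Delta>) = HT_class \<Delta> ` supp (verts \<Delta>)"
  unfolding HT_ring_def FactRing_def A_RCOSETS_def' HT_class_def by auto

lemma HT_class_cong:
  assumes "f - g \<in> sr_zero" shows "HT_class \<Delta> f = HT_class \<Delta> g"
proof -
  have "HT_class \<Delta> f \<subseteq> HT_class \<Delta> g" if "f - g \<in> sr_zero" for f g
  proof
    fix x assume "x \<in> HT_class \<Delta> f"
    then obtain h where h: "h \<in> sr_zero" "x = h + f" unfolding HT_class_eq by auto
    then have "x = (h + (f - g)) + g" by simp
    then show "x \<in> HT_class \<Delta> g" unfolding HT_class_eq using sr_zero_add[OF h(1) that] by blast
  qed
  moreover have "g - f \<in> sr_zero" using sr_zero_uminus[OF assms] by simp
  ultimately show ?thesis using assms by blast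
qed

text \<open>A monomial whose support is no simplex involves a variable outside \<open>I\<close>, and
  this variable is sent to 0. So the substitution is constant on the class and
  \<open>the_elem\<close> is meaningful.\<close>

lemma iota_HT_class:
  assumes I: "I \<in> simplices \<Delta>"
  shows "iota B \<Delta> v I (HT_class \<Delta> f) = iota_series B \<Delta> v I f"
proof -
  have "iota_series B \<Delta> v I (h + f) = iota_series B \<Delta> v I f" if h: "h \<in> sr_zero" for h
  proof (rule mps_eqI)
    fix m
    let ?P = "\<lambda>m'. \<Prod>i\<in>verts \<Delta>. (if i \<in> I then lin_form B (dual_vec v I i) else 0) ^ Poly_Mapping.lookup m' i"
    have z: "mps_nth h m' * mps_nth (?P m') m = 0" for m'
    proof (cases "mps_nth h m' = 0")
      case False
      then have k: "Poly_Mapping.keys m' \<notin> simplices \<Delta>" "Poly_Mapping.keys m' \<subseteq> verts \<Delta>"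
        using h by (auto simp: sr_zero_def supp_def)
      then obtain i where i: "i \<in> Poly_Mapping.keys m'" "i \<notin> I" using sub_closed[OF I] by blast
      have "?P m' = 0"
        by (rule prod_zero[OF fin_verts]) (use i k in \<open>auto simp: in_keys_iff intro!: bexI[of _ i]\<close>)
      then show ?thesis by (simp add: mps_nth_simps)
    qed simp
    show "mps_nth (iota_series B \<Delta> v I (h + f)) m = mps_nth (iota_series B \<Delta> v I f) m"
      unfolding iota_series_def mps_subst_def mps_nth_Abs mps_nth_simps distrib_right z add_0 ..
  qed
  then have "iota_series B \<Delta> v I ` HT_class \<Delta> f = {iota_series B \<Delta> v I f}"
    unfolding HT_class_eq using sr_zero_0 by auto
  then show ?thesis by (simp add: iota_def)
qed

end

section \<open>Laurent expansions of the Kronecker coefficients\<close>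

text \<open>The coefficient \<open>T\<close> of \<open>t = T s^e\<close> in the field of Laurent
  series in \<open>x\<close>.\<close>

definition exp_root :: "real \<Rightarrow> complex fls" where
  "exp_root b = fps_to_fls (fps_exp (- 1)) * fls_const (cis (- 2 * pi * b))"

lemma exp_root_nth: "fls_nth (exp_root b) (int n) = (- 1) ^ n / fact n * cis (- 2 * pi * b)"
  "j < 0 \<Longrightarrow> fls_nth (exp_root b) j = 0"
  by (simp_all add: exp_root_def)

lemma exp_root_0: "fls_nth (exp_root b) 0 = cis (- 2 * pi * b)"
  and exp_root_1: "fls_nth (exp_root b) 1 = - cis (- 2 * pi * b)"
  using exp_root_nth(1)[of b 0] exp_root_nth(1)[of b 1] by simp_all

lemma exp_root_nonzero [simp]: "exp_root b \<noteq> 0"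
  using exp_root_0[of b] by auto

text \<open>The exponential is not constant: its linear coefficient survives. For formal
  \<open>x\<close> this supplies the conditions \<open>T \<noteq> 1\<close> and
  \<open>z * T \<noteq> 1\<close> of the Kronecker expansion.\<close>

lemma const_times_exp_root_ne_1: "c \<noteq> 0 \<Longrightarrow> fls_const c * exp_root b \<noteq> 1"
proof
  assume c: "c \<noteq> 0" and eq: "fls_const c * exp_root b = 1"
  have "fls_nth (fls_const c * exp_root b) 1 = 0" unfolding eq by simp
  then show False using c by (simp add: exp_root_1)
qed

text \<open>Kronecker's identity with Laurent series in \<open>x\<close> as coefficient
  field.\<close>

lemma phi_expansion_nth:
  assumes N: "N > 0" and a: "0 \<le> a" "a < 1" "real N * a \<in> \<int>" and z: "zeta_pow \<sigma> c \<noteq> 1"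
  shows "fls_nth (phi_expansion N a b \<sigma> c) (int r) =
    kronecker_coeff N (nat \<lfloor>real N * a\<rfloor>) (fls_const (zeta_pow \<sigma> c)) (exp_root b) r"
proof -
  define e where "e = nat \<lfloor>real N * a\<rfloor>"
  have "real N * a \<ge> 0" using a by simp
  then have e: "int e = \<lfloor>real N * a\<rfloor>" by (simp add: e_def)
  then have "real e = real N * a" using a(3) by (metis of_int_floor of_int_of_nat_eq)
  moreover have "real N * a < real N" using N a by simp
  ultimately have eN: "e < N" by (metis of_nat_less_iff)
  interpret kronecker N e "exp_root b" "fls_const (zeta_pow \<sigma> c)"
  proof
    show "fls_const (zeta_pow \<sigma> c) \<noteq> 1"
    proof
      assume eq: "fls_const (zeta_pow \<sigma> c) = 1"
      have "fls_nth (fls_const (zeta_pow \<sigma> c)) 0 = 1" unfolding eq by simp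
      then show False using z by simp
    qed
    show "fls_const (zeta_pow \<sigma> c) \<noteq> 0"
    proof
      assume eq: "fls_const (zeta_pow \<sigma> c) = 0"
      have "fls_nth (fls_const (zeta_pow \<sigma> c)) 0 = 0" unfolding eq by simp
      then show False by simp
    qed
    show "exp_root b \<noteq> 1" using const_times_exp_root_ne_1[of 1 b] by simp
  qed (use eN in auto)
  have t: "t = fls_const (exp_root b) * fls_X_intpow \<lfloor>real N * a\<rfloor>"
    by (simp add: t_def fls_monom_def e)
  have X1: "(fls_X :: complex fls fls) = fls_monom 1 1" by (rule fls_eqI) simp
  have Q: "Q = fls_X ^ N" unfolding X1 fls_monom_power by (simp add: Q_def)
  have Z: "Z = fls_const (fls_const (zeta_pow \<sigma> c))" by (simp add: Z_def fls_monom_def)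
  have "phi_expansion N a b \<sigma> c = phi_st (fls_const (exp_root b) * fls_X_intpow \<lfloor>real N * a\<rfloor>)
      (fls_X ^ N) (fls_const (fls_const (zeta_pow \<sigma> c)))"
    unfolding phi_expansion_def exp_root_def ..
  then have "phi_expansion N a b \<sigma> c = phi_st t Q Z"
    unfolding t[symmetric] Q[symmetric] Z[symmetric] .
  then show ?thesis
    unfolding e_def[symmetric] using phi_st_nth[of r] const_times_exp_root_ne_1[of "zeta_pow \<sigma> c" b] by simp
qed

lemma has_laurent_expansion_if:
  "(P \<Longrightarrow> f has_laurent_expansion F) \<Longrightarrow> (\<not> P \<Longrightarrow> g has_laurent_expansion G) \<Longrightarrow>
    (\<lambda>x. if P then f x else g x) has_laurent_expansion (if P then F else G)"
  by auto

lemma exp_root_expansion: "(\<lambda>x. exp (- x) * cis (- 2 * pi * b)) has_laurent_expansion exp_root b"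
proof -
  have "(\<lambda>x :: complex. exp (- 1 * x)) has_fps_expansion fps_exp (- 1)" by (rule has_fps_expansion_exp)
  then have "(\<lambda>x :: complex. exp (- x)) has_laurent_expansion fps_to_fls (fps_exp (- 1))"
    using has_laurent_expansion_fps by fastforce
  then show ?thesis unfolding exp_root_def by (intro has_laurent_expansion_mult has_laurent_expansion_const)
qed

text \<open>\<open>kronecker_coeff\<close> is a rational expression in \<open>T\<close>, so its
  formal value at \<open>exp_root b\<close> is the Laurent expansion of its analytic value. This is
  the passage from formal series to functions.\<close>

lemma kronecker_coeff_expansion:
  "(\<lambda>x. kronecker_coeff N e z (exp (- x) * cis (- 2 * pi * b)) r) has_laurent_expansion
     kronecker_coeff N e (fls_const z) (exp_root b) r"
  unfolding kronecker_coeff_def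
  by (intro has_laurent_expansion_add has_laurent_expansion_diff has_laurent_expansion_sum has_laurent_expansion_if
      has_laurent_expansion_mult has_laurent_expansion_power has_laurent_expansion_inverse has_laurent_expansion_divide
      exp_root_expansion has_laurent_expansion_const has_laurent_expansion_1 has_laurent_expansion_0)

lemma fls_ge_power: "fls_ge 0 f \<Longrightarrow> fls_ge 0 (f ^ k)" for f :: "'a::field fls"
proof (induction k)
  case 0
  show ?case by (simp add: fls_ge_1)
next
  case (Suc k)
  then show ?case using fls_ge_mult[of 0 f 0 "f ^ k"] by simp
qed

lemma exp_root_ge: "fls_ge 0 (exp_root b)" "fls_ge 0 (inverse (exp_root b))" "fls_subdegree (exp_root b) = 0"
proof -
  show "fls_subdegree (exp_root b) = 0"
    by (rule fls_subdegree_eqI) (use exp_root_0 exp_root_nth(2) in auto)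
  then show "fls_ge 0 (exp_root b)" "fls_ge 0 (inverse (exp_root b))"
    by (simp_all add: fls_ge_iff fls_inverse_subdegree)
qed

lemma fls_ge_const: "fls_ge 0 (fls_const c)"
  by (simp add: fls_ge_def)

text \<open>Only \<open>T / (1 - T)\<close> can have a pole at \<open>x = 0\<close>; all else is
  built from constants, powers of \<open>T\<close> and powers of its inverse.\<close>

lemma kronecker_coeff_split:
  assumes e: "e < N"
  obtains h where "fls_ge 0 h" "kronecker_coeff N e (fls_const z) (exp_root b) r =
     h + (if r = 0 \<and> e = 0 then exp_root b / (1 - exp_root b) else 0)"
proof
  define h where "h = (if r = 0 then 1 / (1 - fls_const z) else 0) +
     (if e = 0 then 0 else \<Sum>k=1..r. if k * e = r then exp_root b ^ k else 0) +
     (\<Sum>l=1..r. \<Sum>k=1..r. (if k * (N * l + e) = r then fls_const z ^ l * exp_root b ^ k else 0) -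
        (if k * (N * l - e) = r then inverse (fls_const z) ^ l * inverse (exp_root b) ^ k else 0))"
  show "kronecker_coeff N e (fls_const z) (exp_root b) r =
     h + (if r = 0 \<and> e = 0 then exp_root b / (1 - exp_root b) else 0)"
    by (simp add: kronecker_coeff_def h_def)
  have m: "fls_ge 0 (f * g)" if "fls_ge 0 f" "fls_ge 0 g" for f g :: "complex fls"
    using fls_ge_mult[OF that] by simp
  have c: "1 / (1 - fls_const z) = fls_const (1 / (1 - z))"
    by (simp add: fls_const_divide_const[symmetric] fls_minus_const[symmetric] del: fls_const_divide_const)
  have "inverse (fls_const z) = fls_const (inverse z)" by (simp add: fls_inverse_const)
  then show "fls_ge 0 h"
    unfolding h_def c
    by (auto intro!: fls_ge_add fls_ge_diff fls_ge_sum m fls_ge_power exp_root_ge fls_ge_const)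
qed

text \<open>\<open>1 - T\<close> vanishes at \<open>x = 0\<close> exactly if \<open>b = 0\<close>,
  and then to first order with derivative 1, so that the quotient behaves like
  \<open>1 / x\<close>.\<close>

lemma root_quotient:
  assumes b: "0 \<le> b" "b < 1"
  shows "b \<noteq> 0 \<Longrightarrow> fls_ge 0 (exp_root b / (1 - exp_root b))"
    "fls_ge (- 1) (exp_root b / (1 - exp_root b))"
    "b = 0 \<Longrightarrow> fls_nth (exp_root b / (1 - exp_root b)) (- 1) = 1"
proof -
  have D0: "fls_nth (1 - exp_root b) 0 = 1 - cis (- 2 * pi * b)" by (simp add: exp_root_0)
  have Dn: "fls_nth (1 - exp_root b) j = 0" if "j < 0" for j using that by (simp add: exp_root_nth(2))
  have D1: "fls_nth (1 - exp_root b) 1 \<noteq> 0" by (simp add: exp_root_1)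
  have sub0: "fls_subdegree (1 - exp_root b) = 0" if "b \<noteq> 0"
  proof -
    have "cis (- 2 * pi * b) \<noteq> 1"
    proof
      assume "cis (- 2 * pi * b) = 1"
      then have "cos (2 * pi * b) = 1" by (simp add: complex_eq_iff)
      then obtain x :: int where "2 * pi * b = of_int x * 2 * pi" by (auto simp: cos_one_2pi_int)
      then have "b = of_int x" by simp
      then show False using b that by simp
    qed
    then show ?thesis using D0 Dn by (intro fls_subdegree_eqI) auto
  qed
  have sub1: "fls_subdegree (1 - exp_root b) = 1" if "b = 0"
  proof (rule fls_subdegree_eqI[OF D1])
    fix j :: int assume "j < 1"
    then consider "j = 0" | "j < 0" by linarith
    then show "fls_nth (1 - exp_root b) j = 0" by cases (use D0 Dn that in auto)
  qed
  have nz: "1 - exp_root b \<noteq> 0" using D1 by auto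
  have sd: "fls_subdegree (exp_root b / (1 - exp_root b)) = - fls_subdegree (1 - exp_root b)"
    using nz exp_root_ge(3)[of b] by (simp add: fls_divide_subdegree)
  show "b \<noteq> 0 \<Longrightarrow> fls_ge 0 (exp_root b / (1 - exp_root b))" using sub0 sd by (simp add: fls_ge_iff)
  show "fls_ge (- 1) (exp_root b / (1 - exp_root b))" using sub0 sub1 sd by (cases "b = 0") (auto simp: fls_ge_iff)
  show "fls_nth (exp_root b / (1 - exp_root b)) (- 1) = 1" if "b = 0"
  proof -
    define q where "q = exp_root b / (1 - exp_root b)"
    have q: "q * (1 - exp_root b) = exp_root b" using nz by (simp add: q_def)
    \<comment> \<open>The leading coefficients of a product multiply, which gives the residue
      without any further coefficient.\<close>
    have "fls_nth (q * (1 - exp_root b)) (fls_subdegree q + fls_subdegree (1 - exp_root b)) =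
        fls_nth q (fls_subdegree q) * fls_nth (1 - exp_root b) (fls_subdegree (1 - exp_root b))"
      by (rule fls_times_base)
    then have "fls_nth (exp_root b) 0 = fls_nth q (- 1) * fls_nth (1 - exp_root b) 1"
      unfolding q using sd sub1[OF that] by (simp add: q_def)
    moreover have "fls_nth (exp_root b) 0 = 1" "fls_nth (1 - exp_root b) 1 = 1"
      using that by (simp_all add: exp_root_0 exp_root_1)
    ultimately have "fls_nth q (- 1) = 1" by (metis mult_1_right)
    then show ?thesis unfolding q_def .
  qed
qed

lemma regpart_eqI: "fls_ge 0 f \<Longrightarrow> fps_to_fls (fls_regpart f) = f"
  by (rule fls_eqI) (auto simp: fls_ge_def)

definition x_kronecker :: "nat \<Rightarrow> nat \<Rightarrow> complex \<Rightarrow> real \<Rightarrow> nat \<Rightarrow> complex fps" where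
  "x_kronecker N e z b r = fls_regpart (fls_X * kronecker_coeff N e (fls_const z) (exp_root b) r)"

text \<open>The factor \<open>x\<close> cancels the simple pole, so taking the regular part loses
  nothing. The constant term is the residue: it is 1 if \<open>r\<close>, \<open>e\<close> and
  \<open>b\<close> all vanish and 0 otherwise, which makes the vertices outside a simplex drop out
  of the local contributions.\<close>

lemma x_kronecker_props:
  assumes e: "e < N" and b: "0 \<le> b" "b < 1"
  shows "fps_to_fls (x_kronecker N e z b r) = fls_X * kronecker_coeff N e (fls_const z) (exp_root b) r"
    "fps_nth (x_kronecker N e z b r) 0 = (if r = 0 \<and> e = 0 \<and> b = 0 then 1 else 0)"
proof -
  obtain h where h: "fls_ge 0 h" "kronecker_coeff N e (fls_const z) (exp_root b) r =
     h + (if r = 0 \<and> e = 0 then exp_root b / (1 - exp_root b) else 0)"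
    using kronecker_coeff_split[OF e] by blast
  define k where "k = kronecker_coeff N e (fls_const z) (exp_root b) r"
  have "fls_ge (- 1) k" unfolding k_def h(2)
    using h(1) root_quotient(2)[OF b] by (auto intro!: fls_ge_add intro: fls_ge_mono)
  then have "fls_ge 0 (fls_X * k)" using fls_ge_mult[of 1 fls_X "- 1" k] by (simp add: fls_ge_def)
  then show "fps_to_fls (x_kronecker N e z b r) = fls_X * kronecker_coeff N e (fls_const z) (exp_root b) r"
    unfolding x_kronecker_def k_def by (rule regpart_eqI)
  have "fps_nth (x_kronecker N e z b r) 0 = fls_nth (fls_X * k) 0" by (simp add: x_kronecker_def k_def)
  also have "\<dots> = fls_nth k (- 1)" by (simp add: fls_X_times_conv_shift)
  also have "\<dots> = (if r = 0 \<and> e = 0 \<and> b = 0 then 1 else 0)"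
    unfolding k_def h(2) using h(1) root_quotient(1)[OF b] root_quotient(3)[OF b] by (auto simp: fls_ge_def)
  finally show "fps_nth (x_kronecker N e z b r) 0 = (if r = 0 \<and> e = 0 \<and> b = 0 then 1 else 0)" .
qed

lemma has_laurent_expansion_rescale:
  assumes f: "f has_laurent_expansion fps_to_fls p" and c: "c \<noteq> 0"
  shows "(\<lambda>y. f (c * y)) has_laurent_expansion fps_to_fls (Abs_fps (\<lambda>k. fps_nth p k * c ^ k))"
proof -
  \<comment> \<open>A Laurent expansion says nothing about the value at 0, but composition of power
    series needs the right one, so it is patched.\<close>
  define g where "g = (\<lambda>x. if x = 0 then fps_nth p 0 else f x)"
  have "g has_laurent_expansion fps_to_fls p"
    using f by (subst has_laurent_expansion_cong[of g f]) (auto simp: g_def eventually_at_filter)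
  then have "g has_fps_expansion p" by (simp add: has_fps_expansion_to_laurent g_def)
  moreover have "(\<lambda>y. c * y) has_fps_expansion fps_const c * fps_X"
    by (intro fps_expansion_intros)
  ultimately have "(g \<circ> (\<lambda>y. c * y)) has_fps_expansion (p oo (fps_const c * fps_X))"
    by (intro has_fps_expansion_compose) auto
  then have "(g \<circ> (\<lambda>y. c * y)) has_laurent_expansion fps_to_fls (p oo (fps_const c * fps_X))"
    by (rule has_laurent_expansion_fps)
  moreover have "p oo (fps_const c * fps_X) = Abs_fps (\<lambda>k. fps_nth p k * c ^ k)"
    by (rule fps_ext) (simp add: fps_compose_linear)
  ultimately show ?thesis
    using c by (subst has_laurent_expansion_cong[of _ "g \<circ> (\<lambda>y. c * y)"]) (auto simp: g_def eventually_at_filter)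
qed

text \<open>A nonzero expansion would keep the function from vanishing in a punctured neighbourhood
  of 0.\<close>

lemma laurent_zero_of_positive_reals:
  assumes "f has_laurent_expansion F" "\<And>y :: real. y > 0 \<Longrightarrow> f (of_real y) = 0"
  shows "F = 0"
proof (rule ccontr)
  assume "F \<noteq> 0"
  then have "\<forall>\<^sub>F x in at 0. f x \<noteq> 0"
    by (rule has_laurent_expansion_nonzero_imp_eventually_nonzero[OF assms(1)])
  then obtain d where d: "d > 0" "\<And>x. x \<noteq> 0 \<Longrightarrow> dist x 0 < d \<Longrightarrow> f x \<noteq> 0"
    unfolding eventually_at by auto
  have "f (of_real (d / 2)) \<noteq> 0" using d(1) by (intro d(2)) auto
  then show False using assms(2)[of "d / 2"] d(1) by simp
qed

text \<open>Compares coefficientwise in \<open>s\<close> a family of complex series depending on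
  \<open>y\<close> with a series over power series in \<open>y\<close>. The value at
  \<open>y = 0\<close> is left free, because the functions there are products of zeros and
  poles.\<close>

definition fps_expands :: "(complex \<Rightarrow> complex fps) \<Rightarrow> complex fps fps \<Rightarrow> bool" where
  "fps_expands G H \<longleftrightarrow> (\<forall>r. (\<lambda>y. fps_nth (G y) r) has_laurent_expansion fps_to_fls (fps_nth H r))"

lemma fps_expands_mult: "fps_expands G H \<Longrightarrow> fps_expands G' H' \<Longrightarrow> fps_expands (\<lambda>y. G y * G' y) (H * H')"
  unfolding fps_expands_def fps_mult_nth fps_to_fls_sum fls_times_fps_to_fls
  by (intro allI has_laurent_expansion_sum has_laurent_expansion_mult) auto

lemma fps_expands_sum:
  "(\<And>i. i \<in> A \<Longrightarrow> fps_expands (G i) (H i)) \<Longrightarrow> fps_expands (\<lambda>y. \<Sum>i\<in>A. G i y) (\<Sum>i\<in>A. H i)"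
  unfolding fps_expands_def fps_sum_nth fps_to_fls_sum
  by (intro allI has_laurent_expansion_sum) auto

lemma fps_expands_const: "fps_expands (\<lambda>y. fps_const a) (fps_const (fps_const a))"
  unfolding fps_expands_def
proof
  fix r
  show "(\<lambda>y. fps_nth (fps_const a) r) has_laurent_expansion fps_to_fls (fps_nth (fps_const (fps_const a)) r)"
    by (cases "r = 0") auto
qed

lemma fps_expands_prod:
  assumes "finite A" "\<And>i. i \<in> A \<Longrightarrow> fps_expands (G i) (H i)"
  shows "fps_expands (\<lambda>y. \<Prod>i\<in>A. G i y) (\<Prod>i\<in>A. H i)"
  using assms
proof (induction A rule: finite_induct)
  case empty
  show ?case using fps_expands_const[of 1] by simp
next
  case (insert i A)
  then show ?case by (simp add: fps_expands_mult)
qed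

section \<open>Evaluating the elliptic class\<close>

definition map_ev :: "'i set \<Rightarrow> ('i \<Rightarrow> complex) \<Rightarrow> ('i, complex) mps fps \<Rightarrow> complex fps fps" where
  "map_ev V c F = Abs_fps (\<lambda>r. mps_ev V c (fps_nth F r))"

lemma map_ev_sum: "map_ev V c (\<Sum>i\<in>A. F i) = (\<Sum>i\<in>A. map_ev V c (F i))"
  by (rule fps_ext) (simp add: map_ev_def fps_sum_nth mps_ev_sum)

lemma map_ev_mult: "finite V \<Longrightarrow> map_ev V c (F * G) = map_ev V c F * map_ev V c G"
  by (rule fps_ext) (simp add: map_ev_def fps_mult_nth mps_ev_sum mps_ev_mult)

lemma map_ev_const: "finite V \<Longrightarrow> map_ev V c (fps_const (mps_const a)) = fps_const (fps_const a)"
  by (rule fps_ext) (simp add: map_ev_def mps_ev_const)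

lemma map_ev_prod: "finite V \<Longrightarrow> map_ev V c (\<Prod>i\<in>A. F i) = (\<Prod>i\<in>A. map_ev V c (F i))"
proof (induction A rule: infinite_finite_induct)
  case empty
  have "map_ev V c (fps_const (mps_const 1)) = fps_const (fps_const 1)" by (rule map_ev_const[OF empty])
  then show ?case by (simp add: mps_const_1)
next
  case (infinite A)
  have "map_ev V c (fps_const (mps_const 1)) = fps_const (fps_const 1)" by (rule map_ev_const[OF infinite(2)])
  then show ?case using infinite by (simp add: mps_const_1)
qed (simp add: map_ev_mult)

text \<open>On a vertex of the simplex the restriction is \<open>x\<close> times the Kronecker
  series at \<open>c i * y\<close>. On the other vertices \<open>c i = 0\<close> leaves only the
  constant term, which tests whether both group coordinates vanish.\<close>

lemma map_ev_x_phi: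
  assumes V: "finite V" "i \<in> V" and N: "N > 0" and a: "0 \<le> a" "a < 1" "real N * a \<in> \<int>"
    and b: "0 \<le> b" "b < 1" and z: "zeta_pow \<sigma> d \<noteq> 1"
  shows "c i \<noteq> 0 \<Longrightarrow> fps_expands (\<lambda>y. fps_const (c i * y) *
      Abs_fps (kronecker_coeff N (nat \<lfloor>real N * a\<rfloor>) (zeta_pow \<sigma> d) (exp (- (c i * y)) * cis (- 2 * pi * b))))
      (map_ev V c (x_phi N i a b \<sigma> d))"
    "c i = 0 \<Longrightarrow> map_ev V c (x_phi N i a b \<sigma> d) = (if a = 0 \<and> b = 0 then 1 else 0)"
proof -
  define e where "e = nat \<lfloor>real N * a\<rfloor>"
  have "real N * a \<ge> 0" using a by simp
  then have "real e = real N * a" using a(3) by (simp add: e_def)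
  moreover have "real N * a < real N" using N a by simp
  ultimately have eN: "e < N" and e0: "e = 0 \<longleftrightarrow> a = 0" using N by (metis of_nat_less_iff, auto)
  have ev: "fps_nth (map_ev V c (x_phi N i a b \<sigma> d)) r = Abs_fps (\<lambda>k. fps_nth (x_kronecker N e (zeta_pow \<sigma> d) b r) k * c i ^ k)" for r
    unfolding map_ev_def x_phi_def fps_nth_Abs_fps phi_expansion_nth[OF N a z] mps_ev_of_fps[OF V] x_kronecker_def e_def ..
  show "c i = 0 \<Longrightarrow> map_ev V c (x_phi N i a b \<sigma> d) = (if a = 0 \<and> b = 0 then 1 else 0)"
  proof (rule fps_ext, rule fps_ext)
    fix r k assume c0: "c i = 0"
    show "fps_nth (fps_nth (map_ev V c (x_phi N i a b \<sigma> d)) r) k =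
        fps_nth (fps_nth (if a = 0 \<and> b = 0 then 1 else 0) r) k"
      unfolding ev fps_nth_Abs_fps c0 using x_kronecker_props(2)[OF eN b, of "zeta_pow \<sigma> d" r] e0
      by (cases "k = 0") auto
  qed
  show "fps_expands (\<lambda>y. fps_const (c i * y) *
      Abs_fps (kronecker_coeff N (nat \<lfloor>real N * a\<rfloor>) (zeta_pow \<sigma> d) (exp (- (c i * y)) * cis (- 2 * pi * b))))
      (map_ev V c (x_phi N i a b \<sigma> d))" if c: "c i \<noteq> 0"
    unfolding fps_expands_def ev e_def[symmetric] fps_mult_left_const_nth fps_nth_Abs_fps
  proof
    fix r
    have "(\<lambda>x. x * kronecker_coeff N e (zeta_pow \<sigma> d) (exp (- x) * cis (- 2 * pi * b)) r) has_laurent_expansion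
        fps_to_fls (x_kronecker N e (zeta_pow \<sigma> d) b r)"
      unfolding x_kronecker_props(1)[OF eN b]
      by (intro has_laurent_expansion_mult has_laurent_expansion_fps_X kronecker_coeff_expansion)
    from has_laurent_expansion_rescale[OF this c]
    show "(\<lambda>y. c i * y * kronecker_coeff N e (zeta_pow \<sigma> d) (exp (- (c i * y)) * cis (- 2 * pi * b)) r) has_laurent_expansion
        fps_to_fls (Abs_fps (\<lambda>k. fps_nth (x_kronecker N e (zeta_pow \<sigma> d) b r) k * c i ^ k))" .
  qed
qed

locale elliptic_fan =
  fixes B L :: "'v::real_vector set" and n N :: nat
    and \<Delta> :: "('i, 'v) multi_fan" and v :: "'i \<Rightarrow> 'v" and d :: "'i \<Rightarrow> real" and \<sigma> :: complex
  assumes basis: "lattice_basis B L" "card B = n"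
    and mf: "simplicial_multi_fan L n \<Delta>" and ev: "edge_vectors L \<Delta> v"
    and qd: "q_denominator N L n \<Delta> v" and zne: "\<And>i. i \<in> verts \<Delta> \<Longrightarrow> zeta_pow \<sigma> (d i) \<noteq> 1"

sublocale elliptic_fan \<subseteq> finite_complex \<Delta>
proof
  have "finite ((\<lambda>i. {i}) ` verts \<Delta>)"
    using multi_fan_props(1)[OF mf] by (rule finite_subset[rotated]) (auto simp: verts_def)
  then show "finite (verts \<Delta>)" by (rule finite_imageD) (auto simp: inj_on_def)
  show "K \<in> simplices \<Delta>" if "J \<in> simplices \<Delta>" "K \<subseteq> J" for J K
    using multi_fan_props(3)[OF mf] that by blast
qed

context elliptic_fan
begin

abbreviation "V \<equiv> verts \<Delta>"

lemma top: "I \<in> k_simplices \<Delta> n \<Longrightarrow> I \<in> simplices \<Delta>" "I \<in> k_simplices \<Delta> n \<Longrightarrow> card I = n"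
  by (simp_all add: k_simplices_def)

lemma top_verts: "I \<in> k_simplices \<Delta> n \<Longrightarrow> I \<subseteq> V"
  using sub_closed[OF top(1)] unfolding verts_def by blast

lemma cone: "I \<in> k_simplices \<Delta> n \<Longrightarrow> lattice_cone I v L N"
  using top_simplex_lattice_cone[OF basis mf ev _ qd] .

lemma finite_top: "finite (k_simplices \<Delta> n)"
  using multi_fan_props(1)[OF mf] by (simp add: k_simplices_def)

text \<open>Identifies the group defined with arbitrary representatives and a sum over all vertices
  with the reduced one attached to the cone of \<open>I\<close>.\<close>

lemma G_group_eq:
  assumes I: "I \<in> k_simplices \<Delta> n"
  shows "G_group L \<Delta> v I = lattice_cone.G I v L"
proof -
  interpret C: lattice_cone I v L N using cone[OF I] .
  have sumV: "(\<Sum>i\<in>V. a i *\<^sub>R v i) = (\<Sum>i\<in>I. a i *\<^sub>R v i)" if "\<forall>j. j \<notin> I \<longrightarrow> a j = 0" for a :: "'i \<Rightarrow> real"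
    using that top_verts[OF I] fin_verts by (intro sum.mono_neutral_right) auto
  show ?thesis
  proof (intro equalityI subsetI)
    fix g assume "g \<in> G_group L \<Delta> v I"
    then obtain a where a: "(\<Sum>i\<in>V. a i *\<^sub>R v i) \<in> L" "\<forall>j. j \<notin> I \<longrightarrow> a j = 0" "g = (\<lambda>i. frac (a i))"
      unfolding G_group_def by auto
    have "(\<Sum>i\<in>I. a i *\<^sub>R v i) \<in> L" using a(1) sumV[OF a(2)] by simp
    from C.G_frac[OF this] have "(\<lambda>i. if i \<in> I then frac (C.co i (\<Sum>j\<in>I. a j *\<^sub>R v j)) else 0) \<in> C.G" .
    also have "(\<lambda>i. if i \<in> I then frac (C.co i (\<Sum>j\<in>I. a j *\<^sub>R v j)) else 0) = g"
      using a(2,3) by (auto simp: C.co_comb)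
    finally show "g \<in> C.G" .
  next
    fix g assume g: "g \<in> C.G"
    then have g0: "\<forall>j. j \<notin> I \<longrightarrow> g j = 0" "\<And>i. 0 \<le> g i" "\<And>i. g i < 1" "(\<Sum>i\<in>I. g i *\<^sub>R v i) \<in> L"
      by (auto simp: C.G_def)
    have "(\<lambda>i. frac (g i)) = g" using g0 by (auto simp: frac_eq)
    moreover have "(\<Sum>i\<in>V. g i *\<^sub>R v i) \<in> L" using sumV[OF g0(1)] g0(4) by simp
    ultimately show "g \<in> G_group L \<Delta> v I" unfolding G_group_def using g0(1) by (intro image_eqI[of _ _ g]) auto
  qed
qed

lemma DG_props:
  assumes "(g1, g2) \<in> DG L n \<Delta> v"
  shows "0 \<le> g1 i" "g1 i < 1" "0 \<le> g2 i" "g2 i < 1" "real N * g1 i \<in> \<int>" "i \<notin> V \<Longrightarrow> g1 i = 0 \<and> g2 i = 0"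
proof -
  obtain J where J: "J \<in> k_simplices \<Delta> n" "g1 \<in> G_group L \<Delta> v J" "g2 \<in> G_group L \<Delta> v J"
    using assms by (auto simp: DG_def)
  interpret C: lattice_cone J v L N using cone[OF J(1)] .
  have g: "g1 \<in> C.G" "g2 \<in> C.G" using J G_group_eq[OF J(1)] by auto
  then show "0 \<le> g1 i" "g1 i < 1" "0 \<le> g2 i" "g2 i < 1" by (auto simp: C.G_def)
  show "real N * g1 i \<in> \<int>" using qd J unfolding q_denominator_def by blast
  show "g1 i = 0 \<and> g2 i = 0" if "i \<notin> V" using g that top_verts[OF J(1)] by (auto simp: C.G_def)
qed

lemma finite_DG: "finite (DG L n \<Delta> v)"
  unfolding DG_def
proof (rule finite_UN_I[OF finite_top])
  fix I assume I: "I \<in> k_simplices \<Delta> n"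
  interpret C: lattice_cone I v L N using cone[OF I] .
  show "finite (G_group L \<Delta> v I \<times> G_group L \<Delta> v I)" unfolding G_group_eq[OF I] using C.finite_G by simp
qed

text \<open>Such a pair comes from some other simplex \<open>J\<close>, but its entries are
  supported on \<open>I \<inter> J\<close>, so the lattice condition is the same for
  \<open>I\<close>.\<close>

lemma DG_on_simplex:
  assumes I: "I \<in> k_simplices \<Delta> n" and p: "(g1, g2) \<in> DG L n \<Delta> v" and z: "\<And>i. i \<in> V - I \<Longrightarrow> g1 i = 0 \<and> g2 i = 0"
  shows "g1 \<in> lattice_cone.G I v L" "g2 \<in> lattice_cone.G I v L"
proof -
  interpret C: lattice_cone I v L N using cone[OF I] .
  obtain J where J: "J \<in> k_simplices \<Delta> n" "g1 \<in> G_group L \<Delta> v J" "g2 \<in> G_group L \<Delta> v J"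
    using p by (auto simp: DG_def)
  interpret CJ: lattice_cone J v L N using cone[OF J(1)] .
  have gJ: "g1 \<in> CJ.G" "g2 \<in> CJ.G" using J G_group_eq[OF J(1)] by auto
  have z': "g1 i = 0 \<and> g2 i = 0" if "i \<notin> I" for i using z[of i] DG_props(6)[OF p, of i] that by blast
  have "g \<in> C.G" if g: "g \<in> CJ.G" and g0: "\<And>i. i \<notin> I \<Longrightarrow> g i = 0" for g
  proof -
    have "(\<Sum>i\<in>I. g i *\<^sub>R v i) = (\<Sum>i\<in>I \<inter> J. g i *\<^sub>R v i)"
      using C.fin g by (intro sum.mono_neutral_right) (auto simp: CJ.G_def)
    also have "\<dots> = (\<Sum>i\<in>J. g i *\<^sub>R v i)"
      using CJ.fin g0 by (intro sum.mono_neutral_left) auto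
    finally show ?thesis using g g0 by (simp add: C.G_def CJ.G_def)
  qed
  then show "g1 \<in> C.G" "g2 \<in> C.G" using gJ z' by auto
qed

text \<open>Restriction to \<open>I\<close> kills the pairs with a nonzero entry outside
  \<open>I\<close> and turns the factors outside \<open>I\<close> into 1, so that the sum over
  \<open>DG\<close> reduces to the pairs from the group of \<open>I\<close>. The variables on
  \<open>I\<close> become \<open>co i w * y\<close> and produce the factor in front of
  \<open>Ell\<close>.\<close>

lemma ev_elliptic:
  assumes I: "I \<in> k_simplices \<Delta> n" and w: "\<And>i. i \<in> I \<Longrightarrow> dual_vec v I i w \<noteq> 0"
  shows "(\<lambda>y. (of_real (\<Prod>i\<in>I. dual_vec v I i w) * y ^ n) * fps_nth (lattice_cone.Ell I v L N \<sigma> d w y) r) has_laurent_expansion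
    fps_to_fls (mps_ev V (\<lambda>i. if i \<in> I then of_real (dual_vec v I i w) else 0) (fps_nth (elliptic_series N L n \<Delta> v d \<sigma>) r))"
proof -
  interpret C: lattice_cone I v L N using cone[OF I] .
  define c where "c = (\<lambda>i. if i \<in> I then of_real (C.co i w) else (0 :: complex))"
  define F where "F = (\<lambda>(g1, g2). \<lambda>i. fps_const (fps_const (zeta_pow \<sigma> (d i * g1 i))) * map_ev V c (x_phi N i (g1 i) (g2 i) \<sigma> (d i)))"
  have N: "N > 0" by (rule C.N0)
  have IV: "I \<subseteq> V" by (rule top_verts[OF I])
  have GG: "C.G \<times> C.G \<subseteq> DG L n \<Delta> v" unfolding DG_def G_group_eq[OF I, symmetric] using I by blast
  have F0: "F (g1, g2) i = (if g1 i = 0 \<and> g2 i = 0 then 1 else 0)" if p: "(g1, g2) \<in> DG L n \<Delta> v" and i: "i \<in> V - I" for g1 g2 i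
  proof -
    have "map_ev V c (x_phi N i (g1 i) (g2 i) \<sigma> (d i)) = (if g1 i = 0 \<and> g2 i = 0 then 1 else 0)"
      using i zne DG_props[OF p] N fin_verts by (intro map_ev_x_phi(2)) (auto simp: c_def)
    then show ?thesis by (simp add: F_def)
  qed
  have "map_ev V c (elliptic_series N L n \<Delta> v d \<sigma>) = (\<Sum>p\<in>DG L n \<Delta> v. \<Prod>i\<in>V. F p i)"
    unfolding elliptic_series_def map_ev_sum
    by (rule sum.cong[OF refl])
       (auto simp: map_ev_prod[OF fin_verts] map_ev_mult[OF fin_verts] map_ev_const[OF fin_verts] F_def)
  also have "\<dots> = (\<Sum>p\<in>C.G \<times> C.G. \<Prod>i\<in>V. F p i)"
  proof (rule sum.mono_neutral_right[OF finite_DG GG], rule ballI)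
    fix p assume p: "p \<in> DG L n \<Delta> v - C.G \<times> C.G"
    obtain g1 g2 where pg: "p = (g1, g2)" by (cases p)
    obtain i where i: "i \<in> V - I" "\<not> (g1 i = 0 \<and> g2 i = 0)"
      using DG_on_simplex[OF I, of g1 g2] p unfolding pg by blast
    have "F p i = 0" using F0[of g1 g2 i] i p unfolding pg by auto
    then show "(\<Prod>i\<in>V. F p i) = 0" using i by (intro prod_zero[OF fin_verts]) auto
  qed
  also have "\<dots> = (\<Sum>p\<in>C.G \<times> C.G. \<Prod>i\<in>I. F p i)"
  proof (rule sum.cong[OF refl])
    fix p assume p: "p \<in> C.G \<times> C.G"
    show "(\<Prod>i\<in>V. F p i) = (\<Prod>i\<in>I. F p i)"
    proof (rule prod.mono_neutral_right[OF fin_verts IV], rule ballI)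
      fix i assume i: "i \<in> V - I"
      obtain g1 g2 where pg: "p = (g1, g2)" by (cases p)
      have "g1 i = 0" "g2 i = 0" using p i unfolding pg by (auto simp: C.G_def)
      moreover have "(g1, g2) \<in> DG L n \<Delta> v" using p GG unfolding pg by auto
      ultimately show "F p i = 1" using F0[of g1 g2 i] i unfolding pg by simp
    qed
  qed
  finally have E: "map_ev V c (elliptic_series N L n \<Delta> v d \<sigma>) = (\<Sum>p\<in>C.G \<times> C.G. \<Prod>i\<in>I. F p i)" .
  define K where "K = (\<lambda>(g1, g2). \<lambda>i y. fps_const (zeta_pow \<sigma> (d i * g1 i)) * (fps_const (c i * y) *
     Abs_fps (kronecker_coeff N (nat \<lfloor>real N * g1 i\<rfloor>) (zeta_pow \<sigma> (d i)) (exp (- (c i * y)) * cis (- 2 * pi * g2 i)))))"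
  have "fps_expands (\<lambda>y. \<Sum>p\<in>C.G \<times> C.G. \<Prod>i\<in>I. K p i y) (map_ev V c (elliptic_series N L n \<Delta> v d \<sigma>))"
    unfolding E
  proof (intro fps_expands_sum fps_expands_prod C.fin)
    fix p i assume p: "p \<in> C.G \<times> C.G" and i: "i \<in> I"
    obtain g1 g2 where pg: "p = (g1, g2)" by (cases p)
    have pD: "(g1, g2) \<in> DG L n \<Delta> v" using p GG unfolding pg by auto
    show "fps_expands (K p i) (F p i)"
      unfolding pg K_def F_def prod.case
      using i IV w zne DG_props[OF pD] N fin_verts
      by (intro fps_expands_mult fps_expands_const map_ev_x_phi(1)) (auto simp: c_def)
  qed
  moreover have "(\<Sum>p\<in>C.G \<times> C.G. \<Prod>i\<in>I. K p i y) =
     fps_const (of_real (\<Prod>i\<in>I. C.co i w) * y ^ n) * C.Ell \<sigma> d w y" for y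
  proof -
    have fcp: "(\<Prod>i\<in>I. fps_const (a i)) = fps_const (\<Prod>i\<in>I. a i)" for a :: "'i \<Rightarrow> complex"
      using C.fin by (induction I rule: finite_induct) simp_all
    have cy: "(\<Prod>i\<in>I. c i * y) = of_real (\<Prod>i\<in>I. C.co i w) * y ^ n"
      using top(2)[OF I] by (simp add: prod.distrib c_def)
    have "(\<Prod>i\<in>I. K (g1, g2) i y) = fps_const (of_real (\<Prod>i\<in>I. C.co i w) * y ^ n) *
      (\<Prod>i\<in>I. fps_const (zeta_pow \<sigma> (d i * g1 i)) *
       Abs_fps (kronecker_coeff N (nat \<lfloor>real N * g1 i\<rfloor>) (zeta_pow \<sigma> (d i))
       (exp (- (of_real (C.co i w) * y)) * cis (- 2 * pi * g2 i))))" (is "_ = ?R g1 g2") for g1 g2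
    proof -
      have "(\<Prod>i\<in>I. K (g1, g2) i y) = (\<Prod>i\<in>I. fps_const (c i * y) * (fps_const (zeta_pow \<sigma> (d i * g1 i)) *
       Abs_fps (kronecker_coeff N (nat \<lfloor>real N * g1 i\<rfloor>) (zeta_pow \<sigma> (d i))
       (exp (- (of_real (C.co i w) * y)) * cis (- 2 * pi * g2 i)))))"
        by (rule prod.cong[OF refl]) (simp add: K_def c_def mult.left_commute)
      then show ?thesis unfolding prod.distrib[of "\<lambda>i. fps_const (c i * y)"] fcp cy .
    qed
    then have "(\<Sum>g1\<in>C.G. \<Sum>g2\<in>C.G. \<Prod>i\<in>I. K (g1, g2) i y) = (\<Sum>g1\<in>C.G. \<Sum>g2\<in>C.G. ?R g1 g2)"
      by (intro sum.cong refl)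
    moreover have "(\<Sum>p\<in>C.G \<times> C.G. \<Prod>i\<in>I. K p i y) = (\<Sum>g1\<in>C.G. \<Sum>g2\<in>C.G. \<Prod>i\<in>I. K (g1, g2) i y)"
      by (simp add: sum.cartesian_product case_prod_unfold)
    ultimately show ?thesis unfolding C.Ell_def sum_distrib_left by (simp only:)
  qed
  ultimately have "fps_expands (\<lambda>y. fps_const (of_real (\<Prod>i\<in>I. C.co i w) * y ^ n) * C.Ell \<sigma> d w y)
      (map_ev V c (elliptic_series N L n \<Delta> v d \<sigma>))" by simp
  then show ?thesis
    unfolding fps_expands_def map_ev_def fps_nth_Abs_fps fps_mult_left_const_nth c_def by blast
qed

section \<open>Restriction to rays, and injectivity on the Stanley-Reisner ring\<close>

definition ray_point :: "('v \<Rightarrow> real) \<Rightarrow> 'v" where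
  "ray_point c = (\<Sum>b\<in>B. c b *\<^sub>R b)"

lemma fin_B: "finite B"
  using basis by (simp add: lattice_basis_def)

lemma ev_lin_form:
  assumes I: "I \<in> k_simplices \<Delta> n"
  shows "mps_ev B (\<lambda>b. of_real (c b)) (lin_form B (dual_vec v I i)) = fps_const (of_real (dual_vec v I i (ray_point c))) * fps_X"
proof -
  interpret C: lattice_cone I v L N using cone[OF I] .
  have "mps_ev B (\<lambda>b. of_real (c b)) (lin_form B (C.co i)) = (\<Sum>b\<in>B. fps_const (of_real (C.co i b)) * (fps_const (of_real (c b)) * fps_X))"
    unfolding lin_form_def mps_ev_sum by (rule sum.cong) (simp_all add: mps_ev_mult[OF fin_B] mps_ev_const[OF fin_B] mps_ev_var[OF fin_B])
  also have "\<dots> = (\<Sum>b\<in>B. fps_const (of_real (c b * C.co i b))) * fps_X"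
    unfolding sum_distrib_right by (rule sum.cong) (simp_all add: mult.assoc[symmetric] mult.commute)
  also have "(\<Sum>b\<in>B. fps_const (of_real (c b * C.co i b))) = fps_const (of_real (\<Sum>b\<in>B. c b * C.co i b))"
    using fin_B by (induction B rule: finite_induct) simp_all
  also have "(\<Sum>b\<in>B. c b * C.co i b) = C.co i (ray_point c)" by (simp add: ray_point_def C.co_sum C.co_scale)
  finally show ?thesis .
qed

lemma ev_iota:
  assumes I: "I \<in> k_simplices \<Delta> n"
  shows "mps_ev B (\<lambda>b. of_real (c b)) (iota_series B \<Delta> v I f) =
    mps_ev V (\<lambda>i. if i \<in> I then of_real (dual_vec v I i (ray_point c)) else 0) f"
  unfolding iota_series_def by (rule mps_ev_subst[OF fin_verts fin_B]) (simp add: ev_lin_form[OF I])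

lemma ev_u_prod:
  assumes I: "I \<in> k_simplices \<Delta> n"
  shows "mps_ev B (\<lambda>b. of_real (c b)) (u_prod B v I) =
    fps_const (of_real (\<Prod>i\<in>I. dual_vec v I i (ray_point c))) * fps_X ^ n"
proof -
  interpret C: lattice_cone I v L N using cone[OF I] .
  have fcp: "(\<Prod>i\<in>I. fps_const (a i)) = fps_const (\<Prod>i\<in>I. a i)" for a :: "'i \<Rightarrow> complex"
    using C.fin by (induction I rule: finite_induct) simp_all
  show ?thesis
    unfolding u_prod_def mps_ev_prod[OF fin_B] ev_lin_form[OF I] prod.distrib fcp
    using top(2)[OF I] by simp
qed

lemma lin_form_supp: "lin_form B u \<in> supp B"
  unfolding lin_form_def by (intro supp_sum supp_mult supp_const supp_var)

lemma u_prod_supp: "u_prod B v I \<in> supp B"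
  unfolding u_prod_def by (intro supp_prod lin_form_supp)

lemma iota_supp: "iota_series B \<Delta> v I f \<in> supp B"
  unfolding iota_series_def by (intro supp_subst) (auto intro: lin_form_supp)

lemma ray_point_surj: "\<exists>c. ray_point c = x"
proof
  have "independent B" "span B = UNIV" using basis by (auto simp: lattice_basis_def)
  then show "ray_point (representation B x) = x"
    unfolding ray_point_def using fin_B by (intro sum_representation_eq) auto
qed

text \<open>On the ray through the sum of the edge vectors every dual coordinate is 1.\<close>

lemma u_prod_nonzero:
  assumes I: "I \<in> k_simplices \<Delta> n"
  shows "u_prod B v I \<noteq> 0"
proof
  interpret C: lattice_cone I v L N using cone[OF I] .
  assume z: "u_prod B v I = 0"
  obtain c where c: "ray_point c = (\<Sum>i\<in>I. 1 *\<^sub>R v i)" using ray_point_surj by blast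
  have "(\<Prod>i\<in>I. C.co i (ray_point c)) = 1" unfolding c by (rule prod.neutral) (simp add: C.co_comb[of _ "\<lambda>_. 1", simplified])
  then have "mps_ev B (\<lambda>b. of_real (c b)) (u_prod B v I) = fps_X ^ n" unfolding ev_u_prod[OF I] by simp
  then show False unfolding z by simp
qed

text \<open>A monomial supported on a simplex lies in the variables of some top simplex
  \<open>I\<close>. There the substitution is an invertible linear change of variables, so the part
  of \<open>f - g\<close> in these variables vanishes.\<close>

lemma iota_inj:
  assumes f: "f \<in> supp V" "g \<in> supp V" and eq: "\<And>I. I \<in> k_simplices \<Delta> n \<Longrightarrow> iota_series B \<Delta> v I f = iota_series B \<Delta> v I g"
  shows "f - g \<in> sr_zero"
proof -
  have "mps_nth (f - g) m = 0" if m: "Poly_Mapping.keys m \<in> simplices \<Delta>" for m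
  proof -
    obtain I where I: "I \<in> k_simplices \<Delta> n" "Poly_Mapping.keys m \<subseteq> I" using multi_fan_props(4)[OF mf] m by blast
    interpret C: lattice_cone I v L N using cone[OF I(1)] .
    have IV: "I \<subseteq> V" by (rule top_verts[OF I(1)])
    define h :: "('i, complex) mps" where "h = Abs_mps (\<lambda>m. if Poly_Mapping.keys m \<subseteq> I then mps_nth (f - g) m else 0)"
    have "h = 0"
    proof (rule mps_ev_inj[OF C.fin])
      show "mps_nth h m \<noteq> 0 \<Longrightarrow> Poly_Mapping.keys m \<subseteq> I" for m by (simp add: h_def split: if_splits)
      fix a :: "'i \<Rightarrow> real"
      let ?a = "\<lambda>i. if i \<in> I then of_real (a i) else (0 :: complex)"
      \<comment> \<open>The ray on which the dual coordinates of \<open>I\<close> take the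
        prescribed values \<open>a i\<close>.\<close>
      obtain c where c: "ray_point c = (\<Sum>i\<in>I. a i *\<^sub>R v i)" using ray_point_surj by blast
      have co: "C.co i (ray_point c) = a i" if "i \<in> I" for i unfolding c using C.co_comb[OF that] .
      have "mps_ev V ?a f = mps_ev V ?a g"
        using ev_iota[OF I(1), of c f] ev_iota[OF I(1), of c g] eq[OF I(1)] by (simp add: co cong: if_cong)
      then have "mps_ev V ?a (f - g) = 0" by (simp add: mps_ev_diff)
      moreover have "mps_ev V ?a (f - g) = mps_ev I (\<lambda>i. of_real (a i)) h"
      proof (rule fps_ext)
        fix k
        have mv: "monv V ?a m = (if Poly_Mapping.keys m \<subseteq> I then monv I (\<lambda>i. of_real (a i)) m else 0)" if "Poly_Mapping.keys m \<subseteq> V" for m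
        proof (cases "Poly_Mapping.keys m \<subseteq> I")
          case True
          have z: "Poly_Mapping.lookup m i = 0" if "i \<notin> I" for i
            using True that by (auto simp: in_keys_iff)
          have "monv V ?a m = (\<Prod>i\<in>I. ?a i ^ Poly_Mapping.lookup m i)"
            unfolding monv_def using IV fin_verts z by (intro prod.mono_neutral_right) auto
          then show ?thesis using True by (simp add: monv_def cong: prod.cong)
        next
          case False
          then obtain i where i: "i \<in> Poly_Mapping.keys m" "i \<notin> I" by blast
          have "monv V ?a m = 0" unfolding monv_def
            by (rule prod_zero[OF fin_verts]) (use i that in \<open>auto simp: in_keys_iff intro!: bexI[of _ i]\<close>)
          then show ?thesis using False by simp
        qed
        have "(\<Sum>m\<in>mons V k. mps_nth (f - g) m * monv V ?a m) = (\<Sum>m\<in>mons I k. mps_nth h m * monv I (\<lambda>i. of_real (a i)) m)"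
          using finite_mons[OF fin_verts, of k] IV mv
          by (intro sum.mono_neutral_cong_right) (auto simp: mons_def h_def)
        then show "fps_nth (mps_ev V ?a (f - g)) k = fps_nth (mps_ev I (\<lambda>i. of_real (a i)) h) k"
          by (simp add: mps_ev_def)
      qed
      ultimately show "mps_ev I (\<lambda>i. of_real (a i)) h = 0" by simp
    qed
    then have "mps_nth h m = 0" by (simp add: mps_nth_simps)
    then show ?thesis using I(2) by (simp add: h_def)
  qed
  then show ?thesis using f by (simp add: sr_zero_def supp_diff)
qed

lemma x_phi_supp: "i \<in> V \<Longrightarrow> fps_nth (x_phi N i a b \<sigma> c) r \<in> supp V"
  by (simp add: x_phi_def supp_of_fps)

lemma fps_supp_mult:
  "(\<And>r. fps_nth F r \<in> supp V) \<Longrightarrow> (\<And>r. fps_nth G r \<in> supp V) \<Longrightarrow> fps_nth (F * G) r \<in> supp V"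
  unfolding fps_mult_nth by (intro supp_sum supp_mult) auto

lemma fps_supp_prod: "(\<And>i r. i \<in> A \<Longrightarrow> fps_nth (F i) r \<in> supp V) \<Longrightarrow> fps_nth (\<Prod>i\<in>A. F i) r \<in> supp V"
proof (induction A arbitrary: r rule: infinite_finite_induct)
  case (insert i A)
  then show ?case by (simp add: fps_supp_mult)
qed (auto simp: fps_one_nth)

lemma elliptic_supp: "fps_nth (elliptic_series N L n \<Delta> v d \<sigma>) r \<in> supp V"
  unfolding elliptic_series_def fps_sum_nth case_prod_unfold
  by (intro supp_sum fps_supp_prod fps_supp_mult x_phi_supp) auto

text \<open>The points of the fundamental parallelepiped represent the cosets: fractional parts of
  the coordinates give existence, and two representatives with integral differences
  coincide.\<close>

lemma card_H_group:
  assumes I: "I \<in> k_simplices \<Delta> n"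
  shows "card (H_group L \<Delta> v I) = card (lattice_cone.G I v L)"
proof -
  interpret C: lattice_cone I v L N using cone[OF I] .
  have cone_eq: "mf_cone \<Delta> I = cone_comb v I" by (rule simplex_cone(1)[OF mf ev top(1)[OF I]])
  have LJ: "L \<inter> span (mf_cone \<Delta> I) = L" unfolding cone_eq span_cone_comb[OF C.fin] C.span by simp
  have int_span: "x \<in> int_span (v ` I) \<longleftrightarrow> (\<forall>i\<in>I. C.co i x \<in> \<int>)" for x
  proof
    assume "x \<in> int_span (v ` I)"
    then obtain c :: "'v \<Rightarrow> int" where "x = (\<Sum>b\<in>v ` I. of_int (c b) *\<^sub>R b)"
      unfolding int_span_def mem_Collect_eq by (elim exE conjE)
    then have "x = (\<Sum>i\<in>I. of_int (c (v i)) *\<^sub>R v i)" by (simp add: sum.reindex[OF C.inj])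
    then show "\<forall>i\<in>I. C.co i x \<in> \<int>" using C.co_comb[of _ "\<lambda>i. of_int (c (v i))"] by simp
  next
    assume x: "\<forall>i\<in>I. C.co i x \<in> \<int>"
    define c where "c = (\<lambda>b. \<lfloor>C.co (the_inv_into I v b) x\<rfloor>)"
    have "(\<Sum>b\<in>v ` I. of_int (c b) *\<^sub>R b) = (\<Sum>i\<in>I. C.co i x *\<^sub>R v i)"
      unfolding sum.reindex[OF C.inj] o_def
      by (rule sum.cong) (use x in \<open>simp_all add: c_def the_inv_into_f_f[OF C.inj]\<close>)
    then have "x = (\<Sum>b\<in>v ` I. of_int (c b) *\<^sub>R b)" by (simp only: C.co_expand)
    then show "x \<in> int_span (v ` I)" unfolding int_span_def by blast
  qed
  define R where "R = {(x, y). x \<in> L \<and> y \<in> L \<and> x - y \<in> int_span (v ` I)}"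
  have H: "H_group L \<Delta> v I = L // R" unfolding H_group_def Let_def LJ R_def ..
  have Riff: "(x, y) \<in> R \<longleftrightarrow> x \<in> L \<and> y \<in> L \<and> (\<forall>i\<in>I. C.co i x - C.co i y \<in> \<int>)" for x y
    by (simp add: R_def int_span C.co_diff)
  have eq: "equiv L R"
  proof (rule equivI)
    show "R \<subseteq> L \<times> L" by (auto simp: R_def)
    show "refl_on L R" by (rule refl_onI) (auto simp: Riff)
    show "sym R"
    proof (rule symI)
      fix x y assume "(x, y) \<in> R"
      moreover have "C.co i y - C.co i x = - (C.co i x - C.co i y)" for i by simp
      ultimately show "(y, x) \<in> R" unfolding Riff by (metis Ints_minus)
    qed
    show "trans R"
    proof (rule transI)
      fix x y z assume "(x, y) \<in> R" "(y, z) \<in> R"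
      moreover have "C.co i x - C.co i z = (C.co i x - C.co i y) + (C.co i y - C.co i z)" for i by simp
      ultimately show "(x, z) \<in> R" unfolding Riff by (metis Ints_add)
    qed
  qed
  have "bij_betw (\<lambda>g. R `` {\<Sum>i\<in>I. g i *\<^sub>R v i}) C.G (L // R)"
    unfolding bij_betw_def
  proof
    show "inj_on (\<lambda>g. R `` {\<Sum>i\<in>I. g i *\<^sub>R v i}) C.G"
    proof (rule inj_onI, rule ext)
      fix g h i assume g: "g \<in> C.G" and h: "h \<in> C.G"
        and e: "R `` {\<Sum>i\<in>I. g i *\<^sub>R v i} = R `` {\<Sum>i\<in>I. h i *\<^sub>R v i}"
      have "(\<Sum>i\<in>I. g i *\<^sub>R v i, \<Sum>i\<in>I. h i *\<^sub>R v i) \<in> R"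
        using eq_equiv_class[OF e eq] h by (simp add: C.G_def)
      then have Z: "g i - h i \<in> \<int>" if "i \<in> I" for i using that by (auto simp: Riff C.co_comb)
      show "g i = h i"
      proof (cases "i \<in> I")
        case True
        have b: "0 \<le> g i" "g i < 1" "0 \<le> h i" "h i < 1" using g h by (auto simp: C.G_def)
        obtain k :: int where k: "g i - h i = of_int k" using Z[OF True] by (auto elim: Ints_cases)
        then have "k = 0" using b by linarith
        then show ?thesis using k by simp
      qed (use g h in \<open>simp add: C.G_def\<close>)
    qed
    show "(\<lambda>g. R `` {\<Sum>i\<in>I. g i *\<^sub>R v i}) ` C.G = L // R"
    proof (intro equalityI subsetI)
      fix X assume "X \<in> (\<lambda>g. R `` {\<Sum>i\<in>I. g i *\<^sub>R v i}) ` C.G"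
      then show "X \<in> L // R" by (auto simp: C.G_def intro: quotientI)
    next
      fix X assume "X \<in> L // R"
      then obtain x where x: "x \<in> L" "X = R `` {x}" by (rule quotientE)
      define g where "g = (\<lambda>i. if i \<in> I then frac (C.co i x) else 0)"
      have g: "g \<in> C.G" unfolding g_def by (rule C.G_frac[OF x(1)])
      have "(x, \<Sum>i\<in>I. g i *\<^sub>R v i) \<in> R"
        unfolding Riff using x(1) g by (simp add: C.co_comb C.G_def) (simp add: g_def frac_def)
      then have "X = R `` {\<Sum>i\<in>I. g i *\<^sub>R v i}" unfolding x(2) by (rule equiv_class_eq[OF eq])
      then show "X \<in> (\<lambda>g. R `` {\<Sum>i\<in>I. g i *\<^sub>R v i}) ` C.G" using g by (rule image_eqI)
    qed
  qed
  then show ?thesis unfolding H by (simp add: bij_betw_same_card)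
qed

end

section \<open>The push-forward formula\<close>

lemma power_expansion: "(\<lambda>y. y ^ n) has_laurent_expansion fps_to_fls (fps_X ^ n :: complex fps)"
  by (intro has_laurent_expansion_fps fps_expansion_intros)

lemma Fract_one_mult: "Fract a 1 * Fract b 1 = Fract (a * b) (1 :: 'a::idom)"
  by simp

lemma Fract_one_prod: "(\<Prod>k\<in>K. Fract (f k) 1) = Fract (\<Prod>k\<in>K. f k) (1 :: 'a::idom)"
  by (induction K rule: infinite_finite_induct) (simp_all add: One_fract_def)

lemma Fract_one_sum: "(\<Sum>k\<in>K. Fract (f k) 1) = Fract (\<Sum>k\<in>K. f k) (1 :: 'a::idom)"
  by (induction K rule: infinite_finite_induct) (simp_all add: Zero_fract_def)

text \<open>Reduces the defining equation of the push-forward to an identity without denominators in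
  the ring, where evaluation along rays is available.\<close>

lemma Fract_sum_eq:
  fixes a b :: "'a::idom"
  assumes "finite K" "b \<noteq> 0" and d: "\<And>k. k \<in> K \<Longrightarrow> d k \<noteq> 0"
    and eq: "a * (\<Prod>k\<in>K. d k) = b * (\<Sum>k\<in>K. c k * (\<Prod>l\<in>K - {k}. d l))"
  shows "Fract a 1 = Fract b 1 * (\<Sum>k\<in>K. Fract (c k) (d k))"
proof -
  have nz: "Fract x 1 \<noteq> 0" if "x \<noteq> 0" for x :: 'a using that by (simp add: Zero_fract_def eq_fract)
  have "Fract a 1 / Fract b 1 = (\<Sum>k\<in>K. Fract (c k) 1 / Fract (d k) 1)"
    using assms nz by (intro sum_divide_eq) (simp_all only: Fract_one_mult Fract_one_prod Fract_one_sum eq, auto)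
  also have "\<dots> = (\<Sum>k\<in>K. Fract (c k) (d k))"
    by (rule sum.cong) (use d in simp_all)
  finally show ?thesis using nz[OF \<open>b \<noteq> 0\<close>] by (metis nonzero_divide_eq_eq mult.commute)
qed

lemma of_nat_mps_nth: "mps_nth (of_nat k :: ('k, complex) mps) 0 = of_nat k"
  by (induction k) (simp_all add: mps_nth_simps)

lemma of_nat_mps_nonzero: "k > 0 \<Longrightarrow> (of_nat k :: ('k, complex) mps) \<noteq> 0"
proof
  assume k: "k > 0" and eq: "(of_nat k :: ('k, complex) mps) = 0"
  have "mps_nth (of_nat k :: ('k, complex) mps) 0 = 0" unfolding eq by (simp add: mps_nth_simps)
  then show False using k by (simp add: of_nat_mps_nth)
qed

locale elliptic_birational = birational_setting B L n N \<Delta> v \<Delta>' v' \<rho>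
  for B L :: "'v::real_vector set" and n N :: nat
    and \<Delta> :: "('i, 'v) multi_fan" and v :: "'i \<Rightarrow> 'v"
    and \<Delta>' :: "('j, 'v) multi_fan" and v' :: "'j \<Rightarrow> 'v" and \<rho> :: "'j set \<Rightarrow> 'i set" +
  fixes d :: "'i \<Rightarrow> real" and \<sigma> :: complex
  assumes zne: "\<And>i. i \<in> verts \<Delta> \<Longrightarrow> zeta_pow \<sigma> (d i) \<noteq> 1"
    and zne': "\<And>i. i \<in> verts \<Delta>' \<Longrightarrow> zeta_pow \<sigma> (pull_back \<Delta> v' v \<rho> d i) \<noteq> 1"

sublocale elliptic_birational \<subseteq> E: elliptic_fan B L n N \<Delta> v d \<sigma>
  using basis mf ev qd zne by unfold_locales

sublocale elliptic_birational \<subseteq> E': elliptic_fan B L n N \<Delta>' v' "pull_back \<Delta> v' v \<rho> d" \<sigma>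
  using basis mf' ev' qd' zne' by unfold_locales

context elliptic_birational
begin

abbreviation Y :: "nat \<Rightarrow> ('i, complex) mps" where
  "Y r \<equiv> fps_nth (elliptic_series N L n \<Delta> v d \<sigma>) r"

abbreviation Y' :: "nat \<Rightarrow> ('j, complex) mps" where
  "Y' r \<equiv> fps_nth (elliptic_series N L n \<Delta>' v' (pull_back \<Delta> v' v \<rho> d) \<sigma>) r"

abbreviation hu :: "'i set \<Rightarrow> ('v, complex) mps" where
  "hu I \<equiv> of_nat (card (H_group L \<Delta> v I)) * u_prod B v I"

abbreviation hu' :: "'j set \<Rightarrow> ('v, complex) mps" where
  "hu' I' \<equiv> of_nat (card (H_group L \<Delta>' v' I')) * u_prod B v' I'"

lemma over_top: "I' \<in> over I \<Longrightarrow> I' \<in> k_simplices \<Delta>' n"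
  by (simp add: over_def)

lemma hu_nonzero: "I \<in> k_simplices \<Delta> n \<Longrightarrow> hu I \<noteq> 0"
  using E.u_prod_nonzero[of I] E.card_H_group[of I] lattice_cone.card_G[OF cone, of I]
    of_nat_mps_nonzero[of "card (H_group L \<Delta> v I)"] by simp

lemma hu'_nonzero: "I' \<in> k_simplices \<Delta>' n \<Longrightarrow> hu' I' \<noteq> 0"
  using E'.u_prod_nonzero[of I'] E'.card_H_group[of I'] lattice_cone.card_G[OF cone', of I']
    of_nat_mps_nonzero[of "card (H_group L \<Delta>' v' I')"] by simp

text \<open>The evaluation of \<open>hu I\<close> is \<open>card (H_group L \<Delta> v I)\<close>
  times the very factor that \<open>ev_elliptic\<close> puts in front of \<open>Ell\<close>, so what
  remains is \<open>Ell\<close> divided by the order of the group. These quotients add up for real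
  \<open>y > 0\<close> by \<open>Ell_decomposition\<close>, and that determines the
  expansions.\<close>

lemma ev_local_identity:
  assumes I: "I \<in> k_simplices \<Delta> n" and gen: "generic (E.ray_point c)"
  shows "mps_ev B (\<lambda>b. of_real (c b)) (iota_series B \<Delta> v I (Y r) * (\<Prod>I'\<in>over I. hu' I')) =
    mps_ev B (\<lambda>b. of_real (c b)) (hu I * (\<Sum>I'\<in>over I. iota_series B \<Delta>' v' I' (Y' r) * (\<Prod>K\<in>over I - {I'}. hu' K)))"
proof -
  define w where "w = E.ray_point c"
  note fo = finite_over
  define A where "A = of_nat (card (H_group L \<Delta> v I)) * complex_of_real (\<Prod>i\<in>I. dual_vec v I i w)"
  define A' where "A' = (\<lambda>I'. of_nat (card (H_group L \<Delta>' v' I')) * complex_of_real (\<Prod>i\<in>I'. dual_vec v' I' i w))"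
  have evhu: "mps_ev B (\<lambda>b. of_real (c b)) (hu I) = fps_const A * fps_X ^ n"
    unfolding mps_ev_mult[OF E.fin_B] mps_ev_of_nat[OF E.fin_B] E.ev_u_prod[OF I] A_def w_def
    by (simp only: fps_of_nat[symmetric] fps_const_mult[symmetric] mult.assoc)
  have evhu': "mps_ev B (\<lambda>b. of_real (c b)) (hu' I') = fps_const (A' I') * fps_X ^ n" if "I' \<in> over I" for I'
    unfolding mps_ev_mult[OF E.fin_B] mps_ev_of_nat[OF E.fin_B] E'.ev_u_prod[OF over_top[OF that]] A'_def w_def
    by (simp only: fps_of_nat[symmetric] fps_const_mult[symmetric] mult.assoc)
  define P where "P = mps_ev B (\<lambda>b. of_real (c b)) (iota_series B \<Delta> v I (Y r))"
  define P' where "P' = (\<lambda>I'. mps_ev B (\<lambda>b. of_real (c b)) (iota_series B \<Delta>' v' I' (Y' r)))"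
  have gw: "\<And>i. i \<in> I \<Longrightarrow> dual_vec v I i w \<noteq> 0"
    and gw': "\<And>I' i. I' \<in> over I \<Longrightarrow> i \<in> I' \<Longrightarrow> dual_vec v' I' i w \<noteq> 0"
    using gen I over_top unfolding generic_def w_def by blast+
  define f where "f = (\<lambda>y. of_real (\<Prod>i\<in>I. dual_vec v I i w) * y ^ n * fps_nth (lattice_cone.Ell I v L N \<sigma> d w y) r)"
  define f' where "f' = (\<lambda>I' y. of_real (\<Prod>i\<in>I'. dual_vec v' I' i w) * y ^ n *
     fps_nth (lattice_cone.Ell I' v' L N \<sigma> (pull_back \<Delta> v' v \<rho> d) w y) r)"
  have P: "f has_laurent_expansion fps_to_fls P"
    unfolding P_def E.ev_iota[OF I] f_def using E.ev_elliptic[OF I gw, of r] unfolding w_def .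
  have P': "f' I' has_laurent_expansion fps_to_fls (P' I')" if "I' \<in> over I" for I'
    unfolding P'_def E'.ev_iota[OF over_top[OF that]] f'_def
    using E'.ev_elliptic[OF over_top[OF that] gw'[OF that], of r] unfolding w_def .
  define X where "X = P * (\<Prod>K\<in>over I. fps_const (A' K) * fps_X ^ n) - fps_const A * fps_X ^ n *
     (\<Sum>I'\<in>over I. P' I' * (\<Prod>K\<in>over I - {I'}. fps_const (A' K) * fps_X ^ n))"
  \<comment> \<open>The function whose expansion is \<open>X\<close>, the difference of the two
    sides after evaluation.\<close>
  define F where "F = (\<lambda>y. f y * (\<Prod>K\<in>over I. A' K * y ^ n) - A * y ^ n *
     (\<Sum>I'\<in>over I. f' I' y * (\<Prod>K\<in>over I - {I'}. A' K * y ^ n)))"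
  have "F has_laurent_expansion fps_to_fls X"
    unfolding F_def X_def fps_to_fls_minus fls_times_fps_to_fls fps_to_fls_prod fps_to_fls_sum
      fps_const_to_fls
    by (intro laurent_expansion_intros power_expansion P P')
  moreover have "F (of_real y) = 0" if y: "y > 0" for y
  proof -
    let ?h = "of_nat (card (lattice_cone.G I v L)) :: complex"
    let ?h' = "\<lambda>I'. of_nat (card (lattice_cone.G I' v' L)) :: complex"
    let ?E = "fps_nth (lattice_cone.Ell I v L N \<sigma> d w (of_real y)) r"
    let ?E' = "\<lambda>I'. fps_nth (lattice_cone.Ell I' v' L N \<sigma> (pull_back \<Delta> v' v \<rho> d) w (of_real y)) r"
    define Q where "Q = (\<Prod>K\<in>over I. A' K * complex_of_real y ^ n)"
    have dec: "?E / ?h = (\<Sum>I'\<in>over I. ?E' I' / ?h' I')"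
      using zne E.top_verts[OF I] zne' subsetD[OF E'.top_verts[OF over_top]] gen y
      by (intro Ell_decomposition[OF I]) (auto simp: w_def)
    have h: "?h \<noteq> 0" using lattice_cone.card_G[OF cone[OF I]] by simp
    have h': "?h' I' \<noteq> 0" if "I' \<in> over I" for I' using lattice_cone.card_G[OF cone'[OF over_top[OF that]]] by simp
    have Af: "f (of_real y) = A * of_real y ^ n * (?E / ?h)"
      unfolding f_def A_def E.card_H_group[OF I] using h by simp
    have "f' I' (of_real y) * (\<Prod>K\<in>over I - {I'}. A' K * of_real y ^ n) = (?E' I' / ?h' I') * Q" if I': "I' \<in> over I" for I'
    proof -
      have "Q = A' I' * of_real y ^ n * (\<Prod>K\<in>over I - {I'}. A' K * of_real y ^ n)"
        unfolding Q_def using fo I' by (simp add: prod.remove)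
      moreover have "f' I' (of_real y) = A' I' * of_real y ^ n * (?E' I' / ?h' I')"
        unfolding f'_def A'_def E'.card_H_group[OF over_top[OF I']] using h'[OF I'] by simp
      ultimately show ?thesis by simp
    qed
    then have "(\<Sum>I'\<in>over I. f' I' (of_real y) * (\<Prod>K\<in>over I - {I'}. A' K * of_real y ^ n)) = (\<Sum>I'\<in>over I. (?E' I' / ?h' I') * Q)"
      by (intro sum.cong refl)
    also have "\<dots> = ?E / ?h * Q" unfolding dec sum_distrib_right ..
    finally have S: "(\<Sum>I'\<in>over I. f' I' (of_real y) * (\<Prod>K\<in>over I - {I'}. A' K * of_real y ^ n)) = ?E / ?h * Q" .
    show ?thesis unfolding F_def S Q_def[symmetric] Af by simp
  qed
  ultimately have "fps_to_fls X = 0" by (rule laurent_zero_of_positive_reals)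
  then have X0: "X = 0" by simp
  have "(\<Prod>I'\<in>over I. mps_ev B (\<lambda>b. of_real (c b)) (hu' I')) = (\<Prod>K\<in>over I. fps_const (A' K) * fps_X ^ n)"
    by (rule prod.cong) (simp_all only: evhu')
  moreover have "(\<Sum>I'\<in>over I. P' I' * (\<Prod>K\<in>over I - {I'}. mps_ev B (\<lambda>b. of_real (c b)) (hu' K))) =
    (\<Sum>I'\<in>over I. P' I' * (\<Prod>K\<in>over I - {I'}. fps_const (A' K) * fps_X ^ n))"
    by (intro sum.cong prod.cong arg_cong2[where f = "(*)"] refl evhu') auto
  ultimately show ?thesis
    using X0 unfolding X_def mps_ev_mult[OF E.fin_B, of _ "iota_series B \<Delta> v I (Y r)"] mps_ev_mult[OF E.fin_B, of _ "hu I"] evhu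
      mps_ev_sum mps_ev_mult[OF E.fin_B, of _ "iota_series B \<Delta>' v' I' (Y' r)" for I'] mps_ev_prod[OF E.fin_B] P_def P'_def
    by simp
qed

text \<open>The factor \<open>W\<close> in the proof vanishes on the rays that are not generic.\<close>

lemma local_identity:
  assumes I: "I \<in> k_simplices \<Delta> n"
  shows "iota_series B \<Delta> v I (Y r) * (\<Prod>I'\<in>over I. hu' I') =
    hu I * (\<Sum>I'\<in>over I. iota_series B \<Delta>' v' I' (Y' r) * (\<Prod>K\<in>over I - {I'}. hu' K))" (is "?l = ?r")
proof -
  define W where "W = (\<Prod>I\<in>k_simplices \<Delta> n. u_prod B v I) * (\<Prod>I'\<in>k_simplices \<Delta>' n. u_prod B v' I')"
  have "W \<noteq> 0"
    unfolding W_def using E.u_prod_nonzero E'.u_prod_nonzero E.finite_top E'.finite_top by simp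
  have "(?l - ?r) * W = 0"
  proof (rule mps_ev_inj[OF E.fin_B])
    have "(?l - ?r) * W \<in> supp B" unfolding W_def
      by (intro supp_mult supp_diff supp_prod supp_sum E.iota_supp E'.iota_supp E.u_prod_supp E'.u_prod_supp supp_of_nat)
    then show "mps_nth ((?l - ?r) * W) m \<noteq> 0 \<Longrightarrow> Poly_Mapping.keys m \<subseteq> B" for m by (simp add: supp_def)
    fix c :: "'v \<Rightarrow> real"
    let ?ev = "mps_ev B (\<lambda>b. of_real (c b) :: complex)"
    show "?ev ((?l - ?r) * W) = 0"
    proof (cases "generic (E.ray_point c)")
      case True
      then show ?thesis using ev_local_identity[OF I True] by (simp only: mps_ev_mult[OF E.fin_B, of _ _ W] mps_ev_diff diff_self mult_zero_left)
    next
      case False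
      then consider K i where "K \<in> k_simplices \<Delta> n" "i \<in> K" "dual_vec v K i (E.ray_point c) = 0"
        | K i where "K \<in> k_simplices \<Delta>' n" "i \<in> K" "dual_vec v' K i (E.ray_point c) = 0"
        unfolding generic_def by blast
      then have "?ev W = 0"
      proof cases
        case 1
        interpret K: lattice_cone K v L N using cone[OF 1(1)] .
        have "(\<Prod>i\<in>K. dual_vec v K i (E.ray_point c)) = 0" using 1 K.fin by (intro prod_zero) auto
        then have "?ev (u_prod B v K) = 0" unfolding E.ev_u_prod[OF 1(1)] by simp
        then have "(\<Prod>I\<in>k_simplices \<Delta> n. ?ev (u_prod B v I)) = 0" using 1(1) E.finite_top by (intro prod_zero) auto
        then show ?thesis unfolding W_def mps_ev_mult[OF E.fin_B] mps_ev_prod[OF E.fin_B] by simp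
      next
        case 2
        interpret K: lattice_cone K v' L N using cone'[OF 2(1)] .
        have "(\<Prod>i\<in>K. dual_vec v' K i (E.ray_point c)) = 0" using 2 K.fin by (intro prod_zero) auto
        then have "?ev (u_prod B v' K) = 0" unfolding E'.ev_u_prod[OF 2(1)] by simp
        then have "(\<Prod>I\<in>k_simplices \<Delta>' n. ?ev (u_prod B v' I)) = 0" using 2(1) E'.finite_top by (intro prod_zero) auto
        then show ?thesis unfolding W_def mps_ev_mult[OF E.fin_B] mps_ev_prod[OF E.fin_B] by simp
      qed
      then show ?thesis by (simp only: mps_ev_mult[OF E.fin_B, of _ _ W] mult_zero_right)
    qed
  qed
  then show ?thesis using \<open>W \<noteq> 0\<close> by simp
qed

text \<open>\<open>local_identity\<close> shows that the class satisfies the defining equations;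
  \<open>iota_inj\<close> makes it the only solution, so that the definite description denotes
  it.\<close>

lemma push_forward_elliptic:
  "push_forward B L n \<Delta>' v' \<Delta> v \<rho> (HT_class \<Delta>' (Y' r)) = HT_class \<Delta> (Y r)"
  unfolding push_forward_def
proof (rule the_equality)
  have rhs: "Fract (hu I) 1 * (\<Sum>I' | I' \<in> k_simplices \<Delta>' n \<and> \<rho> I' = I. Fract (iota B \<Delta>' v' I' (HT_class \<Delta>' (Y' r))) (hu' I')) =
      Fract (iota_series B \<Delta> v I (Y r)) 1" if I: "I \<in> k_simplices \<Delta> n" for I
  proof -
    have "Fract (iota_series B \<Delta> v I (Y r)) 1 = Fract (hu I) 1 * (\<Sum>I'\<in>over I. Fract (iota_series B \<Delta>' v' I' (Y' r)) (hu' I'))"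
      by (rule Fract_sum_eq[OF finite_over hu_nonzero[OF I] hu'_nonzero[OF over_top] local_identity[OF I]])
    also have "(\<Sum>I'\<in>over I. Fract (iota_series B \<Delta>' v' I' (Y' r)) (hu' I')) =
        (\<Sum>I' | I' \<in> k_simplices \<Delta>' n \<and> \<rho> I' = I. Fract (iota B \<Delta>' v' I' (HT_class \<Delta>' (Y' r))) (hu' I'))"
      unfolding over_def by (rule sum.cong) (simp_all add: E'.iota_HT_class[OF E'.top(1)])
    finally show ?thesis ..
  qed
  show "HT_class \<Delta> (Y r) \<in> carrier (HT_ring \<Delta>) \<and> (\<forall>I\<in>k_simplices \<Delta> n.
      Fract (iota B \<Delta> v I (HT_class \<Delta> (Y r))) 1 = Fract (hu I) 1 *
      (\<Sum>I' | I' \<in> k_simplices \<Delta>' n \<and> \<rho> I' = I. Fract (iota B \<Delta>' v' I' (HT_class \<Delta>' (Y' r))) (hu' I')))"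
    using E.elliptic_supp[of r] by (simp add: rhs E.HT_carrier E.iota_HT_class[OF E.top(1)])
  fix y assume y: "y \<in> carrier (HT_ring \<Delta>) \<and> (\<forall>I\<in>k_simplices \<Delta> n.
      Fract (iota B \<Delta> v I y) 1 = Fract (hu I) 1 *
      (\<Sum>I' | I' \<in> k_simplices \<Delta>' n \<and> \<rho> I' = I. Fract (iota B \<Delta>' v' I' (HT_class \<Delta>' (Y' r))) (hu' I')))"
  then obtain f where f: "f \<in> supp (verts \<Delta>)" "y = HT_class \<Delta> f" unfolding E.HT_carrier by blast
  have "iota_series B \<Delta> v I f = iota_series B \<Delta> v I (Y r)" if I: "I \<in> k_simplices \<Delta> n" for I
  proof -
    have "Fract (iota B \<Delta> v I y) 1 = Fract (iota_series B \<Delta> v I (Y r)) 1" using y I rhs[OF I] by simp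
    then show ?thesis by (simp add: f(2) E.iota_HT_class[OF E.top(1)[OF I]] eq_fract)
  qed
  then have "f - Y r \<in> E.sr_zero" by (intro E.iota_inj f(1) E.elliptic_supp)
  then show "y = HT_class \<Delta> (Y r)" unfolding f(2) by (rule E.HT_class_cong)
qed

end

theorem theorem1:
  fixes L B :: "'v::real_vector set" and n N :: nat
    and \<Delta> :: "('i, 'v) multi_fan" and v :: "'i \<Rightarrow> 'v" and d :: "'i \<Rightarrow> real"
    and \<Delta>' :: "('j, 'v) multi_fan" and v' :: "'j \<Rightarrow> 'v"
    and \<rho> :: "'j set \<Rightarrow> 'i set" and \<sigma> :: complex
  assumes "lattice_basis B L" and "card B = n"
    and "simplicial_multi_fan L n \<Delta>" and "edge_vectors L \<Delta> v" and "Q_divisor \<Delta> d"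
    and "simplicial_multi_fan L n \<Delta>'" and "edge_vectors L \<Delta>' v'"
    and "birational_morphism \<Delta>' \<Delta> \<rho>"
    and "\<forall>i\<in>verts \<Delta>. zeta_pow \<sigma> (d i) \<noteq> 1"
    and "\<forall>i'\<in>verts \<Delta>'. zeta_pow \<sigma> (pull_back \<Delta> v' v \<rho> d i') \<noteq> 1"
    and "q_denominator N L n \<Delta> v" and "q_denominator N L n \<Delta>' v'"
  shows "push_forward_q B L n \<Delta>' v' \<Delta> v \<rho>
           (elliptic_class N L n \<Delta>' v' (pull_back \<Delta> v' v \<rho> d) \<sigma>) =
         elliptic_class N L n \<Delta> v d \<sigma>"
proof -
  interpret elliptic_birational B L n N \<Delta> v \<Delta>' v' \<rho> d \<sigma>
    using assms by unfold_locales auto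
  show ?thesis
    by (rule fps_ext) (simp add: push_forward_q_def elliptic_class_def push_forward_elliptic)
qed

end
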